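(* Assume that the mappings $f\mapsto|f|*|L^\alpha\phi|$ are continuous $B\to B$ for all multi-indices $\alpha$ with $|\alpha|\le\dim(G)$. Then one can choose $\epsilon>0$ and $U_\epsilon$-relatively separated points $\{x_i\}_{i\in I}$ such that for any $U_\epsilon$-BUPU $\{\psi_i\}$ with $\mathrm{supp}(\psi_i)\subseteq x_iU_\epsilon$ the operator $$T_2f=\sum_i\lambda_i(f)\,\ell_{x_i}\phi,\qquad \lambda_i(f)=\int_G f(x)\psi_i(x)\,dx,$$ is invertible on $B_\phi$. The convergence of the sum is pointwise, and if $C_c(G)$ is dense in $B$ then the convergence is also in norm. Further, $\{(\lambda_i\circ T_2^{-1},\ \ell_{x_i}\phi)\}_{i\in I}$ is an atomic decomposition for $B_\phi$ (with respect to $B^\#$).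
   Context: $G$ is a Lie group of dimension $n=\dim(G)$ with Lie algebra $\mathfrak g$, exponential map $\exp$, and left Haar measure $dx$; $X_1,\dots,X_n$ is a fixed basis of $\mathfrak g$. For $X\in\mathfrak g$, $L(X)f(x)=\lim_{t\to0}\frac{f(\exp(tX)x)-f(x)}{t}$. For a multi-index $\alpha$ of length $|\alpha|=k$ with entries in $\{1,\dots,n\}$, $L^\alpha f=L(X_{\alpha(k)})L(X_{\alpha(k-1)})\cdots L(X_{\alpha(1)})f$ (and $L^\alpha f=f$ if $|\alpha|=0$). For $\epsilon>0$, $U_\epsilon=\{\exp(t_1X_1)\cdots\exp(t_nX_n): -\epsilon\le t_k\le\epsilon\}$. $C_c(G)$ denotes the compactly supported continuous functions. Translations: $\ell_xf(y)=f(x^{-1}y)$, $r_xf(y)=f(yx)$. Convolution: $f*g(y)=\int_G f(x)g(x^{-1}y)\,dx$. Standing assumptions: $B$ is a Banach space of (measurable) functions on $G$ that is solid ($|f|\le|g|$ and $g\in B$ imply $f\in B$), left and right translation invariant with, for each compact $U\subseteq G$, a constant $C_U$ such that $\sup_{y\in U}\|\ell_yf\|_B\le C_U\|f\|_B$ and $\sup_{y\in U}\|r_yf\|_B\le C_U\|f\|_B$ for all $f\in B$; convergence in $B$ implies convergence locally in measure. There is a non-zero $\phi\in B$ with $\left|\int_G f(y)\phi(y^{-1})\,dy\right|\le C\|f\|_B$ for all $f\in B$ and $\phi*\phi=\phi$. Put $B_\phi=\{f\in B: f=f*\phi\}$, a reproducing kernel Banach space with the norm of $B$. For a compact neighbourhood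 $U$ of the identity, $\{x_i\}_{i\in I}$ is $U$-relatively separated if $G\subseteq\bigcup_i x_iU$ and there is $N$ with $\sup_i\#\{j: x_iU\cap x_jU\ne\emptyset\}\le N$. For such a sequence, $B^\#$ is the space of sequences $\{\lambda_i\}_{i\in I}$ with $\sum_i|\lambda_i|1_{x_iU}\in B$ (pointwise sum), normed by $\|\{\lambda_i\}\|_{B^\#}=\|\sum_i|\lambda_i|1_{x_iU}\|_B$; here $U=U_\epsilon$. A $U$-BUPU is a family of non-negative functions $\psi_i$ for which there is a $U$-relatively separated sequence $\{x_i\}$ with $\mathrm{supp}(\psi_i)\subseteq x_iU$ and $\sum_i\psi_i=1$. Atomic decomposition: for a Banach space $E$ with associated Banach sequence space $E^\#$ over the index set $I$, a family $\{(\lambda_i,\phi_i)\}_{i\in I}$ with $\lambda_i\in E^*$, $\phi_i\in E$ is an atomic decomposition of $E$ with respect to $E^\#$ if (a) $\{\lambda_i(f)\}\in E^\#$ for all $f\in E$, (b) the norms $\|\{\lambda_i(f)\}\|_{E^\#}$ and $\|f\|_E$ are equivalent, (c) every $f\in E$ can be written $f=\sum_i\lambda_i(f)\phi_i$. *)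

theory Defs
  imports "HOL-Analysis.Analysis"
begin

text \<open>
  Groups are written additively, because the library's class \<open>topological_group_add\<close> of (not
  necessarily commutative) topological groups is additive: the product \<open>xy\<close> is \<open>x + y\<close>, the inverse
  of \<open>x\<close> is \<open>- x\<close>, the identity is \<open>0\<close>, and \<open>x\<^sup>-\<^sup>1y\<close> is \<open>- x + y\<close>. No definition below assumes
  commutativity.
\<close>

section \<open>Lie groups and the exponential map\<close>

primrec Ck_on :: "nat \<Rightarrow> ('a::real_normed_vector \<Rightarrow> 'b::real_normed_vector) \<Rightarrow> 'a set \<Rightarrow> bool" where
  "Ck_on 0 f S \<longleftrightarrow> continuous_on S f"
| "Ck_on (Suc k) f S \<longleftrightarrow>
     (\<forall>x\<in>S. f differentiable (at x)) \<and> (\<forall>v. Ck_on k (\<lambda>x. frechet_derivative f (at x) v) S)"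

text \<open>Only used on open subsets of finite-dimensional spaces.\<close>

definition smooth_on :: "('a::real_normed_vector \<Rightarrow> 'b::real_normed_vector) \<Rightarrow> 'a set \<Rightarrow> bool" where
  "smooth_on f S \<longleftrightarrow> (\<forall>k. Ck_on k f S)"

type_synonym ('g, 'e) chart = "'g set \<times> ('g \<Rightarrow> 'e)"

text \<open>
  The model space \<open>'e\<close> is an arbitrary finite-dimensional real normed space (the class \<open>banach\<close> is
  then no restriction) and not a \<open>euclidean_space\<close>, so that groups of dimension \<open>0\<close> are included.
  The dimension of the group is \<open>dim (UNIV :: 'e set)\<close>.
\<close>

locale lie_group =
  fixes A :: "('g::{topological_group_add, t2_space, second_countable_topology}, 'e::banach) chart set"
  assumes finite_dimensional: "\<exists>S :: 'e set. finite S \<and> span S = UNIV"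
    and chart: "\<And>U c. (U, c) \<in> A \<Longrightarrow>
      open U \<and> open (c ` U) \<and> homeomorphism U (c ` U) c (inv_into U c)"
    and cover: "(\<Union>(U, c)\<in>A. U) = UNIV"
    and smooth_transition: "\<And>U c V d. (U, c) \<in> A \<Longrightarrow> (V, d) \<in> A \<Longrightarrow>
      smooth_on (\<lambda>p. d (inv_into U c p)) (c ` (U \<inter> V))"
    and smooth_mult: "\<And>U c V d W e. (U, c) \<in> A \<Longrightarrow> (V, d) \<in> A \<Longrightarrow> (W, e) \<in> A \<Longrightarrow>
      smooth_on (\<lambda>(p, q). e (inv_into U c p + inv_into V d q))
        {(p, q). p \<in> c ` U \<and> q \<in> d ` V \<and> inv_into U c p + inv_into V d q \<in> W}"
    and smooth_inverse: "\<And>U c V d. (U, c) \<in> A \<Longrightarrow> (V, d) \<in> A \<Longrightarrow>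
      smooth_on (\<lambda>p. d (- inv_into U c p)) {p \<in> c ` U. - inv_into U c p \<in> V}"

text \<open>
  The Lie algebra is the tangent space at the identity, identified with the model space through a
  chart \<open>c\<close> around the identity: the velocity at time \<open>0\<close> of a curve \<open>\<gamma>\<close> with \<open>\<gamma> 0 = 0\<close> is the
  derivative of \<open>c \<circ> \<gamma>\<close> at \<open>0\<close>. Only its vector space structure is needed.
\<close>

definition one_parameter_subgroup ::
    "('g::topological_group_add \<Rightarrow> 'e::real_normed_vector) \<Rightarrow> 'e \<Rightarrow> (real \<Rightarrow> 'g) \<Rightarrow> bool" where
  "one_parameter_subgroup c v \<gamma> \<longleftrightarrow>
     continuous_on UNIV \<gamma> \<and> (\<forall>s t. \<gamma> (s + t) = \<gamma> s + \<gamma> t) \<and>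
     ((\<lambda>t. c (\<gamma> t)) has_vector_derivative v) (at 0)"

definition lie_exp :: "('g::topological_group_add \<Rightarrow> 'e::real_normed_vector) \<Rightarrow> 'e \<Rightarrow> 'g" where
  "lie_exp c v = (THE \<gamma>. one_parameter_subgroup c v \<gamma>) 1"

definition is_basis :: "(nat \<Rightarrow> 'e::real_vector) \<Rightarrow> bool" where
  "is_basis X \<longleftrightarrow> inj_on X {..<dim (UNIV :: 'e set)} \<and>
     independent (X ` {..<dim (UNIV :: 'e set)}) \<and> span (X ` {..<dim (UNIV :: 'e set)}) = UNIV"

text \<open>The basis vectors are indexed by \<open>0, \<dots>, n - 1\<close>; the sum over the list is the ordered product.\<close>

definition U_eps ::
    "('g::topological_group_add \<Rightarrow> 'e::real_normed_vector) \<Rightarrow> (nat \<Rightarrow> 'e) \<Rightarrow> real \<Rightarrow> 'g set" where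
  "U_eps c X \<epsilon> =
     {(\<Sum>k\<leftarrow>[0..<dim (UNIV :: 'e set)]. lie_exp c (t k *\<^sub>R X k)) | t :: nat \<Rightarrow> real.
        \<forall>k<dim (UNIV :: 'e set). - \<epsilon> \<le> t k \<and> t k \<le> \<epsilon>}"

section \<open>The differential operators\<close>

definition L_quotient ::
    "('g::topological_group_add \<Rightarrow> 'e::real_normed_vector) \<Rightarrow> 'e \<Rightarrow> ('g \<Rightarrow> complex) \<Rightarrow> 'g \<Rightarrow> real \<Rightarrow> complex"
  where "L_quotient c v f x t = (f (lie_exp c (t *\<^sub>R v) + x) - f x) / of_real t"

definition L_op ::
    "('g::topological_group_add \<Rightarrow> 'e::real_normed_vector) \<Rightarrow> 'e \<Rightarrow> ('g \<Rightarrow> complex) \<Rightarrow> 'g \<Rightarrow> complex"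
  where "L_op c v f x = Lim (at 0) (L_quotient c v f x)"

text \<open>The head of the list is the first entry of the multi-index and is applied first.\<close>

primrec L_multi ::
    "('g::topological_group_add \<Rightarrow> 'e::real_normed_vector) \<Rightarrow> (nat \<Rightarrow> 'e) \<Rightarrow> nat list
      \<Rightarrow> ('g \<Rightarrow> complex) \<Rightarrow> 'g \<Rightarrow> complex" where
  "L_multi c X [] f = f"
| "L_multi c X (k # \<alpha>) f = L_multi c X \<alpha> (L_op c (X k) f)"

text \<open>All the limits in the iterated derivative exist (\<open>Lim\<close> is a junk value otherwise).\<close>

primrec L_multi_exists ::
    "('g::topological_group_add \<Rightarrow> 'e::real_normed_vector) \<Rightarrow> (nat \<Rightarrow> 'e) \<Rightarrow> nat list
      \<Rightarrow> ('g \<Rightarrow> complex) \<Rightarrow> bool" where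
  "L_multi_exists c X [] f \<longleftrightarrow> True"
| "L_multi_exists c X (k # \<alpha>) f \<longleftrightarrow>
     (\<forall>x. \<exists>l. (L_quotient c (X k) f x \<longlongrightarrow> l) (at 0)) \<and> L_multi_exists c X \<alpha> (L_op c (X k) f)"

section \<open>Haar measure, translations and convolution\<close>

text \<open>Regularity is automatic, since the groups considered are second countable.\<close>

locale left_haar_measure =
  fixes \<mu> :: "'g::topological_group_add measure"
  assumes sets_eq_borel: "sets \<mu> = sets borel"
    and finite_on_compact: "\<And>K. compact K \<Longrightarrow> emeasure \<mu> K < \<infinity>"
    and nonzero: "emeasure \<mu> UNIV \<noteq> 0"
    and left_invariant: "\<And>x E. E \<in> sets borel \<Longrightarrow> emeasure \<mu> ((\<lambda>y. x + y) ` E) = emeasure \<mu> E"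

definition ltrans :: "'g::group_add \<Rightarrow> ('g \<Rightarrow> complex) \<Rightarrow> 'g \<Rightarrow> complex" where
  "ltrans x f = (\<lambda>y. f (- x + y))"

definition rtrans :: "'g::group_add \<Rightarrow> ('g \<Rightarrow> complex) \<Rightarrow> 'g \<Rightarrow> complex" where
  "rtrans x f = (\<lambda>y. f (y + x))"

definition conv_exists :: "'g::group_add measure \<Rightarrow> ('g \<Rightarrow> complex) \<Rightarrow> ('g \<Rightarrow> complex) \<Rightarrow> bool" where
  "conv_exists \<mu> f g \<longleftrightarrow> (\<forall>y. integrable \<mu> (\<lambda>x. f x * g (- x + y)))"

definition conv :: "'g::group_add measure \<Rightarrow> ('g \<Rightarrow> complex) \<Rightarrow> ('g \<Rightarrow> complex) \<Rightarrow> 'g \<Rightarrow> complex" where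
  "conv \<mu> f g y = (\<integral>x. f x * g (- x + y) \<partial>\<mu>)"

definition absf :: "('g \<Rightarrow> complex) \<Rightarrow> 'g \<Rightarrow> complex" where
  "absf f = (\<lambda>x. of_real (cmod (f x)))"

section \<open>Banach function spaces\<close>

text \<open>
  A space of measurable functions modulo equality almost everywhere is represented by the set \<open>B\<close> of
  all representatives, and its norm by a seminorm \<open>N\<close> that vanishes exactly on the null functions.
  Solidity only asks for membership; no inequality between the norms is required.
\<close>

locale solid_function_space =
  fixes \<mu> :: "'g::topological_group_add measure"
    and B :: "('g \<Rightarrow> complex) set"
    and N :: "('g \<Rightarrow> complex) \<Rightarrow> real"
  assumes measurable: "\<And>f. f \<in> B \<Longrightarrow> f \<in> borel_measurable \<mu>"
    and zero_mem: "(\<lambda>x. 0) \<in> B"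
    and add_mem: "\<And>f g. f \<in> B \<Longrightarrow> g \<in> B \<Longrightarrow> (\<lambda>x. f x + g x) \<in> B"
    and scale_mem: "\<And>a f. f \<in> B \<Longrightarrow> (\<lambda>x. a * f x) \<in> B"
    and norm_nonneg: "\<And>f. f \<in> B \<Longrightarrow> 0 \<le> N f"
    and norm_eq_0_iff: "\<And>f. f \<in> B \<Longrightarrow> N f = 0 \<longleftrightarrow> (AE x in \<mu>. f x = 0)"
    and norm_triangle: "\<And>f g. f \<in> B \<Longrightarrow> g \<in> B \<Longrightarrow> N (\<lambda>x. f x + g x) \<le> N f + N g"
    and norm_scale: "\<And>a f. f \<in> B \<Longrightarrow> N (\<lambda>x. a * f x) = cmod a * N f"
    and complete: "\<And>F :: nat \<Rightarrow> 'g \<Rightarrow> complex. (\<And>k. F k \<in> B) \<Longrightarrow>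
      (\<And>e. e > 0 \<Longrightarrow> \<exists>M. \<forall>j\<ge>M. \<forall>k\<ge>M. N (\<lambda>x. F j x - F k x) < e) \<Longrightarrow>
      \<exists>f\<in>B. (\<lambda>k. N (\<lambda>x. F k x - f x)) \<longlonglongrightarrow> 0"
    and solid: "\<And>f g. f \<in> borel_measurable \<mu> \<Longrightarrow> g \<in> B \<Longrightarrow>
      (AE x in \<mu>. cmod (f x) \<le> cmod (g x)) \<Longrightarrow> f \<in> B"
    and ltrans_mem: "\<And>x f. f \<in> B \<Longrightarrow> ltrans x f \<in> B"
    and rtrans_mem: "\<And>x f. f \<in> B \<Longrightarrow> rtrans x f \<in> B"
    and translation_bounded: "\<And>K. compact K \<Longrightarrow>
      \<exists>C. \<forall>y\<in>K. \<forall>f\<in>B. N (ltrans y f) \<le> C * N f \<and> N (rtrans y f) \<le> C * N f"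
    and locally_in_measure: "\<And>F f K e. (\<And>k. F k \<in> B) \<Longrightarrow> f \<in> B \<Longrightarrow>
      (\<lambda>k. N (\<lambda>x. F k x - f x)) \<longlonglongrightarrow> 0 \<Longrightarrow> compact K \<Longrightarrow> e > 0 \<Longrightarrow>
      (\<lambda>k. measure \<mu> {x \<in> K. cmod (F k x - f x) > e}) \<longlonglongrightarrow> 0"

text \<open>
  The convolution of \<open>\<phi>\<close> with itself is determined everywhere and not just almost everywhere, so
  \<open>\<phi>\<close> and the elements of \<open>B_phi\<close> are genuine functions.
\<close>

definition reproducing ::
    "'g::group_add measure \<Rightarrow> ('g \<Rightarrow> complex) set \<Rightarrow> (('g \<Rightarrow> complex) \<Rightarrow> real) \<Rightarrow> ('g \<Rightarrow> complex) \<Rightarrow> bool"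
  where
  "reproducing \<mu> B N \<phi> \<longleftrightarrow>
     \<phi> \<in> B \<and> \<phi> \<noteq> (\<lambda>x. 0) \<and>
     (\<exists>C. \<forall>f\<in>B. integrable \<mu> (\<lambda>y. f y * \<phi> (- y)) \<and> cmod (\<integral>y. f y * \<phi> (- y) \<partial>\<mu>) \<le> C * N f) \<and>
     conv \<mu> \<phi> \<phi> = \<phi>"

definition B_phi ::
    "'g::group_add measure \<Rightarrow> ('g \<Rightarrow> complex) set \<Rightarrow> ('g \<Rightarrow> complex) \<Rightarrow> ('g \<Rightarrow> complex) set" where
  "B_phi \<mu> B \<phi> = {f \<in> B. f = conv \<mu> f \<phi>}"

definition continuous_self_map ::
    "('g \<Rightarrow> complex) set \<Rightarrow> (('g \<Rightarrow> complex) \<Rightarrow> real) \<Rightarrow> (('g \<Rightarrow> complex) \<Rightarrow> 'g \<Rightarrow> complex) \<Rightarrow> bool" where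
  "continuous_self_map B N T \<longleftrightarrow>
     (\<forall>f\<in>B. T f \<in> B) \<and>
     (\<forall>f\<in>B. \<forall>e>0. \<exists>d>0. \<forall>g\<in>B. N (\<lambda>x. g x - f x) < d \<longrightarrow> N (\<lambda>x. T g x - T f x) < e)"

definition C_c :: "('g::topological_space \<Rightarrow> complex) set" where
  "C_c = {g. continuous_on UNIV g \<and> compact (closure {x. g x \<noteq> 0})}"

definition C_c_dense :: "('g::topological_space \<Rightarrow> complex) set \<Rightarrow> (('g \<Rightarrow> complex) \<Rightarrow> real) \<Rightarrow> bool" where
  "C_c_dense B N \<longleftrightarrow> C_c \<subseteq> B \<and> (\<forall>f\<in>B. \<forall>e>0. \<exists>g\<in>C_c. N (\<lambda>x. f x - g x) < e)"

section \<open>Relatively separated points, sequence spaces and partitions of unity\<close>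

definition relatively_separated ::
    "'g::topological_group_add set \<Rightarrow> 'i set \<Rightarrow> ('i \<Rightarrow> 'g) \<Rightarrow> bool" where
  "relatively_separated U I x \<longleftrightarrow>
     compact U \<and> 0 \<in> interior U \<and>
     (\<Union>i\<in>I. (\<lambda>u. x i + u) ` U) = UNIV \<and>
     (\<exists>M::nat. \<forall>i\<in>I.
        finite {j \<in> I. (\<lambda>u. x i + u) ` U \<inter> (\<lambda>u. x j + u) ` U \<noteq> {}} \<and>
        card {j \<in> I. (\<lambda>u. x i + u) ` U \<inter> (\<lambda>u. x j + u) ` U \<noteq> {}} \<le> M)"

text \<open>Sequences are functions on the index type, of which only the values on \<open>I\<close> matter.\<close>

definition sharp_fun :: "'g::group_add set \<Rightarrow> 'i set \<Rightarrow> ('i \<Rightarrow> 'g) \<Rightarrow> ('i \<Rightarrow> complex) \<Rightarrow> 'g \<Rightarrow> complex" where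
  "sharp_fun U I x s = (\<lambda>y. \<Sum>\<^sub>\<infinity>i\<in>I. of_real (cmod (s i)) * indicator ((\<lambda>u. x i + u) ` U) y)"

definition B_sharp ::
    "('g::group_add \<Rightarrow> complex) set \<Rightarrow> 'g set \<Rightarrow> 'i set \<Rightarrow> ('i \<Rightarrow> 'g) \<Rightarrow> ('i \<Rightarrow> complex) set" where
  "B_sharp B U I x = {s. sharp_fun U I x s \<in> B}"

definition norm_sharp ::
    "(('g::group_add \<Rightarrow> complex) \<Rightarrow> real) \<Rightarrow> 'g set \<Rightarrow> 'i set \<Rightarrow> ('i \<Rightarrow> 'g) \<Rightarrow> ('i \<Rightarrow> complex) \<Rightarrow> real" where
  "norm_sharp N U I x s = N (sharp_fun U I x s)"

definition supp :: "('g::topological_space \<Rightarrow> real) \<Rightarrow> 'g set" where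
  "supp f = closure {x. f x \<noteq> 0}"

definition BUPU :: "'g::topological_group_add set \<Rightarrow> 'i set \<Rightarrow> ('i \<Rightarrow> 'g \<Rightarrow> real) \<Rightarrow> bool" where
  "BUPU U I \<psi> \<longleftrightarrow>
     (\<forall>i\<in>I. \<psi> i \<in> borel_measurable borel \<and> (\<forall>y. 0 \<le> \<psi> i y)) \<and>
     (\<exists>x. relatively_separated U I x \<and> (\<forall>i\<in>I. supp (\<psi> i) \<subseteq> (\<lambda>u. x i + u) ` U)) \<and>
     (\<forall>y. ((\<lambda>i. \<psi> i y) has_sum 1) I)"

section \<open>Invertible operators and atomic decompositions\<close>

definition bounded_functional_on ::
    "('g \<Rightarrow> complex) set \<Rightarrow> (('g \<Rightarrow> complex) \<Rightarrow> real) \<Rightarrow> (('g \<Rightarrow> complex) \<Rightarrow> complex) \<Rightarrow> bool" where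
  "bounded_functional_on E N l \<longleftrightarrow>
     (\<forall>f\<in>E. \<forall>g\<in>E. \<forall>a b. l (\<lambda>x. a * f x + b * g x) = a * l f + b * l g) \<and>
     (\<exists>C. \<forall>f\<in>E. cmod (l f) \<le> C * N f)"

definition bounded_operator_on ::
    "('g \<Rightarrow> complex) set \<Rightarrow> (('g \<Rightarrow> complex) \<Rightarrow> real) \<Rightarrow> (('g \<Rightarrow> complex) \<Rightarrow> 'g \<Rightarrow> complex) \<Rightarrow> bool" where
  "bounded_operator_on E N T \<longleftrightarrow>
     (\<forall>f\<in>E. T f \<in> E) \<and>
     (\<forall>f\<in>E. \<forall>g\<in>E. \<forall>a b. T (\<lambda>x. a * f x + b * g x) = (\<lambda>x. a * T f x + b * T g x)) \<and>
     (\<exists>C. \<forall>f\<in>E. N (T f) \<le> C * N f)"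

definition invertible_on ::
    "('g \<Rightarrow> complex) set \<Rightarrow> (('g \<Rightarrow> complex) \<Rightarrow> real) \<Rightarrow> (('g \<Rightarrow> complex) \<Rightarrow> 'g \<Rightarrow> complex) \<Rightarrow> bool" where
  "invertible_on E N T \<longleftrightarrow>
     bounded_operator_on E N T \<and> bij_betw T E E \<and> bounded_operator_on E N (inv_into E T)"

text \<open>The expansions in an atomic decomposition are understood pointwise (and unconditionally).\<close>

definition atomic_decomposition ::
    "('g \<Rightarrow> complex) set \<Rightarrow> (('g \<Rightarrow> complex) \<Rightarrow> real) \<Rightarrow>
     ('i \<Rightarrow> complex) set \<Rightarrow> (('i \<Rightarrow> complex) \<Rightarrow> real) \<Rightarrow>
     'i set \<Rightarrow> ('i \<Rightarrow> ('g \<Rightarrow> complex) \<Rightarrow> complex) \<Rightarrow> ('i \<Rightarrow> 'g \<Rightarrow> complex) \<Rightarrow> bool" where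
  "atomic_decomposition E N Es Ns I \<Lambda> \<Phi> \<longleftrightarrow>
     (\<forall>i\<in>I. bounded_functional_on E N (\<Lambda> i) \<and> \<Phi> i \<in> E) \<and>
     (\<forall>f\<in>E. (\<lambda>i. \<Lambda> i f) \<in> Es) \<and>
     (\<exists>a>0. \<exists>b>0. \<forall>f\<in>E. a * N f \<le> Ns (\<lambda>i. \<Lambda> i f) \<and> Ns (\<lambda>i. \<Lambda> i f) \<le> b * N f) \<and>
     (\<forall>f\<in>E. \<forall>y. ((\<lambda>i. \<Lambda> i f * \<Phi> i y) has_sum f y) I)"

definition psi_coeff :: "'g measure \<Rightarrow> ('i \<Rightarrow> 'g \<Rightarrow> real) \<Rightarrow> 'i \<Rightarrow> ('g \<Rightarrow> complex) \<Rightarrow> complex" where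
  "psi_coeff \<mu> \<psi> i f = (\<integral>x. f x * of_real (\<psi> i x) \<partial>\<mu>)"

definition T2 ::
    "'g::group_add measure \<Rightarrow> ('g \<Rightarrow> complex) \<Rightarrow> 'i set \<Rightarrow> ('i \<Rightarrow> 'g) \<Rightarrow> ('i \<Rightarrow> 'g \<Rightarrow> real)
      \<Rightarrow> ('g \<Rightarrow> complex) \<Rightarrow> 'g \<Rightarrow> complex" where
  "T2 \<mu> \<phi> I x \<psi> f = (\<lambda>y. \<Sum>\<^sub>\<infinity>i\<in>I. psi_coeff \<mu> \<psi> i f * ltrans (x i) \<phi> y)"

end

theory Submission
  imports Defs
begin

text \<open>
  Since every \<open>f\<close> in \<open>B_phi\<close> equals \<open>f * \<phi>\<close>, the operator \<open>T2\<close> is a Riemann sum of this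
  convolution, and the partition of unity gives the pointwise bound \<open>\<bar>f - T2 f\<bar> \<le> \<bar>f\<bar> * K\<close> for every
  \<open>K\<close> with \<open>\<bar>\<phi> (u + z) - \<phi> z\<bar> \<le> K z\<close> for all \<open>u\<close> in \<open>U_eps\<close> (\<open>T_near_identity\<close>). If convolution
  with \<open>K * K\<close> has small norm, the square of \<open>I - T2\<close> is a contraction of \<open>B_phi\<close> and \<open>T2\<close> is
  invertible (\<open>invertible_of_square_contraction\<close>). The two bounds of the atomic decomposition compare the
  coefficients with averages of \<open>\<bar>f\<bar>\<close> and the atoms with \<open>\<bar>\<phi>\<bar> + K\<close> (\<open>sharp_upper\<close>, \<open>sharp_lower\<close>).

  The kernel comes from a Sobolev inequality. Along a one-parameter subgroup an increment of \<open>\<phi>\<close> is an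
  integral of a derivative, and repeating this in every direction of the basis bounds the oscillation
  by an average of \<open>h = \<Sum>\<bar>L\<^sup>\<alpha> \<phi>\<bar>\<close> over a small box in coordinates of the second kind. Such averages are
  dominated by the Haar measure, so \<open>K = C * (1\<^sub>W * h)\<close> for a neighbourhood \<open>W\<close> of the identity that may
  be as small as desired, with \<open>C\<close> independent of \<open>W\<close> (\<open>oscillation_bound\<close>).

  Now \<open>K * K = C\<^sup>2 (1\<^sub>W * h * 1\<^sub>W) * h\<close>, and \<open>1\<^sub>W * k * 1\<^sub>W \<le> 2\<^sup>-\<^sup>m 1\<^sub>V * k * 1\<^sub>V\<close> for every nonnegative
  \<open>k\<close> as soon as \<open>W\<close> is small enough compared with \<open>V\<close> (\<open>two_sided_gain\<close>). In this way the square of the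
  kernel becomes small although the norms of \<open>1\<^sub>W * h\<close> themselves need not be.

  The norm of \<open>B\<close> need be neither monotone nor continuous along increasing sequences, and functions with
  values in \<open>B\<close> cannot in general be integrated. All estimates are therefore inequalities between nonnegative
  functions, almost everywhere or everywhere, which are turned into norm estimates only at the end. This
  rests on three facts: \<open>\<bar>f\<bar> \<le> \<bar>g\<bar>\<close> implies \<open>N f \<le> c * N g\<close> with a constant \<open>c\<close> (\<open>solid_norm\<close>), the
  continuity of \<open>f \<mapsto> \<bar>f\<bar> * \<bar>L\<^sup>\<alpha> \<phi>\<bar>\<close> bounds the kernels \<open>\<bar>L\<^sup>\<alpha> \<phi>\<bar>\<close>, and indicators of compact sets are
  bounded kernels because \<open>\<bar>\<phi>\<bar> * \<bar>\<phi>\<bar>\<close> is bounded below on an open set.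
\<close>

section \<open>Neighbourhoods in a topological group\<close>

lemma symmetric_half_neighbourhood:
 fixes S :: "'g::topological_group_add set"
 assumes "open S" "0 \<in> S"
 obtains V where "open V" "0 \<in> V" "\<And>x. x \<in> V ==> - x \<in> V"
  "\<And>x y. x \<in> V ==> y \<in> V ==> x + y \<in> S" "V \<subseteq> S"
proof -
 have "open ((%p::'g \<times> 'g. fst p + snd p) -` S)"
  by (intro open_vimage assms continuous_intros)
 moreover have "(0, 0) \<in> (%p::'g \<times> 'g. fst p + snd p) -` S" using assms by simp
 ultimately obtain A B where "open A" "open B" "(0, 0) \<in> A \<times> B"
   "A \<times> B \<subseteq> (%p::'g \<times> 'g. fst p + snd p) -` S"
  by (rule open_prod_elim) blast
 hence AB: "open A" "open B" "0 \<in> A" "0 \<in> B"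
   "A \<times> B \<subseteq> (%p::'g \<times> 'g. fst p + snd p) -` S" by auto
 define V where "V = (A \<inter> B) \<inter> uminus -` (A \<inter> B)"
 have "open V" unfolding V_def using AB by (intro open_Int open_vimage continuous_intros) auto
 moreover have "0 \<in> V" using AB by (auto simp: V_def)
 moreover have "- x \<in> V" if "x \<in> V" for x using that by (auto simp: V_def)
 moreover have *: "x + y \<in> S" if "x \<in> V" "y \<in> V" for x y using that AB(5) by (auto simp: V_def)
 moreover have "V \<subseteq> S" using *[OF _ \<open>0 \<in> V\<close>] by auto
 ultimately show ?thesis using that by blast
qed

lemma closure_neighbourhood:
 fixes S :: "'g::topological_group_add set"
 assumes "open S" "0 \<in> S"
 obtains V where "open V" "0 \<in> V" "\<And>x. x \<in> V ==> - x \<in> V" "closure V \<subseteq> S"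
proof -
 obtain V where V: "open V" "0 \<in> V" "\<And>x. x \<in> V ==> - x \<in> V"
  "\<And>x y. x \<in> V ==> y \<in> V ==> x + y \<in> S"
  using symmetric_half_neighbourhood[OF assms] by metis
 have "closure V \<subseteq> S"
 proof
  fix x assume x: "x \<in> closure V"
  have "open ((%y. - x + y) -` V)" by (intro open_vimage V continuous_intros)
  moreover have "x \<in> (%y. - x + y) -` V" using V by simp
  ultimately obtain y where y: "y \<in> V" "- x + y \<in> V"
   using x by (metis (no_types, lifting) closure_iff_nhds_not_empty disjoint_iff order_refl vimage_eq)
  have "y + - (- x + y) \<in> S" using V y by blast
  thus "x \<in> S" by (simp add: minus_add)
 qed
 thus ?thesis using V that by blast
qed

lemma open_translate:
 fixes S :: "'g::topological_group_add set"
 assumes "open S" shows "open ((%u. x + u) ` S)"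
proof -
 have "(%u. x + u) ` S = (%y. - x + y) -` S"
  by (force simp: image_iff add.assoc[symmetric])
 thus ?thesis by (auto intro!: open_vimage assms continuous_intros)
qed

lemma compact_translate:
 fixes S :: "'g::topological_group_add set"
 assumes "compact S" shows "compact ((%u. x + u) ` S)"
 by (intro compact_continuous_image assms continuous_intros)

lemma compact_sum:
 fixes S T :: "'g::topological_group_add set"
 assumes "compact S" "compact T"
 shows "compact {x + y | x y. x \<in> S \<and> y \<in> T}"
proof -
 have "compact ((%p. fst p + snd p) ` (S \<times> T))"
  by (intro compact_continuous_image compact_Times assms continuous_intros)
 also have "(%p. fst p + snd p) ` (S \<times> T) = {x + y | x y. x \<in> S \<and> y \<in> T}" by force
 finally show ?thesis .
qed

lemma compact_uminus:
 fixes S :: "'g::topological_group_add set"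
 assumes "compact S" shows "compact (uminus ` S)"
 by (intro compact_continuous_image assms continuous_intros)

section \<open>Left Haar measure\<close>

locale haar_group = left_haar_measure \<mu>
 for \<mu> :: "'g::{topological_group_add, t2_space, second_countable_topology} measure" +
 assumes locally_compact: "\<exists>K::'g set. compact K \<and> 0 \<in> interior K"
begin

lemma space_UNIV [simp]: "space \<mu> = UNIV"
 using sets_eq_imp_space_eq[OF sets_eq_borel] by simp

lemma sets_mu [simp, measurable_cong]: "sets \<mu> = sets borel"
 by (rule sets_eq_borel)

lemma compact_neighbourhood:
 fixes S :: "'g set"
 assumes "open S" "0 \<in> S"
 obtains K where "compact K" "0 \<in> interior K" "K \<subseteq> S"
proof -
 obtain C :: "'g set" where C: "compact C" "0 \<in> interior C" using locally_compact by blast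
 obtain V where V: "open V" "0 \<in> V" "closure V \<subseteq> S"
  using closure_neighbourhood[OF assms] by metis
 have "compact (C \<inter> closure V)" using C by (intro compact_Int_closed) auto
 moreover have "0 \<in> interior (C \<inter> closure V)"
  using C V by (simp, metis closure_subset interior_maximal subsetD)
 ultimately show ?thesis using that V by blast
qed

lemma open_compact_neighbourhood:
 fixes S :: "'g set"
 assumes "open S" "0 \<in> S"
 obtains V where "open V" "0 \<in> V" "\<And>x. x \<in> V ==> - x \<in> V" "compact (closure V)" "closure V \<subseteq> S"
proof -
 obtain K where K: "compact K" "0 \<in> interior K" "K \<subseteq> S" using compact_neighbourhood[OF assms] .
 obtain V where V: "open V" "0 \<in> V" "\<And>x. x \<in> V ==> - x \<in> V" "closure V \<subseteq> interior K"
  using closure_neighbourhood[OF open_interior K(2)] by metis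
 have "compact (closure V)"
  using compact_Int_closed[OF K(1) closed_closure[of V]] V(4) interior_subset[of K]
  by (metis inf.absorb2 subset_trans)
 thus ?thesis using that V K interior_subset by blast
qed

lemma countable_translates_cover:
 fixes V :: "'g set"
 assumes "open V" "0 \<in> V"
 obtains X :: "'g set" where "countable X" "(\<Union>x\<in>X. (%u. x + u) ` V) = UNIV"
proof -
 have "open S" if "S \<in> range (%x. (%u. x + u) ` V)" for S
  using open_translate[OF assms(1)] that by blast
 from Lindelof[OF this] obtain F where F: "F \<subseteq> range (%x. (%u. x + u) ` V)" "countable F"
   "\<Union>F = \<Union>(range (%x. (%u. x + u) ` V))"
  by metis
 obtain X where X: "countable X" "F = (%x. (%u. x + u) ` V) ` X"
  using F by (metis countable_subset_image)
 have "y \<in> (%u. y + u) ` V" for y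
  using image_eqI[of y "%u. y + u" 0 V] assms(2) by simp
 hence "\<Union>(range (%x. (%u. x + u) ` V)) = UNIV" by blast
 hence "(\<Union>x\<in>X. (%u. x + u) ` V) = UNIV" using F(3) X(2) by simp
 with X(1) show ?thesis by (rule that)
qed

sublocale sigma_finite_measure \<mu>
proof
 obtain V :: "'g set" where V: "open V" "0 \<in> V" "compact (closure V)"
  using open_compact_neighbourhood[OF open_UNIV UNIV_I] by metis
 obtain X :: "'g set" where X: "countable X" "(\<Union>x\<in>X. (%u. x + u) ` V) = UNIV"
  using countable_translates_cover[OF V(1,2)] by metis
 let ?A = "(%x. (%u. x + u) ` V) ` X"
 have "emeasure \<mu> ((%u. x + u) ` V) \<noteq> \<infinity>" for x
 proof -
  have "emeasure \<mu> ((%u. x + u) ` V) <= emeasure \<mu> ((%u. x + u) ` closure V)"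
   using V by (intro emeasure_mono image_mono closure_subset)
    (auto intro!: borel_closed compact_imp_closed compact_translate)
  also have "\<dots> < \<infinity>" using V by (intro finite_on_compact compact_translate)
  finally show ?thesis by simp
 qed
 thus "\<exists>A. countable A \<and> A \<subseteq> sets \<mu> \<and> \<Union>A = space \<mu> \<and> (\<forall>a\<in>A. emeasure \<mu> a \<noteq> \<infinity>)"
  using X V by (intro exI[of _ ?A]) (auto intro!: borel_open open_translate)
qed

sublocale pair_sigma_finite \<mu> \<mu> ..

lemma emeasure_open_pos:
 fixes S :: "'g set"
 assumes "open S" "S \<noteq> {}" shows "emeasure \<mu> S > 0"
proof (rule ccontr)
 assume "\<not> ?thesis"
 hence 0: "emeasure \<mu> S = 0" by simp
 obtain a where a: "a \<in> S" using assms by blast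
 define V where "V = (%u. - a + u) ` S"
 have V: "open V" "0 \<in> V" "emeasure \<mu> V = 0"
  using assms a 0 left_invariant[of S "- a"] by (auto simp: V_def open_translate image_iff intro!: bexI[of _ a])
 obtain X :: "'g set" where X: "countable X" "(\<Union>x\<in>X. (%u. x + u) ` V) = UNIV"
  using countable_translates_cover[OF V(1,2)] by metis
 have "(\<Union>x\<in>X. (%u. x + u) ` V) \<in> null_sets \<mu>"
  using X V left_invariant[of V] open_translate[OF V(1)]
  by (intro null_sets_UN') (auto simp: null_sets_def)
 thus False using X nonzero by auto
qed

lemma emeasure_finite_subset_compact:
 fixes K :: "'g set"
 assumes "compact K" "S \<subseteq> K" shows "emeasure \<mu> S < \<infinity>"
proof -
 have "emeasure \<mu> S <= emeasure \<mu> K"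
  using assms by (intro emeasure_mono) (auto intro: borel_closed compact_imp_closed)
 thus ?thesis using finite_on_compact[OF assms(1)] by (simp add: le_less_trans)
qed

lemma distr_translate: "distr \<mu> borel (%y. a + y) = \<mu>"
proof (rule measure_eqI)
 fix E assume "E \<in> sets (distr \<mu> borel (%y. a + y))"
 hence E: "E \<in> sets borel" by simp
 have m: "(%y. a + y) \<in> borel_measurable \<mu>"
  using borel_measurable_continuous_onI[of "%y. a + y"]
  by (auto intro!: continuous_intros simp: measurable_cong_sets[OF sets_mu refl])
 have "(%y. a + y) -` E \<inter> space \<mu> = (%y. - a + y) ` E"
  by (force simp: image_iff add.assoc[symmetric])
 thus "emeasure (distr \<mu> borel (%y. a + y)) E = emeasure \<mu> E"
  using m E left_invariant[of E "- a"] by (simp add: emeasure_distr)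
qed simp

lemma borel_measurable_translate [measurable]: "(%y. a + y) \<in> borel_measurable borel"
 for a :: 'g
 by (intro borel_measurable_continuous_onI continuous_intros)

lemma nn_integral_translate:
 assumes [measurable]: "f \<in> borel_measurable borel"
 shows "(\<integral>\<^sup>+x. f (a + x) \<partial>\<mu>) = (\<integral>\<^sup>+x. f x \<partial>\<mu>)"
 by (subst (2) distr_translate[of a, symmetric]) (simp add: nn_integral_distr)

lemma integral_translate:
 fixes f :: "'g => complex"
 assumes [measurable]: "f \<in> borel_measurable borel"
 shows "(\<integral>x. f (a + x) \<partial>\<mu>) = (\<integral>x. f x \<partial>\<mu>)"
 using integral_distr[of "%y. a + y" \<mu> borel f]
 by (simp add: distr_translate)

end

context haar_group
begin

lemma closed_compact_translate_inside:
 fixes S :: "'g set"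
 assumes "open S" "x \<in> S"
 obtains K where "compact K" "x \<in> interior K" "K \<subseteq> S"
proof -
 have "0 \<in> (%u. - x + u) ` S" using assms(2) by (auto simp: image_iff intro!: bexI[of _ x])
 then obtain K where K: "compact K" "0 \<in> interior K" "K \<subseteq> (%u. - x + u) ` S"
  using compact_neighbourhood[OF open_translate[OF assms(1)]] by metis
 have "(%u. x + u) ` K \<subseteq> S" using K(3) by (force simp: add.assoc[symmetric])
 moreover have "x \<in> interior ((%u. x + u) ` K)"
 proof (rule interiorI)
  show "open ((%u. x + u) ` interior K)" by (rule open_translate) simp
  show "x \<in> (%u. x + u) ` interior K" using K(2) by (auto simp: image_iff intro!: bexI[of _ 0])
  show "(%u. x + u) ` interior K \<subseteq> (%u. x + u) ` K" using interior_subset by blast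
 qed
 ultimately show ?thesis using that compact_translate[OF K(1)] by metis
qed

lemma open_countable_Union_closed:
 fixes S :: "'g set"
 assumes "open S"
 obtains C :: "nat => 'g set" where "\<And>i. closed (C i)" "(\<Union>i. C i) = S"
proof -
 obtain \<B> :: "'g set set" where B: "countable \<B>" "topological_basis \<B>"
  using ex_countable_basis by blast
 let ?F = "insert {} (closure ` {b \<in> \<B>. closure b \<subseteq> S})"
 have F: "countable ?F" "?F \<noteq> {}" using B(1) by auto
 have "\<Union>?F = S"
 proof
  show "S \<subseteq> \<Union>?F"
  proof
   fix x assume "x \<in> S"
   obtain K where K: "compact K" "x \<in> interior K" "K \<subseteq> S"
    using closed_compact_translate_inside[OF assms \<open>x \<in> S\<close>] by metis
   obtain b where b: "b \<in> \<B>" "x \<in> b" "b \<subseteq> interior K"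
    using topological_basisE[OF B(2) open_interior K(2)] by metis
   have "closure b \<subseteq> K"
    using b(3) interior_subset[of K] compact_imp_closed[OF K(1)] by (intro closure_minimal) auto
   thus "x \<in> \<Union>?F" using b K closure_subset[of b] by blast
  qed
 qed auto
 moreover have "(\<Union>i. from_nat_into ?F i) = \<Union>?F"
  using range_from_nat_into[OF F(2,1)] by metis
 moreover have "closed (from_nat_into ?F i)" for i
  using from_nat_into[OF F(2), of i] by auto
 ultimately show ?thesis using that by metis
qed

text \<open>A finite Borel measure on the group is regular because open sets are countable unions of
 closed sets.\<close>

lemma finite_measure_regular:
 fixes \<nu> :: "'g measure"
 assumes "finite_measure \<nu>" and sets_nu: "sets \<nu> = sets borel" and "E \<in> sets borel" and "e > (0::real)"
 obtains F S where "closed F" "open S" "F \<subseteq> E" "E \<subseteq> S" "measure \<nu> (S - F) < e"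
proof -
 interpret nu: finite_measure \<nu> by fact
 note [measurable_cong] = sets_nu
 define P where "P E \<longleftrightarrow> (\<forall>e>0. \<exists>F S. closed F \<and> open S \<and> F \<subseteq> E \<and> E \<subseteq> S \<and> measure \<nu> (S - F) < e)"
  for E :: "'g set"
 have mS: "S \<in> sets \<nu>" if "open S" for S using that sets_nu by auto
 have mF: "S \<in> sets \<nu>" if "closed S" for S using that sets_nu by auto
 have approx: "\<exists>n. measure \<nu> (S - (\<Union>i<n. C i)) < measure \<nu> (S - (\<Union>i. C i)) + e"
  if S: "S \<in> sets \<nu>" and C: "\<And>i::nat. C i \<in> sets \<nu>" and e: "e > 0" for S C and e :: real
 proof -
  have "(%n. measure \<nu> (S - (\<Union>i<n. C i))) \<longlonglongrightarrow> measure \<nu> (\<Inter>n. S - (\<Union>i<n. C i))"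
   using S C by (intro nu.finite_Lim_measure_decseq) (auto simp: decseq_def intro!: sets.Diff sets.finite_UN)
  also have "(\<Inter>n. S - (\<Union>i<n. C i)) = S - (\<Union>i. C i)"
   by auto
  finally have "eventually (%n. measure \<nu> (S - (\<Union>i<n. C i)) < measure \<nu> (S - (\<Union>i. C i)) + e) sequentially"
   using e by (intro order_tendstoD) auto
  thus ?thesis by (rule eventually_happens'[OF sequentially_bot])
 qed
 have "P E" if "E \<in> sigma_sets UNIV {S::'g set. open S}" for E
  using that
 proof (induction rule: sigma_sets.induct)
  case (Basic S)
  hence S: "open S" by simp
  obtain C :: "nat => 'g set" where C: "\<And>i. closed (C i)" "(\<Union>i. C i) = S"
   using open_countable_Union_closed[OF S] by metis
  show ?case unfolding P_def
  proof (intro allI impI)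
   fix e :: real assume "e > 0"
   have "\<exists>n. measure \<nu> (S - (\<Union>i<n. C i)) < measure \<nu> (S - (\<Union>i. C i)) + e"
    by (intro approx mS[OF S] mF C(1) \<open>e > 0\<close>)
   then obtain n where "measure \<nu> (S - (\<Union>i<n. C i)) < e" using C(2) by auto
   thus "\<exists>F T. closed F \<and> open T \<and> F \<subseteq> S \<and> S \<subseteq> T \<and> measure \<nu> (T - F) < e"
    using C S by (intro exI[of _ "\<Union>i<n. C i"] exI[of _ S]) auto
  qed
 next
  case Empty
  thus ?case by (auto simp: P_def intro!: exI[of _ "{}"])
 next
  case (Compl E)
  show ?case unfolding P_def
  proof (intro allI impI)
   fix e :: real assume "e > 0"
   from Compl(2)[unfolded P_def, rule_format, OF this]
   obtain F S where "closed F" "open S" "F \<subseteq> E" "E \<subseteq> S" "measure \<nu> (S - F) < e" by metis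
   moreover have "- F - - S = S - F" by auto
   ultimately show "\<exists>F T. closed F \<and> open T \<and> F \<subseteq> UNIV - E \<and> UNIV - E \<subseteq> T \<and> measure \<nu> (T - F) < e"
    by (intro exI[of _ "- S"] exI[of _ "- F"]) auto
  qed
 next
  case (Union E)
  show ?case unfolding P_def
  proof (intro allI impI)
   fix e :: real assume e: "e > 0"
   have "\<exists>F S. closed F \<and> open S \<and> F \<subseteq> E i \<and> E i \<subseteq> S \<and> measure \<nu> (S - F) < e / 4 * (1/2)^i" for i
    by (rule Union(2)[unfolded P_def, rule_format]) (use e in simp)
   then obtain F S where FS: "\<And>i. closed (F i)" "\<And>i. open (S i)" "\<And>i. F i \<subseteq> E i" "\<And>i. E i \<subseteq> S i"
     "\<And>i. measure \<nu> (S i - F i) < e / 4 * (1/2)^i" by metis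
   have sm: "summable (%i. e / 4 * (1/2::real)^i)" by (intro summable_mult summable_geometric) simp
   have sm2: "summable (%i. measure \<nu> (S i - F i))"
    by (rule summable_comparison_test'[OF sm, of 0]) (use FS(5) in \<open>auto intro: less_imp_le\<close>)
   have "measure \<nu> ((\<Union>i. S i) - (\<Union>i. F i)) <= measure \<nu> (\<Union>i. S i - F i)"
    using mS[OF FS(2)] mF[OF FS(1)] by (intro nu.finite_measure_mono) auto
   also have "\<dots> <= (\<Sum>i. measure \<nu> (S i - F i))"
    using mS[OF FS(2)] mF[OF FS(1)] sm2 by (intro nu.finite_measure_subadditive_countably) auto
   also have "\<dots> <= (\<Sum>i. e / 4 * (1/2)^i)"
    using FS(5) by (intro suminf_le sm sm2) (auto intro: less_imp_le)
   also have "\<dots> = e / 2" using suminf_mult[OF summable_geometric[of "1/2::real"], of "e/4"] suminf_geometric[of "1/2::real"] by simp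
   finally have 1: "measure \<nu> ((\<Union>i. S i) - (\<Union>i. F i)) <= e / 2" .
   have "(\<Union>i. S i) \<in> sets \<nu>" using FS(2) by (intro mS) auto
   hence "\<exists>n. measure \<nu> ((\<Union>i. S i) - (\<Union>i<n. F i)) < measure \<nu> ((\<Union>i. S i) - (\<Union>i. F i)) + e/2"
    using e by (intro approx mF[OF FS(1)]) auto
   then obtain n where "measure \<nu> ((\<Union>i. S i) - (\<Union>i<n. F i)) < measure \<nu> ((\<Union>i. S i) - (\<Union>i. F i)) + e/2" ..
   hence "measure \<nu> ((\<Union>i. S i) - (\<Union>i<n. F i)) < e" using 1 by simp
   thus "\<exists>F T. closed F \<and> open T \<and> F \<subseteq> \<Union>(range E) \<and> \<Union>(range E) \<subseteq> T \<and> measure \<nu> (T - F) < e"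
    using FS by (intro exI[of _ "\<Union>i<n. F i"] exI[of _ "\<Union>i. S i"]) (auto, blast, blast)
  qed
 qed
 moreover have "E \<in> sigma_sets UNIV {S::'g set. open S}"
  using assms(3) by (simp add: borel_def)
 ultimately have "P E" by blast
 from this[unfolded P_def, rule_format, OF assms(4)] show ?thesis using that by metis
qed

definition cut :: "'g set => 'g measure" where "cut C = density \<mu> (indicator C)"

lemma cut:
 assumes "compact C"
 shows sets_cut: "sets (cut C) = sets borel" and finite_cut: "finite_measure (cut C)"
  and emeasure_cut: "E \<in> sets borel ==> emeasure (cut C) E = emeasure \<mu> (C \<inter> E)"
proof -
 have C: "C \<in> sets borel" using assms by (auto intro: borel_closed compact_imp_closed)
 show "sets (cut C) = sets borel" by (simp add: cut_def)
 show e: "emeasure (cut C) E = emeasure \<mu> (C \<inter> E)" if "E \<in> sets borel" for E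
  using that C by (simp add: cut_def emeasure_density indicator_inter_arith[symmetric])
 have "emeasure (cut C) (space (cut C)) = emeasure \<mu> C"
  using e[of UNIV] by (simp add: cut_def)
 thus "finite_measure (cut C)" using finite_on_compact[OF assms] by (intro finite_measureI) auto
qed

lemma measure_cut_Int:
 assumes "compact C" "E \<in> sets borel" "E \<subseteq> C"
 shows "emeasure (cut C) E = emeasure \<mu> E"
 using emeasure_cut[OF assms(1,2)] assms(3) by (simp add: Int_absorb1)

lemma inner_compact:
 assumes "E \<in> sets borel" "emeasure \<mu> E > 0"
 obtains K where "compact K" "K \<subseteq> E" "emeasure \<mu> K > 0"
proof -
 obtain V :: "'g set" where V: "open V" "0 \<in> V" "compact (closure V)"
  using open_compact_neighbourhood[OF open_UNIV UNIV_I] by metis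
 obtain X :: "'g set" where X: "countable X" "(\<Union>x\<in>X. (%u. x + u) ` V) = UNIV"
  using countable_translates_cover[OF V(1,2)] by metis
 have "\<exists>x\<in>X. emeasure \<mu> ((%u. x + u) ` closure V \<inter> E) > 0"
 proof (rule ccontr)
  assume "\<not> ?thesis"
  hence *: "emeasure \<mu> ((%u. x + u) ` closure V \<inter> E) = 0" if "x \<in> X" for x using that by auto
  have b: "(%u. x + u) ` closure V \<in> sets borel" for x
   using compact_translate[OF V(3)] by (auto intro: borel_closed compact_imp_closed)
  have "(\<Union>x\<in>X. (%u. x + u) ` closure V \<inter> E) \<in> null_sets \<mu>"
   using X(1) * assms(1) b by (intro null_sets_UN') (auto simp: null_sets_def)
  moreover have "(\<Union>x\<in>X. (%u. x + u) ` closure V \<inter> E) = E"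
   using X(2) closure_subset[of V] by (auto, blast)
  ultimately show False using assms(2) by auto
 qed
 then obtain x where x: "emeasure \<mu> ((%u. x + u) ` closure V \<inter> E) > 0" by blast
 define C where "C = (%u. x + u) ` closure V"
 have C: "compact C" using V by (simp add: C_def compact_translate)
 have CB: "C \<in> sets borel" using C by (auto intro: borel_closed compact_imp_closed)
 interpret c: finite_measure "cut C" by (rule finite_cut[OF C])
 have "emeasure (cut C) (C \<inter> E) > 0"
  using x CB assms(1) emeasure_cut[OF C, of "C \<inter> E"] by (simp add: C_def[symmetric] Int_absorb1)
 hence pos: "measure (cut C) (C \<inter> E) > 0" by (simp add: c.emeasure_eq_measure)
 obtain F S where F: "closed F" "open S" "F \<subseteq> C \<inter> E" "C \<inter> E \<subseteq> S" "measure (cut C) (S - F) < measure (cut C) (C \<inter> E)"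
  using finite_measure_regular[OF finite_cut[OF C] sets_cut[OF C], of "C \<inter> E", OF _ pos] CB assms(1) by auto
 have "measure (cut C) (C \<inter> E) <= measure (cut C) ((S - F) \<union> F)"
  using F CB assms(1) by (intro c.finite_measure_mono) (auto simp: sets_cut[OF C])
 also have "\<dots> <= measure (cut C) (S - F) + measure (cut C) F"
  using F by (intro measure_Un_le) (auto simp: sets_cut[OF C])
 finally have "measure (cut C) F > 0" using F by linarith
 hence "emeasure \<mu> F > 0"
  using measure_cut_Int[OF C, of F] F by (metis borel_closed c.emeasure_eq_measure ennreal_less_zero_iff inf.boundedE)
 moreover have "compact F" using compact_Int_closed[OF C F(1)] F(3) by (simp add: inf.absorb2)
 ultimately show ?thesis using that F by blast
qed

text \<open>Steinhaus: small left translates of a compact set stay inside an open set of only slightly larger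
 measure, in which the set and its translate cannot be disjoint.\<close>

lemma steinhaus:
 assumes K: "compact K" and pos: "emeasure \<mu> K > 0"
 obtains W c where "open W" "0 \<in> W" "c > 0" "c < \<infinity>"
  "\<And>w. w \<in> W ==> c <= emeasure \<mu> (K \<inter> (%u. w + u) ` K)"
proof -
 obtain V :: "'g set" where V: "open V" "0 \<in> V" "compact (closure V)"
  using open_compact_neighbourhood[OF open_UNIV UNIV_I] by metis
 define C where "C = {x + y | x y. x \<in> closure V \<and> y \<in> K}"
 have C: "compact C" unfolding C_def by (intro compact_sum V K)
 interpret c: finite_measure "cut C" by (rule finite_cut[OF C])
 have KB: "K \<in> sets borel" using K by (auto intro: borel_closed compact_imp_closed)
 have KC: "K \<subseteq> C" using V(2) closure_subset[of V] unfolding C_def by force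
 define m where "m = measure (cut C) K"
 have mK: "emeasure \<mu> K = ennreal m"
  using measure_cut_Int[OF C KB KC] by (simp add: c.emeasure_eq_measure m_def)
 hence m: "m > 0" using pos by auto
 obtain F S where F: "closed F" "open S" "F \<subseteq> K" "K \<subseteq> S" "measure (cut C) (S - F) < m / 2"
  using finite_measure_regular[OF finite_cut[OF C] sets_cut[OF C] KB, of "m/2"] m by auto
 have op: "open {p::'g\<times>'g. fst p + snd p \<in> S}"
  using open_vimage[OF F(2), of "%p::'g\<times>'g. fst p + snd p"] by (simp add: vimage_def continuous_intros)
 have "{0} \<times> K \<subseteq> {p. fst p + snd p \<in> S}" using F(4) by auto
 from Elementary_Topology.tube_lemma[OF K op this]
 obtain W where W: "0 \<in> W" "open W" "W \<times> K \<subseteq> {p. fst p + snd p \<in> S}" by blast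
 show ?thesis
 proof (rule that[of "W \<inter> V" "ennreal (m/2)"])
  show "open (W \<inter> V)" "0 \<in> W \<inter> V" using W V by auto
  show "0 < ennreal (m/2)" "ennreal (m/2) < \<infinity>" using m by auto
  fix w assume w: "w \<in> W \<inter> V"
  define L where "L = (%u. w + u) ` K"
  have L: "compact L" unfolding L_def by (rule compact_translate[OF K])
  have LB: "L \<in> sets borel" using L by (auto intro: borel_closed compact_imp_closed)
  have LC: "L \<subseteq> C" using w closure_subset[of V] unfolding C_def L_def by blast
  have LS: "L \<subseteq> S" using W(3) w unfolding L_def by force
  have "emeasure \<mu> L = emeasure \<mu> K" unfolding L_def by (rule left_invariant[OF KB])
  hence mL: "measure (cut C) L = m"
   using measure_cut_Int[OF C LB LC] mK m by (simp add: c.emeasure_eq_measure)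
  have "measure (cut C) (K \<union> L) <= measure (cut C) ((S - F) \<union> F)"
   using F LS by (intro c.finite_measure_mono) (auto simp: sets_cut[OF C])
  also have "\<dots> <= measure (cut C) (S - F) + measure (cut C) F"
   using F by (intro measure_Un_le) (auto simp: sets_cut[OF C])
  also have "\<dots> <= m / 2 + m"
   using F c.finite_measure_mono[of F K] KB by (auto simp: sets_cut[OF C] m_def)
  finally have 1: "measure (cut C) (K \<union> L) <= m / 2 + m" .
  have "measure (cut C) (K \<union> L) = measure (cut C) K + measure (cut C) (L - K)"
   using c.finite_measure_Union[of K "L - K"] KB LB by (auto simp: sets_cut[OF C])
  moreover have "measure (cut C) L = measure (cut C) (L - K) + measure (cut C) (K \<inter> L)"
   using c.finite_measure_Union[of "L - K" "L \<inter> K"] KB LB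
   by (auto simp: sets_cut[OF C] Un_Diff_Int Int_commute[of K])
  ultimately have "measure (cut C) (K \<inter> L) \<ge> m / 2" using 1 mL by (simp add: m_def)
  hence "ennreal (m/2) <= emeasure (cut C) (K \<inter> L)" by (simp add: c.emeasure_eq_measure ennreal_leI)
  thus "ennreal (m/2) <= emeasure \<mu> (K \<inter> (%u. w + u) ` K)"
   using measure_cut_Int[OF C sets.Int[OF KB LB]] KC by (simp add: L_def[symmetric] le_infI1)
 qed
qed

end

context haar_group
begin

section \<open>Convolution of nonnegative functions\<close>

definition star :: "('g => ennreal) => ('g => ennreal) => 'g => ennreal" where
 "star F k y = (\<integral>\<^sup>+x. F x * k (- x + y) \<partial>\<mu>)"

lemma borel_measurable_uminus_group [measurable (raw)]:
 fixes f :: "'a => 'g"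
 assumes "f \<in> borel_measurable M"
 shows "(%x. - f x) \<in> borel_measurable M"
proof -
 have "(%x::'g. - x) \<in> borel_measurable borel"
  by (intro borel_measurable_continuous_onI continuous_intros)
 from measurable_compose[OF assms this] show ?thesis .
qed

lemma star_measurable [measurable]:
 assumes [measurable]: "F \<in> borel_measurable borel" "k \<in> borel_measurable borel"
 shows "star F k \<in> borel_measurable borel"
 unfolding star_def by measurable

lemma star_mono:
 assumes "AE x in \<mu>. F x <= G x" "\<And>z. k z <= l z"
 shows "star F k y <= star G l y"
 unfolding star_def
proof (rule nn_integral_mono_AE)
 show "AE x in \<mu>. F x * k (- x + y) <= G x * l (- x + y)"
  using assms(1) by eventually_elim (intro mult_mono assms(2), auto)
qed

lemma star_assoc:
 assumes [measurable]: "F \<in> borel_measurable borel" "k \<in> borel_measurable borel" "l \<in> borel_measurable borel"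
 shows "star (star F k) l = star F (star k l)"
proof
 fix y
 have "star (star F k) l y = (\<integral>\<^sup>+x. (\<integral>\<^sup>+z. F z * k (- z + x) * l (- x + y) \<partial>\<mu>) \<partial>\<mu>)"
  unfolding star_def by (simp add: nn_integral_multc)
 also have "\<dots> = (\<integral>\<^sup>+z. (\<integral>\<^sup>+x. F z * k (- z + x) * l (- x + y) \<partial>\<mu>) \<partial>\<mu>)"
  by (rule Fubini') measurable
 also have "\<dots> = (\<integral>\<^sup>+z. F z * (\<integral>\<^sup>+x. k (- z + x) * l (- x + y) \<partial>\<mu>) \<partial>\<mu>)"
  by (simp add: nn_integral_cmult mult.assoc)
 also have "\<dots> = (\<integral>\<^sup>+z. F z * (\<integral>\<^sup>+x. k x * l (- x + (- z + y)) \<partial>\<mu>) \<partial>\<mu>)"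
 proof (rule nn_integral_cong, rule arg_cong[where f="%t. F _ * t"])
  fix z
  have "(\<integral>\<^sup>+x. k (- z + (z + x)) * l (- (z + x) + y) \<partial>\<mu>) = (\<integral>\<^sup>+x. k (- z + x) * l (- x + y) \<partial>\<mu>)"
   by (rule nn_integral_translate[of "%x. k (- z + x) * l (- x + y)" z]) measurable
  thus "(\<integral>\<^sup>+x. k (- z + x) * l (- x + y) \<partial>\<mu>) = (\<integral>\<^sup>+x. k x * l (- x + (- z + y)) \<partial>\<mu>)"
   by (simp add: minus_add add.assoc del: add_uminus_conv_diff)
 qed
 finally show "star (star F k) l y = star F (star k l) y" by (simp add: star_def)
qed

lemma star_add_right:
 assumes [measurable]: "F \<in> borel_measurable borel" "k \<in> borel_measurable borel" "l \<in> borel_measurable borel"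
 shows "star F (%z. k z + l z) y = star F k y + star F l y"
 unfolding star_def by (simp add: distrib_left nn_integral_add)

lemma star_cmult_right:
 assumes [measurable]: "F \<in> borel_measurable borel" "k \<in> borel_measurable borel"
 shows "star F (%z. c * k z) y = c * star F k y"
 unfolding star_def by (simp add: nn_integral_cmult[symmetric] mult.left_commute)

lemma star_cmult_left:
 assumes [measurable]: "F \<in> borel_measurable borel" "k \<in> borel_measurable borel"
 shows "star (%z. c * F z) k y = c * star F k y"
 unfolding star_def by (simp add: nn_integral_cmult[symmetric] mult.assoc)

section \<open>Averaging on both sides of a kernel gains smallness\<close>

definition conj_set :: "'g set => 'g => 'g set" where
 "conj_set S b = {s \<in> S. - b + s + b \<in> S}"

lemma conj_set_open: "open S ==> open (conj_set S b)"
proof -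
 assume S: "open S"
 have "conj_set S b = S \<inter> (%s. - b + s + b) -` S" by (auto simp: conj_set_def)
 thus ?thesis using S by (auto intro!: open_Int open_vimage continuous_intros)
qed

text \<open>The path leaves the larger neighbourhood, so at the moment at which it, or its conjugate by
 \<open>b\<close>, leaves an intermediate neighbourhood it provides an element \<open>t\<close> that translates the smaller
 set off itself while keeping it inside the larger one.\<close>

lemma conj_set_halving:
 fixes S :: "'g set" and \<gamma> :: "real => 'g"
 assumes S: "open S" "0 \<in> S"
  and \<gamma>: "continuous_on {0..1} \<gamma>" "\<gamma> 0 = 0" "\<gamma> 1 \<notin> S"
 obtains T where "open T" "0 \<in> T" "\<And>x. x \<in> T ==> - x \<in> T" "T \<subseteq> S"
  "\<And>b. 2 * emeasure \<mu> (conj_set T b) <= emeasure \<mu> (conj_set S b)"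
proof -
 obtain Y where Y: "open Y" "0 \<in> Y" "\<And>x y. x \<in> Y ==> y \<in> Y ==> x + y \<in> S" "Y \<subseteq> S"
  using symmetric_half_neighbourhood[OF S] by metis
 obtain Z where Z: "open Z" "0 \<in> Z" "\<And>x. x \<in> Z ==> - x \<in> Z" "closure Z \<subseteq> Y"
  using closure_neighbourhood[OF Y(1,2)] by metis
 obtain T where T: "open T" "0 \<in> T" "\<And>x. x \<in> T ==> - x \<in> T"
  "\<And>x y. x \<in> T ==> y \<in> T ==> x + y \<in> Z" "T \<subseteq> Z"
  using symmetric_half_neighbourhood[OF Z(1,2)] by metis
 have TY: "T \<subseteq> Y" using T(5) Z(4) closure_subset[of Z] by blast
 have "2 * emeasure \<mu> (conj_set T b) <= emeasure \<mu> (conj_set S b)" for b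
 proof -
  define A where "A = {t \<in> {0..1}. \<gamma> t \<in> Z \<and> - b + \<gamma> t + b \<in> Z}"
  have cont: "continuous_on {0..1} (%t. - b + \<gamma> t + b)" by (intro continuous_intros \<gamma>)
  have opA: "openin (top_of_set {0..1}) A"
  proof -
   have "openin (top_of_set {0..1}) ({0..1} \<inter> \<gamma> -` Z)"
    "openin (top_of_set {0..1}) ({0..1} \<inter> (%t. - b + \<gamma> t + b) -` Z)"
    using \<gamma> cont Z(1) by (auto intro: continuous_openin_preimage_gen)
   moreover have "A = ({0..1} \<inter> \<gamma> -` Z) \<inter> ({0..1} \<inter> (%t. - b + \<gamma> t + b) -` Z)"
    by (auto simp: A_def)
   ultimately show ?thesis by auto
  qed
  have A01: "0 \<in> A" "1 \<notin> A"
   using \<gamma> Z closure_subset[of Z] Y(4) by (auto simp: A_def)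
  have "\<not> closedin (top_of_set {0..1}) A"
   using opA A01 connected_clopen[of "{0..1::real}"] by force
  hence "\<exists>\<tau>\<in>{0..1}. \<tau> \<in> closure A \<and> \<tau> \<notin> A"
  proof (rule contrapos_np)
   assume "\<not> ?thesis"
   hence "A = {0..1} \<inter> closure A" using closure_subset[of A] by (auto simp: A_def)
   thus "closedin (top_of_set {0..1}) A" by (metis closed_closure closedin_closed_Int)
  qed
  then obtain \<tau> where \<tau>: "\<tau> \<in> {0..1}" "\<tau> \<in> closure A" "\<tau> \<notin> A" by blast
  have cl: "f \<tau> \<in> closure Z" if f: "continuous_on {0..1} f" "\<And>t. t \<in> A ==> f t \<in> Z" for f :: "real => 'g"
  proof -
   have "closure A \<subseteq> {0..1}" by (rule closure_minimal) (auto simp: A_def)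
   hence "f ` closure A \<subseteq> closure Z"
    using f by (intro image_closure_subset) (auto intro: continuous_on_subset closure_subset[THEN subsetD])
   thus ?thesis using \<tau> by blast
  qed
  define t where "t = \<gamma> \<tau>"
  have t: "t \<in> closure Z" "- b + t + b \<in> closure Z" "t \<notin> Z \<or> - b + t + b \<notin> Z"
   using cl[OF \<gamma>(1)] cl[OF cont] \<tau> unfolding t_def A_def by auto
  define P where "P = conj_set T b"
  have PB: "open P" unfolding P_def by (rule conj_set_open[OF T(1)])
  have eq: "- b + (x + y) + b = (- b + x + b) + (- b + y + b)" for x y :: 'g
   by (simp add: add.assoc)
  have sub: "P \<union> (%u. t + u) ` P \<subseteq> conj_set S b"
  proof
   fix x assume "x \<in> P \<union> (%u. t + u) ` P"
   thus "x \<in> conj_set S b"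
   proof
    assume "x \<in> P"
    thus ?thesis using TY Y(4) by (auto simp: P_def conj_set_def)
   next
    assume "x \<in> (%u. t + u) ` P"
    then obtain u where u: "x = t + u" "u \<in> Y" "- b + u + b \<in> Y"
     using TY by (auto simp: P_def conj_set_def)
    have "t + u \<in> S" by (rule Y(3)) (use t Z(4) u in auto)
    moreover have "- b + (t + u) + b \<in> S" unfolding eq by (rule Y(3)) (use t Z(4) u in auto)
    ultimately show ?thesis by (simp add: conj_set_def u)
   qed
  qed
  have disj: "P \<inter> (%u. t + u) ` P = {}"
  proof (rule ccontr)
   assume "P \<inter> (%u. t + u) ` P \<noteq> {}"
   then obtain u where u: "u \<in> P" "t + u \<in> P" by auto
   have "(t + u) + - u \<in> Z" using u T(3,4) unfolding P_def conj_set_def by blast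
   moreover have "- b + ((t + u) + - u) + b \<in> Z"
   proof (subst eq, rule T(4))
    show "- b + (t + u) + b \<in> T" using u by (simp add: P_def conj_set_def)
    have "- (- b + u + b) \<in> T" using u T(3) by (simp add: P_def conj_set_def)
    thus "- b + - u + b \<in> T" by (simp add: minus_add add.assoc del: add_uminus_conv_diff)
   qed
   ultimately show False using t(3) by (simp add: add.assoc)
  qed
  have "2 * emeasure \<mu> P = emeasure \<mu> P + emeasure \<mu> ((%u. t + u) ` P)"
   using left_invariant[of P t] PB by (simp add: mult_2)
  also have "\<dots> = emeasure \<mu> (P \<union> (%u. t + u) ` P)"
   using PB open_translate[OF PB] disj by (intro plus_emeasure) auto
  also have "\<dots> <= emeasure \<mu> (conj_set S b)"
   using sub conj_set_open[OF S(1)] by (intro emeasure_mono) auto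
  finally show ?thesis by (simp add: P_def)
 qed
 moreover have "T \<subseteq> S" using TY Y(4) by blast
 ultimately show ?thesis using that T by blast
qed

lemma conj_set_small:
 fixes S :: "'g set" and \<gamma> :: "real => 'g"
 assumes S: "open S" "0 \<in> S"
  and \<gamma>: "continuous_on {0..1} \<gamma>" "\<gamma> 0 = 0" "\<gamma> 1 \<notin> S"
 shows "\<exists>T. open T \<and> 0 \<in> T \<and> T \<subseteq> S \<and> (\<forall>b. 2 ^ m * emeasure \<mu> (conj_set T b) <= emeasure \<mu> (conj_set S b))"
proof (induction m)
 case 0
 thus ?case using S by (intro exI[of _ S]) auto
next
 case (Suc m)
 then obtain T where T: "open T" "0 \<in> T" "T \<subseteq> S"
   "\<And>b. 2 ^ m * emeasure \<mu> (conj_set T b) <= emeasure \<mu> (conj_set S b)" by blast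
 have "\<gamma> 1 \<notin> T" using T \<gamma> by blast
 then obtain T' where T': "open T'" "0 \<in> T'" "T' \<subseteq> T"
   "\<And>b. 2 * emeasure \<mu> (conj_set T' b) <= emeasure \<mu> (conj_set T b)"
  using conj_set_halving[OF T(1,2) \<gamma>(1,2)] by metis
 have "2 ^ Suc m * emeasure \<mu> (conj_set T' b) <= emeasure \<mu> (conj_set S b)" for b
 proof -
  have "2 ^ Suc m * emeasure \<mu> (conj_set T' b) = 2 ^ m * (2 * emeasure \<mu> (conj_set T' b))"
   by (simp add: mult_ac)
  also have "\<dots> <= 2 ^ m * emeasure \<mu> (conj_set T b)" by (intro mult_left_mono T') auto
  also have "\<dots> <= emeasure \<mu> (conj_set S b)" by (rule T)
  finally show ?thesis .
 qed
 thus ?case using T T' by (intro exI[of _ T']) auto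
qed

text \<open>Written out at a point \<open>y\<close>, the triple convolution integrates \<open>k b\<close> against the measure of
 the decompositions \<open>y = a + b + c\<close> with \<open>a\<close> and \<open>c\<close> in the neighbourhood. These form, up to a
 left translation, a set \<open>conj_set\<close>.\<close>

lemma star_indicator_both:
 assumes [measurable]: "k \<in> borel_measurable borel" "W \<in> sets borel"
 shows "star (star (indicator W) k) (indicator W) y
  = (\<integral>\<^sup>+b. k b * emeasure \<mu> {a \<in> W. - b + (- a + y) \<in> W} \<partial>\<mu>)"
proof -
 have "star (star (indicator W) k) (indicator W) y = star (indicator W) (star k (indicator W)) y"
  by (simp add: star_assoc)
 also have "\<dots> = (\<integral>\<^sup>+a. (\<integral>\<^sup>+b. indicator W a * (k b * indicator W (- b + (- a + y))) \<partial>\<mu>) \<partial>\<mu>)"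
  unfolding star_def by (simp add: nn_integral_cmult)
 also have "\<dots> = (\<integral>\<^sup>+b. (\<integral>\<^sup>+a. indicator W a * (k b * indicator W (- b + (- a + y))) \<partial>\<mu>) \<partial>\<mu>)"
  by (rule Fubini') measurable
 also have "\<dots> = (\<integral>\<^sup>+b. k b * (\<integral>\<^sup>+a. indicator {a \<in> W. - b + (- a + y) \<in> W} a \<partial>\<mu>) \<partial>\<mu>)"
 proof (intro nn_integral_cong)
  fix b
  have "(\<integral>\<^sup>+a. indicator W a * (k b * indicator W (- b + (- a + y))) \<partial>\<mu>)
   = (\<integral>\<^sup>+a. k b * indicator {a \<in> W. - b + (- a + y) \<in> W} a \<partial>\<mu>)"
   by (intro nn_integral_cong) (auto simp: indicator_def)
  also have "\<dots> = k b * (\<integral>\<^sup>+a. indicator {a \<in> W. - b + (- a + y) \<in> W} a \<partial>\<mu>)"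
   by (rule nn_integral_cmult) measurable
  finally show "(\<integral>\<^sup>+a. indicator W a * (k b * indicator W (- b + (- a + y))) \<partial>\<mu>) = \<dots>" .
 qed
 also have "\<dots> = (\<integral>\<^sup>+b. k b * emeasure \<mu> {a \<in> W. - b + (- a + y) \<in> W} \<partial>\<mu>)"
  by (intro nn_integral_cong arg_cong2[where f="(*)"] refl nn_integral_indicator) measurable
 finally show ?thesis .
qed

lemma measurable_slice:
 assumes [measurable]: "W \<in> sets borel"
 shows "(%b. emeasure \<mu> {a \<in> W. - b + (- a + y) \<in> W}) \<in> borel_measurable borel"
proof -
 have "(%b. emeasure \<mu> {a \<in> W. - b + (- a + y) \<in> W})
   = (%b. \<integral>\<^sup>+a. indicator W a * indicator W (- b + (- a + y)) \<partial>\<mu>)"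
 proof
  fix b
  have "emeasure \<mu> {a \<in> W. - b + (- a + y) \<in> W} = (\<integral>\<^sup>+a. indicator {a \<in> W. - b + (- a + y) \<in> W} a \<partial>\<mu>)"
   by (rule nn_integral_indicator[symmetric]) measurable
  also have "\<dots> = (\<integral>\<^sup>+a. indicator W a * indicator W (- b + (- a + y)) \<partial>\<mu>)"
   by (intro nn_integral_cong) (auto simp: indicator_def)
  finally show "emeasure \<mu> {a \<in> W. - b + (- a + y) \<in> W} = \<dots>" .
 qed
 also have "\<dots> \<in> borel_measurable borel" by measurable
 finally show ?thesis .
qed

lemma two_sided_gain:
 fixes V :: "'g set" and \<gamma> :: "real => 'g"
 assumes V: "open V" "0 \<in> V" and \<gamma>: "continuous_on {0..1} \<gamma>" "\<gamma> 0 = 0" "\<gamma> 1 \<notin> V"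
 obtains W where "open W" "0 \<in> W" "W \<subseteq> V"
  "\<And>k y. k \<in> borel_measurable borel ==>
   2 ^ m * star (star (indicator W) k) (indicator W) y <= star (star (indicator V) k) (indicator V) y"
proof -
 obtain S where S: "open S" "0 \<in> S" "\<And>x y. x \<in> S ==> y \<in> S ==> x + y \<in> V" "S \<subseteq> V"
   "\<And>x. x \<in> S ==> - x \<in> S"
  using symmetric_half_neighbourhood[OF V] by metis
 have "\<gamma> 1 \<notin> S" using \<gamma> S by blast
 then obtain T where T: "open T" "0 \<in> T" "T \<subseteq> S"
   "\<And>b. 2 ^ m * emeasure \<mu> (conj_set T b) <= emeasure \<mu> (conj_set S b)"
  using conj_set_small[OF S(1,2) \<gamma>(1,2)] by metis
 obtain W where W: "open W" "0 \<in> W" "\<And>x. x \<in> W ==> - x \<in> W"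
   "\<And>x y. x \<in> W ==> y \<in> W ==> x + y \<in> T" "W \<subseteq> T"
  using symmetric_half_neighbourhood[OF T(1,2)] by metis
 have [measurable]: "W \<in> sets borel" "V \<in> sets borel" using W V by auto
 have key: "2 ^ m * emeasure \<mu> {a \<in> W. - b + (- a + y) \<in> W} <= emeasure \<mu> {a \<in> V. - b + (- a + y) \<in> V}" for b y
 proof (cases "{a \<in> W. - b + (- a + y) \<in> W} = {}")
  case True
  show ?thesis unfolding True by simp
 next
  case False
  then obtain a0 where a0: "a0 \<in> W" "- b + (- a0 + y) \<in> W" by blast
  define c0 where "c0 = - b + (- a0 + y)"
  have "{a \<in> W. - b + (- a + y) \<in> W} \<subseteq> (%u. a0 + u) ` conj_set T b"
  proof
   fix a assume a: "a \<in> {a \<in> W. - b + (- a + y) \<in> W}"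
   have "- a0 + a \<in> T" using a a0 W by blast
   moreover have "- b + (- a0 + a) + b = c0 + - (- b + (- a + y))"
    by (simp add: c0_def minus_add add.assoc del: add_uminus_conv_diff)
   hence "- b + (- a0 + a) + b \<in> T" using a a0 W unfolding c0_def by (metis (no_types, lifting) mem_Collect_eq)
   ultimately have "- a0 + a \<in> conj_set T b" by (simp add: conj_set_def)
   thus "a \<in> (%u. a0 + u) ` conj_set T b" by (force simp: image_iff add.assoc[symmetric])
  qed
  hence "emeasure \<mu> {a \<in> W. - b + (- a + y) \<in> W} <= emeasure \<mu> ((%u. a0 + u) ` conj_set T b)"
   using open_translate[OF conj_set_open[OF T(1)]] by (intro emeasure_mono) auto
  also have "\<dots> = emeasure \<mu> (conj_set T b)"
   using conj_set_open[OF T(1)] by (intro left_invariant) auto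
  finally have "2 ^ m * emeasure \<mu> {a \<in> W. - b + (- a + y) \<in> W} <= 2 ^ m * emeasure \<mu> (conj_set T b)"
   by (rule mult_left_mono) simp
  also have "\<dots> <= emeasure \<mu> (conj_set S b)" by (rule T)
  also have "\<dots> = emeasure \<mu> ((%u. a0 + u) ` conj_set S b)"
   using conj_set_open[OF S(1)] by (intro left_invariant[symmetric]) auto
  also have "\<dots> <= emeasure \<mu> {a \<in> V. - b + (- a + y) \<in> V}"
  proof (rule emeasure_mono)
   show "(%u. a0 + u) ` conj_set S b \<subseteq> {a \<in> V. - b + (- a + y) \<in> V}"
   proof clarify
    fix s assume s: "s \<in> conj_set S b"
    have "a0 \<in> S" "c0 \<in> S" using a0 W T c0_def by auto
    hence "a0 + s \<in> V" using s S by (simp add: conj_set_def)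
    moreover have "- (- b + s + b) \<in> S" using s S(5) by (simp add: conj_set_def)
    hence "- (- b + s + b) + c0 \<in> V" using S(3) \<open>c0 \<in> S\<close> by blast
    moreover have "- b + (- (a0 + s) + y) = - (- b + s + b) + c0"
     by (simp add: c0_def minus_add add.assoc del: add_uminus_conv_diff)
    ultimately show "a0 + s \<in> V \<and> - b + (- (a0 + s) + y) \<in> V" by simp
   qed
   show "{a \<in> V. - b + (- a + y) \<in> V} \<in> sets \<mu>" by measurable
  qed
  finally show ?thesis .
 qed
 show ?thesis
 proof (rule that[OF W(1,2)])
  show "W \<subseteq> V" using W T S by blast
  fix k :: "'g => ennreal" and y assume [measurable]: "k \<in> borel_measurable borel"
  show "2 ^ m * star (star (indicator W) k) (indicator W) y <= star (star (indicator V) k) (indicator V) y"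
  proof -
   have [measurable]: "(%b. emeasure \<mu> {a \<in> W. - b + (- a + y) \<in> W}) \<in> borel_measurable borel"
    by (rule measurable_slice) fact
   have "2 ^ m * star (star (indicator W) k) (indicator W) y
     = (\<integral>\<^sup>+b. k b * (2 ^ m * emeasure \<mu> {a \<in> W. - b + (- a + y) \<in> W}) \<partial>\<mu>)"
    by (simp add: star_indicator_both nn_integral_cmult[symmetric] mult.left_commute)
   also have "\<dots> <= (\<integral>\<^sup>+b. k b * emeasure \<mu> {a \<in> V. - b + (- a + y) \<in> V} \<partial>\<mu>)"
    by (intro nn_integral_mono mult_left_mono key) auto
   also have "\<dots> = star (star (indicator V) k) (indicator V) y"
    by (simp add: star_indicator_both)
   finally show ?thesis .
  qed
 qed
qed

end

context haar_group
begin

text \<open>A function that is positive on a set \<open>E\<close> of positive measure has a self-convolution bounded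
 below on an open set: \<open>E\<close> contains a compact \<open>K\<close>, some intersection of \<open>K\<close> with a translate of
 its inverse has positive measure, and Steinhaus applies to that intersection.\<close>

lemma star_self_lower_bound:
 assumes [measurable]: "g \<in> borel_measurable borel" and pos: "\<not> (AE x in \<mu>. g x = 0)"
 obtains W z c where "open W" "0 \<in> W" "c > 0" "c < \<infinity>" "\<And>w. w \<in> W ==> c <= star g g (w + z)"
proof -
 define E where "E n = {x. g x > ennreal (1 / Suc n)}" for n
 have E [measurable]: "E n \<in> sets borel" for n unfolding E_def by measurable
 have "\<exists>n. emeasure \<mu> (E n) > 0"
 proof (rule ccontr)
  assume "\<not> ?thesis"
  hence "(\<Union>n. E n) \<in> null_sets \<mu>" by (intro null_sets_UN) (auto simp: null_sets_def)
  hence "AE x in \<mu>. x \<notin> (\<Union>n. E n)" by (rule AE_not_in)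
  hence "AE x in \<mu>. g x = 0"
  proof eventually_elim
   case (elim x)
   hence le: "g x <= ennreal (1 / Suc n)" for n by (auto simp: E_def not_less)
   have "g x < \<infinity>" using le[of 0] by (auto simp: top_unique less_top intro: le_less_trans)
   then obtain r where r: "g x = ennreal r" "r \<ge> 0" by (cases "g x") auto
   have "r <= 1 / Suc n" for n using le[of n] r by simp
   hence "r <= 0" by (intro LIMSEQ_le_const[OF LIMSEQ_inverse_real_of_nat]) (auto simp: inverse_eq_divide)
   thus ?case using r by simp
  qed
  thus False using pos by simp
 qed
 then obtain n where n: "emeasure \<mu> (E n) > 0" by blast
 obtain K where K: "compact K" "K \<subseteq> E n" "emeasure \<mu> K > 0"
  using inner_compact[OF E n] by metis
 have KB [measurable]: "K \<in> sets borel" using K by (auto intro: borel_closed compact_imp_closed)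
 define D where "D y = {x \<in> K. - x + y \<in> K}" for y
 have Dm: "D y \<in> sets borel" for y unfolding D_def by measurable
 have starK: "star (indicator K) (indicator K) y = emeasure \<mu> (D y)" for y
 proof -
  have "star (indicator K) (indicator K) y = (\<integral>\<^sup>+x. indicator (D y) x \<partial>\<mu>)"
   unfolding star_def by (intro nn_integral_cong) (auto simp: indicator_def D_def)
  also have "\<dots> = emeasure \<mu> (D y)" using Dm by (intro nn_integral_indicator) auto
  finally show ?thesis .
 qed
 have "\<exists>z. emeasure \<mu> (D z) > 0"
 proof (rule ccontr)
  assume "\<not> ?thesis"
  hence 0: "star (indicator K) (indicator K) y = 0" for y by (simp add: starK)
  have "emeasure \<mu> K * emeasure \<mu> K = (\<integral>\<^sup>+x. indicator K x * emeasure \<mu> K \<partial>\<mu>)"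
   by (subst nn_integral_multc) auto
  also have "\<dots> = (\<integral>\<^sup>+x. (\<integral>\<^sup>+y. indicator K x * indicator K (- x + y) \<partial>\<mu>) \<partial>\<mu>)"
   by (simp add: nn_integral_cmult nn_integral_translate[of "indicator K"])
  also have "\<dots> = (\<integral>\<^sup>+y. star (indicator K) (indicator K) y \<partial>\<mu>)"
   unfolding star_def by (rule Fubini') measurable
  also have "\<dots> = 0" by (simp add: 0)
  finally show False using K(3) by simp
 qed
 then obtain z where z: "emeasure \<mu> (D z) > 0" by blast
 have "compact (D z)"
 proof -
  have "D z = K \<inter> (%x. - x + z) -` K" by (auto simp: D_def)
  thus ?thesis using K(1) compact_imp_closed[OF K(1)]
   by (auto intro!: compact_Int_closed closed_vimage continuous_intros)
 qed
 from steinhaus[OF this z] obtain W c where W: "open W" "0 \<in> W" "c > 0" "c < \<infinity>"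
  "\<And>w. w \<in> W ==> c <= emeasure \<mu> (D z \<inter> (%u. w + u) ` D z)" by metis
 define e where "e = ennreal (1 / Suc n)"
 have e: "e > 0" "e < \<infinity>" by (auto simp: e_def)
 show ?thesis
 proof (rule that[OF W(1,2)])
  show "0 < e * e * c" using e W(3) by (simp add: ennreal_zero_less_mult_iff)
  show "e * e * c < \<infinity>" using e W(4) by (simp add: ennreal_mult_less_top)
  fix w assume w: "w \<in> W"
  have "D z \<inter> (%u. w + u) ` D z \<subseteq> D (w + z)"
  proof clarify
   fix u assume "w + u \<in> D z" "u \<in> D z"
   moreover have "- (w + u) + (w + z) = - u + z"
    by (simp add: minus_add add.assoc del: add_uminus_conv_diff)
   ultimately show "w + u \<in> D (w + z)" by (simp add: D_def)
  qed
  hence "c <= emeasure \<mu> (D (w + z))"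
   using W(5)[OF w] Dm[of "w + z"] by (metis (no_types, lifting) emeasure_mono order_trans sets_mu)
  hence "e * e * c <= e * e * star (indicator K) (indicator K) (w + z)"
   by (auto simp: starK intro!: mult_left_mono)
  also have "\<dots> = star (%x. e * indicator K x) (%x. e * indicator K x) (w + z)"
   by (simp add: star_cmult_left star_cmult_right mult.assoc)
  also have "\<dots> <= star g g (w + z)"
   using K(2) by (intro star_mono AE_I2) (auto simp: indicator_def E_def e_def less_imp_le)
  finally show "e * e * c <= star g g (w + z)" .
 qed
qed

section \<open>Relatively separated families\<close>

text \<open>The points are a maximal family for which the translates of a small symmetric \<open>W\<close> are disjoint. The
 points whose cells meet a given cell lie in a translate of a compact set, which finitely many translates
 of \<open>W\<close> cover; each of these contains at most one of the points.\<close>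

lemma relatively_separated_exists:
 fixes U :: "'g set"
 assumes U: "compact U" "0 \<in> interior U"
 obtains I :: "nat set" and x where "relatively_separated U I x"
proof -
 obtain W where W: "open W" "0 \<in> W" "\<And>x. x \<in> W ==> - x \<in> W"
   "\<And>x y. x \<in> W ==> y \<in> W ==> x + y \<in> interior U"
  using symmetric_half_neighbourhood[OF open_interior U(2)] by metis
 define \<A> where "\<A> = {X. pairwise (%x y. (%u. x + u) ` W \<inter> (%u. y + u) ` W = {}) X}"
 have "\<exists>X\<in>\<A>. \<forall>Y\<in>\<A>. X \<subseteq> Y --> Y = X"
 proof (rule subset_Zorn')
  fix C assume C: "subset.chain \<A> C"
  show "\<Union>C \<in> \<A>"
   unfolding \<A>_def mem_Collect_eq pairwise_def
  proof (intro ballI impI)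
   fix x y assume xy: "x \<in> \<Union>C" "y \<in> \<Union>C" "x \<noteq> y"
   then obtain X Y where XY: "X \<in> C" "Y \<in> C" "x \<in> X" "y \<in> Y" by blast
   hence "X \<subseteq> Y \<or> Y \<subseteq> X" "X \<in> \<A>" "Y \<in> \<A>" using C by (auto simp: subset.chain_def)
   thus "(%u. x + u) ` W \<inter> (%u. y + u) ` W = {}"
    using xy XY unfolding \<A>_def pairwise_def mem_Collect_eq by (meson subsetD)
  qed
 qed
 then obtain X where X: "X \<in> \<A>" and max: "\<And>Y. Y \<in> \<A> ==> X \<subseteq> Y ==> Y = X" by blast
 have disj: "x = y" if "x \<in> X" "y \<in> X" "a \<in> (%u. x + u) ` W" "a \<in> (%u. y + u) ` W" for x y a
  using X that unfolding \<A>_def pairwise_def by blast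
 have inW: "x \<in> (%u. x + u) ` W" for x using W(2) by (auto simp: image_iff intro!: bexI[of _ 0])
 have inj: "inj_on (%x. (%u. x + u) ` W) X" using disj inW by (intro inj_onI) blast
 have "countable ((%x. (%u. x + u) ` W) ` X)"
 proof (rule countable_disjoint_open_subsets)
  show "pairwise disjnt ((%x. (%u. x + u) ` W) ` X)"
  proof (rule pairwiseI)
   fix P Q assume "P \<in> (%x. (%u. x + u) ` W) ` X" "Q \<in> (%x. (%u. x + u) ` W) ` X" "P \<noteq> Q"
   then obtain x y where "x \<in> X" "y \<in> X" "x \<noteq> y" "P = (%u. x + u) ` W" "Q = (%u. y + u) ` W"
    by blast
   thus "disjnt P Q"
    using X unfolding \<A>_def mem_Collect_eq pairwise_def disjnt_def by meson
  qed
 qed (use open_translate[OF W(1)] in blast)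
 hence cX: "countable X" using inj by (rule countable_image_inj_on)
 have cover: "\<exists>x\<in>X. g \<in> (%u. x + u) ` U" for g
 proof -
  have "\<exists>x\<in>X. (%u. x + u) ` W \<inter> (%u. g + u) ` W \<noteq> {}"
  proof (rule ccontr)
   assume *: "\<not> ?thesis"
   hence "insert g X \<in> \<A>" using X unfolding \<A>_def by (auto simp: pairwise_insert)
   hence "g \<in> X" using max[of "insert g X"] by blast
   thus False using * inW by blast
  qed
  then obtain x v w where "x \<in> X" "v \<in> W" "w \<in> W" "x + v = g + w" by auto
  moreover from this have "g = x + (v + - w)" by (metis add.assoc add.right_neutral right_minus)
  moreover have "v + - w \<in> U" using W calculation interior_subset[of U] by blast
  ultimately show ?thesis by blast
 qed
 define D where "D = {x + y | x y. x \<in> U \<and> y \<in> uminus ` U}"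
 have D: "compact D" unfolding D_def by (intro compact_sum compact_uminus U)
 obtain A where A: "finite A" "D \<subseteq> (\<Union>a\<in>A. (%u. a + u) ` W)"
 proof (rule compactE_image[OF D, of D "%a. (%u. a + u) ` W"])
  show "D \<subseteq> (\<Union>a\<in>D. (%u. a + u) ` W)" using inW by blast
 qed (use open_translate[OF W(1)] in auto)
 have fin: "finite {y \<in> X. (%u. x + u) ` U \<inter> (%u. y + u) ` U \<noteq> {}} \<and>
   card {y \<in> X. (%u. x + u) ` U \<inter> (%u. y + u) ` U \<noteq> {}} <= card A" for x
 proof -
  let ?J = "{y \<in> X. (%u. x + u) ` U \<inter> (%u. y + u) ` U \<noteq> {}}"
  have "\<exists>a\<in>A. x + a \<in> (%u. y + u) ` W" if y: "y \<in> ?J" for y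
  proof -
   obtain u v where uv: "u \<in> U" "v \<in> U" "x + u = y + v" using y by auto
   hence y': "y = x + (u + - v)" by (metis add.assoc add.right_neutral right_minus)
   have "u + - v \<in> D" unfolding D_def using uv by blast
   hence "u + - v \<in> (\<Union>a\<in>A. (%u. a + u) ` W)" using A(2) by (rule rev_subsetD)
   then obtain a w where a: "a \<in> A" "w \<in> W" "u + - v = a + w" by (elim UN_E imageE)
   have "x + a = y + - w" unfolding y' a(3) by (simp add: add.assoc del: add_uminus_conv_diff)
   hence "x + a \<in> (%u. y + u) ` W" using W(3)[OF a(2)] by (rule image_eqI)
   with a(1) show ?thesis by (rule bexI[rotated])
  qed
  hence "\<forall>y\<in>?J. \<exists>a. a \<in> A \<and> x + a \<in> (%u. y + u) ` W" unfolding Bex_def by (rule ballI)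
  from bchoice[OF this] obtain f where f: "\<And>y. y \<in> ?J ==> f y \<in> A \<and> x + f y \<in> (%u. y + u) ` W" by (elim exE) (rule that, erule bspec)
  have "inj_on f ?J"
  proof (rule inj_onI)
   fix y y' assume yy: "y \<in> ?J" "y' \<in> ?J" "f y = f y'"
   have "x + f y \<in> (%u. y + u) ` W" using f[OF yy(1)] by (rule conjunct2)
   moreover have "x + f y \<in> (%u. y' + u) ` W" unfolding yy(3) using f[OF yy(2)] by (rule conjunct2)
   moreover have "y \<in> X" "y' \<in> X" using yy(1,2) by auto
   ultimately show "y = y'" using disj by metis
  qed
  moreover have "f ` ?J \<subseteq> A" using f by blast
  ultimately show ?thesis using A(1) by (meson card_inj_on_le inj_on_finite)
 qed
 define I where "I = to_nat_on X ` X"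
 define x where "x = inv_into X (to_nat_on X)"
 have injX: "inj_on (to_nat_on X) X" using cX by (rule inj_on_to_nat_on)
 have x: "x ` I = X" "inj_on x I"
  unfolding I_def x_def using injX by (auto simp: image_inv_into_cancel image_iff inj_on_inv_into)
 have "relatively_separated U I x"
  unfolding relatively_separated_def
 proof (intro conjI exI[of _ "card A"] ballI)
  show "(\<Union>i\<in>I. (%u. x i + u) ` U) = UNIV" using cover x(1) by blast
  fix i assume "i \<in> I"
  let ?J = "{j \<in> I. (%u. x i + u) ` U \<inter> (%u. x j + u) ` U \<noteq> {}}"
  have im: "x ` ?J \<subseteq> {y \<in> X. (%u. x i + u) ` U \<inter> (%u. y + u) ` U \<noteq> {}}" using x(1) by blast
  have inj: "inj_on x ?J" using x(2) by (rule inj_on_subset) auto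
  show "finite ?J" using inj_on_finite[OF inj im] fin[of "x i"] by blast
  show "card ?J <= card A" using card_inj_on_le[OF inj im] fin[of "x i"] by linarith
 qed (use U in auto)
 thus ?thesis using that by blast
qed

end

section \<open>Countably subadditive seminorms on complete seminormed spaces\<close>

text \<open>Zabreiko's lemma: by Baire's theorem some sublevel set of \<open>q\<close> is dense in a ball, hence, after
 scaling, every \<open>z\<close> is approximated by elements on which \<open>q\<close> is controlled by \<open>p z\<close>; summing the
 successive corrections gives the bound for \<open>z\<close> itself.\<close>

lemma zabreiko:
 fixes X :: "('a => complex) set" and p q :: "('a => complex) => real"
 assumes zero: "(%t. 0) \<in> X"
  and add: "\<And>x y. x \<in> X ==> y \<in> X ==> (%t. x t + y t) \<in> X"
  and scale: "\<And>a x. x \<in> X ==> (%t. a * x t) \<in> X"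
  and p_nonneg: "\<And>x. x \<in> X ==> 0 <= p x"
  and p_add: "\<And>x y. x \<in> X ==> y \<in> X ==> p (%t. x t + y t) <= p x + p y"
  and p_scale: "\<And>a x. x \<in> X ==> p (%t. a * x t) = cmod a * p x"
  and complete: "\<And>F :: nat => 'a => complex. (\<And>k. F k \<in> X) ==>
   (\<And>e. e > 0 ==> \<exists>M. \<forall>j\<ge>M. \<forall>k\<ge>M. p (%x. F j x - F k x) < e) ==>
   \<exists>f\<in>X. (%k. p (%x. F k x - f x)) \<longlonglongrightarrow> 0"
  and q_nonneg: "\<And>x. x \<in> X ==> 0 <= q x"
  and q_add: "\<And>x y. x \<in> X ==> y \<in> X ==> q (%t. x t + y t) <= q x + q y"
  and q_scale: "\<And>a x. x \<in> X ==> q (%t. a * x t) = cmod a * q x"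
  and q_series: "\<And>x s. s \<in> X ==> (\<And>k. x k \<in> X) ==>
   (%n. p (%t. (\<Sum>k<n. x k t) - s t)) \<longlonglongrightarrow> 0 ==> summable (%k. q (x k)) ==> q s <= (\<Sum>k. q (x k))"
 obtains C where "C \<ge> 0" "\<And>x. x \<in> X ==> q x <= C * p x"
proof -
 have diff: "(%t. x t - y t) \<in> X" if "x \<in> X" "y \<in> X" for x y
  using add[OF that(1) scale[OF that(2), of "-1"]] by simp
 have p_minus: "p (%t. x t - y t) = p (%t. y t - x t)" if "x \<in> X" "y \<in> X" for x y
  using p_scale[OF diff[OF that(2,1)], of "-1"] by simp
 have p_tri: "p (%t. x t - z t) <= p (%t. x t - y t) + p (%t. y t - z t)"
  if "x \<in> X" "y \<in> X" "z \<in> X" for x y z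
  using p_add[OF diff[OF that(1,2)] diff[OF that(2,3)]] by simp
 have q_diff: "q (%t. x t - y t) <= q x + q y" if "x \<in> X" "y \<in> X" for x y
  using q_add[OF that(1) scale[OF that(2), of "-1"]] q_scale[OF that(2), of "-1"] by simp
 have p0: "p (%t. 0) = 0" using p_scale[OF zero, of 0] by simp
 \<comment> \<open>Otherwise there are nested balls, with radii at least halved in every step, of which the \<open>n\<close>-th keeps
  away from all points with \<open>q \<le> n\<close>; nothing can be the value of \<open>q\<close> at their common point.\<close>
 have "\<exists>n::nat. \<exists>y\<in>X. \<exists>r>0. \<forall>z\<in>X. p (%t. z t - y t) < r -->
   (\<forall>e>0. \<exists>w\<in>X. q w <= real n \<and> p (%t. z t - w t) < e)"
 proof (rule ccontr)
  assume H: "\<not> ?thesis"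
  define R where "R n a b \<longleftrightarrow> snd b <= snd a / 2 \<and> p (%t. fst b t - fst a t) + snd b <= snd a \<and>
   (\<forall>w\<in>X. q w <= real n --> p (%t. fst b t - w t) > snd b)" for n :: nat and a b :: "('a => complex) \<times> real"
  have step: "\<exists>b. (fst b \<in> X \<and> snd b > 0) \<and> R n a b" if a: "fst a \<in> X \<and> snd a > 0" for n a
  proof -
   have "\<not> (\<forall>z\<in>X. p (%t. z t - fst a t) < snd a -->
     (\<forall>e>0. \<exists>w\<in>X. q w <= real n \<and> p (%t. z t - w t) < e))" using H a by blast
   then obtain z e where z: "z \<in> X" "p (%t. z t - fst a t) < snd a" "e > 0"
     "\<And>w. w \<in> X ==> q w <= real n ==> \<not> p (%t. z t - w t) < e" by blast
   define r where "r = min (e / 2) (min (snd a / 2) (snd a - p (%t. z t - fst a t)))"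
   have "r > 0" using z a by (auto simp: r_def)
   moreover have "r < e" "r <= snd a / 2" "p (%t. z t - fst a t) + r <= snd a"
    using z(3) by (auto simp: r_def min_def)
   ultimately show ?thesis using z by (intro exI[of _ "(z, r)"]) (force simp: R_def not_less)
  qed
  obtain f where f: "\<And>n. fst (f n) \<in> X \<and> snd (f n) > 0" "\<And>n. R n (f n) (f (Suc n))"
   using dependent_nat_choice[of "%n a. fst a \<in> X \<and> snd a > 0" R, OF _ step]
   by (metis fst_conv snd_conv zero zero_less_one)
  define y r where "y n = fst (f n)" and "r n = snd (f n)" for n
  have y: "y n \<in> X" "r n > 0" for n using f by (auto simp: y_def r_def)
  have Rn: "r (Suc n) <= r n / 2" "p (%t. y (Suc n) t - y n t) + r (Suc n) <= r n"
    "\<And>w. w \<in> X ==> q w <= real n ==> p (%t. y (Suc n) t - w t) > r (Suc n)" for n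
   using f(2)[of n] by (auto simp: y_def r_def R_def)
  have near: "p (%t. y (n + k) t - y n t) + r (n + k) <= r n" for n k
  proof (induction k)
   case 0 thus ?case by (simp add: p0)
  next
   case (Suc k)
   have "p (%t. y (n + Suc k) t - y n t) <= p (%t. y (Suc (n+k)) t - y (n+k) t) + p (%t. y (n+k) t - y n t)"
    using p_tri[OF y(1) y(1) y(1)] by simp
   thus ?case using Suc Rn(2)[of "n+k"] by simp
  qed
  have rgeo: "r n <= r 0 * (1/2)^n" for n
   by (induction n) (use Rn(1) in \<open>auto intro: order_trans\<close>)
  have r0: "r \<longlonglongrightarrow> 0"
  proof (rule tendsto_sandwich[of "%_. 0" _ _ "%n. r 0 * (1/2)^n"])
   show "(%n. r 0 * (1/2)^n) \<longlonglongrightarrow> 0" by (intro tendsto_mult_right_zero LIMSEQ_power_zero) simp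
  qed (use rgeo y(2) in \<open>auto intro!: always_eventually less_imp_le\<close>)
  have nearer: "p (%t. y j t - y n t) <= r n" if "j \<ge> n" for j n
   using near[of n "j - n"] that y(2)[of j] by simp
  have "\<exists>s\<in>X. (%k. p (%x. y k x - s x)) \<longlonglongrightarrow> 0"
  proof (rule complete[OF y(1)])
   fix e :: real assume "e > 0"
   then obtain M where M: "r M < e / 2"
    using order_tendstoD(2)[OF r0, of "e/2"] by (auto simp: eventually_sequentially)
   have "p (%x. y j x - y k x) < e" if "j \<ge> M" "k \<ge> M" for j k
    using p_tri[OF y(1)[of j] y(1)[of M] y(1)[of k]] nearer[OF that(1)] nearer[OF that(2)] M
     p_minus[OF y(1)[of M] y(1)[of k]] by linarith
   thus "\<exists>M. \<forall>j\<ge>M. \<forall>k\<ge>M. p (%x. y j x - y k x) < e" by blast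
  qed
  then obtain s where s: "s \<in> X" "(%k. p (%x. y k x - s x)) \<longlonglongrightarrow> 0" by blast
  have close: "p (%t. y n t - s t) <= r n" for n
  proof (rule field_le_epsilon)
   fix e :: real assume "e > 0"
   then obtain M where M: "\<And>k. k \<ge> M ==> p (%x. y k x - s x) < e"
    using order_tendstoD(2)[OF s(2), of e] by (auto simp: eventually_sequentially)
   define j where "j = max M n"
   have "p (%t. y n t - s t) <= p (%t. y n t - y j t) + p (%t. y j t - s t)"
    by (rule p_tri[OF y(1) y(1) s(1)])
   thus "p (%t. y n t - s t) <= r n + e"
    using M[of j] nearer[of n j] p_minus[OF y(1)[of n] y(1)[of j]] by (simp add: j_def)
  qed
  obtain n :: nat where "q s <= real n" using real_arch_simple by blast
  thus False using Rn(3)[OF s(1), of n] close[of "Suc n"] by linarith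
 qed
 then obtain n :: nat and y r where y: "y \<in> X" "r > 0"
  and dense: "\<And>z e. z \<in> X ==> p (%t. z t - y t) < r ==> e > 0 ==> \<exists>w\<in>X. q w <= real n \<and> p (%t. z t - w t) < e"
  by blast
 have ball: "\<exists>w\<in>X. q w <= 2 * real n \<and> p (%t. z t - w t) < e" if z: "z \<in> X" "p z < r" and e: "e > 0" for z e
 proof -
  have "p (%t. y t - y t) < r" using y p0 by simp
  then obtain w2 where w2: "w2 \<in> X" "q w2 <= real n" "p (%t. y t - w2 t) < e/2"
   using dense[OF y(1), of "e/2"] e by auto
  obtain w1 where w1: "w1 \<in> X" "q w1 <= real n" "p (%t. z t + y t - w1 t) < e/2"
   using dense[OF add[OF z(1) y(1)], of "e/2"] z e by auto
  have "p (%t. (z t + y t - w1 t) + (-1) * (y t - w2 t)) <= p (%t. z t + y t - w1 t) + p (%t. (-1) * (y t - w2 t))"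
   by (intro p_add diff scale add z y w1 w2)
  also have "p (%t. (-1) * (y t - w2 t)) = p (%t. y t - w2 t)"
   using p_scale[OF diff[OF y(1) w2(1)], of "-1"] by simp
  finally have "p (%t. z t - (w1 t - w2 t)) < e" using w1 w2 by (simp add: algebra_simps)
  moreover have "q (%t. w1 t - w2 t) <= 2 * real n" using q_diff[OF w1(1) w2(1)] w1 w2 by linarith
  ultimately show ?thesis using diff[OF w1(1) w2(1)] by blast
 qed
 define K where "K = 2 * real n / r"
 have K: "K \<ge> 0" using y by (simp add: K_def)
 have approx: "\<exists>w. w \<in> X \<and> q w <= K * d \<and> p (%t. z t - w t) < d / 2" if z: "z \<in> X" "p z < d" for z d
 proof -
  have d: "d > 0" using z p_nonneg[OF z(1)] by linarith
  have "p (%t. complex_of_real (r / d) * z t) = r / d * p z"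
   using p_scale[OF z(1), of "complex_of_real (r/d)"] y d by (simp add: norm_divide)
  also have "\<dots> < r" using z y d by (simp add: field_simps)
  finally obtain w where w: "w \<in> X" "q w <= 2 * real n" "p (%t. complex_of_real (r / d) * z t - w t) < r / 2"
   using ball[OF scale[OF z(1)], of "complex_of_real (r/d)" "r/2"] y by auto
  define v where "v = (%t. complex_of_real (d / r) * w t)"
  have v: "v \<in> X" unfolding v_def by (rule scale[OF w(1)])
  have qv: "q v = d / r * q w"
   unfolding v_def using q_scale[OF w(1), of "complex_of_real (d/r)"] y d by (simp add: norm_divide)
  have "q v <= d / r * (2 * real n)"
   unfolding qv by (intro mult_left_mono w) (use y d in auto)
  hence "q v <= K * d" by (simp add: K_def field_simps)
  moreover have "p (%t. z t - v t) = p (%t. complex_of_real (d / r) * (complex_of_real (r / d) * z t - w t))"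
   using y d by (intro arg_cong[where f=p]) (auto simp: v_def fun_eq_iff field_simps)
  hence "p (%t. z t - v t) = d / r * p (%t. complex_of_real (r / d) * z t - w t)"
   using p_scale[OF diff[OF scale[OF z(1), of "complex_of_real (r/d)"] w(1)], of "complex_of_real (d/r)"] y d
   by (simp add: norm_divide)
  hence "p (%t. z t - v t) < d / 2"
   using mult_strict_left_mono[OF w(3), of "d / r"] y d by simp
  ultimately show ?thesis using v by blast
 qed
 have main: "q z <= 2 * K * d" if z: "z \<in> X" "p z < d" for z d
 proof -
  obtain W where W: "\<And>z d. z \<in> X ==> p z < d ==> W z d \<in> X \<and> q (W z d) <= K * d \<and> p (%t. z t - W z d t) < d / 2"
   using approx by metis
  define s where "s = rec_nat z (%k v t. v t - W v (d / 2^k) t)"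
  have s0: "s 0 = z" and sS: "s (Suc k) = (%t. s k t - W (s k) (d / 2^k) t)" for k
   by (simp_all add: s_def)
  have s: "s k \<in> X \<and> p (s k) < d / 2^k" for k
  proof (induction k)
   case 0 thus ?case using z by (simp add: s0)
  next
   case (Suc k)
   hence k: "s k \<in> X" "p (s k) < d / 2^k" by auto
   from W[OF k] show ?case using diff[OF k(1)] unfolding sS by (simp add: field_simps)
  qed
  define x where "x k = W (s k) (d / 2^k)" for k
  have x: "x k \<in> X" "q (x k) <= K * (d / 2^k)" for k using W s unfolding x_def by blast+
  have sum: "(\<Sum>k<n. x k t) - z t = (-1) * s n t" for n t
   by (induction n) (auto simp: s0 sS x_def)
  have lim: "(%n. p (%t. (\<Sum>k<n. x k t) - z t)) \<longlonglongrightarrow> 0"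
  proof (rule tendsto_sandwich[of "%_. 0" _ _ "%n. d * (1/2)^n"])
   have "p (%t. (\<Sum>k<n. x k t) - z t) = p (s n)" for n
    unfolding sum using p_scale[of "s n" "-1"] s by simp
   thus "\<forall>\<^sub>F n in sequentially. p (%t. (\<Sum>k<n. x k t) - z t) <= d * (1/2)^n"
    "\<forall>\<^sub>F n in sequentially. 0 <= p (%t. (\<Sum>k<n. x k t) - z t)"
    using s p_nonneg by (auto simp: field_simps intro!: always_eventually less_imp_le)
   show "(%n. d * (1/2)^n) \<longlonglongrightarrow> 0" by (intro tendsto_mult_right_zero LIMSEQ_power_zero) simp
  qed simp
  have geo: "(%k. K * d * (1/2)^k) sums (K * d * 2)"
   using sums_mult[OF geometric_sums[of "1/2::real"], of "K * d"] by simp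
  have qx: "q (x k) <= K * d * (1/2)^k" for k using x(2)[of k] by (simp add: field_simps)
  have sm: "summable (%k. q (x k))"
   by (rule summable_comparison_test'[OF sums_summable[OF geo], of 0]) (use qx q_nonneg[OF x(1)] in auto)
  have "q z <= (\<Sum>k. q (x k))" by (rule q_series[OF z(1) x(1) lim sm])
  also have "\<dots> <= K * d * 2" using suminf_le[OF qx sm sums_summable[OF geo]] sums_unique[OF geo] by simp
  finally show ?thesis by simp
 qed
 show ?thesis
 proof (rule that[of "2 * K"])
  show "2 * K \<ge> 0" using K by simp
  fix x assume x: "x \<in> X"
  show "q x <= 2 * K * p x"
  proof (rule field_le_epsilon)
   fix e :: real assume e: "e > 0"
   have "q x <= 2 * K * (p x + e / (2 * K + 1))" using e K by (intro main x) auto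
   also have "\<dots> <= 2 * K * p x + e" using e K by (simp add: field_simps)
   finally show "q x <= 2 * K * p x + e" .
  qed
 qed
qed

section \<open>Solid function spaces\<close>

locale haar_space = haar_group \<mu> + solid_function_space \<mu> B N
 for \<mu> :: "'g::{topological_group_add, t2_space, second_countable_topology} measure" and B N
begin

lemma B_measurable: "f \<in> B ==> f \<in> borel_measurable borel"
 using measurable[of f] by (simp add: measurable_cong_sets[OF sets_mu refl])

lemma measurable_mu [simp]: "borel_measurable \<mu> = borel_measurable borel"
 by (rule measurable_cong_sets[OF sets_mu refl])

lemma diff_mem: "f \<in> B ==> g \<in> B ==> (%x. f x - g x) \<in> B"
 using add_mem[OF _ scale_mem[of g "-1"], of f] by simp

lemma norm_diff_sym: "f \<in> B ==> g \<in> B ==> N (%x. f x - g x) = N (%x. g x - f x)"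
 using norm_scale[OF diff_mem[of g f], of "-1"] by simp

lemma norm_diff_le: "f \<in> B ==> g \<in> B ==> N (%x. f x - g x) <= N f + N g"
 using norm_triangle[OF _ scale_mem[of g "-1"], of f] norm_scale[of g "-1"] by simp

lemma norm_zero: "N (%x. 0) = 0"
 using norm_scale[OF zero_mem, of 0] by simp

lemma norm_le_add_diff: "f \<in> B ==> g \<in> B ==> N f <= N g + N (%x. f x - g x)"
 using norm_triangle[OF _ diff_mem[of f g], of g] by simp

lemma AE_eq_mem:
 assumes "f \<in> B" "g \<in> borel_measurable borel" "AE x in \<mu>. g x = f x"
 shows "g \<in> B" "N g = N f"
proof -
 show g: "g \<in> B" using assms by (intro solid[of g f]) auto
 have "N (%x. g x - f x) = 0" using assms g by (subst norm_eq_0_iff) (auto intro: diff_mem)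
 thus "N g = N f"
  using norm_le_add_diff[OF g assms(1)] norm_le_add_diff[OF assms(1) g] norm_diff_sym[OF g assms(1)] by simp
qed

lemma sum_mem:
 assumes "finite A" "\<And>i. i \<in> A ==> f i \<in> B"
 shows "(%x. \<Sum>i\<in>A. f i x) \<in> B" "N (%x. \<Sum>i\<in>A. f i x) <= (\<Sum>i\<in>A. N (f i))"
 using assms
proof (induction A)
 case empty
 { case 1 show ?case using zero_mem by simp }
 { case 2 show ?case using norm_zero by simp }
next
 case (insert a A)
 { case 1 thus ?case using insert add_mem[of "f a" "%x. \<Sum>i\<in>A. f i x"] by simp }
 { case 2 thus ?case using insert norm_triangle[of "f a" "%x. \<Sum>i\<in>A. f i x"] by force }
qed

lemma compact_exhaustion:
 obtains K :: "nat => 'g set" where "\<And>n. compact (K n)" "(\<Union>n. K n) = UNIV"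
proof -
 obtain V :: "'g set" where V: "open V" "0 \<in> V" "compact (closure V)"
  using open_compact_neighbourhood[OF open_UNIV UNIV_I] by metis
 obtain X :: "'g set" where X: "countable X" "(\<Union>x\<in>X. (%u. x + u) ` V) = UNIV"
  using countable_translates_cover[OF V(1,2)] by metis
 have "X \<noteq> {}" using X(2) by auto
 show ?thesis
 proof (rule that[of "%n. (%u. from_nat_into X n + u) ` closure V"])
  show "(\<Union>n. (%u. from_nat_into X n + u) ` closure V) = UNIV"
  proof (intro equalityI subset_UNIV subsetI)
   fix y :: 'g
   obtain x where x: "x \<in> X" "y \<in> (%u. x + u) ` V" using X(2) by blast
   obtain n where "from_nat_into X n = x" using from_nat_into_surj[OF X(1) x(1)] by blast
   thus "y \<in> (\<Union>n. (%u. from_nat_into X n + u) ` closure V)" using x closure_subset[of V] by blast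
  qed
 qed (use compact_translate[OF V(3)] in auto)
qed

text \<open>Convergence in measure on every compact set: the only mode of convergence that the norm is known to
 control. It determines the limit almost everywhere.\<close>

definition lim_meas :: "(nat => 'g => complex) => ('g => complex) => bool" where
 "lim_meas F f \<longleftrightarrow> (\<forall>K e. compact K --> e > 0 -->
   (%k. measure \<mu> {x \<in> K. cmod (F k x - f x) > e}) \<longlonglongrightarrow> 0)"

lemma fmeasurable_compact_part:
 assumes "compact K" "{x \<in> K. P x} \<in> sets borel"
 shows "{x \<in> K. P x} \<in> fmeasurable \<mu>"
 using assms emeasure_finite_subset_compact[OF assms(1), of "{x \<in> K. P x}"] by (auto intro!: fmeasurableI)

lemma compact_borel: "compact (K::'g set) ==> K \<in> sets borel"
 by (auto intro: borel_closed compact_imp_closed)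

lemma lim_meas_norm:
 "(\<And>k. F k \<in> B) ==> f \<in> B ==> (%k. N (%x. F k x - f x)) \<longlonglongrightarrow> 0 ==> lim_meas F f"
 unfolding lim_meas_def using locally_in_measure by blast

lemma lim_meas_pointwise:
 assumes [measurable]: "\<And>k. F k \<in> borel_measurable borel" "f \<in> borel_measurable borel"
  and lim: "\<And>x. (%k. F k x) \<longlonglongrightarrow> f x"
 shows "lim_meas F f"
 unfolding lim_meas_def
proof (intro allI impI)
 fix K :: "'g set" and e :: real assume K: "compact K" and e: "e > 0"
 note [measurable] = compact_borel[OF K]
 have m [measurable]: "{x \<in> K. cmod (F k x - f x) > e} \<in> sets borel" for k by measurable
 have "(%k. \<integral>x. indicator {x \<in> K. cmod (F k x - f x) > e} x \<partial>\<mu>) \<longlonglongrightarrow> (\<integral>x. (0::real) \<partial>\<mu>)"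
 proof (rule integral_dominated_convergence)
  show "integrable \<mu> (indicator K :: 'g => real)"
   using finite_on_compact[OF K] by (intro integrable_real_indicator) auto
  show "AE x in \<mu>. (%k. indicator {x \<in> K. cmod (F k x - f x) > e} x :: real) \<longlonglongrightarrow> 0"
  proof (rule AE_I2)
   fix x
   have "\<forall>\<^sub>F k in sequentially. dist (F k x) (f x) < e" using lim[of x] e by (rule tendstoD)
   hence "\<forall>\<^sub>F k in sequentially. indicator {x \<in> K. cmod (F k x - f x) > e} x = (0::real)"
    by eventually_elim (auto simp: dist_norm indicator_def)
   thus "(%k. indicator {x \<in> K. cmod (F k x - f x) > e} x :: real) \<longlonglongrightarrow> 0"
    by (rule tendsto_eventually)
  qed
 qed (auto simp: indicator_def)
 thus "(%k. measure \<mu> {x \<in> K. cmod (F k x - f x) > e}) \<longlonglongrightarrow> 0" by simp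
qed

lemma lim_meas_mult:
 assumes F: "\<And>k. F k \<in> borel_measurable borel" "f \<in> borel_measurable borel"
  and "\<And>x. cmod (m x) <= 1" and "lim_meas F f"
 shows "lim_meas (%k x. m x * F k x) (%x. m x * f x)"
 unfolding lim_meas_def
proof (intro allI impI)
 fix K :: "'g set" and e :: real assume K: "compact K" and e: "e > 0"
 note [measurable] = compact_borel[OF K] F
 show "(%k. measure \<mu> {x \<in> K. cmod (m x * F k x - m x * f x) > e}) \<longlonglongrightarrow> 0"
 proof (rule tendsto_sandwich[OF _ _ tendsto_const])
  show "(%k. measure \<mu> {x \<in> K. cmod (F k x - f x) > e}) \<longlonglongrightarrow> 0"
   using assms(4) K e unfolding lim_meas_def by blast
  have "measure \<mu> {x \<in> K. cmod (m x * F k x - m x * f x) > e} <= measure \<mu> {x \<in> K. cmod (F k x - f x) > e}" for k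
  proof (cases "{x \<in> K. cmod (m x * F k x - m x * f x) > e} \<in> sets borel")
   case True
   show ?thesis
   proof (rule measure_mono_fmeasurable)
    show "{x \<in> K. cmod (m x * F k x - m x * f x) > e} \<subseteq> {x \<in> K. cmod (F k x - f x) > e}"
    proof clarify
     fix x assume "e < cmod (m x * F k x - m x * f x)"
     also have "\<dots> = cmod (m x) * cmod (F k x - f x)" by (simp add: norm_mult[symmetric] algebra_simps)
     also have "\<dots> <= cmod (F k x - f x)" using assms(3)[of x] by (simp add: mult_left_le_one_le)
     finally show "e < cmod (F k x - f x)" .
    qed
    show "{x \<in> K. cmod (F k x - f x) > e} \<in> fmeasurable \<mu>"
     by (rule fmeasurable_compact_part[OF K]) measurable
   qed (use True in auto)
  next
   case False
   thus ?thesis by (simp add: measure_notin_sets)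
  qed
  thus "\<forall>\<^sub>F k in sequentially. measure \<mu> {x \<in> K. cmod (m x * F k x - m x * f x) > e}
    <= measure \<mu> {x \<in> K. cmod (F k x - f x) > e}" by simp
 qed simp
qed

lemma lim_meas_unique:
 assumes [measurable]: "\<And>k. F k \<in> borel_measurable borel" "f \<in> borel_measurable borel" "g \<in> borel_measurable borel"
  and "lim_meas F f" "lim_meas F g"
 shows "AE x in \<mu>. f x = g x"
proof -
 have null: "{x \<in> K. cmod (f x - g x) > 2 * e} \<in> null_sets \<mu>" if K: "compact K" and e: "e > 0" for K e
 proof -
  note [measurable] = compact_borel[OF K]
  have "measure \<mu> {x \<in> K. cmod (f x - g x) > 2 * e}
    <= measure \<mu> {x \<in> K. cmod (F k x - f x) > e} + measure \<mu> {x \<in> K. cmod (F k x - g x) > e}" for k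
  proof -
   have fm: "{x \<in> K. cmod (F k x - f x) > e} \<in> fmeasurable \<mu>" "{x \<in> K. cmod (F k x - g x) > e} \<in> fmeasurable \<mu>"
    by (rule fmeasurable_compact_part[OF K], measurable)+
   have "measure \<mu> {x \<in> K. cmod (f x - g x) > 2 * e}
     <= measure \<mu> ({x \<in> K. cmod (F k x - f x) > e} \<union> {x \<in> K. cmod (F k x - g x) > e})"
   proof (rule measure_mono_fmeasurable)
    show "{x \<in> K. 2 * e < cmod (f x - g x)} \<subseteq> {x \<in> K. e < cmod (F k x - f x)} \<union> {x \<in> K. e < cmod (F k x - g x)}"
    proof
     fix x assume x: "x \<in> {x \<in> K. 2 * e < cmod (f x - g x)}"
     have "cmod (f x - g x) <= cmod (F k x - f x) + cmod (F k x - g x)"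
      using norm_triangle_ineq4[of "F k x - g x" "F k x - f x"] by simp
     thus "x \<in> {x \<in> K. e < cmod (F k x - f x)} \<union> {x \<in> K. e < cmod (F k x - g x)}" using x by auto
    qed
   qed (use fm in auto)
   also have "\<dots> <= measure \<mu> {x \<in> K. cmod (F k x - f x) > e} + measure \<mu> {x \<in> K. cmod (F k x - g x) > e}"
    using fm by (intro measure_Un_le) (auto dest: fmeasurableD)
   finally show ?thesis .
  qed
  moreover have "(%k. measure \<mu> {x \<in> K. cmod (F k x - f x) > e} + measure \<mu> {x \<in> K. cmod (F k x - g x) > e}) \<longlonglongrightarrow> 0 + 0"
   using assms(4,5) K e unfolding lim_meas_def by (intro tendsto_add) blast+
  ultimately have "measure \<mu> {x \<in> K. cmod (f x - g x) > 2 * e} <= 0 + 0"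
   by (intro LIMSEQ_le_const[of _ "0+0"]) auto
  hence "measure \<mu> {x \<in> K. cmod (f x - g x) > 2 * e} = 0" using measure_nonneg[of \<mu>] by (simp add: antisym)
  moreover have "{x \<in> K. cmod (f x - g x) > 2 * e} \<in> fmeasurable \<mu>"
   by (rule fmeasurable_compact_part[OF K]) measurable
  ultimately show ?thesis by (simp add: fmeasurable_def emeasure_eq_ennreal_measure null_sets_def less_top[symmetric])
 qed
 obtain K :: "nat => 'g set" where K: "\<And>n. compact (K n)" "(\<Union>n. K n) = UNIV"
  using compact_exhaustion by metis
 have "(\<Union>n. \<Union>j. {x \<in> K n. cmod (f x - g x) > 2 * inverse (Suc j)}) \<in> null_sets \<mu>"
  by (intro null_sets_UN null K) simp
 hence "AE x in \<mu>. x \<notin> (\<Union>n. \<Union>j. {x \<in> K n. cmod (f x - g x) > 2 * inverse (Suc j)})" by (rule AE_not_in)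
 thus ?thesis
 proof eventually_elim
  case (elim x)
  obtain n where "x \<in> K n" using K(2) by blast
  hence "cmod (f x - g x) <= 2 * inverse (real (Suc j))" for j using elim by (auto simp: not_less)
  moreover have "(%j. 2 * inverse (real (Suc j))) \<longlonglongrightarrow> 0"
   using tendsto_mult_right_zero[OF LIMSEQ_inverse_real_of_nat] by blast
  ultimately have "cmod (f x - g x) <= 0" by (intro LIMSEQ_le_const[of "%j. 2 * inverse (real (Suc j))" 0]) blast+
  thus ?case by simp
 qed
qed

text \<open>An absolutely convergent series has a sum whose norm is at most the sum of the norms. This is the
 countable subadditivity that Zabreiko's lemma asks for.\<close>

lemma series_limit:
 fixes x :: "nat => 'g => complex"
 assumes x: "\<And>k. x k \<in> B" and sm: "summable (%k. N (x k))"
 obtains h where "h \<in> B" "(%n. N (%t. (\<Sum>k<n. x k t) - h t)) \<longlonglongrightarrow> 0" "N h <= (\<Sum>k. N (x k))"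
proof -
 have S: "(%t. \<Sum>k<n. x k t) \<in> B" for n using sum_mem(1)[of "{..<n}" x] x by auto
 have blk: "N (%t. (\<Sum>k<m. x k t) - (\<Sum>k<n. x k t)) <= (\<Sum>k=n..<m. N (x k))" if "n <= m" for m n
 proof -
  have "(%t. (\<Sum>k<m. x k t) - (\<Sum>k<n. x k t)) = (%t. \<Sum>k=n..<m. x k t)"
   using sum_diff_nat_ivl[OF le0 that, where f="%k. x k _"] by (simp add: lessThan_atLeast0)
  thus ?thesis using sum_mem(2)[of "{n..<m}" x] x by simp
 qed
 have "\<exists>h\<in>B. (%n. N (%t. (\<Sum>k<n. x k t) - h t)) \<longlonglongrightarrow> 0"
 proof (rule complete[OF S])
  fix e :: real assume "e > 0"
  then obtain M where M: "\<And>m n. m \<ge> M ==> norm (\<Sum>k=m..<n. N (x k)) < e"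
   using sm unfolding summable_Cauchy by blast
  have less: "N (%t. (\<Sum>k<m. x k t) - (\<Sum>k<n. x k t)) < e" if "M <= n" "n <= m" for m n
   using blk[OF that(2)] M[OF that(1), of m] by simp
  have "N (%t. (\<Sum>k<j. x k t) - (\<Sum>k<i. x k t)) < e" if "j \<ge> M" "i \<ge> M" for i j
   using less[of i j] less[of j i] that norm_diff_sym[OF S[of i] S[of j]] by (cases "i <= j") auto
  thus "\<exists>M. \<forall>j\<ge>M. \<forall>k\<ge>M. N (%t. (\<Sum>k<j. x k t) - (\<Sum>i<k. x i t)) < e" by blast
 qed
 then obtain h where h: "h \<in> B" "(%n. N (%t. (\<Sum>k<n. x k t) - h t)) \<longlonglongrightarrow> 0" by blast
 have "N h <= (\<Sum>k. N (x k)) + N (%t. (\<Sum>k<n. x k t) - h t)" for n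
 proof -
  have "N h <= N (%t. \<Sum>k<n. x k t) + N (%t. (\<Sum>k<n. x k t) - h t)"
   using norm_le_add_diff[OF h(1) S[of n]] norm_diff_sym[OF h(1) S[of n]] by simp
  also have "N (%t. \<Sum>k<n. x k t) <= (\<Sum>k<n. N (x k))" using sum_mem(2)[of "{..<n}" x] x by simp
  also have "(\<Sum>k<n. N (x k)) <= (\<Sum>k. N (x k))" using norm_nonneg[OF x] by (intro sum_le_suminf sm) auto
  finally show ?thesis by simp
 qed
 moreover have "(%n. (\<Sum>k. N (x k)) + N (%t. (\<Sum>k<n. x k t) - h t)) \<longlonglongrightarrow> (\<Sum>k. N (x k)) + 0"
  by (intro tendsto_intros h)
 ultimately have "N h <= (\<Sum>k. N (x k)) + 0" by (intro LIMSEQ_le_const[of _ "_ + 0"]) auto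
 thus ?thesis using that h by simp
qed

end

context haar_space
begin

text \<open>Multiplication of a fixed \<open>g\<close> by bounded functions is bounded: this is Zabreiko's lemma on the
 space of bounded measurable multipliers.\<close>

lemma multiplier_bounded:
 assumes g: "g \<in> B"
 obtains C where "\<And>m. m \<in> borel_measurable borel ==> (\<And>x. cmod (m x) <= 1) ==> N (%x. m x * g x) <= C"
proof -
 define X where "X = {m :: 'g => complex. m \<in> borel_measurable borel \<and> bounded (range m)}"
 define p where "p m = (SUP x. cmod (m x))" for m :: "'g => complex"
 note [measurable] = B_measurable[OF g]
 have bdd: "bdd_above (range (%x. cmod (m x)))" if "m \<in> X" for m
  using that unfolding X_def bounded_iff bdd_above_def by auto
 have le: "cmod (m x) <= p m" if "m \<in> X" for m x
  unfolding p_def by (rule cSUP_upper[OF UNIV_I bdd[OF that]])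
 have pI: "p m <= c" if "\<And>x. cmod (m x) <= c" for m c
  unfolding p_def using that by (intro cSUP_least) auto
 have p_nonneg: "0 <= p m" if "m \<in> X" for m using le[OF that, of 0] norm_ge_zero[of "m 0"] by linarith
 have mem: "(%x. m x * g x) \<in> B" if m: "m \<in> X" for m
 proof (rule solid[OF _ scale_mem[OF g, of "complex_of_real (p m)"]])
  have [measurable]: "m \<in> borel_measurable borel" using m by (simp add: X_def)
  show "(%x. m x * g x) \<in> borel_measurable \<mu>" by simp
  show "AE x in \<mu>. cmod (m x * g x) <= cmod (complex_of_real (p m) * g x)"
   using le[OF m] p_nonneg[OF m] by (auto simp: norm_mult intro!: mult_right_mono)
 qed
 have XI: "m \<in> X" if "m \<in> borel_measurable borel" "\<And>x. cmod (m x) <= c" for m c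
  using that by (auto simp: X_def bounded_iff)
 have Xm: "m \<in> borel_measurable borel" if "m \<in> X" for m using that by (simp add: X_def)
 have Xadd: "(%t. x t + y t) \<in> X" if "x \<in> X" "y \<in> X" for x y
  using Xm[OF that(1)] Xm[OF that(2)] le[OF that(1)] le[OF that(2)]
  by (intro XI[of _ "p x + p y"]) (auto intro: order_trans[OF norm_triangle_ineq add_mono])
 have Xscale: "(%t. a * x t) \<in> X" if "x \<in> X" for x a
  using Xm[OF that] le[OF that]
  by (intro XI[of _ "cmod a * p x"]) (auto simp: norm_mult intro: mult_left_mono)
 obtain C where C: "C \<ge> 0" "\<And>x. x \<in> X ==> N (%t. x t * g t) <= C * p x"
 proof (rule zabreiko[of X p "%m. N (%x. m x * g x)"])
  show "(%t. 0) \<in> X" by (rule XI[of _ 0]) auto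
  fix x y a assume x: "x \<in> X"
  show "0 <= p x" by (rule p_nonneg[OF x])
  show "(%t. a * x t) \<in> X" by (rule Xscale[OF x])
  show "p (%t. a * x t) = cmod a * p x"
  proof (rule antisym)
   show "p (%t. a * x t) <= cmod a * p x" using le[OF x] by (intro pI) (simp add: norm_mult mult_left_mono)
   show "cmod a * p x <= p (%t. a * x t)"
   proof (cases "a = 0")
    case True thus ?thesis using p_nonneg[OF Xscale[OF x, of a]] by simp
   next
    case False
    have "p x <= p (%t. a * x t) / cmod a"
     using le[OF Xscale[OF x], of a] False by (intro pI) (auto simp: field_simps norm_mult)
    thus ?thesis using False by (simp add: field_simps)
   qed
  qed
  show "0 <= N (%t. x t * g t)" by (rule norm_nonneg[OF mem[OF x]])
  show "N (%t. a * x t * g t) = cmod a * N (%t. x t * g t)"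
   using norm_scale[OF mem[OF x], of a] by (simp add: mult.assoc)
  assume y: "y \<in> X"
  show "(%t. x t + y t) \<in> X" by (rule Xadd[OF x y])
  show "p (%t. x t + y t) <= p x + p y"
   using le[OF x] le[OF y] by (intro pI) (auto intro: order_trans[OF norm_triangle_ineq add_mono])
  show "N (%t. (x t + y t) * g t) <= N (%t. x t * g t) + N (%t. y t * g t)"
   using norm_triangle[OF mem[OF x] mem[OF y]] by (simp add: distrib_right)
 next
  fix F :: "nat => 'g => complex"
  assume F: "\<And>k. F k \<in> X" and Cauchy: "\<And>e. e > 0 ==> \<exists>M. \<forall>j\<ge>M. \<forall>k\<ge>M. p (%x. F j x - F k x) < e"
  have Xdiff: "(%x. F j x - F k x) \<in> X" for j k
   using Xadd[OF F[of j] Xscale[OF F[of k], of "-1"]] by simp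
  have cau: "\<exists>M. \<forall>x. \<forall>j\<ge>M. \<forall>k\<ge>M. dist (F j x) (F k x) < e" if e: "e > 0" for e
  proof -
   obtain M where M: "\<forall>j\<ge>M. \<forall>k\<ge>M. p (%x. F j x - F k x) < e" using Cauchy[OF e] by blast
   show ?thesis
   proof (intro exI[of _ M] allI impI)
    fix x j k assume "j \<ge> M" "k \<ge> M"
    thus "dist (F j x) (F k x) < e"
     using M le[OF Xdiff[of j k], of x] by (fastforce simp: dist_norm)
   qed
  qed
  hence "uniformly_Cauchy_on UNIV F" by (auto simp: uniformly_Cauchy_on_def)
  hence "uniformly_convergent_on UNIV F" by (rule Cauchy_uniformly_convergent)
  then obtain f where f: "uniform_limit UNIV F f sequentially" by (auto simp: uniformly_convergent_on_def)
  have fm: "f \<in> borel_measurable borel"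
   by (rule borel_measurable_LIMSEQ_metric[of F]) (use Xm[OF F] tendsto_uniform_limitI[OF f] in auto)
  have ev: "\<forall>\<^sub>F k in sequentially. \<forall>x. cmod (F k x - f x) < e" if "e > 0" for e
   using uniform_limitD[OF f that] by (simp add: dist_norm)
  obtain k where k: "\<forall>x. cmod (F k x - f x) < 1"
   using ev[of 1] by (auto simp: eventually_sequentially)
  have "f \<in> X"
  proof (rule XI[OF fm])
   fix x show "cmod (f x) <= p (F k) + 1"
    using k[rule_format, of x] le[OF F[of k], of x] norm_triangle_sub[of "f x" "F k x"]
    by (simp add: norm_minus_commute)
  qed
  moreover have "(%k. p (%x. F k x - f x)) \<longlonglongrightarrow> 0"
  proof (rule tendstoI)
   fix e :: real assume e: "e > 0"
   have "e / 2 > 0" using e by simp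
   from ev[OF this] show "\<forall>\<^sub>F k in sequentially. dist (p (%x. F k x - f x)) 0 < e"
   proof eventually_elim
    case (elim k)
    have "p (%x. F k x - f x) <= e / 2" using elim by (intro pI) (auto intro: less_imp_le)
    moreover have "0 <= p (%x. F k x - f x)"
     using p_nonneg[OF Xadd[OF F[of k] Xscale[OF \<open>f \<in> X\<close>, of "-1"]]] by simp
    ultimately show ?case using e by simp
   qed
  qed
  ultimately show "\<exists>f\<in>X. (%k. p (%x. F k x - f x)) \<longlonglongrightarrow> 0" by blast
 next
  fix x :: "nat => 'g => complex" and s
  assume s: "s \<in> X" and x: "\<And>k. x k \<in> X" and lim: "(%n. p (%t. (\<Sum>k<n. x k t) - s t)) \<longlonglongrightarrow> 0"
   and sm: "summable (%k. N (%t. x k t * g t))"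
  have Sx: "(%t. (\<Sum>k<n. x k t) - s t) \<in> X" for n
  proof -
   have "(%t. \<Sum>k<n. x k t) \<in> X"
   proof (induction n)
    case 0 show ?case using XI[of "%_. 0" 0] by simp
   next
    case (Suc n) thus ?case using Xadd[OF Suc x[of n]] by simp
   qed
   thus ?thesis using Xadd[OF _ Xscale[OF s, of "-1"]] by force
  qed
  obtain h where h: "h \<in> B" "(%n. N (%t. (\<Sum>k<n. x k t * g t) - h t)) \<longlonglongrightarrow> 0" "N h <= (\<Sum>k. N (%t. x k t * g t))"
   by (rule series_limit[of "%k t. x k t * g t"]) (use mem[OF x] sm in auto)
  have S: "(%t. \<Sum>k<n. x k t * g t) \<in> B" for n using sum_mem(1)[of "{..<n}" "%k t. x k t * g t"] mem[OF x] by auto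
  have "AE t in \<mu>. h t = s t * g t"
  proof (rule lim_meas_unique[of "%n t. \<Sum>k<n. x k t * g t"])
   show "lim_meas (%n t. \<Sum>k<n. x k t * g t) h" by (rule lim_meas_norm[OF S h(1,2)])
   show "lim_meas (%n t. \<Sum>k<n. x k t * g t) (%t. s t * g t)"
   proof (rule lim_meas_pointwise)
    fix t
    have "(%n. (\<Sum>k<n. x k t) - s t) \<longlonglongrightarrow> 0"
     by (rule Lim_null_comparison[OF _ lim]) (use le[OF Sx] in auto)
    hence "(%n. (\<Sum>k<n. x k t)) \<longlonglongrightarrow> s t" by (simp add: LIM_zero_iff)
    from tendsto_mult_right[OF this, of "g t"]
    show "(%n. \<Sum>k<n. x k t * g t) \<longlonglongrightarrow> s t * g t" by (simp add: sum_distrib_right)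
   qed (use B_measurable[OF S] Xm[OF s] in auto)
  qed (use B_measurable[OF S] B_measurable[OF h(1)] Xm[OF s] in auto)
  hence "N (%t. s t * g t) = N h" using Xm[OF s] by (intro AE_eq_mem(2)[OF h(1)]) auto
  thus "N (%t. s t * g t) <= (\<Sum>k. N (%t. x k t * g t))" using h(3) by simp
 next
  fix C assume "C \<ge> 0" "\<And>x. x \<in> X ==> N (%t. x t * g t) <= C * p x"
  thus thesis by (rule that)
 qed
 show ?thesis
 proof (rule that[of C])
  fix m :: "'g => complex" assume m: "m \<in> borel_measurable borel" "\<And>x. cmod (m x) <= 1"
  have "N (%x. m x * g x) <= C * p m" by (rule C(2)[OF XI[OF m]])
  also have "\<dots> <= C * 1" using m C by (intro mult_left_mono pI) auto
  finally show "N (%x. m x * g x) <= C" by simp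
 qed
qed

text \<open>Solidity of the norm up to a constant is Zabreiko's lemma for the supremum of the norms of all
 unimodularly bounded multiples.\<close>

lemma solid_norm:
 obtains C where "C > 0"
  "\<And>f g. f \<in> borel_measurable borel ==> g \<in> B ==> (AE x in \<mu>. cmod (f x) <= cmod (g x)) ==> N f <= C * N g"
proof -
 define M where "M = {m :: 'g => complex. m \<in> borel_measurable borel \<and> (\<forall>x. cmod (m x) <= 1)}"
 define q where "q g = (SUP m\<in>M. N (%x. m x * g x))" for g
 have one: "(%_. 1) \<in> M" by (simp add: M_def)
 have mem: "(%x. m x * g x) \<in> B" if g: "g \<in> B" and m: "m \<in> M" for m g
  using m B_measurable[OF g]
  by (intro solid[OF _ g]) (auto simp: M_def norm_mult intro!: mult_left_le_one_le)
 have bdd: "bdd_above ((%m. N (%x. m x * g x)) ` M)" if g: "g \<in> B" for g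
 proof -
  obtain C where "\<And>m. m \<in> borel_measurable borel ==> (\<And>x. cmod (m x) <= 1) ==> N (%x. m x * g x) <= C"
   using multiplier_bounded[OF g] by metis
  thus ?thesis by (intro bdd_aboveI[of _ C]) (auto simp: M_def)
 qed
 have le: "N (%x. m x * g x) <= q g" if "g \<in> B" "m \<in> M" for m g
  unfolding q_def by (rule cSUP_upper[OF that(2) bdd[OF that(1)]])
 have qI: "q g <= c" if "\<And>m. m \<in> M ==> N (%x. m x * g x) <= c" for g c
  unfolding q_def using that one by (intro cSUP_least) auto
 have q_nonneg: "0 <= q g" if "g \<in> B" for g
  using le[OF that one] norm_nonneg[OF that] by simp
 obtain C where C: "C \<ge> 0" "\<And>g. g \<in> B ==> q g <= C * N g"
 proof (rule zabreiko[of B N q])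
  fix x y a assume x: "x \<in> B"
  show "0 <= q x" by (rule q_nonneg[OF x])
  show "q (%t. a * x t) = cmod a * q x"
  proof (rule antisym)
   have eq: "N (%t. m t * (a * x t)) = cmod a * N (%t. m t * x t)" if "m \<in> M" for m
    using norm_scale[OF mem[OF x that], of a] by (simp add: mult.left_commute)
   show "q (%t. a * x t) <= cmod a * q x"
    using le[OF x] by (intro qI) (simp add: eq mult_left_mono)
   show "cmod a * q x <= q (%t. a * x t)"
   proof (cases "a = 0")
    case True thus ?thesis using q_nonneg[OF scale_mem[OF x, of a]] by simp
   next
    case False
    have "q x <= q (%t. a * x t) / cmod a"
    proof (rule qI)
     fix m assume m: "m \<in> M"
     show "N (%t. m t * x t) <= q (%t. a * x t) / cmod a"
      using le[OF scale_mem[OF x, of a] m] False unfolding eq[OF m] by (simp add: field_simps)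
    qed
    thus ?thesis using False by (simp add: field_simps)
   qed
  qed
  assume y: "y \<in> B"
  show "q (%t. x t + y t) <= q x + q y"
  proof (rule qI)
   fix m assume m: "m \<in> M"
   show "N (%t. m t * (x t + y t)) <= q x + q y"
    using norm_triangle[OF mem[OF x m] mem[OF y m]] le[OF x m] le[OF y m] by (simp add: distrib_left)
  qed
 next
  fix x :: "nat => 'g => complex" and s
  assume s: "s \<in> B" and x: "\<And>k. x k \<in> B" and lim: "(%n. N (%t. (\<Sum>k<n. x k t) - s t)) \<longlonglongrightarrow> 0"
   and sm: "summable (%k. q (x k))"
  show "q s <= (\<Sum>k. q (x k))"
  proof (rule qI)
   fix m assume m: "m \<in> M"
   have sm': "summable (%k. N (%t. m t * x k t))"
    by (rule summable_comparison_test'[OF sm, of 0]) (use le[OF x m] norm_nonneg[OF mem[OF x m]] in auto)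
   obtain h where h: "h \<in> B" "(%n. N (%t. (\<Sum>k<n. m t * x k t) - h t)) \<longlonglongrightarrow> 0" "N h <= (\<Sum>k. N (%t. m t * x k t))"
    by (rule series_limit[of "%k t. m t * x k t"]) (use mem[OF x m] sm' in auto)
   have S: "(%t. \<Sum>k<n. m t * x k t) \<in> B" for n
    using sum_mem(1)[of "{..<n}" "%k t. m t * x k t"] mem[OF x m] by auto
   have S': "(%t. \<Sum>k<n. x k t) \<in> B" for n using sum_mem(1)[of "{..<n}" x] x by auto
   have ms: "(%t. m t * s t) \<in> B" by (rule mem[OF s m])
   have "AE t in \<mu>. h t = m t * s t"
   proof (rule lim_meas_unique[of "%n t. \<Sum>k<n. m t * x k t"])
    show "lim_meas (%n t. \<Sum>k<n. m t * x k t) h" by (rule lim_meas_norm[OF S h(1,2)])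
    have "lim_meas (%n t. m t * (\<Sum>k<n. x k t)) (%t. m t * s t)"
     using m B_measurable[OF S'] B_measurable[OF s]
     by (intro lim_meas_mult lim_meas_norm[OF S' s lim]) (auto simp: M_def)
    thus "lim_meas (%n t. \<Sum>k<n. m t * x k t) (%t. m t * s t)" by (simp add: sum_distrib_left)
   qed (use B_measurable[OF S] B_measurable[OF h(1)] B_measurable[OF ms] in auto)
   hence "N (%t. m t * s t) = N h" using B_measurable[OF ms] by (intro AE_eq_mem(2)[OF h(1)]) auto
   also have "\<dots> <= (\<Sum>k. N (%t. m t * x k t))" by (rule h)
   also have "\<dots> <= (\<Sum>k. q (x k))" by (rule suminf_le[OF le[OF x m] sm' sm])
   finally show "N (%t. m t * s t) <= (\<Sum>k. q (x k))" .
  qed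
 next
  fix C assume "C \<ge> 0" "\<And>g. g \<in> B ==> q g <= C * N g"
  thus thesis by (rule that)
 qed (use zero_mem add_mem scale_mem norm_nonneg norm_triangle norm_scale complete in auto)
 show ?thesis
 proof (rule that[of "C + 1"])
  fix f g assume f [measurable]: "f \<in> borel_measurable borel" and g: "g \<in> B"
   and le': "AE x in \<mu>. cmod (f x) <= cmod (g x)"
  note [measurable] = B_measurable[OF g]
  define m where "m x = (if cmod (f x) <= cmod (g x) \<and> g x \<noteq> 0 then f x / g x else 0)" for x
  have mm: "m \<in> borel_measurable borel" unfolding m_def by measurable
  have "m \<in> M" using mm by (auto simp: M_def m_def norm_divide divide_le_eq_1)
  have "AE x in \<mu>. f x = m x * g x" using le' by eventually_elim (auto simp: m_def)
  hence "N f = N (%x. m x * g x)" by (intro AE_eq_mem(2)[OF mem[OF g \<open>m \<in> M\<close>]]) auto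
  also have "\<dots> <= q g" by (rule le[OF g \<open>m \<in> M\<close>])
  also have "\<dots> <= C * N g" by (rule C(2)[OF g])
  also have "\<dots> <= (C + 1) * N g" using norm_nonneg[OF g] by (simp add: distrib_right)
  finally show "N f <= (C + 1) * N g" .
 qed (use C in simp)
qed

end

abbreviation mag :: "('a => complex) => 'a => ennreal" where
 "mag f \<equiv> (%x. ennreal (cmod (f x)))"

section \<open>Domination by elements of the space\<close>

context haar_space
begin

definition solid_const :: real where
 "solid_const = (SOME C. C > 0 \<and> (\<forall>f g. f \<in> borel_measurable borel --> g \<in> B -->
  (AE x in \<mu>. cmod (f x) <= cmod (g x)) --> N f <= C * N g))"

lemma solid_const: "solid_const > 0"
 "f \<in> borel_measurable borel ==> g \<in> B ==> (AE x in \<mu>. cmod (f x) <= cmod (g x)) ==> N f <= solid_const * N g"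
proof -
 have "\<exists>C. C > 0 \<and> (\<forall>f g. f \<in> borel_measurable borel --> g \<in> B -->
  (AE x in \<mu>. cmod (f x) <= cmod (g x)) --> N f <= C * N g)"
  by (rule solid_norm) blast
 from someI_ex[OF this] show "solid_const > 0"
  "f \<in> borel_measurable borel ==> g \<in> B ==> (AE x in \<mu>. cmod (f x) <= cmod (g x)) ==> N f <= solid_const * N g"
  unfolding solid_const_def by blast+
qed

text \<open>A nonnegative function, possibly infinite somewhere, below the absolute value of an element of \<open>B\<close>
 of norm at most \<open>c\<close>. It takes the place of the norm for functions that are only known through
 pointwise inequalities.\<close>

definition dominated :: "('g => ennreal) => real => bool" where
 "dominated F c \<longleftrightarrow> (\<exists>g\<in>B. N g <= c \<and> (AE x in \<mu>. F x <= ennreal (cmod (g x))))"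

lemma dominatedE:
 assumes "dominated F c"
 obtains g where "g \<in> B" "N g <= c" "AE x in \<mu>. F x <= mag g x"
 using assms unfolding dominated_def by blast

lemma dominated_nonneg: "dominated F c ==> 0 <= c"
 using norm_nonneg by (auto simp: dominated_def intro: order_trans)

lemma dominated_mono:
 assumes "dominated G c" "AE x in \<mu>. F x <= G x" "c <= d"
 shows "dominated F d"
proof -
 obtain g where g: "g \<in> B" "N g <= c" "AE x in \<mu>. G x <= mag g x" using assms(1) by (rule dominatedE)
 have "AE x in \<mu>. F x <= mag g x" using assms(2) g(3) by eventually_elim (rule order_trans)
 thus ?thesis using g assms(3) unfolding dominated_def by force
qed

lemma dominated_mag: "f \<in> B ==> dominated (mag f) (N f)"
 unfolding dominated_def by auto

lemma dominated_mem:
 assumes "f \<in> borel_measurable borel" "dominated (mag f) c"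
 shows "f \<in> B" "N f <= solid_const * c"
proof -
 obtain g where g: "g \<in> B" "N g <= c" "AE x in \<mu>. mag f x <= mag g x" using assms(2) by (rule dominatedE)
 have *: "AE x in \<mu>. cmod (f x) <= cmod (g x)" using g(3) by eventually_elim simp
 show "f \<in> B" using assms * by (intro solid[OF _ g(1)]) auto
 have "N f <= solid_const * N g" by (rule solid_const(2)[OF assms(1) g(1) *])
 also have "\<dots> <= solid_const * c" using g solid_const(1) by (intro mult_left_mono) auto
 finally show "N f <= solid_const * c" .
qed

lemma absf_mem: assumes "f \<in> B" shows "absf f \<in> B" "N (absf f) <= solid_const * N f"
proof -
 note [measurable] = B_measurable[OF assms]
 have *: "absf f \<in> borel_measurable borel" unfolding absf_def by measurable
 show "absf f \<in> B" "N (absf f) <= solid_const * N f"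
  using dominated_mem[OF *, of "N f"] dominated_mag[OF assms] by (auto simp: absf_def)
qed

lemma dominated_add:
 assumes "dominated F a" "dominated G b"
 shows "dominated (%x. F x + G x) (solid_const * (a + b))"
proof -
 obtain f where f: "f \<in> B" "N f <= a" "AE x in \<mu>. F x <= mag f x" using assms(1) by (rule dominatedE)
 obtain g where g: "g \<in> B" "N g <= b" "AE x in \<mu>. G x <= mag g x" using assms(2) by (rule dominatedE)
 have "N (%x. absf f x + absf g x) <= solid_const * N f + solid_const * N g"
  using norm_triangle[OF absf_mem(1)[OF f(1)] absf_mem(1)[OF g(1)]] absf_mem(2)[OF f(1)] absf_mem(2)[OF g(1)] by linarith
 also have "\<dots> <= solid_const * (a + b)"
  using f g solid_const(1) by (simp add: distrib_left[symmetric])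
 finally have "N (%x. absf f x + absf g x) <= solid_const * (a + b)" .
 moreover have "AE x in \<mu>. F x + G x <= mag (%x. absf f x + absf g x) x"
  using f(3) g(3)
 proof eventually_elim
  case (elim x)
  have "F x + G x <= ennreal (cmod (f x) + cmod (g x))" using add_mono[OF elim] by simp
  also have "cmod (f x) + cmod (g x) = cmod (absf f x + absf g x)"
   by (simp add: absf_def of_real_add[symmetric] del: of_real_add)
  finally show ?case .
 qed
 moreover have "(%x. absf f x + absf g x) \<in> B" by (intro add_mem absf_mem f g)
 ultimately show ?thesis unfolding dominated_def by blast
qed

lemma dominated_cmult:
 assumes "dominated F c" "r \<ge> 0"
 shows "dominated (%x. ennreal r * F x) (r * c)"
proof -
 obtain f where f: "f \<in> B" "N f <= c" "AE x in \<mu>. F x <= mag f x" using assms(1) by (rule dominatedE)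
 have "N (%x. complex_of_real r * f x) <= r * c"
  using norm_scale[OF f(1), of "complex_of_real r"] f(2) assms(2) by (simp add: mult_left_mono)
 moreover have "AE x in \<mu>. ennreal r * F x <= mag (%x. complex_of_real r * f x) x"
  using f(3) by eventually_elim (use assms(2) in \<open>auto simp: norm_mult ennreal_mult intro: mult_left_mono\<close>)
 ultimately show ?thesis using scale_mem[OF f(1)] unfolding dominated_def by blast
qed

lemma dominated_AE_finite: "dominated F c ==> AE x in \<mu>. F x < \<infinity>"
 by (elim dominatedE) (auto elim!: eventually_mono intro: le_less_trans)

lemma AE_right_translate:
 assumes "AE x in \<mu>. P x"
 shows "AE x in \<mu>. P (x + z)"
proof -
 obtain S where S: "{x \<in> space \<mu>. \<not> P x} \<subseteq> S" "emeasure \<mu> S = 0" "S \<in> sets \<mu>" using assms by (rule AE_E)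
 define f where "f = (%x. indicator S x :: complex)"
 have "AE x in \<mu>. x \<notin> S" using S by (intro AE_not_in) (auto simp: null_sets_def)
 hence f0: "AE x in \<mu>. f x = 0" by eventually_elim (simp add: f_def)
 have fB: "f \<in> B" using S(3) f0 by (intro AE_eq_mem(1)[OF zero_mem]) (auto simp: f_def)
 have "N f = 0" using fB f0 norm_eq_0_iff by blast
 obtain C where C: "\<And>f. f \<in> B ==> N (rtrans z f) <= C * N f"
  using translation_bounded[of "{z}"] by auto
 have "N (rtrans z f) = 0"
  using C[OF fB] norm_nonneg[OF rtrans_mem[OF fB, of z]] \<open>N f = 0\<close> by simp
 hence "AE x in \<mu>. rtrans z f x = 0" using norm_eq_0_iff[OF rtrans_mem[OF fB]] by blast
 thus ?thesis
 proof eventually_elim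
  case (elim x)
  hence "x + z \<notin> S" by (auto simp: rtrans_def f_def indicator_def split: if_splits)
  thus "P (x + z)" using S(1) by auto
 qed
qed

lemma dominated_rtrans:
 obtains C where "C \<ge> 0" "\<And>F c. dominated F c ==> dominated (%y. F (y + z)) (C * c)"
proof -
 obtain C where C: "\<And>f. f \<in> B ==> N (rtrans z f) <= C * N f"
  using translation_bounded[of "{z}"] by auto
 show ?thesis
 proof (rule that[of "max C 0"])
  fix F c assume "dominated F c"
  then obtain f where f: "f \<in> B" "N f <= c" "AE x in \<mu>. F x <= mag f x" by (rule dominatedE)
  have "N (rtrans z f) <= max C 0 * c"
   using C[OF f(1)] norm_nonneg[OF f(1)] f(2)
   by (meson max.cobounded1 max.cobounded2 mult_mono order_trans)
  moreover have "AE x in \<mu>. F (x + z) <= mag (rtrans z f) x"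
   using AE_right_translate[OF f(3), of z] by (simp add: rtrans_def)
  ultimately show "dominated (%y. F (y + z)) (max C 0 * c)"
   using rtrans_mem[OF f(1)] unfolding dominated_def by blast
 qed simp
qed

text \<open>Right convolution with \<open>k\<close> is a bounded operator, expressed through pointwise domination.\<close>

definition kernel_bounded :: "('g => ennreal) => bool" where
 "kernel_bounded k \<longleftrightarrow> k \<in> borel_measurable borel \<and>
  (\<exists>C\<ge>0. \<forall>F c. F \<in> borel_measurable borel --> dominated F c --> dominated (star F k) (C * c))"

lemma kernel_bounded_measurable: "kernel_bounded k ==> k \<in> borel_measurable borel"
 by (simp add: kernel_bounded_def)

lemma kernel_boundedE:
 assumes "kernel_bounded k"
 obtains C where "C \<ge> 0" "\<And>F c. F \<in> borel_measurable borel ==> dominated F c ==> dominated (star F k) (C * c)"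
 using assms unfolding kernel_bounded_def by blast

lemma kernel_boundedI:
 assumes "k \<in> borel_measurable borel" "C \<ge> 0"
  "\<And>F c. F \<in> borel_measurable borel ==> dominated F c ==> dominated (star F k) (C * c)"
 shows "kernel_bounded k"
 using assms unfolding kernel_bounded_def by blast

lemma kernel_bounded_mono:
 assumes "kernel_bounded l" "k \<in> borel_measurable borel" "\<And>z. k z <= l z"
 shows "kernel_bounded k"
proof -
 obtain C where C: "C \<ge> 0" "\<And>F c. F \<in> borel_measurable borel ==> dominated F c ==> dominated (star F l) (C * c)"
  using assms(1) by (rule kernel_boundedE) blast
 show ?thesis
  by (rule kernel_boundedI[OF assms(2) C(1)], rule dominated_mono[OF C(2)]) (auto intro!: star_mono assms)
qed

lemma kernel_bounded_add:
 assumes "kernel_bounded k" "kernel_bounded l"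
 shows "kernel_bounded (%z. k z + l z)"
proof -
 obtain C where C: "C \<ge> 0" "\<And>F c. F \<in> borel_measurable borel ==> dominated F c ==> dominated (star F k) (C * c)"
  using assms(1) by (rule kernel_boundedE) blast
 obtain D where D: "D \<ge> 0" "\<And>F c. F \<in> borel_measurable borel ==> dominated F c ==> dominated (star F l) (D * c)"
  using assms(2) by (rule kernel_boundedE) blast
 note [measurable] = assms[THEN kernel_bounded_measurable]
 show ?thesis
 proof (rule kernel_boundedI[of _ "solid_const * (C + D)"])
  fix F c assume [measurable]: "F \<in> borel_measurable borel" and F: "dominated F c"
  have "dominated (%y. star F k y + star F l y) (solid_const * (C * c + D * c))"
   by (intro dominated_add C D F) fact+
  thus "dominated (star F (%z. k z + l z)) (solid_const * (C + D) * c)"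
   by (rule dominated_mono) (auto simp: star_add_right algebra_simps)
 qed (use C D solid_const in auto)
qed

lemma kernel_bounded_cmult:
 assumes "kernel_bounded k" "r \<ge> 0"
 shows "kernel_bounded (%z. ennreal r * k z)"
proof -
 obtain C where C: "C \<ge> 0" "\<And>F c. F \<in> borel_measurable borel ==> dominated F c ==> dominated (star F k) (C * c)"
  using assms(1) by (rule kernel_boundedE) blast
 note [measurable] = assms(1)[THEN kernel_bounded_measurable]
 show ?thesis
 proof (rule kernel_boundedI[of _ "r * C"])
  fix F c assume [measurable]: "F \<in> borel_measurable borel" and F: "dominated F c"
  have "dominated (%y. ennreal r * star F k y) (r * (C * c))"
   by (intro dominated_cmult C F assms) fact
  thus "dominated (star F (%z. ennreal r * k z)) (r * C * c)"
   by (rule dominated_mono) (auto simp: star_cmult_right algebra_simps)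
 qed (use C assms in auto)
qed

lemma kernel_bounded_zero: "kernel_bounded (%z. 0)"
proof (rule kernel_boundedI[of _ 0])
 fix F c
 show "dominated (star F (%z. 0)) (0 * c)"
  unfolding dominated_def using zero_mem norm_zero by (intro bexI[of _ "%x. 0"]) (auto simp: star_def)
qed auto

lemma kernel_bounded_sum:
 assumes "finite A" "\<And>i. i \<in> A ==> kernel_bounded (k i)"
 shows "kernel_bounded (%z. \<Sum>i\<in>A. k i z)"
 using assms by (induction A) (auto intro: kernel_bounded_zero kernel_bounded_add)

lemma kernel_bounded_star:
 assumes "kernel_bounded k" "kernel_bounded l"
 shows "kernel_bounded (star k l)"
proof -
 obtain C where C: "C \<ge> 0" "\<And>F c. F \<in> borel_measurable borel ==> dominated F c ==> dominated (star F k) (C * c)"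
  using assms(1) by (rule kernel_boundedE) blast
 obtain D where D: "D \<ge> 0" "\<And>F c. F \<in> borel_measurable borel ==> dominated F c ==> dominated (star F l) (D * c)"
  using assms(2) by (rule kernel_boundedE) blast
 note [measurable] = assms[THEN kernel_bounded_measurable]
 show ?thesis
 proof (rule kernel_boundedI[of _ "D * C"])
  fix F c assume [measurable]: "F \<in> borel_measurable borel" and F: "dominated F c"
  have "dominated (star (star F k) l) (D * (C * c))"
   by (intro C D F) measurable
  thus "dominated (star F (star k l)) (D * C * c)"
   by (rule dominated_mono) (auto simp: star_assoc mult.assoc)
 qed (use C D in auto)
qed

lemma star_mag_conv:
 assumes [measurable]: "f \<in> borel_measurable borel" "h \<in> borel_measurable borel"
  and "conv_exists \<mu> (absf f) (absf h)"
 shows "star (mag f) (mag h) y = mag (conv \<mu> (absf f) (absf h)) y"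
proof -
 have int: "integrable \<mu> (%x. absf f x * absf h (- x + y))"
  using assms(3) by (simp add: conv_exists_def)
 have eq: "absf f x * absf h (- x + y) = complex_of_real (cmod (f x) * cmod (h (- x + y)))" for x
  by (simp add: absf_def)
 have int': "integrable \<mu> (%x. cmod (f x) * cmod (h (- x + y)))"
  using integrable_norm[OF int] by (simp add: eq norm_mult)
 have "conv \<mu> (absf f) (absf h) y = complex_of_real (\<integral>x. cmod (f x) * cmod (h (- x + y)) \<partial>\<mu>)"
  unfolding conv_def eq by (rule integral_complex_of_real)
 moreover have "star (mag f) (mag h) y = ennreal (\<integral>x. cmod (f x) * cmod (h (- x + y)) \<partial>\<mu>)"
  unfolding star_def using nn_integral_eq_integral[OF int'] by (simp add: ennreal_mult)
 ultimately show ?thesis by simp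
qed

text \<open>The map is homogeneous under nonnegative scalars and vanishes at \<open>0\<close>, so continuity at \<open>0\<close> bounds it by
 scaling.\<close>

lemma kernel_bounded_of_continuous:
 assumes [measurable]: "h \<in> borel_measurable borel"
  and ex: "\<And>f. f \<in> B ==> conv_exists \<mu> (absf f) (absf h)"
  and cont: "continuous_self_map B N (%f. conv \<mu> (absf f) (absf h))"
 shows "kernel_bounded (mag h)"
proof -
 define T where "T f = conv \<mu> (absf f) (absf h)" for f
 have TB: "T f \<in> B" if "f \<in> B" for f using cont that by (auto simp: continuous_self_map_def T_def)
 have T0: "T (%x. 0) = (%x. 0)" by (auto simp: T_def conv_def absf_def)
 have Tscale: "T (%x. complex_of_real a * f x) = (%x. complex_of_real a * T f x)" if "a \<ge> 0" for a f
 proof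
  fix y
  have "T (%x. complex_of_real a * f x) y = (\<integral>x. complex_of_real a * (absf f x * absf h (- x + y)) \<partial>\<mu>)"
   using that unfolding T_def conv_def by (intro Bochner_Integration.integral_cong) (auto simp: absf_def norm_mult)
  also have "\<dots> = complex_of_real a * T f y" unfolding T_def conv_def by simp
  finally show "T (%x. complex_of_real a * f x) y = complex_of_real a * T f y" .
 qed
 obtain d where d: "d > 0" "\<And>g. g \<in> B ==> N g < d ==> N (T g) < 1"
  using cont[unfolded continuous_self_map_def, THEN conjunct2, rule_format, OF zero_mem zero_less_one]
  unfolding T_def[symmetric] T0 by auto
 have bound: "N (T g) <= 2 / d * c" if g: "g \<in> B" "N g <= c" for g c
 proof (rule field_le_epsilon)
  fix e :: real assume e: "e > 0"
  define b where "b = c + e * d / 2"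
  have b: "b > 0" "N g < b" using e d(1) g norm_nonneg[OF g(1)] by (auto simp: b_def add_nonneg_pos add.commute intro: add_pos_nonneg le_less_trans)
  have "N (%x. complex_of_real (d / b) * g x) < d"
  proof -
   have "N (%x. complex_of_real (d / b) * g x) = d / b * N g"
    using norm_scale[OF g(1), of "complex_of_real (d/b)"] b d(1) by (simp add: norm_divide)
   also have "\<dots> < d" using b d(1) by (simp add: field_simps)
   finally show ?thesis .
  qed
  from d(2)[OF scale_mem[OF g(1)] this]
  have "d / b * N (T g) < 1"
   using Tscale[of "d/b" g] norm_scale[OF TB[OF g(1)], of "complex_of_real (d/b)"] b d(1) by (simp add: norm_divide)
  hence "N (T g) <= b / d" using b d(1) by (simp add: field_simps)
  also have "\<dots> <= 2 / d * c + e"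
   using d(1) e g norm_nonneg[OF g(1)] by (simp add: b_def field_simps)
  finally show "N (T g) <= 2 / d * c + e" .
 qed
 show ?thesis
 proof (rule kernel_boundedI[of _ "2 / d"])
  fix F c assume [measurable]: "F \<in> borel_measurable borel" and "dominated F c"
  then obtain g where g: "g \<in> B" "N g <= c" "AE x in \<mu>. F x <= mag g x" by (elim dominatedE)
  note [measurable] = B_measurable[OF g(1)]
  have "star F (mag h) y <= mag (T g) y" for y
   using star_mono[OF g(3), of "mag h" "mag h" y] star_mag_conv[of g h y, OF _ _ ex[OF g(1)]] by (simp add: T_def)
  thus "dominated (star F (mag h)) (2 / d * c)"
   using bound[OF g(1,2)] TB[OF g(1)] unfolding dominated_def by blast
 qed (use d in auto)
qed

text \<open>Averaging over compact sets is bounded because \<open>\<bar>\<phi>\<bar> * \<bar>\<phi>\<bar>\<close> is bounded below on an open set.\<close>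

lemma kernel_bounded_indicator:
 assumes \<phi> [measurable]: "\<phi> \<in> borel_measurable borel" and nz: "\<not> (AE x in \<mu>. \<phi> x = 0)"
  and kb: "kernel_bounded (mag \<phi>)" and V: "compact V"
 shows "kernel_bounded (indicator V)"
proof -
 have "\<not> (AE x in \<mu>. mag \<phi> x = 0)" using nz by simp
 then obtain W z c where W: "open W" "0 \<in> W" and c: "c > 0" "c < \<infinity>"
  and lower: "\<And>w. w \<in> W ==> c <= star (mag \<phi>) (mag \<phi>) (w + z)"
  by (rule star_self_lower_bound[rotated]) auto
 obtain r where r: "c = ennreal r" "r > 0" using c by (cases c) auto
 have [measurable]: "W \<in> sets borel" using W by auto
 have kW: "kernel_bounded (indicator W)"
 proof -
  obtain C where C: "C \<ge> 0" "\<And>F c. F \<in> borel_measurable borel ==> dominated F c ==> dominated (star F (star (mag \<phi>) (mag \<phi>))) (C * c)"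
   using kernel_bounded_star[OF kb kb] by (rule kernel_boundedE) blast
  obtain D where D: "D \<ge> 0" "\<And>F c. dominated F c ==> dominated (%y. F (y + z)) (D * c)"
   using dominated_rtrans[of z] by metis
  show ?thesis
  proof (rule kernel_boundedI[of _ "1 / r * (D * C)"])
   fix F a assume [measurable]: "F \<in> borel_measurable borel" and F: "dominated F a"
   have "dominated (%y. ennreal (1 / r) * star F (star (mag \<phi>) (mag \<phi>)) (y + z)) (1 / r * (D * (C * a)))"
    by (intro dominated_cmult D C F) (use r in auto)
   moreover have "star F (indicator W) y <= ennreal (1 / r) * star F (star (mag \<phi>) (mag \<phi>)) (y + z)" for y
   proof -
    have "indicator W v <= ennreal (1 / r) * star (mag \<phi>) (mag \<phi>) (v + z)" for v
    proof (cases "v \<in> W")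
     case True
     have "(1::ennreal) = ennreal (1 / r) * c" using r by (simp add: ennreal_mult[symmetric])
     also have "\<dots> <= ennreal (1 / r) * star (mag \<phi>) (mag \<phi>) (v + z)" by (intro mult_left_mono lower True) simp
     finally show ?thesis using True by simp
    qed simp
    hence "star F (indicator W) y <= star F (%v. ennreal (1 / r) * star (mag \<phi>) (mag \<phi>) (v + z)) y"
     by (intro star_mono) auto
    also have "\<dots> = ennreal (1 / r) * star F (%v. star (mag \<phi>) (mag \<phi>) (v + z)) y"
     by (rule star_cmult_right) measurable
    also have "star F (%v. star (mag \<phi>) (mag \<phi>) (v + z)) y = star F (star (mag \<phi>) (mag \<phi>)) (y + z)"
     by (simp add: star_def[of F] add.assoc)
    finally show ?thesis .
   qed
   ultimately show "dominated (star F (indicator W)) (1 / r * (D * C) * a)"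
    by (elim dominated_mono) (auto simp: algebra_simps)
  qed (use r C D in auto)
 qed
 have opg: "open ((%u. u + - g) -` W)" for g by (intro open_vimage W continuous_intros)
 obtain A where A: "finite A" "V \<subseteq> (\<Union>g\<in>A. (%u. u + - g) -` W)"
 proof (rule compactE_image[OF V, of V "%g. (%u. u + - g) -` W"])
  show "V \<subseteq> (\<Union>g\<in>V. (%u. u + - g) -` W)"
  proof
   fix v assume "v \<in> V"
   moreover have "v \<in> (%u. u + - v) -` W" using W(2) by simp
   ultimately show "v \<in> (\<Union>g\<in>V. (%u. u + - g) -` W)" by (rule UN_I)
  qed
 qed (use opg in auto)
 have [measurable]: "V \<in> sets borel" by (rule compact_borel[OF V])
 have "kernel_bounded (%v. \<Sum>g\<in>A. indicator W (v + - g))"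
 proof (rule kernel_bounded_sum[OF A(1)])
  fix g
  obtain C where C: "C \<ge> 0" "\<And>F c. F \<in> borel_measurable borel ==> dominated F c ==> dominated (star F (indicator W)) (C * c)"
   using kW by (rule kernel_boundedE) blast
  obtain D where D: "D \<ge> 0" "\<And>F c. dominated F c ==> dominated (%y. F (y + - g)) (D * c)"
   using dominated_rtrans[of "- g"] by metis
  have meas: "(%v. indicator W (v + - g) :: ennreal) \<in> borel_measurable borel" by measurable
  show "kernel_bounded (%v. indicator W (v + - g))"
  proof (rule kernel_boundedI[OF meas, of "D * C"])
   fix F a assume [measurable]: "F \<in> borel_measurable borel" and F: "dominated F a"
   have "dominated (%y. star F (indicator W) (y + - g)) (D * (C * a))" by (intro D C F) fact
   moreover have "star F (%v. indicator W (v + - g)) y = star F (indicator W) (y + - g)" for y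
    by (simp add: star_def add.assoc del: add_uminus_conv_diff)
   hence "star F (%v. indicator W (v + - g)) = (%y. star F (indicator W) (y + - g))" by (rule ext)
   ultimately show "dominated (star F (%v. indicator W (v + - g))) (D * C * a)" by (simp only: mult.assoc)
  qed (use C D in \<open>simp_all del: add_uminus_conv_diff\<close>)
 qed
 thus ?thesis
 proof (rule kernel_bounded_mono)
  fix v
  show "indicator V v <= (\<Sum>g\<in>A. indicator W (v + - g) :: ennreal)"
  proof (cases "v \<in> V")
   case True
   then obtain g where g: "g \<in> A" "v + - g \<in> W" using A(2) by auto
   have "(1::ennreal) = (\<Sum>g\<in>{g}. indicator W (v + - g))" using g by simp
   also have "\<dots> <= (\<Sum>g\<in>A. indicator W (v + - g))" using g A(1) by (intro sum_mono2) auto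
   finally show ?thesis using True by simp
  qed simp
 qed simp
qed

text \<open>On an open set the convolution of \<open>\<bar>f\<bar>\<close> with the indicator of a large compact set is at least the integral
 over \<open>K\<close>. So a constant multiple of an indicator is dominated, and its norm bounds the constant.\<close>

lemma local_integral_bound:
 assumes kV: "\<And>V. compact V ==> kernel_bounded (indicator V)" and K: "compact K"
 obtains C where "C \<ge> 0" "\<And>f. f \<in> B ==> (\<integral>\<^sup>+x. mag f x * indicator K x \<partial>\<mu>) <= ennreal (C * N f)"
proof -
 obtain U :: "'g set" where U: "open U" "0 \<in> U" "compact (closure U)"
  using open_compact_neighbourhood[OF open_UNIV UNIV_I] by metis
 define V where "V = {x + y | x y. x \<in> uminus ` K \<and> y \<in> closure U}"
 have V: "compact V" unfolding V_def by (intro compact_sum compact_uminus K U)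
 obtain C where C: "C \<ge> 0" "\<And>F c. F \<in> borel_measurable borel ==> dominated F c ==> dominated (star F (indicator V)) (C * c)"
  using kV[OF V] by (rule kernel_boundedE) blast
 note [measurable] = compact_borel[OF K] compact_borel[OF V]
 have [measurable]: "U \<in> sets borel" using U by auto
 have dom: "dominated (%y. (\<integral>\<^sup>+x. mag f x * indicator K x \<partial>\<mu>) * indicator U y) (C * N f)" if f: "f \<in> B" for f
 proof -
  note [measurable] = B_measurable[OF f]
  have "dominated (star (mag f) (indicator V)) (C * N f)" by (intro C dominated_mag f) measurable
  thus ?thesis
  proof (rule dominated_mono)
   show "AE y in \<mu>. (\<integral>\<^sup>+x. mag f x * indicator K x \<partial>\<mu>) * indicator U y <= star (mag f) (indicator V) y"
   proof (rule AE_I2)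
    fix y
    show "(\<integral>\<^sup>+x. mag f x * indicator K x \<partial>\<mu>) * indicator U y <= star (mag f) (indicator V) y"
    proof (cases "y \<in> U")
     case True
     have "- x + y \<in> V" if "x \<in> K" for x
      unfolding V_def using that True closure_subset[of U] by blast
     hence "(\<integral>\<^sup>+x. mag f x * indicator K x \<partial>\<mu>) <= star (mag f) (indicator V) y"
      unfolding star_def by (intro nn_integral_mono) (auto simp: indicator_def)
     thus ?thesis using True by simp
    qed simp
   qed
  qed simp
 qed
 have posU: "emeasure \<mu> U > 0" using U by (intro emeasure_open_pos) auto
 have fin: "(\<integral>\<^sup>+x. mag f x * indicator K x \<partial>\<mu>) < \<infinity>" if f: "f \<in> B" for f
 proof (rule ccontr)
  assume "\<not> ?thesis"
  hence "AE y in \<mu>. y \<notin> U"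
   using dominated_AE_finite[OF dom[OF f]]
   by (auto simp: indicator_def ennreal_mult_eq_top_iff top_unique split: if_splits elim!: eventually_mono)
  hence "emeasure \<mu> U = 0" by (subst (asm) AE_iff_measurable[of U]) auto
  thus False using posU by simp
 qed
 define u where "u = (%y. indicator U y :: complex)"
 have u [measurable]: "u \<in> borel_measurable borel" unfolding u_def by measurable
 show ?thesis
 proof (cases "u \<in> B")
  case True
  have "\<not> (AE y in \<mu>. u y = 0)"
  proof
   assume "AE y in \<mu>. u y = 0"
   hence "AE y in \<mu>. y \<notin> U" by eventually_elim (auto simp: u_def indicator_def split: if_splits)
   hence "emeasure \<mu> U = 0" by (subst (asm) AE_iff_measurable[of U]) auto
   thus False using posU by simp
  qed
  hence Nu: "N u > 0" using norm_eq_0_iff[OF True] norm_nonneg[OF True] by force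
  show ?thesis
  proof (rule that[of "solid_const * C / N u"])
   fix f assume f: "f \<in> B"
   define a where "a = enn2real (\<integral>\<^sup>+x. mag f x * indicator K x \<partial>\<mu>)"
   have a: "(\<integral>\<^sup>+x. mag f x * indicator K x \<partial>\<mu>) = ennreal a" "a \<ge> 0"
    using fin[OF f] by (auto simp: a_def less_top)
   have "mag (%y. complex_of_real a * u y) = (%y. ennreal a * indicator U y)"
    using a(2) by (auto simp: fun_eq_iff u_def indicator_def norm_mult)
   hence "dominated (mag (%y. complex_of_real a * u y)) (C * N f)" using dom[OF f] a(1) by simp
   hence "N (%y. complex_of_real a * u y) <= solid_const * (C * N f)" by (intro dominated_mem) auto
   hence "a * N u <= solid_const * (C * N f)" using norm_scale[OF True, of "complex_of_real a"] a(2) by simp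
   hence "a <= solid_const * C / N u * N f" using Nu by (simp add: field_simps)
   thus "(\<integral>\<^sup>+x. mag f x * indicator K x \<partial>\<mu>) <= ennreal (solid_const * C / N u * N f)"
    unfolding a(1) by (rule ennreal_leI)
  qed (use solid_const C Nu in auto)
 next
  case False
  show ?thesis
  proof (rule that[of 0])
   fix f assume f: "f \<in> B"
   have "(\<integral>\<^sup>+x. mag f x * indicator K x \<partial>\<mu>) = 0"
   proof (rule ccontr)
    assume nz: "(\<integral>\<^sup>+x. mag f x * indicator K x \<partial>\<mu>) \<noteq> 0"
    define a where "a = enn2real (\<integral>\<^sup>+x. mag f x * indicator K x \<partial>\<mu>)"
    have a: "(\<integral>\<^sup>+x. mag f x * indicator K x \<partial>\<mu>) = ennreal a" "a > 0"
     using fin[OF f] nz by (auto simp: a_def less_top enn2real_positive_iff zero_less_iff_neq_zero)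
    have "mag (%y. complex_of_real a * u y) = (%y. ennreal a * indicator U y)"
     using a(2) by (auto simp: fun_eq_iff u_def indicator_def norm_mult)
    hence "dominated (mag (%y. complex_of_real a * u y)) (C * N f)" using dom[OF f] a(1) by simp
    hence "(%y. complex_of_real a * u y) \<in> B" by (intro dominated_mem) auto
    from scale_mem[OF this, of "complex_of_real (1/a)"] have "u \<in> B" using a(2) by simp
    thus False using False by simp
   qed
   thus "(\<integral>\<^sup>+x. mag f x * indicator K x \<partial>\<mu>) <= ennreal (0 * N f)" by simp
  qed simp
 qed
qed

end

section \<open>Reproducing kernel spaces\<close>

locale reproducing_space = haar_space \<mu> B N
 for \<mu> :: "'g::{topological_group_add, t2_space, second_countable_topology} measure" and B N +
 fixes \<phi> :: "'g => complex"
 assumes repr: "reproducing \<mu> B N \<phi>"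
  and conv_ex: "\<And>f. f \<in> B ==> conv_exists \<mu> (absf f) (absf \<phi>)"
  and kernel_phi: "kernel_bounded (mag \<phi>)"
begin

abbreviation "E \<equiv> B_phi \<mu> B \<phi>"

lemma phi_mem: "\<phi> \<in> B" and phi_conv: "conv \<mu> \<phi> \<phi> = \<phi>" and phi_nz: "\<phi> \<noteq> (%x. 0)"
 using repr by (auto simp: reproducing_def)

lemma phi_measurable [measurable]: "\<phi> \<in> borel_measurable borel"
 by (rule B_measurable[OF phi_mem])

lemma phi_not_null: "\<not> (AE x in \<mu>. \<phi> x = 0)"
proof
 assume *: "AE x in \<mu>. \<phi> x = 0"
 have "conv \<mu> \<phi> \<phi> y = 0" for y
  unfolding conv_def using * by (intro integral_eq_zero_AE) (auto elim!: eventually_mono)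
 thus False using phi_conv phi_nz by auto
qed

lemma kernel_indicator: "compact V ==> kernel_bounded (indicator V)"
 by (rule kernel_bounded_indicator[OF phi_measurable phi_not_null kernel_phi])

lemma star_phi_finite:
 assumes "dominated F c"
 shows "star F (mag \<phi>) y < \<infinity>"
proof -
 obtain g where g: "g \<in> B" "N g <= c" "AE x in \<mu>. F x <= mag g x" using assms by (rule dominatedE)
 have "star F (mag \<phi>) y <= star (mag g) (mag \<phi>) y" using g(3) by (intro star_mono) auto
 also have "\<dots> < \<infinity>" using star_mag_conv[OF B_measurable[OF g(1)] phi_measurable conv_ex[OF g(1)]] by simp
 finally show ?thesis .
qed

lemma conv_integrable:
 assumes f: "f \<in> B" shows "integrable \<mu> (%x. f x * \<phi> (- x + y))"
proof (rule integrableI_bounded)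
 note [measurable] = B_measurable[OF f]
 show "(%x. f x * \<phi> (- x + y)) \<in> borel_measurable \<mu>" by simp
 have "(\<integral>\<^sup>+x. ennreal (norm (f x * \<phi> (- x + y))) \<partial>\<mu>) = star (mag f) (mag \<phi>) y"
  unfolding star_def by (simp add: norm_mult ennreal_mult)
 thus "(\<integral>\<^sup>+x. ennreal (norm (f x * \<phi> (- x + y))) \<partial>\<mu>) < \<infinity>"
  using star_phi_finite[OF dominated_mag[OF f]] by simp
qed

lemma conv_mag_le: "f \<in> B ==> mag (conv \<mu> f \<phi>) y <= star (mag f) (mag \<phi>) y"
proof -
 assume f: "f \<in> B"
 have "mag (conv \<mu> f \<phi>) y <= (\<integral>\<^sup>+x. ennreal (norm (f x * \<phi> (- x + y))) \<partial>\<mu>)"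
  unfolding conv_def by (rule integral_norm_bound_ennreal[OF conv_integrable[OF f]])
 also have "\<dots> = star (mag f) (mag \<phi>) y"
  unfolding star_def by (simp add: norm_mult ennreal_mult)
 finally show ?thesis .
qed

lemma phi_mag_le: "mag \<phi> y <= star (mag \<phi>) (mag \<phi>) y"
 using conv_mag_le[OF phi_mem, of y] by (simp add: phi_conv)

lemma conv_point_bound:
 obtains C where "\<And>f. f \<in> B ==> cmod (conv \<mu> f \<phi> y) <= C * N f"
proof -
 obtain C where C: "\<And>f. f \<in> B ==> cmod (\<integral>y. f y * \<phi> (- y) \<partial>\<mu>) <= C * N f"
  using repr by (auto simp: reproducing_def)
 obtain D where D: "\<And>f. f \<in> B ==> N (ltrans (- y) f) <= D * N f"
  using translation_bounded[of "{- y}"] by auto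
 show ?thesis
 proof (rule that[of "max C 0 * D"])
  fix f assume f: "f \<in> B"
  note [measurable] = B_measurable[OF f]
  have "conv \<mu> f \<phi> y = (\<integral>x. f (y + x) * \<phi> (- (y + x) + y) \<partial>\<mu>)"
   unfolding conv_def by (rule integral_translate[symmetric]) measurable
  also have "\<dots> = (\<integral>x. ltrans (- y) f x * \<phi> (- x) \<partial>\<mu>)"
   by (intro Bochner_Integration.integral_cong) (auto simp: ltrans_def minus_add add.assoc simp del: add_uminus_conv_diff)
  finally have "cmod (conv \<mu> f \<phi> y) <= C * N (ltrans (- y) f)" using C[OF ltrans_mem[OF f]] by simp
  also have "\<dots> <= max C 0 * N (ltrans (- y) f)"
   using norm_nonneg[OF ltrans_mem[OF f]] by (intro mult_right_mono) auto
  also have "\<dots> <= max C 0 * (D * N f)" by (intro mult_left_mono D f) simp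
  finally show "cmod (conv \<mu> f \<phi> y) <= max C 0 * D * N f" by (simp add: mult.assoc)
 qed
qed

lemma conv_linear:
 assumes "f \<in> B" "g \<in> B"
 shows "conv \<mu> (%x. a * f x + b * g x) \<phi> y = a * conv \<mu> f \<phi> y + b * conv \<mu> g \<phi> y"
proof -
 have "conv \<mu> (%x. a * f x + b * g x) \<phi> y
   = (\<integral>x. a * (f x * \<phi> (- x + y)) + b * (g x * \<phi> (- x + y)) \<partial>\<mu>)"
  unfolding conv_def by (simp add: algebra_simps)
 thus ?thesis using conv_integrable[OF assms(1), of y] conv_integrable[OF assms(2), of y]
  by (simp add: conv_def)
qed

lemma E_mem: "f \<in> E ==> f \<in> B"
 by (simp add: B_phi_def)

lemma E_conv: "f \<in> E ==> conv \<mu> f \<phi> y = f y"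
 unfolding B_phi_def mem_Collect_eq by (elim conjE) (erule fun_cong[OF sym])

lemma E_I: "f \<in> B ==> (\<And>y. conv \<mu> f \<phi> y = f y) ==> f \<in> E"
 by (auto simp: B_phi_def)

lemma E_lin: "f \<in> E ==> g \<in> E ==> (%x. a * f x + b * g x) \<in> E"
 by (intro E_I add_mem scale_mem) (auto simp: E_mem conv_linear E_conv)

lemma E_add: "f \<in> E ==> g \<in> E ==> (%x. f x + g x) \<in> E"
 using E_lin[of f g 1 1] by simp

lemma E_diff: "f \<in> E ==> g \<in> E ==> (%x. f x - g x) \<in> E"
 using E_lin[of f g 1 "-1"] by simp

lemma E_zero: "(%x. 0) \<in> E"
 by (intro E_I zero_mem) (simp add: conv_def)

lemma E_norm_0: assumes "f \<in> E" "N f <= 0" shows "f = (%x. 0)"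
proof
 fix y
 obtain C where C: "\<And>f. f \<in> B ==> cmod (conv \<mu> f \<phi> y) <= C * N f" using conv_point_bound by metis
 have "N f = 0" using assms norm_nonneg[OF E_mem] by force
 thus "f y = 0" using C[OF E_mem[OF assms(1)]] E_conv[OF assms(1)] by simp
qed

text \<open>The limit in \<open>B\<close> is only determined almost everywhere; its convolution with \<open>\<phi>\<close> is the
 pointwise limit and represents it within the reproducing space.\<close>

lemma E_complete:
 assumes F: "\<And>k. F k \<in> E" and Cauchy: "\<And>e. e > 0 ==> \<exists>M. \<forall>j\<ge>M. \<forall>k\<ge>M. N (%x. F j x - F k x) < e"
 shows "\<exists>f\<in>E. (%k. N (%x. F k x - f x)) \<longlonglongrightarrow> 0"
proof -
 have FB: "F k \<in> B" for k using F E_mem by blast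
 obtain g where g: "g \<in> B" "(%k. N (%x. F k x - g x)) \<longlonglongrightarrow> 0" using complete[OF FB Cauchy] by blast
 define f where "f = conv \<mu> g \<phi>"
 have lim: "(%k. F k y) \<longlonglongrightarrow> f y" for y
 proof -
  obtain C where C: "\<And>f. f \<in> B ==> cmod (conv \<mu> f \<phi> y) <= C * N f" using conv_point_bound by metis
  have le: "cmod (F k y - f y) <= C * N (%x. F k x - g x)" for k
   using C[OF diff_mem[OF FB[of k] g(1)]] conv_linear[OF FB[of k] g(1), of 1 "-1" y] E_conv[OF F[of k], of y]
   by (simp add: f_def)
  have "(%k. F k y - f y) \<longlonglongrightarrow> 0"
  proof (rule Lim_null_comparison)
   show "\<forall>\<^sub>F k in sequentially. norm (F k y - f y) <= C * N (%x. F k x - g x)" using le by simp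
   show "(%k. C * N (%x. F k x - g x)) \<longlonglongrightarrow> 0" by (rule tendsto_mult_right_zero[OF g(2)])
  qed
  thus ?thesis by (simp add: LIM_zero_iff)
 qed
 have fm [measurable]: "f \<in> borel_measurable borel"
  by (rule borel_measurable_LIMSEQ_metric[of F]) (use B_measurable[OF FB] lim in auto)
 have AE: "AE x in \<mu>. f x = g x"
  by (rule lim_meas_unique[OF B_measurable[OF FB] fm B_measurable[OF g(1)]
     lim_meas_pointwise[OF B_measurable[OF FB] fm lim] lim_meas_norm[OF FB g]])
 have fB: "f \<in> B" by (rule AE_eq_mem(1)[OF g(1) fm AE])
 have "conv \<mu> f \<phi> y = f y" for y
 proof -
  note [measurable] = B_measurable[OF g(1)]
  have "conv \<mu> f \<phi> y = conv \<mu> g \<phi> y"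
   unfolding conv_def by (rule integral_cong_AE) (use AE in \<open>auto elim!: eventually_mono\<close>)
  thus ?thesis by (simp add: f_def)
 qed
 hence "f \<in> E" by (intro E_I fB)
 moreover have "N (%x. F k x - f x) = N (%x. F k x - g x)" for k
  using AE B_measurable[OF FB[of k]]
  by (intro AE_eq_mem(2)[OF diff_mem[OF FB g(1)]]) (auto elim!: eventually_mono)
 ultimately show ?thesis using g(2) by (intro bexI[of _ f]) simp_all
qed

text \<open>It suffices that the square of \<open>I - T\<close> is a contraction.\<close>

lemma invertible_of_square_contraction:
 assumes T: "bounded_operator_on E N T"
  and small: "\<And>f. f \<in> E ==> N (%x. (f x - T f x) - T (%z. f z - T f z) x) <= N f / 2"
 shows "invertible_on E N T" "\<exists>C>0. \<forall>f\<in>E. N f <= C * N (T f)"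
proof -
 define R where "R f = (%x. f x - T f x)" for f
 have TE: "T f \<in> E" if "f \<in> E" for f using T that by (auto simp: bounded_operator_on_def)
 have Tlin: "T (%x. a * f x + b * g x) = (%x. a * T f x + b * T g x)" if "f \<in> E" "g \<in> E" for f g a b
  using T that by (auto simp: bounded_operator_on_def)
 have Tadd: "T (%x. f x + g x) = (%x. T f x + T g x)" if "f \<in> E" "g \<in> E" for f g
  using Tlin[OF that, of 1 1] by simp
 have Tdiff: "T (%x. f x - g x) = (%x. T f x - T g x)" if "f \<in> E" "g \<in> E" for f g
  using Tlin[OF that, of 1 "-1"] by simp
 obtain C0 where C0: "\<And>f. f \<in> E ==> N (T f) <= C0 * N f" using T unfolding bounded_operator_on_def by metis
 have RE: "R f \<in> E" if "f \<in> E" for f unfolding R_def by (intro E_diff TE that)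
 define C where "C = 1 + max C0 0"
 have C: "C \<ge> 1" by (simp add: C_def)
 have RN: "N (R f) <= C * N f" if f: "f \<in> E" for f
 proof -
  have "N (R f) <= N f + N (T f)" unfolding R_def by (intro norm_diff_le E_mem TE f)
  also have "N (T f) <= max C0 0 * N f"
   using C0[OF f] norm_nonneg[OF E_mem[OF f]] by (meson max.cobounded1 mult_right_mono order_trans)
  finally show ?thesis by (simp add: C_def distrib_right)
 qed
 have RR: "N (R (R f)) <= N f / 2" if "f \<in> E" for f using small[OF that] by (simp add: R_def)
 have Radd: "R (%x. f x + g x) = (%x. R f x + R g x)" if "f \<in> E" "g \<in> E" for f g
  using Tadd[OF that] by (simp add: R_def algebra_simps)
 have Rdiff: "R (%x. f x - g x) = (%x. R f x - R g x)" if "f \<in> E" "g \<in> E" for f g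
  using Tdiff[OF that] by (simp add: R_def algebra_simps)
 have lower: "N f <= 2 * (1 + C) * N (T f)" if f: "f \<in> E" for f
 proof -
  have eq: "f = (%x. (T f x + R (T f) x) + R (R f) x)"
   using Tdiff[OF f TE[OF f]] by (auto simp: R_def)
  have "N f <= N (%x. T f x + R (T f) x) + N (R (R f))"
   by (subst eq) (intro norm_triangle add_mem E_mem RE TE f)
  also have "N (%x. T f x + R (T f) x) <= N (T f) + N (R (T f))" by (intro norm_triangle E_mem RE TE f)
  finally have "N f <= N (T f) + C * N (T f) + N f / 2" using RN[OF TE[OF f]] RR[OF f] by linarith
  thus ?thesis by (simp add: algebra_simps)
 qed
 have inj: "inj_on T E"
 proof (rule inj_onI)
  fix f g assume fg: "f \<in> E" "g \<in> E" "T f = T g"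
  have "T (%x. f x - g x) = (%x. 0)" using Tdiff[OF fg(1,2)] fg(3) by simp
  hence "N (%x. f x - g x) <= 0" using lower[OF E_diff[OF fg(1,2)]] norm_zero by simp
  from fun_cong[OF E_norm_0[OF E_diff[OF fg(1,2)] this]] show "f = g" by auto
 qed
 have surj: "\<exists>f\<in>E. T f = g" if g: "g \<in> E" for g
 proof -
  \<comment> \<open>The solution is the sum of \<open>R\<^sup>2\<^sup>k (g + R g)\<close> over all \<open>k\<close>.\<close>
  define h where "h = (%x. g x + R g x)"
  have h: "h \<in> E" unfolding h_def by (intro E_add RE g)
  define s where "s = rec_nat (%x. 0) (%_ v x. h x + R (R v) x)"
  have s0: "s 0 = (%x. 0)" and sS: "s (Suc k) = (%x. h x + R (R (s k)) x)" for k by (simp_all add: s_def)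
  have s: "s k \<in> E" for k
  proof (induction k)
   case 0 show ?case unfolding s0 by (rule E_zero)
  next
   case (Suc k) show ?case unfolding sS by (intro E_add h RE Suc)
  qed
  have step: "N (%x. s (Suc k) x - s k x) <= N h * (1/2)^k" for k
  proof (induction k)
   case 0
   have "s (Suc 0) = (%x. h x + R (R (%x. 0)) x)" by (simp add: sS s0)
   moreover have "R (R (%x. 0)) = (%x. 0)"
   proof -
    have "R (%x. 0) = (%x. 0)" using Rdiff[OF h h] by simp
    thus ?thesis by simp
   qed
   ultimately show ?case by (simp add: s0)
  next
   case (Suc k)
   have "(%x. s (Suc (Suc k)) x - s (Suc k) x) = R (R (%x. s (Suc k) x - s k x))"
    unfolding Rdiff[OF s s] Rdiff[OF RE[OF s] RE[OF s]] by (simp add: sS[of "Suc k"] sS[of k])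
   hence "N (%x. s (Suc (Suc k)) x - s (Suc k) x) <= N (%x. s (Suc k) x - s k x) / 2"
    using RR[OF E_diff[OF s[of "Suc k"] s[of k]]] by simp
   thus ?case using Suc by simp
  qed
  have far: "N (%x. s (k + j) x - s k x) <= 2 * N h * (1/2)^k" for k j
  proof -
   have "N (%x. s (k + j) x - s k x) <= 2 * N h * (1/2)^k * (1 - (1/2)^j)"
   proof (induction j)
    case 0 thus ?case by (simp add: norm_zero)
   next
    case (Suc j)
    have "N (%x. (s (k + Suc j) x - s (k + j) x) + (s (k + j) x - s k x))
     <= N (%x. s (k + Suc j) x - s (k + j) x) + N (%x. s (k + j) x - s k x)"
     by (intro norm_triangle diff_mem E_mem s)
    thus ?case using Suc step[of "k + j"] by (simp add: algebra_simps power_add)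
   qed
   also have "\<dots> <= 2 * N h * (1/2)^k * 1"
    using norm_nonneg[OF E_mem[OF h]] by (intro mult_left_mono) auto
   finally show ?thesis by simp
  qed
  have "\<exists>f\<in>E. (%k. N (%x. s k x - f x)) \<longlonglongrightarrow> 0"
  proof (rule E_complete[OF s])
   fix e :: real assume e: "e > 0"
   have "(%k. 2 * N h * (1/2)^k) \<longlonglongrightarrow> 0" by (intro tendsto_mult_right_zero LIMSEQ_power_zero) simp
   then obtain M where M: "2 * N h * (1/2)^M < e / 2"
    using order_tendstoD(2)[of _ 0 sequentially "e/2"] e by (force simp: eventually_sequentially)
   have "N (%x. s j x - s k x) < e" if "j \<ge> M" "k \<ge> M" for j k
   proof -
    have "N (%x. (s j x - s M x) - (s k x - s M x)) <= N (%x. s j x - s M x) + N (%x. s k x - s M x)"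
     by (intro norm_diff_le diff_mem E_mem s)
    thus ?thesis using far[of M "j - M"] far[of M "k - M"] that M by simp
   qed
   thus "\<exists>M. \<forall>j\<ge>M. \<forall>k\<ge>M. N (%x. s j x - s k x) < e" by blast
  qed
  then obtain f where f: "f \<in> E" "(%k. N (%x. s k x - f x)) \<longlonglongrightarrow> 0" by blast
  have fix_h: "f = (%x. h x + R (R f) x)"
  proof -
   let ?d = "%x. f x - (h x + R (R f) x)"
   have dE: "?d \<in> E" by (intro E_diff E_add f h RE)
   have "N ?d <= N (%x. s (Suc k) x - f x) + N (%x. s k x - f x) / 2" for k
   proof -
    have "R (R (%x. s k x - f x)) = (%x. R (R (s k)) x - R (R f) x)"
     unfolding Rdiff[OF s f(1)] by (rule Rdiff[OF RE[OF s] RE[OF f(1)]])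
    hence "?d = (%x. (R (R (%x. s k x - f x)) x) - (s (Suc k) x - f x))" by (auto simp: sS)
    hence "N ?d <= N (R (R (%x. s k x - f x))) + N (%x. s (Suc k) x - f x)"
     using norm_diff_le[OF E_mem[OF RE[OF RE[OF E_diff[OF s[of k] f(1)]]]] E_mem[OF E_diff[OF s[of "Suc k"] f(1)]]] by simp
    thus ?thesis using RR[OF E_diff[OF s[of k] f(1)]] by simp
   qed
   moreover have "(%k. N (%x. s (Suc k) x - f x) + N (%x. s k x - f x) / 2) \<longlonglongrightarrow> 0 + 0 / 2"
    using LIMSEQ_Suc[OF f(2)] f(2) by (intro tendsto_intros) auto
   ultimately have "N ?d <= 0 + 0/2" by (intro LIMSEQ_le_const[of _ "0 + 0/2"]) auto
   hence "?d = (%x. 0)" by (intro E_norm_0[OF dE]) simp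
   thus ?thesis by (auto simp: fun_eq_iff)
  qed
  define d where "d = (%x. T f x - g x)"
  have dE: "d \<in> E" unfolding d_def by (intro E_diff TE f g)
  have Tf: "T f = (%x. f x - R f x)" by (simp add: R_def)
  have Rd: "R d = (%x. R f x - R (R f) x - R g x)"
   unfolding d_def Rdiff[OF TE[OF f(1)] g] by (subst Tf, subst Rdiff[OF f(1) RE[OF f(1)]]) simp
  have "R d = (%x. - d x)"
  proof
   fix x show "R d x = - d x" using fun_cong[OF fix_h, of x] unfolding Rd by (simp add: d_def Tf h_def)
  qed
  hence "R (R d) = R (%x. 0 - d x)" by simp
  also have "\<dots> = d" using Rdiff[OF E_zero dE] \<open>R d = (%x. - d x)\<close> Rdiff[OF h h] by simp
  finally have "N d <= N d / 2" using RR[OF dE] by simp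
  hence "d = (%x. 0)" by (intro E_norm_0[OF dE]) simp
  hence "T f = g" by (auto simp: d_def fun_eq_iff)
  thus ?thesis using f by blast
 qed
 have bij: "bij_betw T E E" using inj surj TE by (auto simp: bij_betw_def)
 have inv: "inv_into E T g \<in> E" "T (inv_into E T g) = g" if "g \<in> E" for g
  using bij that by (auto simp: bij_betw_def inv_into_into f_inv_into_f)
 have "bounded_operator_on E N (inv_into E T)"
  unfolding bounded_operator_on_def
 proof (intro conjI ballI allI exI[of _ "2 * (1 + C)"])
  fix f g a b assume fg: "f \<in> E" "g \<in> E"
  have "T (%x. a * inv_into E T f x + b * inv_into E T g x) = (%x. a * f x + b * g x)"
   using Tlin[OF inv(1)[OF fg(1)] inv(1)[OF fg(2)]] inv(2)[OF fg(1)] inv(2)[OF fg(2)] by simp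
  thus "inv_into E T (%x. a * f x + b * g x) = (%x. a * inv_into E T f x + b * inv_into E T g x)"
   using inv_into_f_f[OF inj E_lin[OF inv(1)[OF fg(1)] inv(1)[OF fg(2)]], of a b] by simp
 next
  fix f assume f: "f \<in> E"
  show "inv_into E T f \<in> E" by (rule inv(1)[OF f])
  show "N (inv_into E T f) <= 2 * (1 + C) * N f" using lower[OF inv(1)[OF f]] inv(2)[OF f] by simp
 qed
 thus "invertible_on E N T" using T bij by (simp add: invertible_on_def)
 show "\<exists>C>0. \<forall>f\<in>E. N f <= C * N (T f)" using lower C by (intro exI[of _ "2 * (1 + C)"]) auto
qed

end

section \<open>Discretized convolution\<close>

text \<open>The abstract sampling situation: \<open>K\<close> majorizes the oscillation of \<open>\<phi>\<close> over \<open>U\<close>, and convolving twice with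
 \<open>K\<close> reduces norms by enough to make up for the constant by which solidity enlarges them.\<close>

locale sampling = reproducing_space \<mu> B N \<phi>
 for \<mu> :: "'g::{topological_group_add, t2_space, second_countable_topology} measure" and B N \<phi> +
 fixes U :: "'g set" and K :: "'g => ennreal" and I :: "nat set" and x :: "nat => 'g"
  and \<psi> :: "nat => 'g => real"
 assumes U: "compact U" "0 \<in> interior U"
  and sep: "relatively_separated U I x"
  and kernel_K: "kernel_bounded K"
  and osc: "\<And>u z. u \<in> U ==> ennreal (cmod (\<phi> (u + z) - \<phi> z)) <= K z"
  and small: "\<And>F c. F \<in> borel_measurable borel ==> dominated F c ==>
   dominated (star (star F K) K) (c / (2 * solid_const))"
  and psi_measurable: "\<And>i. i \<in> I ==> \<psi> i \<in> borel_measurable borel"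
  and psi_nonneg: "\<And>i y. i \<in> I ==> 0 <= \<psi> i y"
  and psi_supp: "\<And>i. i \<in> I ==> supp (\<psi> i) \<subseteq> (%u. x i + u) ` U"
  and psi_sum: "\<And>y. ((%i. \<psi> i y) has_sum 1) I"
begin

text \<open>Extended by zero outside \<open>I\<close>, so that sums run over all natural numbers.\<close>

definition p :: "nat => 'g => real" where "p i y = (if i \<in> I then \<psi> i y else 0)"

definition coeff :: "nat => ('g => complex) => complex" where
 "coeff i f = (if i \<in> I then psi_coeff \<mu> \<psi> i f else 0)"

lemma K_measurable [measurable]: "K \<in> borel_measurable borel"
 by (rule kernel_bounded_measurable[OF kernel_K])

lemma p_measurable [measurable]: "p i \<in> borel_measurable borel"
 unfolding p_def using psi_measurable by (cases "i \<in> I") auto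

lemma p_nonneg: "0 <= p i y" by (simp add: p_def psi_nonneg)

lemma p_sums: "(%i. p i y) sums 1"
proof -
 have "((%i. p i y) has_sum 1) UNIV \<longleftrightarrow> ((%i. \<psi> i y) has_sum 1) I"
  by (intro has_sum_cong_neutral) (auto simp: p_def)
 thus ?thesis using psi_sum has_sum_imp_sums by blast
qed

lemma p_suminf: "(\<Sum>i. ennreal (p i y)) = 1"
 using suminf_ennreal_eq[OF p_nonneg p_sums] by simp

lemma p_le_1: "p i y <= 1"
proof -
 have "sum (%i. p i y) {i} <= (\<Sum>i. p i y)"
  using p_sums[of y] p_nonneg by (intro sum_le_suminf sums_summable[OF p_sums]) auto
 thus ?thesis using sums_unique[OF p_sums[of y]] by simp
qed

lemma p_support: assumes "p i z \<noteq> 0" shows "i \<in> I" "- x i + z \<in> U"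
proof -
 show i: "i \<in> I" using assms by (auto simp: p_def split: if_splits)
 have "z \<in> supp (\<psi> i)" unfolding supp_def using assms i closure_subset by (force simp: p_def)
 then obtain u where "u \<in> U" "z = x i + u" using psi_supp[OF i] by blast
 thus "- x i + z \<in> U" by (simp add: add.assoc[symmetric])
qed

lemma coeff_integral: "coeff i f = (\<integral>y. f y * complex_of_real (p i y) \<partial>\<mu>)"
 by (simp add: coeff_def psi_coeff_def p_def)

definition mass :: "nat => ('g => ennreal) => ennreal" where
 "mass i F = (\<integral>\<^sup>+y. F y * ennreal (p i y) \<partial>\<mu>)"

lemma compact_cell: "compact ((%u. x i + u) ` U)" by (rule compact_translate[OF U(1)])

lemma mass_bound:
 obtains C where "C \<ge> 0" "\<And>f. f \<in> B ==> mass i (mag f) <= ennreal (C * N f)"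
proof -
 obtain C where C: "C \<ge> 0" "\<And>f. f \<in> B ==> (\<integral>\<^sup>+y. mag f y * indicator ((%u. x i + u) ` U) y \<partial>\<mu>) <= ennreal (C * N f)"
  using local_integral_bound[OF kernel_indicator compact_cell[of i]] by metis
 show ?thesis
 proof (rule that[OF C(1)])
  fix f assume f: "f \<in> B"
  have "mass i (mag f) <= (\<integral>\<^sup>+y. mag f y * indicator ((%u. x i + u) ` U) y \<partial>\<mu>)"
   unfolding mass_def
  proof (rule nn_integral_mono)
   fix y
   show "mag f y * ennreal (p i y) <= mag f y * indicator ((%u. x i + u) ` U) y"
   proof (cases "p i y = 0")
    case False
    have "y \<in> (%u. x i + u) ` U"
     using p_support(2)[OF False] by (rule image_eqI[rotated]) (simp add: add.assoc[symmetric])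
    moreover have "ennreal (p i y) <= 1" using p_le_1[of i y] p_nonneg by (simp add: ennreal_le_1)
    ultimately show ?thesis by (intro mult_left_mono) auto
   qed simp
  qed
  thus "mass i (mag f) <= ennreal (C * N f)" using C(2)[OF f] by (rule order_trans)
 qed
qed

lemma mass_finite: "f \<in> B ==> mass i (mag f) < \<infinity>"
 using mass_bound[of i] by (metis ennreal_less_top infinity_ennreal_def le_less_trans)

lemma coeff_integrable:
 assumes f: "f \<in> B" shows "integrable \<mu> (%y. f y * complex_of_real (p i y))"
proof (rule integrableI_bounded)
 note [measurable] = B_measurable[OF f]
 show "(%y. f y * complex_of_real (p i y)) \<in> borel_measurable \<mu>" by simp
 have "(\<integral>\<^sup>+y. ennreal (norm (f y * complex_of_real (p i y))) \<partial>\<mu>) = mass i (mag f)"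
  unfolding mass_def by (simp add: norm_mult ennreal_mult p_nonneg)
 thus "(\<integral>\<^sup>+y. ennreal (norm (f y * complex_of_real (p i y))) \<partial>\<mu>) < \<infinity>"
  using mass_finite[OF f] by simp
qed

lemma coeff_le_mass: "f \<in> B ==> ennreal (cmod (coeff i f)) <= mass i (mag f)"
proof -
 assume f: "f \<in> B"
 have "ennreal (cmod (coeff i f)) <= (\<integral>\<^sup>+y. ennreal (norm (f y * complex_of_real (p i y))) \<partial>\<mu>)"
  unfolding coeff_integral by (rule integral_norm_bound_ennreal[OF coeff_integrable[OF f]])
 thus ?thesis unfolding mass_def by (simp add: norm_mult ennreal_mult p_nonneg)
qed

lemma coeff_bound:
 obtains C where "\<And>f. f \<in> B ==> cmod (coeff i f) <= C * N f"
proof -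
 obtain C where C: "C \<ge> 0" "\<And>f. f \<in> B ==> mass i (mag f) <= ennreal (C * N f)"
  using mass_bound by metis
 show ?thesis
 proof (rule that[of C])
  fix f assume f: "f \<in> B"
  have "ennreal (cmod (coeff i f)) <= ennreal (C * N f)" using coeff_le_mass[OF f] C(2)[OF f] by (rule order_trans)
  thus "cmod (coeff i f) <= C * N f" using C(1) norm_nonneg[OF f] by (subst (asm) ennreal_le_iff) auto
 qed
qed

lemma coeff_linear:
 assumes "f \<in> B" "g \<in> B"
 shows "coeff i (%y. a * f y + b * g y) = a * coeff i f + b * coeff i g"
proof -
 have "coeff i (%y. a * f y + b * g y)
   = (\<integral>y. a * (f y * complex_of_real (p i y)) + b * (g y * complex_of_real (p i y)) \<partial>\<mu>)"
  unfolding coeff_integral by (simp add: algebra_simps)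
 thus ?thesis using coeff_integrable[OF assms(1), of i] coeff_integrable[OF assms(2), of i]
  by (simp add: coeff_integral)
qed

lemma shift_decomp: "- x i + y = (- x i + z) + (- z + y)"
 by (simp add: add.assoc)

lemma osc_cell: "- x i + z \<in> U ==> ennreal (cmod (\<phi> (- z + y) - \<phi> (- x i + y))) <= K (- z + y)"
 using osc[of "- x i + z" "- z + y"] shift_decomp[of i y z] by (simp add: norm_minus_commute)

lemma osc_at: "p i z \<noteq> 0 ==> ennreal (cmod (\<phi> (- z + y) - \<phi> (- x i + y))) <= K (- z + y)"
 by (rule osc_cell[OF p_support(2)])

definition k1 :: "'g => ennreal" where "k1 z = mag \<phi> z + K z"

text \<open>On the support of \<open>p i\<close> the value of \<open>\<phi>\<close> at \<open>- x i + y\<close> is controlled by the values of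
 \<open>\<phi>\<close> and of its oscillation bound at the point \<open>- z + y\<close>.\<close>

lemma mag_cell: "- x i + z \<in> U ==> mag \<phi> (- x i + y) <= k1 (- z + y)"
proof -
 assume "- x i + z \<in> U"
 have "mag \<phi> (- x i + y) <= ennreal (cmod (\<phi> (- z + y)) + cmod (\<phi> (- z + y) - \<phi> (- x i + y)))"
  using norm_triangle_sub[of "\<phi> (- x i + y)" "\<phi> (- z + y)"] by (intro ennreal_leI) (simp add: norm_minus_commute)
 also have "\<dots> = mag \<phi> (- z + y) + ennreal (cmod (\<phi> (- z + y) - \<phi> (- x i + y)))" by (simp add: ennreal_plus)
 also have "\<dots> <= k1 (- z + y)" unfolding k1_def by (intro add_left_mono osc_cell) fact
 finally show ?thesis .
qed

lemma kernel_k1: "kernel_bounded k1"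
 unfolding k1_def by (intro kernel_bounded_add kernel_phi kernel_K)

lemma k1_measurable [measurable]: "k1 \<in> borel_measurable borel"
 by (rule kernel_bounded_measurable[OF kernel_k1])

text \<open>A majorant of \<open>T2 f\<close>, and of every partial sum of its defining series, for \<open>F = \<bar>f\<bar>\<close>.\<close>

definition spread :: "('g => ennreal) => 'g => ennreal" where
 "spread F y = (\<Sum>i. mass i F * mag \<phi> (- x i + y))"

lemma spread_measurable [measurable]: "spread F \<in> borel_measurable borel"
 unfolding spread_def by measurable

lemma spread_le:
 assumes [measurable]: "F \<in> borel_measurable borel"
 shows "spread F y <= star F k1 y"
proof -
 have "spread F y = (\<Sum>i. \<integral>\<^sup>+z. F z * ennreal (p i z) * mag \<phi> (- x i + y) \<partial>\<mu>)"
  unfolding spread_def mass_def by (simp add: nn_integral_multc)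
 also have "\<dots> <= (\<Sum>i. \<integral>\<^sup>+z. F z * k1 (- z + y) * ennreal (p i z) \<partial>\<mu>)"
 proof (intro suminf_le nn_integral_mono)
  fix i z
  show "F z * ennreal (p i z) * mag \<phi> (- x i + y) <= F z * k1 (- z + y) * ennreal (p i z)"
  proof (cases "p i z = 0")
   case False
   have "F z * ennreal (p i z) * mag \<phi> (- x i + y) <= F z * ennreal (p i z) * k1 (- z + y)"
    by (intro mult_left_mono mag_cell p_support False) simp
   thus ?thesis by (simp add: mult_ac)
  qed simp
 qed auto
 also have "\<dots> = (\<integral>\<^sup>+z. (\<Sum>i. F z * k1 (- z + y) * ennreal (p i z)) \<partial>\<mu>)"
  by (rule nn_integral_suminf[symmetric]) measurable
 also have "\<dots> = star F k1 y"
  unfolding star_def by (simp add: p_suminf)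
 finally show ?thesis .
qed

lemma dominated_spread:
 obtains C where "C \<ge> 0" "\<And>F c. F \<in> borel_measurable borel ==> dominated F c ==> dominated (spread F) (C * c)"
proof -
 obtain C where C: "C \<ge> 0" "\<And>F c. F \<in> borel_measurable borel ==> dominated F c ==> dominated (star F k1) (C * c)"
  using kernel_k1 by (rule kernel_boundedE) blast
 show ?thesis
  by (rule that[OF C(1)], rule dominated_mono[OF C(2)]) (auto intro: spread_le)
qed

text \<open>The bound for \<open>spread\<close> only yields convergence almost everywhere; since
 \<open>\<bar>\<phi>\<bar> \<le> \<bar>\<phi>\<bar> * \<bar>\<phi>\<bar>\<close>, convolving once more with \<open>\<bar>\<phi>\<bar>\<close> yields it at every point.\<close>

lemma spread_le_star: "spread F y <= star (spread F) (mag \<phi>) y"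
proof -
 have "spread F y <= (\<Sum>i. mass i F * star (mag \<phi>) (mag \<phi>) (- x i + y))"
  unfolding spread_def by (intro suminf_le mult_left_mono phi_mag_le) auto
 also have "\<dots> = (\<Sum>i. \<integral>\<^sup>+z. mass i F * mag \<phi> (- x i + z) * mag \<phi> (- z + y) \<partial>\<mu>)"
 proof (intro suminf_cong)
  fix i
  have "star (mag \<phi>) (mag \<phi>) (- x i + y) = (\<integral>\<^sup>+z. mag \<phi> (- x i + z) * mag \<phi> (- z + y) \<partial>\<mu>)"
  proof -
   have "(\<integral>\<^sup>+z. mag \<phi> (- x i + (x i + z)) * mag \<phi> (- (x i + z) + y) \<partial>\<mu>) = (\<integral>\<^sup>+z. mag \<phi> (- x i + z) * mag \<phi> (- z + y) \<partial>\<mu>)"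
    by (rule nn_integral_translate[of "%z. mag \<phi> (- x i + z) * mag \<phi> (- z + y)" "x i"]) measurable
   moreover have "- (x i + z) + y = - z + (- x i + y)" for z
    by (simp add: minus_add add.assoc del: add_uminus_conv_diff)
   ultimately show ?thesis by (simp add: star_def add.assoc[symmetric])
  qed
  thus "mass i F * star (mag \<phi>) (mag \<phi>) (- x i + y) = (\<integral>\<^sup>+z. mass i F * mag \<phi> (- x i + z) * mag \<phi> (- z + y) \<partial>\<mu>)"
   by (simp add: nn_integral_cmult[symmetric] mult.assoc)
 qed
 also have "\<dots> = (\<integral>\<^sup>+z. (\<Sum>i. mass i F * mag \<phi> (- x i + z) * mag \<phi> (- z + y)) \<partial>\<mu>)"
  by (rule nn_integral_suminf[symmetric]) measurable
 also have "\<dots> = star (spread F) (mag \<phi>) y"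
  unfolding star_def spread_def by simp
 finally show ?thesis .
qed

lemma star_spread_finite: "f \<in> B ==> star (spread (mag f)) (mag \<phi>) y < \<infinity>"
proof -
 assume f: "f \<in> B"
 obtain C where "C \<ge> 0" "\<And>F c. F \<in> borel_measurable borel ==> dominated F c ==> dominated (spread F) (C * c)"
  using dominated_spread by metis
 from this(2)[OF _ dominated_mag[OF f]] show ?thesis using B_measurable[OF f] by (intro star_phi_finite) auto
qed

lemma spread_finite: "f \<in> B ==> spread (mag f) y < \<infinity>"
 using spread_le_star star_spread_finite by (rule le_less_trans)

definition atom :: "('g => complex) => nat => 'g => complex" where
 "atom f i y = coeff i f * \<phi> (- x i + y)"

lemma atom_mag: "f \<in> B ==> ennreal (cmod (atom f i y)) <= mass i (mag f) * mag \<phi> (- x i + y)"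
 unfolding atom_def norm_mult ennreal_mult[OF norm_ge_zero norm_ge_zero]
 by (intro mult_right_mono coeff_le_mass) auto

lemma summable_norm_atom: assumes "f \<in> B" shows "summable (%i. cmod (atom f i y))"
proof (rule summable_suminf_not_top)
 have "(\<Sum>i. ennreal (cmod (atom f i y))) <= spread (mag f) y"
  unfolding spread_def by (intro suminf_le atom_mag assms) auto
 thus "(\<Sum>i. ennreal (cmod (atom f i y))) \<noteq> top" using spread_finite[OF assms, of y] by (auto simp: top_unique)
qed simp

abbreviation "T \<equiv> T2 \<mu> \<phi> I x \<psi>"

lemma atom_has_sum: assumes "f \<in> B"
 shows "((%i. psi_coeff \<mu> \<psi> i f * ltrans (x i) \<phi> y) has_sum (\<Sum>i. atom f i y)) I"
proof -
 have "((%i. atom f i y) has_sum (\<Sum>i. atom f i y)) UNIV"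
  by (intro norm_summable_imp_has_sum summable_norm_atom[OF assms] summable_sums summable_norm_cancel[OF summable_norm_atom[OF assms]])
 also have "?this \<longleftrightarrow> ?thesis"
  by (intro has_sum_cong_neutral) (auto simp: atom_def coeff_def ltrans_def)
 finally show ?thesis .
qed

lemma T_eq: "f \<in> B ==> T f y = (\<Sum>i. atom f i y)"
 unfolding T2_def using atom_has_sum infsumI by blast

lemma T_mag_le: assumes "f \<in> B" shows "mag (T f) y <= spread (mag f) y"
proof -
 have "mag (T f) y <= ennreal (\<Sum>i. cmod (atom f i y))"
  unfolding T_eq[OF assms] by (intro ennreal_leI summable_norm summable_norm_atom assms)
 also have "\<dots> = (\<Sum>i. ennreal (cmod (atom f i y)))"
  by (rule suminf_ennreal2[symmetric]) (auto intro: summable_norm_atom assms)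
 also have "\<dots> <= spread (mag f) y" unfolding spread_def by (intro suminf_le atom_mag assms) auto
 finally show ?thesis .
qed

lemma T_measurable: assumes "f \<in> B" shows "T f \<in> borel_measurable borel"
proof -
 have "T f = (%y. \<Sum>i. atom f i y)" using T_eq[OF assms] by auto
 also have "\<dots> \<in> borel_measurable borel" unfolding atom_def by measurable
 finally show ?thesis .
qed

lemma T_bounded:
 obtains C where "C \<ge> 0" "\<And>f. f \<in> B ==> T f \<in> B \<and> N (T f) <= C * N f"
proof -
 obtain C where C: "C \<ge> 0" "\<And>F c. F \<in> borel_measurable borel ==> dominated F c ==> dominated (spread F) (C * c)"
  using dominated_spread by metis
 show ?thesis
 proof (rule that[of "solid_const * C"])
  fix f assume f: "f \<in> B"
  note [measurable] = B_measurable[OF f]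
  have "dominated (spread (mag f)) (C * N f)" by (intro C(2) dominated_mag f) measurable
  hence "dominated (mag (T f)) (C * N f)" by (rule dominated_mono) (auto intro: T_mag_le f)
  from dominated_mem[OF T_measurable[OF f] this] show "T f \<in> B \<and> N (T f) <= solid_const * C * N f"
   by (simp add: mult.assoc)
 qed (use C solid_const in auto)
qed

lemma conv_ltrans_phi: "conv \<mu> (ltrans a \<phi>) \<phi> y = ltrans a \<phi> y"
proof -
 have "conv \<mu> (ltrans a \<phi>) \<phi> y = (\<integral>z. ltrans a \<phi> (a + z) * \<phi> (- (a + z) + y) \<partial>\<mu>)"
  unfolding conv_def by (rule integral_translate[symmetric]) (simp add: ltrans_def)
 also have "\<dots> = (\<integral>z. \<phi> z * \<phi> (- z + (- a + y)) \<partial>\<mu>)"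
  by (intro Bochner_Integration.integral_cong)
   (auto simp: ltrans_def minus_add add.assoc[symmetric] simp del: add_uminus_conv_diff)
 also have "\<dots> = ltrans a \<phi> y" using fun_cong[OF phi_conv, of "- a + y"] by (simp add: conv_def ltrans_def)
 finally show ?thesis .
qed

lemma ltrans_phi_E: "ltrans a \<phi> \<in> E"
 by (intro E_I ltrans_mem phi_mem conv_ltrans_phi)

text \<open>The atoms belong to the reproducing space, and sum and convolution may be exchanged because the convolution
 of the majorant \<open>spread\<close> with \<open>\<bar>\<phi>\<bar>\<close> is finite.\<close>

lemma T_E: assumes f: "f \<in> B" shows "T f \<in> E"
proof -
 obtain C where C: "\<And>f. f \<in> B ==> T f \<in> B \<and> N (T f) <= C * N f" using T_bounded by metis
 have "conv \<mu> (T f) \<phi> y = T f y" for y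
 proof -
  let ?g = "%i z. atom f i z * \<phi> (- z + y)"
  have int: "integrable \<mu> (?g i)" for i
   using integrable_mult_right[OF conv_integrable[OF ltrans_mem[OF phi_mem, of "x i"], of y], of "coeff i f"]
   by (simp add: atom_def ltrans_def mult.assoc)
  have sum: "(\<Sum>i. ennreal (\<integral>z. norm (?g i z) \<partial>\<mu>)) < \<infinity>"
  proof -
   have "(\<Sum>i. ennreal (\<integral>z. norm (?g i z) \<partial>\<mu>)) = (\<Sum>i. \<integral>\<^sup>+z. ennreal (norm (?g i z)) \<partial>\<mu>)"
    using int by (intro suminf_cong nn_integral_eq_integral[symmetric]) auto
   also have "\<dots> <= (\<Sum>i. \<integral>\<^sup>+z. mass i (mag f) * mag \<phi> (- x i + z) * mag \<phi> (- z + y) \<partial>\<mu>)"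
    by (intro suminf_le nn_integral_mono) (auto simp: norm_mult ennreal_mult intro!: mult_right_mono atom_mag[OF f])
   also have "\<dots> = (\<integral>\<^sup>+z. (\<Sum>i. mass i (mag f) * mag \<phi> (- x i + z) * mag \<phi> (- z + y)) \<partial>\<mu>)"
    by (rule nn_integral_suminf[symmetric]) measurable
   also have "\<dots> = star (spread (mag f)) (mag \<phi>) y" unfolding star_def spread_def by simp
   also have "\<dots> < \<infinity>" by (rule star_spread_finite[OF f])
   finally show ?thesis .
  qed
  have sm: "summable (%i. \<integral>z. norm (?g i z) \<partial>\<mu>)"
   using sum by (intro summable_suminf_not_top) auto
  have "conv \<mu> (T f) \<phi> y = (\<integral>z. (\<Sum>i. ?g i z) \<partial>\<mu>)"
   unfolding conv_def T_eq[OF f]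
   by (intro Bochner_Integration.integral_cong refl suminf_mult2 summable_norm_cancel[OF summable_norm_atom[OF f]])
  also have "\<dots> = (\<Sum>i. \<integral>z. ?g i z \<partial>\<mu>)"
  proof (rule integral_suminf[OF int _ sm])
   show "AE z in \<mu>. summable (%i. norm (?g i z))"
    using summable_mult2[OF summable_norm_atom[OF f]] by (simp add: norm_mult)
  qed
  also have "\<dots> = (\<Sum>i. atom f i y)"
  proof (intro suminf_cong)
   fix i
   have "(\<integral>z. ?g i z \<partial>\<mu>) = coeff i f * conv \<mu> (ltrans (x i) \<phi>) \<phi> y"
    by (simp add: atom_def conv_def ltrans_def mult.assoc)
   thus "(\<integral>z. ?g i z \<partial>\<mu>) = atom f i y" unfolding conv_ltrans_phi by (simp add: atom_def ltrans_def)
  qed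
  finally show ?thesis using T_eq[OF f] by simp
 qed
 thus ?thesis using C[OF f] by (intro E_I) auto
qed

lemma T_linear:
 assumes "f \<in> B" "g \<in> B"
 shows "T (%y. a * f y + b * g y) = (%y. a * T f y + b * T g y)"
proof
 fix y
 note s = summable_norm_cancel[OF summable_norm_atom]
 have "T (%y. a * f y + b * g y) y = (\<Sum>i. a * atom f i y + b * atom g i y)"
  using T_eq[of "%y. a * f y + b * g y" y] add_mem[OF scale_mem[OF assms(1), of a] scale_mem[OF assms(2), of b]]
  by (simp add: atom_def coeff_linear[OF assms] algebra_simps)
 also have "\<dots> = a * T f y + b * T g y"
  unfolding T_eq[OF assms(1)] T_eq[OF assms(2)]
  using s[OF assms(1), of y] s[OF assms(2), of y]
  by (simp add: suminf_add[symmetric] suminf_mult summable_mult)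
 finally show "T (%y. a * f y + b * g y) y = a * T f y + b * T g y" .
qed

lemma T_operator: "bounded_operator_on E N T"
proof -
 obtain C where C: "\<And>f. f \<in> B ==> T f \<in> B \<and> N (T f) <= C * N f" using T_bounded by metis
 show ?thesis
  unfolding bounded_operator_on_def
  using T_E[OF E_mem] T_linear[OF E_mem E_mem] C[OF E_mem] by blast
qed

text \<open>Writing \<open>f y\<close> as \<open>\<integral>f z * \<phi> (- z + y)\<close> and inserting the partition of unity, the difference to \<open>T f y\<close> is
 \<open>\<Sum>i. \<integral>f z * p i z * (\<phi> (- z + y) - \<phi> (- x i + y))\<close>, where \<open>- x i + z\<close> lies in \<open>U\<close>.\<close>

lemma T_near_identity:
 assumes f: "f \<in> E"
 shows "mag (%z. f z - T f z) y <= star (mag f) K y"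
proof (cases "star (mag f) K y = \<infinity>")
 case False
 have fB: "f \<in> B" by (rule E_mem[OF f])
 note [measurable] = B_measurable[OF fB]
 let ?g = "%i z. f z * complex_of_real (p i z) * \<phi> (- z + y)"
 have intg: "integrable \<mu> (?g i)" for i
 proof (rule Bochner_Integration.integrable_bound[OF conv_integrable[OF fB, of y]])
  have "norm (f z * complex_of_real (p i z)) <= norm (f z)" for z
   using p_le_1[of i z] p_nonneg[of i z] by (simp add: norm_mult mult_left_le)
  thus "AE z in \<mu>. norm (?g i z) <= norm (f z * \<phi> (- z + y))"
   by (intro AE_I2) (simp only: norm_mult[of _ "\<phi> _"] mult_right_mono norm_ge_zero)
 qed simp
 have intf: "(\<integral>\<^sup>+z. mag f z * mag \<phi> (- z + y) \<partial>\<mu>) < \<infinity>"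
  using star_phi_finite[OF dominated_mag[OF fB], of y] by (simp add: star_def)
 have sumg: "(\<Sum>i. ennreal (\<integral>z. norm (?g i z) \<partial>\<mu>)) < \<infinity>"
 proof -
  have "(\<Sum>i. ennreal (\<integral>z. norm (?g i z) \<partial>\<mu>)) = (\<Sum>i. \<integral>\<^sup>+z. ennreal (norm (?g i z)) \<partial>\<mu>)"
   using intg by (intro suminf_cong nn_integral_eq_integral[symmetric]) auto
  also have "\<dots> = (\<Sum>i. \<integral>\<^sup>+z. mag f z * mag \<phi> (- z + y) * ennreal (p i z) \<partial>\<mu>)"
   by (intro suminf_cong nn_integral_cong) (simp add: norm_mult ennreal_mult p_nonneg mult_ac)
  also have "\<dots> = (\<integral>\<^sup>+z. (\<Sum>i. mag f z * mag \<phi> (- z + y) * ennreal (p i z)) \<partial>\<mu>)"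
   by (rule nn_integral_suminf[symmetric]) measurable
  also have "\<dots> < \<infinity>" using intf by (simp add: p_suminf)
  finally show ?thesis .
 qed
 have smg: "summable (%i. \<integral>z. norm (?g i z) \<partial>\<mu>)" using sumg by (intro summable_suminf_not_top) auto
 have pc: "(%i. complex_of_real (p i z)) sums 1" for z
  using sums_of_real[OF p_sums[of z]] by simp
 have "f y = (\<integral>z. f z * \<phi> (- z + y) \<partial>\<mu>)" using E_conv[OF f, of y] by (simp add: conv_def)
 also have "\<dots> = (\<integral>z. (\<Sum>i. ?g i z) \<partial>\<mu>)"
 proof (intro Bochner_Integration.integral_cong refl)
  fix z
  have "(%i. ?g i z) sums (f z * 1 * \<phi> (- z + y))"
   by (intro sums_mult2 sums_mult pc)
  thus "f z * \<phi> (- z + y) = (\<Sum>i. ?g i z)" by (simp add: sums_iff)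
 qed
 also have "\<dots> = (\<Sum>i. \<integral>z. ?g i z \<partial>\<mu>)"
 proof (rule integral_suminf[OF intg _ smg])
  have "summable (%i. norm (?g i z))" for z
  proof -
   have "(%i. norm (?g i z)) = (%i. cmod (f z) * p i z * cmod (\<phi> (- z + y)))"
    by (simp add: norm_mult p_nonneg)
   thus ?thesis using sums_summable[OF p_sums[of z]] by (simp add: summable_mult summable_mult2)
  qed
  thus "AE z in \<mu>. summable (%i. norm (?g i z))" by simp
 qed
 finally have fy: "f y = (\<Sum>i. \<integral>z. ?g i z \<partial>\<mu>)" .
 have sg: "summable (%i. \<integral>z. ?g i z \<partial>\<mu>)"
  by (rule summable_norm_cancel, rule summable_comparison_test'[OF smg, of 0]) (auto intro: integral_norm_bound)
 let ?d = "%i. (\<integral>z. ?g i z \<partial>\<mu>) - atom f i y"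
 have d: "?d i = (\<integral>z. f z * complex_of_real (p i z) * (\<phi> (- z + y) - \<phi> (- x i + y)) \<partial>\<mu>)" for i
 proof -
  have "atom f i y = (\<integral>z. f z * complex_of_real (p i z) * \<phi> (- x i + y) \<partial>\<mu>)"
   by (simp add: atom_def coeff_integral)
  thus ?thesis
   using Bochner_Integration.integral_diff[OF intg[of i] integrable_mult_left[OF coeff_integrable[OF fB, of i], of "\<phi> (- x i + y)"]]
   by (simp add: right_diff_distrib)
 qed
 have nd: "ennreal (norm (?d i)) <= (\<integral>\<^sup>+z. mag f z * K (- z + y) * ennreal (p i z) \<partial>\<mu>)" for i
 proof -
  have "integrable \<mu> (%z. f z * complex_of_real (p i z) * (\<phi> (- z + y) - \<phi> (- x i + y)))"
   using Bochner_Integration.integrable_diff[OF intg[of i] integrable_mult_left[OF coeff_integrable[OF fB, of i], of "\<phi> (- x i + y)"]]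
   by (simp add: right_diff_distrib)
  hence "ennreal (norm (?d i)) <= (\<integral>\<^sup>+z. ennreal (norm (f z * complex_of_real (p i z) * (\<phi> (- z + y) - \<phi> (- x i + y)))) \<partial>\<mu>)"
   unfolding d by (rule integral_norm_bound_ennreal)
  also have "\<dots> <= (\<integral>\<^sup>+z. mag f z * K (- z + y) * ennreal (p i z) \<partial>\<mu>)"
  proof (rule nn_integral_mono)
   fix z
   show "ennreal (norm (f z * complex_of_real (p i z) * (\<phi> (- z + y) - \<phi> (- x i + y)))) <= mag f z * K (- z + y) * ennreal (p i z)"
   proof (cases "p i z = 0")
    case False
    have "mag f z * ennreal (p i z) * ennreal (cmod (\<phi> (- z + y) - \<phi> (- x i + y))) <= mag f z * ennreal (p i z) * K (- z + y)"
     by (intro mult_left_mono osc_at False) simp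
    thus ?thesis by (simp add: norm_mult ennreal_mult p_nonneg mult_ac)
   qed simp
  qed
  finally show ?thesis .
 qed
 have tot: "(\<Sum>i. ennreal (norm (?d i))) <= star (mag f) K y"
 proof -
  have "(\<Sum>i. ennreal (norm (?d i))) <= (\<Sum>i. \<integral>\<^sup>+z. mag f z * K (- z + y) * ennreal (p i z) \<partial>\<mu>)"
   by (intro suminf_le nd) auto
  also have "\<dots> = (\<integral>\<^sup>+z. (\<Sum>i. mag f z * K (- z + y) * ennreal (p i z)) \<partial>\<mu>)"
   by (rule nn_integral_suminf[symmetric]) measurable
  also have "\<dots> = star (mag f) K y" unfolding star_def by (simp add: p_suminf)
  finally show ?thesis .
 qed
 have smd: "summable (%i. norm (?d i))"
  using tot False by (intro summable_suminf_not_top) (auto simp: top_unique)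
 have "f y - T f y = (\<Sum>i. ?d i)"
  unfolding fy T_eq[OF fB] by (rule suminf_diff[OF sg summable_norm_cancel[OF summable_norm_atom[OF fB]]])
 hence "mag (%z. f z - T f z) y <= ennreal (\<Sum>i. norm (?d i))"
  using summable_norm[OF smd] by (simp add: ennreal_leI)
 also have "\<dots> = (\<Sum>i. ennreal (norm (?d i)))" by (rule suminf_ennreal2[symmetric]) (auto intro: smd)
 also have "\<dots> <= star (mag f) K y" by (rule tot)
 finally show ?thesis .
qed simp

lemma T_invertible: "invertible_on E N T" "\<exists>C>0. \<forall>f\<in>E. N f <= C * N (T f)"
proof -
 have sm: "N (%y. (f y - T f y) - T (%z. f z - T f z) y) <= N f / 2" if f: "f \<in> E" for f
 proof -
  define g where "g = (%z. f z - T f z)"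
  have g: "g \<in> E" unfolding g_def by (intro E_diff f T_E E_mem)
  note [measurable] = B_measurable[OF E_mem[OF f]] B_measurable[OF E_mem[OF g]] T_measurable[OF E_mem[OF g]]
  have "mag (%y. g y - T g y) y <= star (star (mag f) K) K y" for y
  proof -
   have "mag (%y. g y - T g y) y <= star (mag g) K y" by (rule T_near_identity[OF g])
   also have "\<dots> <= star (star (mag f) K) K y"
    using T_near_identity[OF f] by (intro star_mono) (auto simp: g_def)
   finally show ?thesis .
  qed
  hence "dominated (mag (%y. g y - T g y)) (N f / (2 * solid_const))"
   by (intro dominated_mono[OF small[OF _ dominated_mag[OF E_mem[OF f]]]]) auto
  hence "N (%y. g y - T g y) <= solid_const * (N f / (2 * solid_const))"
   by (intro dominated_mem) measurable
  thus ?thesis using solid_const(1) by (simp add: g_def)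
 qed
 show "invertible_on E N T" "\<exists>C>0. \<forall>f\<in>E. N f <= C * N (T f)"
  using invertible_of_square_contraction[OF T_operator] sm by blast+
qed

end

context sampling
begin

abbreviation "cell i \<equiv> (%u. x i + u) ` U"

lemma cell_iff: "z \<in> cell i \<longleftrightarrow> - x i + z \<in> U"
proof
 assume "- x i + z \<in> U"
 thus "z \<in> cell i" by (rule image_eqI[rotated]) (simp add: add.assoc[symmetric])
qed (auto simp: add.assoc[symmetric])

lemma cell_borel: "cell i \<in> sets borel"
 by (rule compact_borel[OF compact_cell])

lemma finite_containing: "finite {i \<in> I. z \<in> cell i}"
proof -
 have "(\<Union>i\<in>I. cell i) = UNIV" using sep unfolding relatively_separated_def by (elim conjE)
 hence "z \<in> (\<Union>i\<in>I. cell i)" by (simp only: UNIV_I)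
 then obtain k where k: "k \<in> I" "z \<in> cell k" by (rule UN_E)
 have "finite {j \<in> I. cell k \<inter> cell j \<noteq> {}}" using sep unfolding relatively_separated_def
  by (elim conjE exE) (drule bspec[OF _ k(1)], erule conjunct1)
 thus ?thesis by (rule finite_subset[rotated]) (use k(2) in blast)
qed

lemma finite_meeting:
 assumes Q: "compact Q" shows "finite {i \<in> I. cell i \<inter> Q \<noteq> {}}"
proof -
 define D where "D = {a + b | a b. a \<in> Q \<and> b \<in> uminus ` U}"
 have D: "compact D" unfolding D_def by (intro compact_sum compact_uminus U Q)
 define W where "W b = {z. - z + b \<in> interior U}" for b :: 'g
 have opW: "open (W b)" for b
 proof -
  have "W b = (%z. - z + b) -` interior U" by (auto simp: W_def)
  thus ?thesis by (auto intro!: open_vimage continuous_intros)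
 qed
 obtain A where A: "finite A" "D \<subseteq> (\<Union>b\<in>A. W b)"
 proof (rule compactE_image[OF D, of D W])
  show "D \<subseteq> (\<Union>b\<in>D. W b)" using U(2) by (auto simp: W_def)
 qed (use opW in auto)
 have "{i \<in> I. cell i \<inter> Q \<noteq> {}} \<subseteq> (\<Union>b\<in>A. {i \<in> I. b \<in> cell i})"
 proof
  fix i assume "i \<in> {i \<in> I. cell i \<inter> Q \<noteq> {}}"
  then obtain u where u: "i \<in> I" "u \<in> U" "x i + u \<in> Q" by auto
  have "x i = (x i + u) + - u" by (simp add: add.assoc del: add_uminus_conv_diff)
  hence "x i \<in> D" unfolding D_def using u by blast
  then obtain b where b: "b \<in> A" "x i \<in> W b" using A(2) by (auto dest: subsetD)
  hence "b \<in> cell i" unfolding cell_iff using interior_subset[of U] by (auto simp: W_def)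
  thus "i \<in> (\<Union>b\<in>A. {i \<in> I. b \<in> cell i})" using b(1) u(1) by (intro UN_I) auto
 qed
 thus ?thesis by (rule finite_subset) (intro finite_UN_I A finite_containing)
qed

lemma coeff_eq: "i \<in> I ==> psi_coeff \<mu> \<psi> i f = coeff i f"
 by (simp add: coeff_def)

text \<open>For a continuous function with compact support only finitely many coefficients are nonzero; the
 partial sums are bounded uniformly by the majorant \<open>spread\<close>, so density suffices.\<close>

lemma norm_convergence:
 assumes dense: "C_c_dense B N" and f: "f \<in> E"
 shows "((%F. N (%y. T f y - (\<Sum>i\<in>F. psi_coeff \<mu> \<psi> i f * ltrans (x i) \<phi> y))) \<longlongrightarrow> 0) (finite_subsets_at_top I)"
proof (rule tendstoI)
 fix e :: real assume e: "e > 0"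
 have fB: "f \<in> B" by (rule E_mem[OF f])
 obtain C where C: "C \<ge> 0" "\<And>F c. F \<in> borel_measurable borel ==> dominated F c ==> dominated (spread F) (C * c)"
  using dominated_spread by metis
 define D where "D = solid_const * C"
 have D: "D \<ge> 0" using C solid_const by (simp add: D_def)
 obtain g where g: "g \<in> C_c" "N (%x. f x - g x) < e / (D + 1)"
  using dense e D unfolding C_c_dense_def by (meson add_nonneg_pos divide_pos_pos fB zero_less_one)
 have gB: "g \<in> B" using g dense by (auto simp: C_c_dense_def)
 define h where "h = (%x. f x - g x)"
 have hB: "h \<in> B" unfolding h_def by (rule diff_mem[OF fB gB])
 note [measurable] = B_measurable[OF fB] B_measurable[OF gB] B_measurable[OF hB]
 define S where "S = closure {y. g y \<noteq> 0}"
 have S: "compact S" using g(1) by (simp add: C_c_def S_def)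
 define J where "J = {i \<in> I. cell i \<inter> S \<noteq> {}}"
 have J: "finite J" "J \<subseteq> I" unfolding J_def using finite_meeting[OF S] by auto
 have mass_g: "mass i (mag g) = 0" if "i \<notin> J" for i
 proof -
  have "mag g z * ennreal (p i z) = 0" for z
  proof (cases "p i z = 0")
   case False
   hence "z \<in> cell i" "i \<in> I" using p_support[of i z] by (auto simp: cell_iff simp del: image_iff)
   hence "z \<notin> S" using that by (auto simp: J_def)
   hence "g z = 0" using closure_subset[of "{y. g y \<noteq> 0}"] by (auto simp: S_def)
   thus ?thesis by simp
  qed simp
  hence "(%z. mag g z * ennreal (p i z)) = (%_. 0)" by (rule ext)
  thus ?thesis by (simp only: mass_def nn_integral_const mult_zero_left)
 qed
 have mass_f: "mass i (mag f) <= mass i (mag h)" if "i \<notin> J" for i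
 proof -
  have "mass i (mag f) <= (\<integral>\<^sup>+y. mag h y * ennreal (p i y) + mag g y * ennreal (p i y) \<partial>\<mu>)"
   unfolding mass_def
  proof (rule nn_integral_mono)
   fix y
   have "mag f y <= mag h y + mag g y"
    using norm_triangle_ineq[of "h y" "g y"] by (simp add: h_def ennreal_plus[symmetric] del: ennreal_plus)
   thus "mag f y * ennreal (p i y) <= mag h y * ennreal (p i y) + mag g y * ennreal (p i y)"
    unfolding distrib_right[symmetric] by (rule mult_right_mono) simp
  qed
  also have "\<dots> = mass i (mag h) + mass i (mag g)" unfolding mass_def by (rule nn_integral_add) measurable
  finally show ?thesis using mass_g[OF that] by simp
 qed
 have main: "N (%y. T f y - (\<Sum>i\<in>F. psi_coeff \<mu> \<psi> i f * ltrans (x i) \<phi> y)) < e"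
  if F: "finite F" "J \<subseteq> F" "F \<subseteq> I" for F
 proof -
  have eq: "(\<Sum>i\<in>F. psi_coeff \<mu> \<psi> i f * ltrans (x i) \<phi> y) = (\<Sum>i\<in>F. atom f i y)" for y
   using F(3) by (intro sum.cong) (auto simp: atom_def ltrans_def coeff_eq)
  define t where "t y i = (if i \<in> F then 0 else atom f i y)" for y i
  have at: "mag (%y. T f y - (\<Sum>i\<in>F. atom f i y)) y <= spread (mag h) y" for y
  proof -
   have s: "summable (%i. atom f i y)" by (rule summable_norm_cancel[OF summable_norm_atom[OF fB]])
   have tn: "summable (%i. cmod (t y i))"
    by (rule summable_comparison_test'[OF summable_norm_atom[OF fB, of y], of 0]) (auto simp: t_def)
   have "(%i. atom f i y - (if i \<in> F then atom f i y else 0)) sums (T f y - (\<Sum>i\<in>F. atom f i y))"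
    unfolding T_eq[OF fB] by (intro sums_diff summable_sums s sums_If_finite_set F)
   also have "(%i. atom f i y - (if i \<in> F then atom f i y else 0)) = t y" by (auto simp: t_def)
   finally have "T f y - (\<Sum>i\<in>F. atom f i y) = (\<Sum>i. t y i)" by (rule sums_unique)
   hence "mag (%y. T f y - (\<Sum>i\<in>F. atom f i y)) y <= ennreal (\<Sum>i. cmod (t y i))"
    using summable_norm[OF tn] by (simp add: ennreal_leI)
   also have "\<dots> = (\<Sum>i. ennreal (cmod (t y i)))" by (rule suminf_ennreal2[symmetric]) (auto intro: tn)
   also have "\<dots> <= spread (mag h) y" unfolding spread_def
   proof (intro suminf_le)
    fix i
    show "ennreal (cmod (t y i)) <= mass i (mag h) * mag \<phi> (- x i + y)"
    proof (cases "i \<in> F")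
     case False
     hence "i \<notin> J" using F by blast
     have "ennreal (cmod (t y i)) <= mass i (mag f) * mag \<phi> (- x i + y)"
      using atom_mag[OF fB, of i y] False by (simp add: t_def)
     also have "\<dots> <= mass i (mag h) * mag \<phi> (- x i + y)" by (intro mult_right_mono mass_f \<open>i \<notin> J\<close>) simp
     finally show ?thesis .
    qed (simp add: t_def)
   qed auto
   finally show ?thesis .
  qed
  have am: "atom f i \<in> borel_measurable borel" for i
   unfolding atom_def by measurable
  have m: "(%y. T f y - (\<Sum>i\<in>F. atom f i y)) \<in> borel_measurable borel"
   using T_measurable[OF fB] am by (intro borel_measurable_diff borel_measurable_sum) auto
  have "dominated (mag (%y. T f y - (\<Sum>i\<in>F. atom f i y))) (C * N h)"
   by (rule dominated_mono[OF C(2)[OF _ dominated_mag[OF hB]]]) (auto intro: at)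
  from dominated_mem(2)[OF m this]
  have "N (%y. T f y - (\<Sum>i\<in>F. atom f i y)) <= D * N h" by (simp add: D_def mult.assoc)
  also have "\<dots> <= (D + 1) * N h" using norm_nonneg[OF hB] by (simp add: distrib_right)
  also have "\<dots> < e" using g(2) D by (simp add: h_def field_simps)
  finally show ?thesis by (simp add: eq)
 qed
 show "\<forall>\<^sub>F F in finite_subsets_at_top I. dist (N (%y. T f y - (\<Sum>i\<in>F. psi_coeff \<mu> \<psi> i f * ltrans (x i) \<phi> y))) 0 < e"
  unfolding eventually_finite_subsets_at_top
 proof (intro exI[of _ J] conjI allI impI)
  fix F assume F: "finite F \<and> J \<subseteq> F \<and> F \<subseteq> I"
  have "(%y. T f y - (\<Sum>i\<in>F. psi_coeff \<mu> \<psi> i f * ltrans (x i) \<phi> y)) \<in> B"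
   using F by (intro diff_mem sum_mem E_mem[OF T_E[OF fB]] scale_mem ltrans_mem phi_mem) auto
  from norm_nonneg[OF this] main[of F] F
  show "dist (N (%y. T f y - (\<Sum>i\<in>F. psi_coeff \<mu> \<psi> i f * ltrans (x i) \<phi> y))) 0 < e" by simp
 qed (use J in auto)
qed

text \<open>The nonnegative function whose norm is the norm of the sequence \<open>s\<close>.\<close>

definition gauge :: "(nat => complex) => 'g => ennreal" where
 "gauge s y = (\<Sum>i. (if i \<in> I then ennreal (cmod (s i)) else 0) * indicator (cell i) y)"

lemma gauge_measurable [measurable]: "gauge s \<in> borel_measurable borel"
proof -
 note [measurable] = cell_borel
 show ?thesis unfolding gauge_def by measurable
qed

lemma sharp_fun_sum: "sharp_fun U I x s y = complex_of_real (\<Sum>i\<in>{i \<in> I. y \<in> cell i}. cmod (s i))"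
proof -
 have "sharp_fun U I x s y = (\<Sum>\<^sub>\<infinity>i\<in>{i \<in> I. y \<in> cell i}. complex_of_real (cmod (s i)))"
  unfolding sharp_fun_def by (rule infsum_cong_neutral) (auto simp: indicator_def)
 thus ?thesis using finite_containing[of y] by simp
qed

lemma mag_sharp_fun: "mag (sharp_fun U I x s) y = gauge s y"
proof -
 have "gauge s y = (\<Sum>i\<in>{i \<in> I. y \<in> cell i}. (if i \<in> I then ennreal (cmod (s i)) else 0) * indicator (cell i) y)"
  unfolding gauge_def by (rule suminf_finite[OF finite_containing]) (auto simp: indicator_def)
 also have "\<dots> = (\<Sum>i\<in>{i \<in> I. y \<in> cell i}. ennreal (cmod (s i)))" by (rule sum.cong) auto
 also have "\<dots> = ennreal (\<Sum>i\<in>{i \<in> I. y \<in> cell i}. cmod (s i))" by (rule sum_ennreal) simp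
 also have "\<dots> = mag (sharp_fun U I x s) y" unfolding sharp_fun_sum norm_of_real
  by (simp add: sum_nonneg)
 finally show ?thesis by simp
qed

lemma sharp_fun_measurable: "sharp_fun U I x s \<in> borel_measurable borel"
proof -
 have "sharp_fun U I x s = (%y. complex_of_real (enn2real (gauge s y)))"
 proof
  fix y
  have "enn2real (gauge s y) = cmod (sharp_fun U I x s y)" by (simp add: mag_sharp_fun[symmetric])
  also have "\<dots> = (\<Sum>i\<in>{i \<in> I. y \<in> cell i}. cmod (s i))" unfolding sharp_fun_sum norm_of_real by (simp add: sum_nonneg)
  finally show "sharp_fun U I x s y = complex_of_real (enn2real (gauge s y))" by (simp add: sharp_fun_sum)
 qed
 also have "\<dots> \<in> borel_measurable borel" by measurable
 finally show ?thesis .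
qed

lemma gauge_coeff_le:
 assumes g: "g \<in> B"
 defines "D \<equiv> {a + b | a b. a \<in> uminus ` U \<and> b \<in> U}"
 shows "gauge (%i. psi_coeff \<mu> \<psi> i g) y <= star (mag g) (indicator D) y"
proof -
 note [measurable] = B_measurable[OF g]
 have [measurable]: "D \<in> sets borel" unfolding D_def by (intro compact_borel compact_sum compact_uminus U)
 have "gauge (%i. psi_coeff \<mu> \<psi> i g) y <= (\<Sum>i. \<integral>\<^sup>+z. mag g z * indicator D (- z + y) * ennreal (p i z) \<partial>\<mu>)"
  unfolding gauge_def
 proof (intro suminf_le)
  fix i
  show "(if i \<in> I then ennreal (cmod (psi_coeff \<mu> \<psi> i g)) else 0) * indicator (cell i) y
    <= (\<integral>\<^sup>+z. mag g z * indicator D (- z + y) * ennreal (p i z) \<partial>\<mu>)"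
  proof (cases "i \<in> I \<and> y \<in> cell i")
   case True
   hence "(if i \<in> I then ennreal (cmod (psi_coeff \<mu> \<psi> i g)) else 0) * indicator (cell i) y <= mass i (mag g)"
    using coeff_le_mass[OF g, of i] by (simp add: coeff_eq)
   also have "\<dots> <= (\<integral>\<^sup>+z. mag g z * indicator D (- z + y) * ennreal (p i z) \<partial>\<mu>)"
    unfolding mass_def
   proof (rule nn_integral_mono)
    fix z
    show "mag g z * ennreal (p i z) <= mag g z * indicator D (- z + y) * ennreal (p i z)"
    proof (cases "p i z = 0")
     case False
     have "- z + y = - (- x i + z) + (- x i + y)" by (simp add: minus_add add.assoc)
     moreover have "- x i + z \<in> U" by (rule p_support(2)[OF False])
     moreover have "- x i + y \<in> U" using True cell_iff by blast
     ultimately have "- z + y \<in> D" unfolding D_def by blast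
     thus ?thesis by simp
    qed simp
   qed
   finally show ?thesis .
  qed (auto simp: indicator_def)
 qed auto
 also have "\<dots> = (\<integral>\<^sup>+z. (\<Sum>i. mag g z * indicator D (- z + y) * ennreal (p i z)) \<partial>\<mu>)"
  by (rule nn_integral_suminf[symmetric]) measurable
 also have "\<dots> = star (mag g) (indicator D) y" unfolding star_def by (simp add: p_suminf)
 finally show ?thesis .
qed

text \<open>The \<open>i\<close>-th coefficient is at most the integral of \<open>\<bar>f\<bar>\<close> over the \<open>i\<close>-th cell, which is an average of \<open>\<bar>f\<bar>\<close>
 around any point of that cell.\<close>

lemma sharp_upper:
 obtains C where "C \<ge> 0" "\<And>g. g \<in> B ==> sharp_fun U I x (%i. psi_coeff \<mu> \<psi> i g) \<in> B \<and>
   N (sharp_fun U I x (%i. psi_coeff \<mu> \<psi> i g)) <= C * N g"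
proof -
 define D where "D = {a + b | a b. a \<in> uminus ` U \<and> b \<in> U}"
 have "compact D" unfolding D_def by (intro compact_sum compact_uminus U)
 then obtain C where C: "C \<ge> 0" "\<And>F c. F \<in> borel_measurable borel ==> dominated F c ==> dominated (star F (indicator D)) (C * c)"
  using kernel_indicator kernel_boundedE by metis
 show ?thesis
 proof (rule that[of "solid_const * C"])
  fix g assume g: "g \<in> B"
  note [measurable] = B_measurable[OF g]
  have "dominated (star (mag g) (indicator D)) (C * N g)" by (intro C dominated_mag g) measurable
  hence "dominated (mag (sharp_fun U I x (%i. psi_coeff \<mu> \<psi> i g))) (C * N g)"
   by (rule dominated_mono) (auto simp: mag_sharp_fun D_def intro: gauge_coeff_le[OF g])
  from dominated_mem[OF sharp_fun_measurable this]
  show "sharp_fun U I x (%i. psi_coeff \<mu> \<psi> i g) \<in> B \<and>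
   N (sharp_fun U I x (%i. psi_coeff \<mu> \<psi> i g)) <= solid_const * C * N g" by (simp add: mult.assoc)
 qed (use C solid_const in auto)
qed

lemma mag_cell_average: "i \<in> I ==> emeasure \<mu> U * mag \<phi> (- x i + y) <= (\<integral>\<^sup>+z. indicator (cell i) z * k1 (- z + y) \<partial>\<mu>)"
proof -
 note [measurable] = cell_borel
 have "emeasure \<mu> U = emeasure \<mu> (cell i)"
  by (rule left_invariant[symmetric]) (rule compact_borel[OF U(1)])
 hence "emeasure \<mu> U * mag \<phi> (- x i + y) = (\<integral>\<^sup>+z. indicator (cell i) z * mag \<phi> (- x i + y) \<partial>\<mu>)"
  by (subst nn_integral_multc) auto
 also have "\<dots> <= (\<integral>\<^sup>+z. indicator (cell i) z * k1 (- z + y) \<partial>\<mu>)"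
 proof (rule nn_integral_mono)
  fix z
  show "indicator (cell i) z * mag \<phi> (- x i + y) <= indicator (cell i) z * k1 (- z + y)"
  proof (cases "z \<in> cell i")
   case True
   hence u: "- x i + z \<in> U" using cell_iff by blast
   show ?thesis using mag_cell[OF u] by (intro mult_left_mono) auto
  qed simp
 qed
 finally show ?thesis .
qed

text \<open>Every atom is bounded by an average of \<open>\<bar>\<phi>\<bar> + K\<close> over its cell, so the sum of the series is bounded by the
 convolution of the sequence, viewed as a function, with this kernel.\<close>

lemma sharp_lower:
 obtains C where "C > 0" "\<And>g. g \<in> E ==> N (T g) <= C * N (sharp_fun U I x (%i. psi_coeff \<mu> \<psi> i g))"
proof -
 obtain C where C: "C \<ge> 0" "\<And>F c. F \<in> borel_measurable borel ==> dominated F c ==> dominated (star F k1) (C * c)"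
  using kernel_k1 by (rule kernel_boundedE) blast
 have "emeasure \<mu> (interior U) > 0" using U(2) by (intro emeasure_open_pos) auto
 hence "emeasure \<mu> U > 0"
  using emeasure_mono[OF interior_subset[of U], of \<mu>] compact_borel[OF U(1)] by (auto intro: less_le_trans)
 moreover have "emeasure \<mu> U < \<infinity>" by (rule finite_on_compact[OF U(1)])
 ultimately obtain m where m: "emeasure \<mu> U = ennreal m" "m > 0" by (cases "emeasure \<mu> U") auto
 obtain C' where C': "\<And>g. g \<in> B ==> sharp_fun U I x (%i. psi_coeff \<mu> \<psi> i g) \<in> B"
  using sharp_upper by metis
 show ?thesis
 proof (rule that[of "solid_const * (1 / m * C) + 1"])
  fix g assume g: "g \<in> E"
  have gB: "g \<in> B" by (rule E_mem[OF g])
  define s where "s = (%i. psi_coeff \<mu> \<psi> i g)"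
  note [measurable] = cell_borel
  have "mag (T g) y <= ennreal (1 / m) * star (gauge s) k1 y" for y
  proof -
   have "ennreal m * mag (T g) y <= ennreal m * (\<Sum>i. ennreal (cmod (atom g i y)))"
   proof (rule mult_left_mono)
    have "mag (T g) y <= ennreal (\<Sum>i. cmod (atom g i y))"
     unfolding T_eq[OF gB] by (intro ennreal_leI summable_norm summable_norm_atom gB)
    also have "\<dots> = (\<Sum>i. ennreal (cmod (atom g i y)))"
     by (rule suminf_ennreal2[symmetric]) (auto intro: summable_norm_atom gB)
    finally show "mag (T g) y <= (\<Sum>i. ennreal (cmod (atom g i y)))" .
   qed simp
   also have "\<dots> = (\<Sum>i. ennreal m * ennreal (cmod (atom g i y)))" by simp
   also have "\<dots> <= (\<Sum>i. \<integral>\<^sup>+z. (if i \<in> I then ennreal (cmod (s i)) else 0) * indicator (cell i) z * k1 (- z + y) \<partial>\<mu>)"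
   proof (intro suminf_le)
    fix i
    show "ennreal m * ennreal (cmod (atom g i y))
      <= (\<integral>\<^sup>+z. (if i \<in> I then ennreal (cmod (s i)) else 0) * indicator (cell i) z * k1 (- z + y) \<partial>\<mu>)"
    proof (cases "i \<in> I")
     case True
     have "ennreal m * ennreal (cmod (atom g i y)) = ennreal (cmod (s i)) * (emeasure \<mu> U * mag \<phi> (- x i + y))"
      using True m(2) by (simp add: m(1) atom_def norm_mult ennreal_mult s_def coeff_eq mult_ac)
     also have "\<dots> <= ennreal (cmod (s i)) * (\<integral>\<^sup>+z. indicator (cell i) z * k1 (- z + y) \<partial>\<mu>)"
      by (intro mult_left_mono mag_cell_average True) simp
     also have "\<dots> = (\<integral>\<^sup>+z. (if i \<in> I then ennreal (cmod (s i)) else 0) * indicator (cell i) z * k1 (- z + y) \<partial>\<mu>)"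
      using True by (simp add: nn_integral_cmult[symmetric] mult.assoc)
     finally show ?thesis .
    qed (simp add: atom_def coeff_def)
   qed auto
   also have "\<dots> = (\<integral>\<^sup>+z. (\<Sum>i. (if i \<in> I then ennreal (cmod (s i)) else 0) * indicator (cell i) z * k1 (- z + y)) \<partial>\<mu>)"
    by (rule nn_integral_suminf[symmetric]) measurable
   also have "\<dots> = star (gauge s) k1 y" unfolding star_def gauge_def by simp
   finally have "ennreal (1 / m) * (ennreal m * mag (T g) y) <= ennreal (1 / m) * star (gauge s) k1 y"
    by (rule mult_left_mono) simp
   thus ?thesis using m(2) by (simp add: mult.assoc[symmetric] ennreal_mult[symmetric])
  qed
  moreover have "dominated (%y. ennreal (1 / m) * star (gauge s) k1 y) (1 / m * (C * N (sharp_fun U I x s)))"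
  proof (intro dominated_cmult C(2))
   show "dominated (gauge s) (N (sharp_fun U I x s))"
    using dominated_mag[OF C'[OF gB]] by (simp add: mag_sharp_fun s_def)
  qed (use m in auto)
  ultimately have "dominated (mag (T g)) (1 / m * (C * N (sharp_fun U I x s)))"
   by (elim dominated_mono[rotated 2, OF order_refl]) (auto)
  from dominated_mem(2)[OF T_measurable[OF gB] this]
  show "N (T g) <= (solid_const * (1 / m * C) + 1) * N (sharp_fun U I x (%i. psi_coeff \<mu> \<psi> i g))"
   using norm_nonneg[OF C'[OF gB]] by (simp add: s_def algebra_simps)
 next
  have "0 <= solid_const * (1 / m * C)" using C(1) m(2) solid_const(1) by simp
  thus "0 < solid_const * (1 / m * C) + 1" by linarith
 qed
qed

lemma decomposition:
 "atomic_decomposition E N (B_sharp B U I x) (norm_sharp N U I x) I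
  (%i f. psi_coeff \<mu> \<psi> i (inv_into E T f)) (%i. ltrans (x i) \<phi>)"
proof -
 define S where "S = inv_into E T"
 have bij: "bij_betw T E E" and opS: "bounded_operator_on E N S"
  using T_invertible(1) by (auto simp: invertible_on_def S_def)
 have S: "S f \<in> E" "T (S f) = f" if "f \<in> E" for f
  using bij that unfolding S_def by (auto simp: bij_betw_def inv_into_into f_inv_into_f)
 obtain C where C: "\<And>f. f \<in> E ==> N (S f) <= C * N f" using opS unfolding bounded_operator_on_def by metis
 have Slin: "S (%x. a * f x + b * g x) = (%x. a * S f x + b * S g x)" if "f \<in> E" "g \<in> E" for f g a b
  using opS that unfolding bounded_operator_on_def by metis
 obtain C1 where C1: "C1 \<ge> 0" "\<And>g. g \<in> B ==> sharp_fun U I x (%i. psi_coeff \<mu> \<psi> i g) \<in> B \<and>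
   N (sharp_fun U I x (%i. psi_coeff \<mu> \<psi> i g)) <= C1 * N g" using sharp_upper by metis
 obtain C2 where C2: "C2 > 0" "\<And>g. g \<in> E ==> N (T g) <= C2 * N (sharp_fun U I x (%i. psi_coeff \<mu> \<psi> i g))"
  using sharp_lower by metis
 have SN: "N (S f) <= max C 0 * N f" if "f \<in> E" for f
  using C[OF that] norm_nonneg[OF E_mem[OF that]] by (meson max.cobounded1 mult_right_mono order_trans)
 have "bounded_functional_on E N (%f. psi_coeff \<mu> \<psi> i (S f))" if i: "i \<in> I" for i
 proof -
  obtain D where D: "\<And>f. f \<in> B ==> cmod (coeff i f) <= D * N f" using coeff_bound by metis
  have "cmod (coeff i (S f)) <= max D 0 * max C 0 * N f" if f: "f \<in> E" for f
  proof -
   have "cmod (coeff i (S f)) <= max D 0 * N (S f)"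
    using D[OF E_mem[OF S(1)[OF f]]] norm_nonneg[OF E_mem[OF S(1)[OF f]]]
    by (meson max.cobounded1 mult_right_mono order_trans)
   also have "\<dots> <= max D 0 * (max C 0 * N f)" by (intro mult_left_mono SN f) simp
   finally show ?thesis by (simp add: mult.assoc)
  qed
  thus ?thesis
   unfolding bounded_functional_on_def coeff_eq[OF i]
   using coeff_linear[OF E_mem[OF S(1)] E_mem[OF S(1)]] Slin by (auto intro!: exI[of _ "max D 0 * max C 0"])
 qed
 moreover have "(%i. psi_coeff \<mu> \<psi> i (S f)) \<in> B_sharp B U I x" if "f \<in> E" for f
  using C1(2)[OF E_mem[OF S(1)[OF that]]] by (simp add: B_sharp_def)
 moreover have "\<exists>a>0. \<exists>b>0. \<forall>f\<in>E. a * N f <= norm_sharp N U I x (%i. psi_coeff \<mu> \<psi> i (S f)) \<and>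
   norm_sharp N U I x (%i. psi_coeff \<mu> \<psi> i (S f)) <= b * N f"
 proof (rule exI[of _ "1 / C2"], rule conjI, goal_cases)
  case 2
  show ?case
 proof (rule exI[of _ "C1 * max C 0 + 1"], intro conjI ballI)
  fix f assume f: "f \<in> E"
  show "1 / C2 * N f <= norm_sharp N U I x (%i. psi_coeff \<mu> \<psi> i (S f))"
   using C2(2)[OF S(1)[OF f]] C2(1) S(2)[OF f] by (simp add: norm_sharp_def field_simps)
  have "norm_sharp N U I x (%i. psi_coeff \<mu> \<psi> i (S f)) <= C1 * N (S f)"
   using C1(2)[OF E_mem[OF S(1)[OF f]]] by (simp add: norm_sharp_def)
  also have "\<dots> <= C1 * (max C 0 * N f)" by (intro mult_left_mono SN f C1)
  also have "\<dots> <= (C1 * max C 0 + 1) * N f" using norm_nonneg[OF E_mem[OF f]] by (simp add: algebra_simps)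
  finally show "norm_sharp N U I x (%i. psi_coeff \<mu> \<psi> i (S f)) <= (C1 * max C 0 + 1) * N f" .
 next
  have "0 <= C1 * max C 0" using C1(1) by simp
  thus "0 < C1 * max C 0 + 1" by linarith
 qed
 qed (use C2 in simp)
 moreover have "((%i. psi_coeff \<mu> \<psi> i (S f) * ltrans (x i) \<phi> y) has_sum f y) I" if "f \<in> E" for f y
  using atom_has_sum[OF E_mem[OF S(1)[OF that]], of y] T_eq[OF E_mem[OF S(1)[OF that]], of y] S(2)[OF that] by simp
 ultimately show ?thesis
  unfolding atomic_decomposition_def S_def[symmetric] using ltrans_phi_E by blast
qed

lemma psi_integrable: "f \<in> B ==> i \<in> I ==> integrable \<mu> (%y. f y * complex_of_real (\<psi> i y))"
 using coeff_integrable[of f i] by (simp add: p_def)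

lemma atoms_summable: "f \<in> B ==> (%i. psi_coeff \<mu> \<psi> i f * ltrans (x i) \<phi> y) summable_on I"
 using atom_has_sum[of f y] by (auto simp: summable_on_def)

end

section \<open>Coordinates in a finite-dimensional normed space\<close>

text \<open>The coordinate functionals are bounded because a continuous function without zeros on the
 compact boundary of a cube has a positive minimum there.\<close>

lemma basis_lower_bound:
 fixes X :: "nat => 'e::real_normed_vector"
 assumes inj: "inj_on X {..<n}" and ind: "independent (X ` {..<n})"
 obtains a where "a > 0" "\<And>t k. k < n ==> a * \<bar>t k\<bar> <= norm (\<Sum>j<n. t j *\<^sub>R X j)"
proof -
 define F where "F t = (\<Sum>j<n. t j *\<^sub>R X j)" for t :: "nat => real"
 have F0: "t k = 0" if "F t = 0" "k < n" for t k
 proof -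
  define u where "u v = t (the_inv_into {..<n} X v)" for v
  have "(\<Sum>v\<in>X ` {..<n}. u v *\<^sub>R v) = F t"
   unfolding F_def by (subst sum.reindex[OF inj]) (simp add: u_def the_inv_into_f_f[OF inj])
  hence "u (X k) = 0" using independentD[OF ind, of "X ` {..<n}" u "X k"] that by auto
  thus ?thesis using that by (simp add: u_def the_inv_into_f_f[OF inj])
 qed
 have cont: "continuous_on UNIV F" unfolding F_def by (intro continuous_intros continuous_on_product_coordinates)
 have "\<exists>a>0. \<forall>t. t i = 1 --> (\<forall>k<n. \<bar>t k\<bar> <= 1) --> a <= norm (F t)" if i: "i < n" for i
 proof -
  define B where "B = (\<Pi>\<^sub>E k\<in>UNIV. (if k = i then {1::real} else if k < n then {-1..1} else {0}))"
  have "compactin (product_topology (%_. euclidean) UNIV) B"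
   unfolding B_def compactin_PiE by auto
  hence B: "compact B" unfolding euclidean_product_topology by simp
  have mem: "t \<in> B \<longleftrightarrow> (\<forall>k. t k \<in> (if k = i then {1::real} else if k < n then {-1..1} else {0}))" for t
   unfolding B_def PiE_UNIV_domain Pi_iff by simp
  have "(%k. if k = i then 1 else 0) \<in> B" unfolding mem by auto
  hence "B \<noteq> {}" by blast
  then obtain s where s: "s \<in> B" "\<And>t. t \<in> B ==> norm (F s) <= norm (F t)"
   using continuous_attains_inf[OF B, of "%t. norm (F t)"] continuous_on_subset[OF cont] 
   by (metis continuous_on_norm subset_UNIV)
  have "s i = 1" using s(1)[unfolded mem, rule_format, of i] by simp
  hence "F s \<noteq> 0" using F0[OF _ i] by force
  show ?thesis
  proof (intro exI[of _ "norm (F s)"] conjI allI impI)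
   show "0 < norm (F s)" using \<open>F s \<noteq> 0\<close> by simp
   fix t :: "nat => real" assume t: "t i = 1" "\<forall>k<n. \<bar>t k\<bar> <= 1"
   define t' where "t' k = (if k < n then t k else 0)" for k
   have "t' \<in> B" unfolding mem t'_def using t i by (auto simp: abs_le_iff)
   moreover have "F t' = F t" by (simp add: F_def t'_def)
   ultimately show "norm (F s) <= norm (F t)" using s(2) by metis
  qed
 qed
 then obtain a where a: "\<And>i. i < n ==> a i > 0"
   "\<And>i t. i < n ==> t i = 1 ==> (\<forall>k<n. \<bar>t k\<bar> <= 1) ==> a i <= norm (F t)" by metis
 define a0 where "a0 = Min (insert 1 (a ` {..<n}))"
 have a0: "a0 > 0" "\<And>i. i < n ==> a0 <= a i" using a(1) by (auto simp: a0_def)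
 show ?thesis
 proof (rule that[OF a0(1)])
  fix t :: "nat => real" and k assume k: "k < n"
  obtain i where i: "i < n" "\<And>j. j < n ==> \<bar>t j\<bar> <= \<bar>t i\<bar>"
  proof -
   have "{..<n} \<noteq> {}" using k by auto
   hence "Max ((%j. \<bar>t j\<bar>) ` {..<n}) \<in> (%j. \<bar>t j\<bar>) ` {..<n}" by (intro Max_in) auto
   then obtain i where "i < n" "Max ((%j. \<bar>t j\<bar>) ` {..<n}) = \<bar>t i\<bar>" by auto
   thus ?thesis using that Max_ge[of "(%j. \<bar>t j\<bar>) ` {..<n}"] by (metis (no_types, lifting) finite_imageI finite_lessThan imageI lessThan_iff)
  qed
  show "a0 * \<bar>t k\<bar> <= norm (\<Sum>j<n. t j *\<^sub>R X j)"
  proof (cases "t i = 0")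
   case True thus ?thesis using i(2)[OF k] by simp
  next
   case False
   have "a i <= norm (F (%j. t j / t i))" using i False by (intro a(2)) (auto simp: divide_le_eq_1)
   also have "F (%j. t j / t i) = (1 / t i) *\<^sub>R F t" by (simp add: F_def scaleR_sum_right)
   finally have "a i * \<bar>t i\<bar> <= norm (F t)" using False by (simp add: field_simps)
   moreover have "a0 * \<bar>t k\<bar> <= a i * \<bar>t i\<bar>" using a0 i k a(1)[OF i(1)] by (intro mult_mono) auto
   ultimately show ?thesis by (simp add: F_def)
  qed
 qed
qed

text \<open>The model space is merely a finite-dimensional normed space, so the equivalence of norms and the
 compactness of balls have to be obtained from a basis.\<close>

locale basis_coordinates =
 fixes X :: "nat => 'e::banach" and n :: nat
 assumes basis: "is_basis X" and n_def: "n = dim (UNIV :: 'e set)"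
begin

definition coord_const :: real where
 "coord_const = (SOME a. a > 0 \<and> (\<forall>t k. k < n --> a * \<bar>t k\<bar> <= norm (\<Sum>j<n. t j *\<^sub>R X j)))"

lemma coord_const: "coord_const > 0"
 "k < n ==> coord_const * \<bar>t k\<bar> <= norm (\<Sum>j<n. t j *\<^sub>R X j)"
proof -
 have "\<exists>a. a > 0 \<and> (\<forall>t k. k < n --> a * \<bar>t k\<bar> <= norm (\<Sum>j<n. t j *\<^sub>R X j))"
  using basis_lower_bound[of X n] basis unfolding is_basis_def n_def[symmetric] by metis
 from someI_ex[OF this] show "coord_const > 0" "k < n ==> coord_const * \<bar>t k\<bar> <= norm (\<Sum>j<n. t j *\<^sub>R X j)"
  unfolding coord_const_def by blast+
qed

lemma coord_exists: "\<exists>t. (\<Sum>j<n. t j *\<^sub>R X j) = v"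
proof -
 have inj: "inj_on X {..<n}" using basis by (simp add: is_basis_def n_def)
 have "v \<in> span (X ` {..<n})" using basis by (simp add: is_basis_def n_def)
 then obtain u where "v = (\<Sum>w\<in>X ` {..<n}. u w *\<^sub>R w)" by (auto simp: span_finite)
 hence "v = (\<Sum>j<n. u (X j) *\<^sub>R X j)" by (simp add: sum.reindex[OF inj])
 thus ?thesis by (intro exI[of _ "%j. u (X j)"]) simp
qed

definition co :: "nat => 'e => real" where
 "co k v = (SOME t. (\<Sum>j<n. t j *\<^sub>R X j) = v) k"

lemma co_sum: "(\<Sum>j<n. co j v *\<^sub>R X j) = v"
 using someI_ex[OF coord_exists[of v]] by (simp add: co_def)

lemma co_bound: "k < n ==> \<bar>co k v\<bar> <= norm v / coord_const"
 using coord_const(2)[of k "%k. co k v"] coord_const(1) by (simp add: co_sum field_simps)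

lemma linear_norm_bound:
 fixes L :: "'e => 'f::real_normed_vector"
 assumes "linear L" "\<And>k. k < n ==> norm (L (X k)) <= M"
 shows "norm (L v) <= real n * M / coord_const * norm v"
proof -
 have "L v = (\<Sum>j<n. co j v *\<^sub>R L (X j))"
  by (subst co_sum[symmetric, of v]) (simp add: linear_sum[OF assms(1)] linear_scale[OF assms(1)])
 also have "norm \<dots> <= (\<Sum>j<n. norm v / coord_const * M)"
 proof (rule sum_norm_le)
  fix j assume "j \<in> {..<n}"
  hence j: "j < n" by simp
  show "norm (co j v *\<^sub>R L (X j)) <= norm v / coord_const * M"
   unfolding norm_scaleR using coord_const(1) by (intro mult_mono co_bound j assms(2)) auto
 qed
 also have "\<dots> = real n * M / coord_const * norm v" by simp
 finally show ?thesis .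
qed

lemma linear_norm_bound2:
 fixes L :: "'e \<times> 'e => 'f::real_normed_vector"
 assumes L: "linear L" and M: "\<And>k. k < n ==> norm (L (X k, 0)) <= M" "\<And>k. k < n ==> norm (L (0, X k)) <= M"
 shows "norm (L v) <= 2 * (real n * M / coord_const) * norm v"
proof -
 have l1: "linear (%a. L (a, 0))" "linear (%a. L (0, a))"
  using linear_add[OF L, of "(_, 0)" "(_, 0)"] linear_scale[OF L, of _ "(_, 0)"]
   linear_add[OF L, of "(0, _)" "(0, _)"] linear_scale[OF L, of _ "(0, _)"]
  by (auto intro!: linearI)
 have "L v = L (fst v, 0) + L (0, snd v)" using linear_add[OF L, of "(fst v, 0)" "(0, snd v)"] by simp
 hence "norm (L v) <= norm (L (fst v, 0)) + norm (L (0, snd v))" by (simp add: norm_triangle_ineq)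
 also have "\<dots> <= real n * M / coord_const * norm (fst v) + real n * M / coord_const * norm (snd v)"
  using linear_norm_bound[OF l1(1) M(1), of "fst v"] linear_norm_bound[OF l1(2) M(2), of "snd v"] by (intro add_mono) auto
 also have "\<dots> <= real n * M / coord_const * norm v + real n * M / coord_const * norm v"
 proof (cases "n = 0")
  case False
  have "0 <= M" using order_trans[OF norm_ge_zero M(1)[of 0]] False by simp
  thus ?thesis using coord_const(1) norm_fst_le[of "fst v" "snd v"] norm_snd_le[of "snd v" "fst v"]
   by (intro add_mono mult_left_mono) auto
 qed simp
 also have "\<dots> = 2 * (real n * M / coord_const) * norm v" by simp
 finally show ?thesis .
qed

lemma compact_cball: "compact (cball (0::'e) r)"
proof -
 define M where "M = \<bar>r\<bar> / coord_const"
 define B where "B = (\<Pi>\<^sub>E k\<in>(UNIV::nat set). {-M..M})"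
 have "compactin (product_topology (%_. euclidean) UNIV) B"
  unfolding B_def compactin_PiE by auto
 hence B: "compact B" unfolding euclidean_product_topology by simp
 have "compact ((%t. \<Sum>j<n. t j *\<^sub>R X j) ` B)"
  by (intro compact_continuous_image B continuous_intros continuous_on_subset[OF continuous_on_product_coordinates]) auto
 moreover have "cball 0 r \<subseteq> (%t. \<Sum>j<n. t j *\<^sub>R X j) ` B"
 proof
  fix v :: 'e assume v: "v \<in> cball 0 r"
  define t where "t k = (if k < n then co k v else 0)" for k
  have "\<bar>co k v\<bar> <= M" if "k < n" for k
  proof -
   have "norm v / coord_const <= M" using v coord_const(1) unfolding M_def by (intro divide_right_mono) auto
   thus ?thesis using co_bound[OF that, of v] by linarith
  qed
  moreover have "M \<ge> 0" using coord_const(1) by (simp add: M_def)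
  ultimately have "t \<in> B" by (auto simp: B_def t_def PiE_UNIV_domain abs_le_iff minus_le_iff)
  moreover have "v = (\<Sum>j<n. t j *\<^sub>R X j)" by (simp add: t_def co_sum)
  ultimately show "v \<in> (%t. \<Sum>j<n. t j *\<^sub>R X j) ` B" by blast
 qed
 ultimately show ?thesis using compact_Int_closed[OF _ closed_cball[of 0 r]] by (metis inf.absorb2)
qed

text \<open>A \<open>C\<^sup>1\<close> function, with continuity of the derivative only tested on basis vectors, is locally
 Lipschitz.\<close>

lemma C1_locally_lipschitz:
 fixes f :: "'e \<times> 'e => 'f::real_normed_vector"
 assumes S: "open S" "x0 \<in> S" and C1: "Ck_on 1 f S"
 obtains r M where "r > 0" "M \<ge> 0" "cball x0 r \<subseteq> S"
  "\<And>x y. x \<in> cball x0 r ==> y \<in> cball x0 r ==> norm (f x - f y) <= M * norm (x - y)"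
proof -
 have d: "f differentiable (at x)" if "x \<in> S" for x using C1 that by (simp add: One_nat_def)
 have c: "continuous_on S (%x. frechet_derivative f (at x) v)" for v
  using C1 unfolding One_nat_def Ck_on.simps by blast
 define D where "D x = frechet_derivative f (at x)" for x
 have der: "(f has_derivative D x) (at x)" if "x \<in> S" for x
  using d[OF that] unfolding D_def frechet_derivative_works by simp
 define P where "P v x \<longleftrightarrow> norm (D x v) < norm (D x0 v) + 1" for v x
 have ev: "\<forall>\<^sub>F x in nhds x0. P v x" for v
 proof -
  have "isCont (%x. norm (D x v)) x0"
   using c[of v] S unfolding D_def by (intro continuous_intros) (auto simp: continuous_on_eq_continuous_at)
  hence "((%x. norm (D x v)) \<longlongrightarrow> norm (D x0 v)) (at x0)" by (simp add: isCont_def)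
  hence "\<forall>\<^sub>F x in at x0. norm (D x v) < norm (D x0 v) + 1" by (rule order_tendstoD(2)) simp
  hence "eventually (P v) (at x0)" by eventually_elim (simp add: P_def)
  thus ?thesis unfolding eventually_nhds_conv_at by (simp add: P_def)
 qed
 have "\<forall>\<^sub>F x in nhds x0. x \<in> S \<and> (\<forall>k\<in>{..<n}. P (X k, 0) x \<and> P (0, X k) x)"
  using S ev by (auto simp: eventually_conj_iff eventually_ball_finite_distrib eventually_nhds_in_open)
 then obtain e where e: "e > 0" "\<And>x. dist x x0 < e ==> x \<in> S \<and> (\<forall>k<n. P (X k, 0) x \<and> P (0, X k) x)"
  by (auto simp: eventually_nhds_metric)
 define M0 where "M0 = (\<Sum>k<n. norm (D x0 (X k, 0)) + norm (D x0 (0, X k))) + 1"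
 define M where "M = 2 * (real n * M0 / coord_const)"
 have M0: "M0 \<ge> 0" unfolding M0_def by (intro add_nonneg_nonneg sum_nonneg) auto
 have le: "norm (D x (X k, 0)) <= M0 \<and> norm (D x (0, X k)) <= M0" if "dist x x0 < e" "k < n" for x k
 proof -
  have "norm (D x0 (X k, 0)) + norm (D x0 (0, X k)) <= (\<Sum>k<n. norm (D x0 (X k, 0)) + norm (D x0 (0, X k)))"
   using that(2) by (intro member_le_sum) auto
  moreover have "P (X k, 0) x" "P (0, X k) x" using e(2)[OF that(1)] that(2) by auto
  ultimately show ?thesis unfolding P_def M0_def using norm_ge_zero[of "D x0 (X k, 0)"] norm_ge_zero[of "D x0 (0, X k)"] by linarith
 qed
 have sub: "cball x0 (e/2) \<subseteq> S" using e by (auto simp: dist_commute)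
 show ?thesis
 proof (rule that[of "e/2" M])
  show "M \<ge> 0" using M0 coord_const(1) by (simp add: M_def)
  fix x y assume xy: "x \<in> cball x0 (e/2)" "y \<in> cball x0 (e/2)"
  show "norm (f x - f y) <= M * norm (x - y)"
  proof (rule differentiable_bound[OF convex_cball _ _ xy])
   fix z assume z: "z \<in> cball x0 (e/2)"
   show "(f has_derivative D z) (at z within cball x0 (e/2))"
    using der[of z] sub z has_derivative_at_withinI by blast
   have "linear (D z)" using der[of z] sub z has_derivative_linear by blast
   moreover have "dist z x0 < e" using z e(1) by (simp add: dist_commute)
   ultimately show "onorm (D z) <= M"
    unfolding M_def using le coord_const(1) M0 by (intro onorm_bound linear_norm_bound2) auto
  qed
 qed (use e sub in auto)
qed

end

section \<open>The group law in a chart\<close>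

text \<open>Subtracting from the chart expression of the product its linear part leaves a function that
 vanishes on both axes and is Lipschitz in each variable with a constant proportional to the other.\<close>

lemma (in basis_coordinates) chart_estimate:
 fixes A :: "('g::{topological_group_add, t2_space, second_countable_topology}, 'e) chart set"
 assumes A: "lie_group A" and c: "(U, c) \<in> A" and zero: "0 \<in> U"
 obtains r C where "r > 0" "C \<ge> 0" "cball (c 0) r \<subseteq> c ` U"
  "\<And>a b. a \<in> U ==> b \<in> U ==> norm (c a - c 0) <= r ==> norm (c b - c 0) <= r ==> a + b \<in> U"
  "\<And>a a' b. a \<in> U ==> a' \<in> U ==> b \<in> U ==>
   norm (c a - c 0) <= r ==> norm (c a' - c 0) <= r ==> norm (c b - c 0) <= r ==>
   norm ((c (a + b) - c a) - (c (a' + b) - c a')) <= C * norm (c b - c 0) * norm (c a - c a')"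
  "\<And>a b b'. a \<in> U ==> b \<in> U ==> b' \<in> U ==>
   norm (c a - c 0) <= r ==> norm (c b - c 0) <= r ==> norm (c b' - c 0) <= r ==>
   norm ((c (a + b) - c b) - (c (a + b') - c b')) <= C * norm (c a - c 0) * norm (c b - c b')"
proof -
 interpret lie_group A by fact
 define i where "i = inv_into U c"
 have opU: "open U" and opO: "open (c ` U)" and hom: "homeomorphism U (c ` U) c i"
  using chart[OF c] by (auto simp: i_def)
 have ic: "i (c g) = g" if "g \<in> U" for g using hom that by (auto simp: homeomorphism_def)
 have ci: "c (i p) = p" "i p \<in> U" if "p \<in> c ` U" for p using hom that by (auto simp: homeomorphism_def)
 define m where "m = (%(p, q). c (i p + i q))"
 define D where "D = {(p, q). p \<in> c ` U \<and> q \<in> c ` U \<and> i p + i q \<in> U}"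
 define x0 where "x0 = (c 0, c 0)"
 have x0D: "x0 \<in> D" using zero ic[OF zero] by (auto simp: x0_def D_def)
 have opD: "open D"
 proof -
  have ci': "continuous_on (c ` U) i" using hom by (simp add: homeomorphism_def)
  have "continuous_on (c ` U \<times> c ` U) (%x. i (fst x) + i (snd x))"
   by (intro continuous_intros continuous_on_compose2[OF ci']) auto
  hence "open ((c ` U \<times> c ` U) \<inter> (%x. i (fst x) + i (snd x)) -` U)"
   by (intro continuous_open_preimage open_Times opO opU)
  also have "(c ` U \<times> c ` U) \<inter> (%x. i (fst x) + i (snd x)) -` U = D" by (auto simp: D_def)
  finally show ?thesis .
 qed
 have "Ck_on (Suc 1) m D"
  using smooth_mult[OF c c c] unfolding smooth_on_def m_def D_def i_def by blast
 hence diff: "m differentiable (at x)" and C1: "Ck_on 1 (%x. frechet_derivative m (at x) v) D" if "x \<in> D" for x v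
  using that unfolding Ck_on.simps(2)[of 1] by blast+
 define L where "L x = frechet_derivative m (at x)" for x
 have der: "(m has_derivative L x) (at x)" if "x \<in> D" for x
  using diff[OF that] unfolding L_def frechet_derivative_works by simp
 have "\<exists>r M. r > 0 \<and> M \<ge> 0 \<and> cball x0 r \<subseteq> D \<and> (\<forall>x\<in>cball x0 r. \<forall>y\<in>cball x0 r. norm (L x v - L y v) <= M * norm (x - y))" for v
  using C1_locally_lipschitz[OF opD x0D C1[OF x0D, of v]] unfolding L_def by metis
 then obtain r M where rM: "\<And>v. r v > 0" "\<And>v. M v \<ge> 0" "\<And>v. cball x0 (r v) \<subseteq> D"
   "\<And>v x y. x \<in> cball x0 (r v) ==> y \<in> cball x0 (r v) ==> norm (L x v - L y v) <= M v * norm (x - y)"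
  by metis
 define bs where "bs = insert (0, 0) ((%k. (X k, 0)) ` {..<n} \<union> (%k. (0, X k)) ` {..<n})"
 have bs: "finite bs" "bs \<noteq> {}" "\<And>k. k < n ==> (X k, 0) \<in> bs" "\<And>k. k < n ==> (0, X k) \<in> bs" by (auto simp: bs_def)
 define R where "R = Min (r ` bs)"
 define M0 where "M0 = (\<Sum>v\<in>bs. M v)"
 have R: "R > 0" "\<And>v. v \<in> bs ==> R <= r v" using bs rM(1) by (auto simp: R_def)
 have M0: "M0 \<ge> 0" "\<And>v. v \<in> bs ==> M v <= M0"
  unfolding M0_def using bs rM(2) by (auto intro: sum_nonneg member_le_sum)
 have cbR: "cball x0 R \<subseteq> D"
  using rM(3)[of "(0,0)"] R(2)[of "(0,0)"] by (auto simp: bs_def)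
 define C where "C = 2 * (real n * M0 / coord_const)"
 have C0: "C \<ge> 0" using M0 coord_const(1) by (simp add: C_def)
 have lip: "norm (L x v - L y v) <= C * norm (x - y) * norm v" if x: "x \<in> cball x0 R" and y: "y \<in> cball x0 R" for x y v
 proof -
  have xD: "x \<in> D" "y \<in> D" using x y cbR by auto
  have lin: "linear (%v. L x v - L y v)"
   using has_derivative_linear[OF der[OF xD(1)]] has_derivative_linear[OF der[OF xD(2)]] by (rule linear_compose_sub)
  have b: "norm (L x w - L y w) <= M0 * norm (x - y)" if "w \<in> bs" for w
  proof -
   have "norm (L x w - L y w) <= M w * norm (x - y)" using x y R(2)[OF that] by (intro rM(4)) auto
   also have "\<dots> <= M0 * norm (x - y)" by (intro mult_right_mono M0 that) auto
   finally show ?thesis .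
  qed
  have "norm (L x v - L y v) <= 2 * (real n * (M0 * norm (x - y)) / coord_const) * norm v"
   by (rule linear_norm_bound2[OF lin]) (use b bs in auto)
  thus ?thesis by (simp add: C_def mult_ac)
 qed
 define \<rho> where "\<rho> = R / 2"
 have \<rho>: "\<rho> > 0" using R by (simp add: \<rho>_def)
 have inR: "(p, q) \<in> cball x0 R" if "norm (p - c 0) <= \<rho>" "norm (q - c 0) <= \<rho>" for p q
 proof -
  have "norm ((p, q) - (c 0, c 0)) <= norm (p - c 0) + norm (q - c 0)"
   using norm_Pair_le[of "p - c 0" "q - c 0"] by simp
  hence "dist (p, q) (c 0, c 0) <= R" using that unfolding dist_norm \<rho>_def by linarith
  thus ?thesis by (simp add: x0_def dist_commute)
 qed
 have memO: "p \<in> c ` U" if "norm (p - c 0) <= \<rho>" for p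
  using inR[OF that, of "c 0"] cbR \<rho> by (auto simp: D_def)
 have m1: "m (p, c 0) = p" if "p \<in> c ` U" for p using ci[OF that] ic[OF zero] by (simp add: m_def)
 have m2: "m (c 0, q) = q" if "q \<in> c ` U" for q using ci[OF that] ic[OF zero] by (simp add: m_def)
 have L1: "L (p, c 0) (v, 0) = v" if "norm (p - c 0) <= \<rho>" for p v
 proof -
  have "(p, c 0) \<in> D" using inR[OF that, of "c 0"] cbR \<rho> by auto
  have "((%p'. (p', c 0)) has_derivative (%v. (v, 0))) (at p)" by (auto intro!: derivative_eq_intros)
  from diff_chain_at[OF this der[OF \<open>(p, c 0) \<in> D\<close>]]
  have "((%p'. m (p', c 0)) has_derivative (%v. L (p, c 0) (v, 0))) (at p)" by (simp add: o_def)
  hence "((%p'. p') has_derivative (%v. L (p, c 0) (v, 0))) (at p)"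
   by (rule has_derivative_transform_within_open[OF _ opO memO[OF that]]) (rule m1)
  from has_derivative_unique[OF this has_derivative_ident] show ?thesis by (rule fun_cong)
 qed
 have L2: "L (c 0, q) (0, v) = v" if "norm (q - c 0) <= \<rho>" for q v
 proof -
  have "(c 0, q) \<in> D" using inR[OF _ that, of "c 0"] cbR \<rho> by auto
  have "((%q'. (c 0, q')) has_derivative (%v. (0, v))) (at q)" by (auto intro!: derivative_eq_intros)
  from diff_chain_at[OF this der[OF \<open>(c 0, q) \<in> D\<close>]]
  have "((%q'. m (c 0, q')) has_derivative (%v. L (c 0, q) (0, v))) (at q)" by (simp add: o_def)
  hence "((%q'. q') has_derivative (%v. L (c 0, q) (0, v))) (at q)"
   by (rule has_derivative_transform_within_open[OF _ opO memO[OF that]]) (rule m2)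
  from has_derivative_unique[OF this has_derivative_ident] show ?thesis by (rule fun_cong)
 qed
 have cb: "z \<in> cball (c 0) \<rho> \<longleftrightarrow> norm (z - c 0) <= \<rho>" for z
  unfolding mem_cball dist_norm by (subst norm_minus_commute) (rule refl)
 have E1: "norm ((m (p, q) - p) - (m (p', q) - p')) <= C * norm (q - c 0) * norm (p - p')"
  if p: "norm (p - c 0) <= \<rho>" "norm (p' - c 0) <= \<rho>" and q: "norm (q - c 0) <= \<rho>" for p p' q
 proof (rule differentiable_bound[OF convex_cball[of "c 0" \<rho>], where f="%p. m (p, q) - p" and f'="%p v. L (p, q) (v, 0) - v"])
  fix z assume "z \<in> cball (c 0) \<rho>"
  hence z: "norm (z - c 0) <= \<rho>" by (simp only: cb)
  have "(z, q) \<in> D" using inR[OF z q] cbR by auto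
  have "((%p'. (p', q)) has_derivative (%v. (v, 0))) (at z)" by (auto intro!: derivative_eq_intros)
  from diff_chain_at[OF this der[OF \<open>(z, q) \<in> D\<close>]]
  have "((%p'. m (p', q)) has_derivative (%v. L (z, q) (v, 0))) (at z)" by (simp add: o_def)
  thus "((%p. m (p, q) - p) has_derivative (%v. L (z, q) (v, 0) - v)) (at z within cball (c 0) \<rho>)"
   by (intro has_derivative_diff has_derivative_ident) (rule has_derivative_at_withinI)
  have "norm (L (z, q) (v, 0) - v) <= C * norm (q - c 0) * norm v" for v
   using lip[OF inR[OF z q] inR[OF z, of "c 0"], of "(v, 0)"] L1[OF z, of v] \<rho> by (simp add: norm_Pair)
  thus "onorm (%v. L (z, q) (v, 0) - v) <= C * norm (q - c 0)"
   using C0 by (intro onorm_bound) auto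
 qed (use p in \<open>simp_all only: cb\<close>)
 have E2: "norm ((m (p, q) - q) - (m (p, q') - q')) <= C * norm (p - c 0) * norm (q - q')"
  if p: "norm (p - c 0) <= \<rho>" and q: "norm (q - c 0) <= \<rho>" "norm (q' - c 0) <= \<rho>" for p q q'
 proof (rule differentiable_bound[OF convex_cball[of "c 0" \<rho>], where f="%q. m (p, q) - q" and f'="%q v. L (p, q) (0, v) - v"])
  fix z assume "z \<in> cball (c 0) \<rho>"
  hence z: "norm (z - c 0) <= \<rho>" by (simp only: cb)
  have "(p, z) \<in> D" using inR[OF p z] cbR by auto
  have "((%q'. (p, q')) has_derivative (%v. (0, v))) (at z)" by (auto intro!: derivative_eq_intros)
  from diff_chain_at[OF this der[OF \<open>(p, z) \<in> D\<close>]]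
  have "((%q'. m (p, q')) has_derivative (%v. L (p, z) (0, v))) (at z)" by (simp add: o_def)
  thus "((%q. m (p, q) - q) has_derivative (%v. L (p, z) (0, v) - v)) (at z within cball (c 0) \<rho>)"
   by (intro has_derivative_diff has_derivative_ident) (rule has_derivative_at_withinI)
  have "norm (L (p, z) (0, v) - v) <= C * norm (p - c 0) * norm v" for v
   using lip[OF inR[OF p z] inR[OF _ z, of "c 0"], of "(0, v)"] L2[OF z, of v] \<rho> by (simp add: norm_Pair)
  thus "onorm (%v. L (p, z) (0, v) - v) <= C * norm (p - c 0)"
   using C0 by (intro onorm_bound) auto
 qed (use q in \<open>simp_all only: cb\<close>)
 show ?thesis
 proof (rule that[of \<rho> C])
  show "cball (c 0) \<rho> \<subseteq> c ` U" using memO cb by blast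
  fix a b assume ab: "a \<in> U" "b \<in> U" "norm (c a - c 0) <= \<rho>" "norm (c b - c 0) <= \<rho>"
  show "a + b \<in> U" using subsetD[OF cbR inR[OF ab(3,4)]] ic[OF ab(1)] ic[OF ab(2)] by (simp add: D_def)
 next
  fix a a' b assume ab: "a \<in> U" "a' \<in> U" "b \<in> U" "norm (c a - c 0) <= \<rho>" "norm (c a' - c 0) <= \<rho>" "norm (c b - c 0) <= \<rho>"
  show "norm ((c (a + b) - c a) - (c (a' + b) - c a')) <= C * norm (c b - c 0) * norm (c a - c a')"
   using E1[OF ab(4,5,6)] ab(1-3) by (simp add: m_def ic)
 next
  fix a b b' assume ab: "a \<in> U" "b \<in> U" "b' \<in> U" "norm (c a - c 0) <= \<rho>" "norm (c b - c 0) <= \<rho>" "norm (c b' - c 0) <= \<rho>"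
  show "norm ((c (a + b) - c b) - (c (a + b') - c b')) <= C * norm (c a - c 0) * norm (c b - c b')"
   using E2[OF ab(4,5,6)] ab(1-3) by (simp add: m_def ic)
 qed (use \<rho> C0 in auto)
qed

text \<open>The chart \<open>ch\<close> is translated so as to map the identity to \<open>0\<close>. The deviation of the group law from
 addition, \<open>ch (a + b) - ch a - ch b\<close>, is Lipschitz in each variable with a constant proportional to the
 size of the other; everything about the group near the identity is derived from these two estimates.\<close>

locale local_group = basis_coordinates X n
 for X :: "nat => 'e::banach" and n :: nat +
 fixes U0 :: "'g::{topological_group_add, t2_space, second_countable_topology} set"
  and ch :: "'g => 'e" and r0 C :: real
 assumes open_U0: "open U0" and zero_U0: "0 \<in> U0" and ch_0: "ch 0 = 0"
  and r0: "r0 > 0" and C: "C \<ge> 0" and Cr: "C * r0 <= 1 / 8"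
  and open_image: "open (ch ` U0)"
  and hom: "homeomorphism U0 (ch ` U0) ch (inv_into U0 ch)"
  and ball: "cball 0 r0 \<subseteq> ch ` U0"
  and prod_mem: "\<And>a b. a \<in> U0 ==> b \<in> U0 ==> norm (ch a) <= r0 ==> norm (ch b) <= r0 ==> a + b \<in> U0"
  and minus_mem: "\<And>a. a \<in> U0 ==> norm (ch a) <= r0 ==> - a \<in> U0"
  and beta_left: "\<And>a a' b. a \<in> U0 ==> a' \<in> U0 ==> b \<in> U0 ==>
   norm (ch a) <= r0 ==> norm (ch a') <= r0 ==> norm (ch b) <= r0 ==>
   norm ((ch (a + b) - ch a) - (ch (a' + b) - ch a')) <= C * norm (ch b) * norm (ch a - ch a')"
  and beta_right: "\<And>a b b'. a \<in> U0 ==> b \<in> U0 ==> b' \<in> U0 ==>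
   norm (ch a) <= r0 ==> norm (ch b) <= r0 ==> norm (ch b') <= r0 ==>
   norm ((ch (a + b) - ch b) - (ch (a + b') - ch b')) <= C * norm (ch a) * norm (ch b - ch b')"
  and ch_minus: "\<And>a. a \<in> U0 ==> norm (ch a) <= r0 ==> norm (ch (- a)) <= 2 * norm (ch a)"

lemma (in basis_coordinates) local_group_exists:
 fixes A :: "('g::{topological_group_add, t2_space, second_countable_topology}, 'e) chart set"
 assumes A: "lie_group A" and c: "(U, c) \<in> A" and zero: "0 \<in> U"
 obtains r C where "local_group X n U (%g. c g - c 0) r C"
proof -
 interpret lie_group A by fact
 obtain r C where est: "r > 0" "C \<ge> 0" "cball (c 0) r \<subseteq> c ` U"
  "\<And>a b. a \<in> U ==> b \<in> U ==> norm (c a - c 0) <= r ==> norm (c b - c 0) <= r ==> a + b \<in> U"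
  "\<And>a a' b. a \<in> U ==> a' \<in> U ==> b \<in> U ==>
   norm (c a - c 0) <= r ==> norm (c a' - c 0) <= r ==> norm (c b - c 0) <= r ==>
   norm ((c (a + b) - c a) - (c (a' + b) - c a')) <= C * norm (c b - c 0) * norm (c a - c a')"
  "\<And>a b b'. a \<in> U ==> b \<in> U ==> b' \<in> U ==>
   norm (c a - c 0) <= r ==> norm (c b - c 0) <= r ==> norm (c b' - c 0) <= r ==>
   norm ((c (a + b) - c b) - (c (a + b') - c b')) <= C * norm (c a - c 0) * norm (c b - c b')"
  by (rule chart_estimate[OF A c zero]) (rule that)
 define ch where "ch g = c g - c 0" for g
 have opU: "open U" and opO: "open (c ` U)" and hom: "homeomorphism U (c ` U) c (inv_into U c)"
  using chart[OF c] by auto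
 have im: "ch ` U = (%v. v - c 0) ` (c ` U)" by (auto simp: ch_def image_image)
 have opK: "open (ch ` U)" unfolding im using open_translation_subtract[OF opO, of "c 0"] by simp
 have cc: "continuous_on U c" using hom by (simp add: homeomorphism_def)
 have injc: "inj_on c U" 
  by (rule inj_on_inverseI[of _ "inv_into U c"]) (use hom in \<open>simp add: homeomorphism_def\<close>)
 have injk: "inj_on ch U"
 proof (rule inj_onI)
  fix x y assume "x \<in> U" "y \<in> U" "ch x = ch y"
  moreover from this have "c x = c y" unfolding ch_def by simp
  ultimately show "x = y" using injc by (simp only: inj_on_eq_iff)
 qed
 have inv: "inv_into U ch v = inv_into U c (v + c 0)" if v: "v \<in> ch ` U" for v
 proof -
  obtain g where g: "g \<in> U" "v = ch g" using v by blast
  thus ?thesis using inv_into_f_f[OF injk g(1)] inv_into_f_f[OF injc g(1)] by (simp add: ch_def)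
 qed
 have homk: "homeomorphism U (ch ` U) ch (inv_into U ch)"
  unfolding homeomorphism_def
 proof (intro conjI ballI)
  show "continuous_on U ch" unfolding ch_def by (intro continuous_intros cc)
  have "continuous_on (c ` U) (inv_into U c)" using hom by (simp add: homeomorphism_def)
  hence "continuous_on (ch ` U) (%v. inv_into U c (v + c 0))"
   by (rule continuous_on_compose2) (auto intro!: continuous_intros simp: ch_def)
  thus "continuous_on (ch ` U) (inv_into U ch)" using inv by (simp cong: continuous_on_cong)
  show "inv_into U ch ` ch ` U = U" by (rule inv_into_image_cancel[OF injk subset_refl])
 qed (use injk in \<open>simp_all add: inv_into_f_f f_inv_into_f\<close>)
 have kc: "isCont ch 0" using cc opU zero unfolding ch_def by (intro continuous_intros) (auto simp: continuous_on_eq_continuous_at)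
 \<comment> \<open>The inverses of elements near the identity stay in the domain of the estimates.\<close>
 define S where "S = uminus -` (U \<inter> ch -` ball 0 r) \<inter> U"
 have opS: "open S"
 proof -
  have "open (U \<inter> ch -` ball 0 r)"
   using homk opU by (intro continuous_open_preimage) (auto simp: homeomorphism_def)
  from open_vimage[OF this, of uminus] have "open (uminus -` (U \<inter> ch -` ball 0 r))"
   by (simp add: continuous_on_minus)
  thus ?thesis unfolding S_def using opU by (rule open_Int)
 qed
 have "open (ch ` S)"
 proof -
  have "inv_into U ch -` S \<inter> ch ` U = ch ` S" using injk by (auto simp: S_def inv_into_f_f image_iff)
  moreover have "open (ch ` U \<inter> inv_into U ch -` S)"
   using homk opK opS by (intro continuous_open_preimage) (auto simp: homeomorphism_def)
  ultimately show ?thesis by (simp add: Int_commute)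
 qed
 moreover have "0 \<in> ch ` S" using zero est(1) by (auto simp: S_def ch_def image_iff intro!: bexI[of _ 0])
 ultimately obtain d where d: "d > 0" "cball 0 d \<subseteq> ch ` S" by (meson open_contains_cball)
 define r' where "r' = min d (min r (1 / (8 * (C + 1))))"
 have r': "r' > 0" "r' <= d" "r' <= r" "r' <= 1 / (8 * (C + 1))" using d est(1,2) by (auto simp: r'_def)
 have Cr': "C * r' <= 1 / 8"
 proof -
  have "C * r' <= (C + 1) * (1 / (8 * (C + 1)))" using est(2) r' by (intro mult_mono) auto
  also have "(C + 1) * (1 / (8 * (C + 1))) = 1 / 8" using est(2) by (simp add: field_simps)
  finally show ?thesis .
 qed
 have inS: "a \<in> S" if "a \<in> U" "norm (ch a) <= r'" for a
 proof -
  have "ch a \<in> ch ` S" using d(2) that r'(2) by (auto simp: subset_iff)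
  then obtain s where "s \<in> S" "ch a = ch s" by auto
  thus ?thesis using injk that(1) by (metis IntE S_def inj_onD)
 qed
 have mm: "- a \<in> U" "norm (ch (- a)) <= 2 * norm (ch a)" if a: "a \<in> U" "norm (ch a) <= r'" for a
 proof -
  have s: "- a \<in> U" "norm (ch (- a)) <= r" using inS[OF a] by (auto simp: S_def)
  show "- a \<in> U" by (rule s)
  have "norm ((c (a + - a) - c (- a)) - (c (a + 0) - c 0)) <= C * norm (c a - c 0) * norm (c (- a) - c 0)"
   using a s r' zero est(1) by (intro est(6)) (auto simp: ch_def)
  hence "norm (ch (- a) + ch a) <= C * norm (ch a) * norm (ch (- a))"
   by (simp add: ch_def norm_minus_commute algebra_simps)
  also have "C * norm (ch a) * norm (ch (- a)) <= 1 / 8 * norm (ch (- a))"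
  proof (rule mult_right_mono)
   have "C * norm (ch a) <= C * r'" by (intro mult_left_mono a est)
   thus "C * norm (ch a) <= 1 / 8" using Cr' by simp
  qed simp
  finally show "norm (ch (- a)) <= 2 * norm (ch a)"
   using norm_triangle_ineq2[of "ch (- a)" "- ch a", unfolded diff_minus_eq_add norm_minus_cancel]
    norm_ge_zero[of "ch (- a)"] by linarith
 qed
 have "local_group X n U ch r' C"
 proof
  have "cball 0 r' \<subseteq> cball (0::'e) d" using r'(2) by (rule subset_cball)
  also note d(2)
  also have "ch ` S \<subseteq> ch ` U" by (intro image_mono) (simp add: S_def)
  finally show "cball 0 r' \<subseteq> ch ` U" .
  show "homeomorphism U (ch ` U) ch (inv_into U ch)" by (rule homk)
 qed (use opU zero r' est Cr' opK mm in \<open>auto simp: ch_def\<close>)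
 thus ?thesis using that unfolding ch_def by blast
qed

section \<open>Powers and one-parameter subgroups\<close>

primrec pw :: "nat => 'g::group_add => 'g" where
 "pw 0 a = 0"
| "pw (Suc k) a = pw k a + a"

lemma pw_add: "pw (k + l) a = pw k a + pw l a"
 by (induction l) (simp_all add: add.assoc[symmetric])

lemma pw_mult: "pw (k * l) a = pw k (pw l a)"
 by (induction k) (simp_all add: pw_add add.commute[of l])

lemma pw_commute: "a + b = b + a ==> pw k a + b = b + pw k a"
 by (induction k) (simp_all, metis add.assoc)

lemma pw_hom: "(\<And>s t. \<gamma> (s + t) = \<gamma> s + \<gamma> t) ==> \<gamma> (real k * t) = pw k (\<gamma> t)"
proof (induction k)
 case 0
 have "\<gamma> 0 + \<gamma> 0 = \<gamma> 0 + 0" using 0[of 0 0] by simp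
 hence "\<gamma> 0 = 0" by (rule add_left_imp_eq)
 thus ?case by simp
next
 case (Suc k)
 thus ?case using Suc(2)[of "real k * t" t] by (simp add: distrib_right add.commute)
qed

context local_group
begin

definition W :: "real => 'g set" where "W r = {g \<in> U0. norm (ch g) <= r}"

definition \<iota> :: "'e => 'g" where "\<iota> = inv_into U0 ch"

lemma iota_ch: "g \<in> U0 ==> \<iota> (ch g) = g"
 using hom by (simp add: homeomorphism_def \<iota>_def)

lemma ch_iota: "norm v <= r0 ==> ch (\<iota> v) = v" and iota_mem: "norm v <= r0 ==> \<iota> v \<in> U0"
proof -
 assume "norm v <= r0"
 hence "v \<in> ch ` U0" using ball by auto
 thus "ch (\<iota> v) = v" "\<iota> v \<in> U0" unfolding \<iota>_def by (simp_all add: f_inv_into_f inv_into_into)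
qed

lemma ch_eqD: "a \<in> U0 ==> b \<in> U0 ==> ch a = ch b ==> a = b"
 using iota_ch by metis

lemma iota_0: "\<iota> 0 = 0"
 using iota_ch[OF zero_U0] by (simp add: ch_0)

lemma cont_iota: "continuous_on (cball 0 r0) \<iota>"
 using hom continuous_on_subset[OF _ ball] by (auto simp: homeomorphism_def \<iota>_def)

lemma cont_ch: "continuous_on U0 ch"
 using hom by (simp add: homeomorphism_def)

lemma W_eq_image: "r <= r0 ==> W r = \<iota> ` cball 0 r"
proof (intro equalityI subsetI)
 fix g assume "r <= r0" "g \<in> W r"
 thus "g \<in> \<iota> ` cball 0 r" using iota_ch[of g] by (intro image_eqI[of _ _ "ch g"]) (auto simp: W_def)
next
 fix g assume r: "r <= r0" and "g \<in> \<iota> ` cball 0 r"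
 then obtain v where v: "norm v <= r" "g = \<iota> v" by auto
 thus "g \<in> W r" using r ch_iota[of v] iota_mem[of v] by (auto simp: W_def)
qed

lemma compact_W: "r <= r0 ==> compact (W r)"
 unfolding W_eq_image
 by (intro compact_continuous_image compact_cball continuous_on_subset[OF cont_iota]) auto

lemma W_neighbourhood: "r > 0 ==> 0 \<in> interior (W r)"
proof (rule interiorI)
 assume "r > 0"
 show "open (U0 \<inter> ch -` ball 0 r)" by (intro continuous_open_preimage cont_ch open_U0 open_ball)
 show "0 \<in> U0 \<inter> ch -` ball 0 r" using zero_U0 \<open>r > 0\<close> by (simp add: ch_0)
 show "U0 \<inter> ch -` ball 0 r \<subseteq> W r" by (auto simp: W_def)
qed

lemma W_basis:
 assumes S: "open S" "0 \<in> S"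
 obtains r where "r > 0" "r <= r0" "W r \<subseteq> S"
proof -
 have "isCont \<iota> 0"
  using continuous_on_subset[OF cont_iota ball_subset_cball] r0
  by (simp add: continuous_on_eq_continuous_at[OF open_ball])
 hence "\<forall>\<^sub>F v in at 0. \<iota> v \<in> S"
  unfolding isCont_def using S by (auto simp: iota_0 intro: topological_tendstoD)
 hence "\<forall>\<^sub>F v in nhds 0. \<iota> v \<in> S" using S by (simp add: eventually_nhds_conv_at iota_0)
 then obtain d where d: "d > 0" "\<And>v. norm v < d ==> \<iota> v \<in> S" by (auto simp: eventually_nhds_metric)
 have "W (min (d/2) r0) \<subseteq> S"
 proof
  fix g assume g: "g \<in> W (min (d/2) r0)"
  hence "\<iota> (ch g) \<in> S" using d by (intro d(2)) (auto simp: W_def)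
  thus "g \<in> S" using g iota_ch by (simp add: W_def)
 qed
 thus ?thesis using that[of "min (d/2) r0"] d r0 by auto
qed

lemma W_I: "g \<in> U0 ==> norm (ch g) <= r ==> g \<in> W r" by (simp add: W_def)

lemma beta:
 assumes "a \<in> U0" "b \<in> U0" "norm (ch a) <= r0" "norm (ch b) <= r0"
 shows "norm (ch (a + b) - ch a - ch b) <= C * norm (ch a) * norm (ch b)"
 using beta_left[OF assms(1) zero_U0 assms(2,3) _ assms(4)] r0 by (simp add: ch_0 mult_ac)

lemma C_small: "norm v <= r0 ==> C * norm v <= 1 / 8"
 using mult_left_mono[of "norm v" r0 C] C Cr by linarith

lemma pw_small:
 assumes a: "a \<in> U0" and N: "2 * real N * norm (ch a) <= r0" and k: "k <= N"
 shows "pw k a \<in> U0 \<and> norm (ch (pw k a)) <= 9 / 8 * real k * norm (ch a)"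
 using k
proof (induction k)
 case 0 thus ?case using zero_U0 by (simp add: ch_0)
next
 case (Suc k)
 hence IH: "pw k a \<in> U0" "norm (ch (pw k a)) <= 9 / 8 * real k * norm (ch a)" by auto
 have kN: "real k * norm (ch a) <= real N * norm (ch a)" "1 * norm (ch a) <= real N * norm (ch a)"
  using Suc by (intro mult_right_mono; simp)+
 have s: "norm (ch (pw k a)) <= r0" "norm (ch a) <= r0"
  using IH(2) kN N norm_ge_zero[of "ch a"] by linarith+
 have "norm (ch (pw k a + a) - ch (pw k a) - ch a) <= C * norm (ch (pw k a)) * norm (ch a)"
  by (rule beta[OF IH(1) a s])
 also have "\<dots> <= 1 / 8 * norm (ch a)" using C_small[OF s(1)] by (intro mult_right_mono) auto
 finally have b: "norm (ch (pw k a + a) - ch (pw k a) - ch a) <= 1 / 8 * norm (ch a)" .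
 have "norm (ch (pw k a + a)) <= norm (ch (pw k a)) + norm (ch a) + 1 / 8 * norm (ch a)"
  using b norm_triangle_ineq[of "ch (pw k a + a) - ch (pw k a) - ch a" "ch (pw k a) + ch a"]
   norm_triangle_ineq[of "ch (pw k a)" "ch a"] by simp
 thus ?case using IH prod_mem[OF IH(1) a s] by (simp add: algebra_simps)
qed

lemma pw_range:
 assumes a: "a \<in> U0" and N: "2 * real N * norm (ch a) <= r0" and k: "k <= N"
 shows "pw k a \<in> U0" "norm (ch (pw k a)) <= r0"
proof -
 have "real k * norm (ch a) <= real N * norm (ch a)" using k by (intro mult_right_mono) auto
 moreover have "0 <= real N * norm (ch a)" by simp
 moreover have "2 * (real N * norm (ch a)) <= r0" "norm (ch (pw k a)) <= 9 / 8 * (real k * norm (ch a))"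
  using pw_small[OF a N k] N by (simp_all add: mult_ac)
 ultimately show "norm (ch (pw k a)) <= r0" by linarith
 show "pw k a \<in> U0" using pw_small[OF a N k] by blast
qed

text \<open>Adding one more factor \<open>a\<close> makes an error at most proportional to the size of the product so far,
 so the errors add up to a quadratic one.\<close>

lemma pw_quadratic:
 assumes a: "a \<in> U0" and N: "2 * real N * norm (ch a) <= r0" and k: "k <= N"
 shows "norm (ch (pw k a) - real k *\<^sub>R ch a) <= C * (real k)\<^sup>2 * (norm (ch a))\<^sup>2"
 using k
proof (induction k)
 case 0 thus ?case by (simp add: ch_0)
next
 case (Suc k)
 hence kN: "k <= N" by simp
 note p = pw_range[OF a N kN]
 have a0: "norm (ch a) <= r0"
 proof -
  have "1 * norm (ch a) <= 2 * real N * norm (ch a)" using Suc by (intro mult_right_mono) auto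
  thus ?thesis using N by simp
 qed
 have "norm (ch (pw k a + a) - ch (pw k a) - ch a) <= C * norm (ch (pw k a)) * norm (ch a)"
  by (rule beta[OF p(1) a p(2) a0])
 also have "\<dots> <= C * (9 / 8 * real k * norm (ch a)) * norm (ch a)"
  using pw_small[OF a N kN] C by (intro mult_right_mono mult_left_mono) auto
 also have "\<dots> <= C * (2 * real k * norm (ch a)) * norm (ch a)"
  using C by (intro mult_right_mono mult_left_mono) auto
 finally have b: "norm (ch (pw k a + a) - ch (pw k a) - ch a) <= C * (2 * real k) * (norm (ch a))\<^sup>2"
  by (simp add: power2_eq_square mult_ac)
 have "norm (ch (pw (Suc k) a) - real (Suc k) *\<^sub>R ch a)
   = norm ((ch (pw k a + a) - ch (pw k a) - ch a) + (ch (pw k a) - real k *\<^sub>R ch a))"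
  by (simp add: algebra_simps)
 also have "\<dots> <= C * (2 * real k) * (norm (ch a))\<^sup>2 + C * (real k)\<^sup>2 * (norm (ch a))\<^sup>2"
  using b Suc kN by (intro norm_triangle_mono) auto
 also have "\<dots> <= C * (real (Suc k))\<^sup>2 * (norm (ch a))\<^sup>2"
  using C by (simp add: power2_eq_square algebra_simps)
 finally show ?case .
qed

text \<open>Each step multiplies the difference by at most \<open>1 + C * A\<close>; as \<open>N * A\<close> is bounded, these factors multiply
 to at most \<open>exp 1 < 3\<close>.\<close>

lemma pw_diff:
 assumes a: "a \<in> U0" "norm (ch a) <= A" and b: "b \<in> U0" "norm (ch b) <= A"
  and N: "2 * real N * A <= r0" and k: "k <= N"
 shows "norm (ch (pw k a) - ch (pw k b)) <= 6 * real k * norm (ch a - ch b)"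
proof (cases "N = 0")
 case True thus ?thesis using k by simp
next
 case False
 have A0: "A \<ge> 0" using a(2) norm_ge_zero order_trans by blast
 have Na: "2 * real N * norm (ch a) <= r0" "2 * real N * norm (ch b) <= r0"
  using mult_left_mono[OF a(2), of "2 * real N"] mult_left_mono[OF b(2), of "2 * real N"] N by auto
 have "1 * A <= real N * A" using False A0 by (intro mult_right_mono) auto
 hence AR: "A <= r0" using N A0 by linarith
 define d where "d = norm (ch a - ch b)"
 define q where "q = 1 + C * A"
 have q: "q \<ge> 1" using C A0 by (simp add: q_def)
 have "norm (ch (pw k a) - ch (pw k b)) <= 2 * real k * q ^ k * d"
  using k
 proof (induction k)
  case 0 thus ?case by simp
 next
  case (Suc k)
  hence kN: "k <= N" by simp
  note pa = pw_range[OF a(1) Na(1) kN] and pb = pw_range[OF b(1) Na(2) kN]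
  have ar: "norm (ch a) <= r0" "norm (ch b) <= r0" using a b AR by auto
  have e1: "norm ((ch (pw k a + a) - ch (pw k a)) - (ch (pw k b + a) - ch (pw k b))) <= C * A * norm (ch (pw k a) - ch (pw k b))"
   by (rule order_trans[OF beta_left[OF pa(1) pb(1) a(1) pa(2) pb(2) ar(1)] mult_right_mono[OF mult_left_mono[OF a(2) C] norm_ge_zero]])
  have e2: "norm ((ch (pw k b + a) - ch a) - (ch (pw k b + b) - ch b)) <= 1 * d"
   using beta_right[OF pb(1) a(1) b(1) pb(2) ar] mult_right_mono[of "C * norm (ch (pw k b))" 1 d] C_small[OF pb(2)]
   by (simp add: d_def)
  have "norm (ch (pw (Suc k) a) - ch (pw (Suc k) b))
   = norm (((ch (pw k a + a) - ch (pw k a)) - (ch (pw k b + a) - ch (pw k b)))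
     + (((ch (pw k b + a) - ch a) - (ch (pw k b + b) - ch b)) + ((ch (pw k a) - ch (pw k b)) + (ch a - ch b))))"
   by (simp add: algebra_simps)
  also have "\<dots> <= C * A * norm (ch (pw k a) - ch (pw k b)) + (1 * d + (norm (ch (pw k a) - ch (pw k b)) + d))"
   by (intro norm_triangle_mono e1 e2) (simp_all add: d_def)
  also have "\<dots> = q * norm (ch (pw k a) - ch (pw k b)) + 2 * d" by (simp add: q_def algebra_simps)
  also have "\<dots> <= q * (2 * real k * q ^ k * d) + 2 * (q ^ Suc k * d)"
  proof (intro add_mono mult_left_mono)
   show "norm (ch (pw k a) - ch (pw k b)) <= 2 * real k * q ^ k * d" using Suc kN by blast
   have "1 <= q ^ Suc k" using q by (rule one_le_power)
   from mult_right_mono[OF this, of d] show "d <= q ^ Suc k * d" by (simp add: d_def)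
  qed (use q in auto)
  also have "\<dots> = 2 * real (Suc k) * q ^ Suc k * d" by (simp add: algebra_simps)
  finally show ?case .
 qed
 also have "\<dots> <= 2 * real k * 3 * d"
 proof (intro mult_right_mono mult_left_mono)
  have "q ^ k <= exp (C * A) ^ k"
   using q exp_ge_add_one_self[of "C * A"] by (intro power_mono) (auto simp: q_def)
  also have "\<dots> = exp (real k * (C * A))" by (simp add: exp_of_nat_mult)
  also have "\<dots> <= exp 1"
  proof -
   have "real k * (C * A) <= real N * (C * A)" using k C A0 by (intro mult_right_mono) auto
   also have "\<dots> = C * (2 * real N * A) / 2" by simp
   also have "\<dots> <= C * r0 / 2" using N C by (intro divide_right_mono mult_left_mono) auto
   also have "\<dots> <= 1" using Cr by simp
   finally show ?thesis by simp
  qed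
  also have "\<dots> <= 3" by (rule exp_le)
  finally show "q ^ k <= 3" .
 qed (auto simp: d_def)
 finally show ?thesis by (simp add: d_def)
qed

lemma one_parameter_subgroup_0: "one_parameter_subgroup ch v \<gamma> ==> \<gamma> 0 = 0"
proof -
 assume "one_parameter_subgroup ch v \<gamma>"
 hence "\<gamma> (0 + 0) = \<gamma> 0 + \<gamma> 0" unfolding one_parameter_subgroup_def by blast
 hence "\<gamma> 0 + \<gamma> 0 = \<gamma> 0 + 0" by simp
 thus "\<gamma> 0 = 0" by (rule add_left_imp_eq)
qed

lemma one_parameter_near:
 assumes \<gamma>: "one_parameter_subgroup ch v \<gamma>" and e: "e > 0"
 obtains d where "d > 0" "\<And>t. \<bar>t\<bar> < d ==> \<gamma> t \<in> U0 \<and> norm (ch (\<gamma> t) - t *\<^sub>R v) <= e * \<bar>t\<bar>"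
proof -
 have "\<forall>\<^sub>F t in nhds 0. \<gamma> t \<in> U0"
 proof -
  have "isCont \<gamma> 0" using \<gamma> by (simp add: one_parameter_subgroup_def continuous_on_eq_continuous_at)
  hence "\<forall>\<^sub>F t in at 0. \<gamma> t \<in> U0"
   unfolding isCont_def using open_U0 zero_U0 one_parameter_subgroup_0[OF \<gamma>] by (auto intro: topological_tendstoD)
  thus ?thesis using zero_U0 one_parameter_subgroup_0[OF \<gamma>] by (simp add: eventually_nhds_conv_at)
 qed
 then obtain d1 where d1: "d1 > 0" "\<And>t. \<bar>t\<bar> < d1 ==> \<gamma> t \<in> U0" by (auto simp: eventually_nhds_metric dist_real_def)
 have "((%t. ch (\<gamma> t)) has_derivative (%t. t *\<^sub>R v)) (at 0)"
  using \<gamma> by (simp add: one_parameter_subgroup_def has_vector_derivative_def)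
 then obtain d2 where d2: "d2 > 0" "\<And>t. norm (t - 0) < d2 ==>
   norm (ch (\<gamma> t) - ch (\<gamma> 0) - (t - 0) *\<^sub>R v) <= e * norm (t - 0)"
  unfolding has_derivative_at_alt using e by blast
 show ?thesis
 proof (rule that[of "min d1 d2"])
  fix t :: real assume "\<bar>t\<bar> < min d1 d2"
  thus "\<gamma> t \<in> U0 \<and> norm (ch (\<gamma> t) - t *\<^sub>R v) <= e * \<bar>t\<bar>"
   using d1(2)[of t] d2(2)[of t] one_parameter_subgroup_0[OF \<gamma>] by (simp add: ch_0)
 qed (use d1 d2 in auto)
qed

text \<open>Uniqueness: two one-parameter subgroups with the same velocity differ by \<open>o(1/m)\<close> at time
 \<open>t/m\<close>, hence by \<open>m\<close> times as much at time \<open>t\<close>.\<close>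

lemma one_parameter_unique:
 assumes 1: "one_parameter_subgroup ch v \<gamma>1" and 2: "one_parameter_subgroup ch v \<gamma>2"
 shows "\<gamma>1 = \<gamma>2"
proof
 have h1: "\<gamma>1 (s + t) = \<gamma>1 s + \<gamma>1 t" and h2: "\<gamma>2 (s + t) = \<gamma>2 s + \<gamma>2 t" for s t
  using 1 2 by (auto simp: one_parameter_subgroup_def)
 define \<tau> where "\<tau> = r0 / (2 * (norm v + 1))"
 have \<tau>: "\<tau> > 0" "2 * (norm v + 1) * \<tau> = r0"
  using r0 norm_ge_zero[of v] add_nonneg_pos[of "norm v" 1] by (auto simp: \<tau>_def field_simps)
 have small: "\<gamma>1 t = \<gamma>2 t" if t: "\<bar>t\<bar> <= \<tau>" for t
 proof -
  have main: "\<gamma>1 t \<in> U0 \<and> \<gamma>2 t \<in> U0 \<and> norm (ch (\<gamma>1 t) - ch (\<gamma>2 t)) <= 12 * \<bar>t\<bar> * e"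
   if e: "0 < e" "e <= 1" for e
  proof -
   obtain d1 where d1: "d1 > 0" "\<And>t. \<bar>t\<bar> < d1 ==> \<gamma>1 t \<in> U0 \<and> norm (ch (\<gamma>1 t) - t *\<^sub>R v) <= e * \<bar>t\<bar>"
    using one_parameter_near[OF 1 e(1)] by metis
   obtain d2 where d2: "d2 > 0" "\<And>t. \<bar>t\<bar> < d2 ==> \<gamma>2 t \<in> U0 \<and> norm (ch (\<gamma>2 t) - t *\<^sub>R v) <= e * \<bar>t\<bar>"
    using one_parameter_near[OF 2 e(1)] by metis
   obtain N :: nat where N: "N > 0" "\<bar>t\<bar> / real N < min d1 d2"
   proof -
    define d where "d = min d1 d2"
    have d: "d > 0" using d1(1) d2(1) by (simp add: d_def)
    obtain M :: nat where "\<bar>t\<bar> / d < real M" using reals_Archimedean2 by blast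
    hence "\<bar>t\<bar> < real (Suc M) * d" using d by (simp add: field_simps)
    thus ?thesis using that[of "Suc M"] by (simp add: field_simps d_def[symmetric])
   qed
   define u where "u = t / real N"
   have u: "\<bar>u\<bar> < d1" "\<bar>u\<bar> < d2" using N by (auto simp: u_def)
   note n1 = d1(2)[OF u(1)] and n2 = d2(2)[OF u(2)]
   define A where "A = (norm v + 1) * \<bar>u\<bar>"
   have eu: "e * \<bar>u\<bar> <= 1 * \<bar>u\<bar>" using e by (intro mult_right_mono) auto
   have A1: "norm (ch (\<gamma>1 u)) <= A" "norm (ch (\<gamma>2 u)) <= A"
    using n1 n2 eu norm_triangle_ineq2[of "ch (\<gamma>1 u)" "u *\<^sub>R v"] norm_triangle_ineq2[of "ch (\<gamma>2 u)" "u *\<^sub>R v"]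
    by (auto simp: A_def algebra_simps)
   have NA: "2 * real N * A <= r0"
   proof -
    have "2 * real N * A = 2 * (norm v + 1) * \<bar>t\<bar>" using N(1) by (simp add: A_def u_def)
    also have "\<dots> <= 2 * (norm v + 1) * \<tau>" using t by (intro mult_left_mono) auto
    finally show ?thesis using \<tau>(2) by simp
   qed
   have pw: "\<gamma>1 t = pw N (\<gamma>1 u)" "\<gamma>2 t = pw N (\<gamma>2 u)"
    using pw_hom[of \<gamma>1 N u, OF h1] pw_hom[of \<gamma>2 N u, OF h2] N(1) by (simp_all add: u_def)
   have Na: "2 * real N * norm (ch (\<gamma>1 u)) <= r0" "2 * real N * norm (ch (\<gamma>2 u)) <= r0"
    using mult_left_mono[OF A1(1), of "2 * real N"] mult_left_mono[OF A1(2), of "2 * real N"] NA by auto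
   have "norm (ch (\<gamma>1 t) - ch (\<gamma>2 t)) <= 6 * real N * norm (ch (\<gamma>1 u) - ch (\<gamma>2 u))"
    unfolding pw using n1 n2 A1 by (intro pw_diff[OF _ _ _ _ NA]) auto
   also have "\<dots> <= 6 * real N * (2 * (e * \<bar>u\<bar>))"
    using n1 n2 norm_triangle_ineq4[of "ch (\<gamma>1 u) - u *\<^sub>R v" "ch (\<gamma>2 u) - u *\<^sub>R v"]
    by (intro mult_left_mono) auto
   also have "\<dots> = 12 * \<bar>t\<bar> * e" using N(1) by (simp add: u_def)
   finally show ?thesis
    using pw_range(1)[OF _ Na(1) order_refl] pw_range(1)[OF _ Na(2) order_refl] n1 n2 by (simp add: pw)
  qed
  have "norm (ch (\<gamma>1 t) - ch (\<gamma>2 t)) <= 0"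
  proof (rule field_le_epsilon)
   fix e :: real assume e: "e > 0"
   define e' where "e' = min 1 (e / (12 * \<bar>t\<bar> + 1))"
   have "norm (ch (\<gamma>1 t) - ch (\<gamma>2 t)) <= 12 * \<bar>t\<bar> * e'"
    using main[of e'] e by (auto simp: e'_def divide_pos_pos add_nonneg_pos)
   also have "\<dots> <= 12 * \<bar>t\<bar> * (e / (12 * \<bar>t\<bar> + 1))" by (intro mult_left_mono) (auto simp: e'_def)
   also have "\<dots> <= e" using e by (simp add: field_simps)
   finally show "norm (ch (\<gamma>1 t) - ch (\<gamma>2 t)) <= 0 + e" by simp
  qed
  thus ?thesis using main[of 1] by (intro ch_eqD) auto
 qed
 fix t
 obtain M :: nat where M: "\<bar>t\<bar> / \<tau> < real M" using reals_Archimedean2 by blast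
 hence M': "M > 0" using \<tau>(1) by (cases M) (auto simp: field_simps not_less[symmetric])
 have "\<bar>t / real M\<bar> <= \<tau>" using M M' \<tau>(1) by (simp add: field_simps)
 from small[OF this] show "\<gamma>1 t = \<gamma>2 t"
  using pw_hom[of \<gamma>1 M "t / real M", OF h1] pw_hom[of \<gamma>2 M "t / real M", OF h2] M' by simp
qed

end

section \<open>Existence of one-parameter subgroups\<close>

lemma convergent_geometric_steps:
 fixes f :: "nat => 'a::banach"
 assumes "\<And>j. norm (f (Suc j) - f j) <= M / 2 ^ j"
 shows "convergent f"
proof -
 have "summable (%j. M * (1 / 2) ^ j)" by (intro summable_mult summable_geometric) simp
 hence "summable (%j. f (Suc j) - f j)"
  by (rule summable_comparison_test'[of _ 0]) (use assms in \<open>simp add: power_divide\<close>)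
 hence "convergent (%n. \<Sum>j<n. f (Suc j) - f j)" by (rule summable_iff_convergent[THEN iffD1])
 hence "convergent (%n. (f n - f 0) + f 0)"
  unfolding sum_lessThan_telescope by (intro convergent_add convergent_const)
 thus ?thesis by simp
qed

lemma continuous_pw: "continuous_on UNIV (pw k :: 'g::topological_group_add => 'g)"
 by (induction k) (auto intro!: continuous_intros)

lemma pw_uminus: "pw k (- a) = - pw k a"
proof (induction k)
 case (Suc k)
 have "a + pw k a = pw k a + a" by (rule pw_commute[symmetric]) simp
 hence "- (a + pw k a) = - (pw k a + a)" by simp
 thus ?case using Suc by (simp add: minus_add del: add_uminus_conv_diff)
qed simp

context local_group
begin

lemma pw_compare:
 assumes "x \<in> U0" "y \<in> U0" "2 ^ j * norm (ch x) <= r0 / 2" "2 ^ j * norm (ch y) <= r0 / 2"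
 shows "norm (ch (pw (2 ^ j) x) - ch (pw (2 ^ j) y)) <= 6 * 2 ^ j * norm (ch x - ch y)"
  "pw (2 ^ j) x \<in> U0" "norm (ch (pw (2 ^ j) x)) <= r0"
proof -
 define A where "A = r0 / 2 / 2 ^ j"
 have "norm (ch x) <= A" "norm (ch y) <= A" using assms(3,4) by (simp_all add: A_def field_simps)
 from pw_diff[OF assms(1) this(1) assms(2) this(2), of "2 ^ j" "2 ^ j"]
 show "norm (ch (pw (2 ^ j) x) - ch (pw (2 ^ j) y)) <= 6 * 2 ^ j * norm (ch x - ch y)" by (simp add: A_def)
 have "2 * real (2 ^ j) * norm (ch x) <= r0" using assms(3) by simp
 from pw_range[OF assms(1) this order_refl]
 show "pw (2 ^ j) x \<in> U0" "norm (ch (pw (2 ^ j) x)) <= r0" by auto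
qed

context
 fixes v :: 'e
begin

text \<open>The one-parameter subgroup with velocity \<open>v\<close> is the limit of these powers.\<close>

definition approx :: "nat => real => 'g" where
 "approx j t = pw (2 ^ j) (\<iota> ((t / 2 ^ j) *\<^sub>R v))"

lemma div_small: "norm (t *\<^sub>R v) <= r ==> norm ((t / 2 ^ j) *\<^sub>R v) <= r"
proof -
 assume "norm (t *\<^sub>R v) <= r"
 moreover have "norm (t *\<^sub>R v) / 2 ^ j <= norm (t *\<^sub>R v) / 1"
  by (rule divide_left_mono) (auto intro: one_le_power)
 hence "norm ((t / 2 ^ j) *\<^sub>R v) <= norm (t *\<^sub>R v)" by simp
 ultimately show ?thesis by simp
qed

lemma step_ch:
 assumes "norm (t *\<^sub>R v) <= r0"
 shows "\<iota> ((t / 2 ^ j) *\<^sub>R v) \<in> U0" "ch (\<iota> ((t / 2 ^ j) *\<^sub>R v)) = (t / 2 ^ j) *\<^sub>R v"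
  "2 ^ j * norm (ch (\<iota> ((t / 2 ^ j) *\<^sub>R v))) = norm (t *\<^sub>R v)"
 using iota_mem[OF div_small[OF assms]] ch_iota[OF div_small[OF assms]] by auto

lemma approx_range:
 assumes "norm (t *\<^sub>R v) <= r0 / 2"
 shows "approx j t \<in> U0" "norm (ch (approx j t)) <= r0"
  "norm (ch (approx j t) - t *\<^sub>R v) <= C * (norm (t *\<^sub>R v))\<^sup>2"
proof -
 have t: "norm (t *\<^sub>R v) <= r0" using assms r0 by simp
 note s = step_ch[OF t, of j]
 have m: "2 ^ j * norm (ch (\<iota> ((t / 2 ^ j) *\<^sub>R v))) <= r0 / 2" using s(3) assms by simp
 show "approx j t \<in> U0" "norm (ch (approx j t)) <= r0"
  unfolding approx_def using pw_compare(2,3)[OF s(1) s(1) m m] by auto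
 have "2 * real (2 ^ j) * norm (ch (\<iota> ((t / 2 ^ j) *\<^sub>R v))) <= r0" using m by simp
 from pw_quadratic[OF s(1) this order_refl]
 have "norm (ch (approx j t) - real (2 ^ j) *\<^sub>R ch (\<iota> ((t / 2 ^ j) *\<^sub>R v)))
   <= C * (2 ^ j * norm (ch (\<iota> ((t / 2 ^ j) *\<^sub>R v))))\<^sup>2"
  by (simp add: approx_def power_mult_distrib mult_ac)
 thus "norm (ch (approx j t) - t *\<^sub>R v) <= C * (norm (t *\<^sub>R v))\<^sup>2"
  unfolding s(3) s(2) by simp
qed

lemma approx_lipschitz:
 assumes "norm (t *\<^sub>R v) <= r0 / 2" "norm (s *\<^sub>R v) <= r0 / 2"
 shows "norm (ch (approx j t) - ch (approx j s)) <= 6 * \<bar>t - s\<bar> * norm v"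
proof -
 have t: "norm (t *\<^sub>R v) <= r0" "norm (s *\<^sub>R v) <= r0" using assms r0 by auto
 note s = step_ch[OF t(1), of j] and s' = step_ch[OF t(2), of j]
 have "norm (ch (approx j t) - ch (approx j s)) <= 6 * 2 ^ j * norm ((t / 2 ^ j) *\<^sub>R v - (s / 2 ^ j) *\<^sub>R v)"
  unfolding approx_def using pw_compare(1)[OF s(1) s'(1), of j] s(2,3) s'(2,3) assms by simp
 also have "(t / 2 ^ j) *\<^sub>R v - (s / 2 ^ j) *\<^sub>R v = ((t - s) / 2 ^ j) *\<^sub>R v"
  by (simp add: scaleR_diff_left[symmetric] diff_divide_distrib)
 also have "6 * 2 ^ j * norm \<dots> = 6 * \<bar>t - s\<bar> * norm v" by simp
 finally show ?thesis .
qed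

text \<open>Two families of base points that agree up to \<open>o(2\<^sup>-\<^sup>j)\<close> have powers with the same limit.\<close>

lemma same_limit:
 assumes lim: "(%j. pw (2 ^ j) (x j)) \<longlonglongrightarrow> l" "(%j. pw (2 ^ j) (y j)) \<longlonglongrightarrow> l'"
  and x: "\<And>j. x j \<in> U0" "\<And>j. 2 ^ j * norm (ch (x j)) <= r0 / 2"
  and y: "\<And>j. y j \<in> U0" "\<And>j. 2 ^ j * norm (ch (y j)) <= r0 / 2"
  and d: "\<And>j. 2 ^ j * norm (ch (x j) - ch (y j)) <= M / 2 ^ j"
 shows "l = l'"
proof -
 define p where "p j = ch (pw (2 ^ j) (x j))" for j
 define q where "q j = ch (pw (2 ^ j) (y j))" for j
 have "(%j. p j - q j) \<longlonglongrightarrow> 0"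
 proof (rule Lim_null_comparison)
  show "\<forall>\<^sub>F j in sequentially. norm (p j - q j) <= 6 * (M * (1 / 2) ^ j)"
  proof (rule always_eventually, rule allI)
   fix j
   have "norm (p j - q j) <= 6 * (2 ^ j * norm (ch (x j) - ch (y j)))"
    unfolding p_def q_def using pw_compare(1)[OF x(1) y(1) x(2) y(2), of j] by simp
   also have "\<dots> <= 6 * (M / 2 ^ j)" by (intro mult_left_mono d) auto
   finally show "norm (p j - q j) <= 6 * (M * (1 / 2) ^ j)" by (simp add: power_divide)
  qed
  have "(%j. (1 / 2 :: real) ^ j) \<longlonglongrightarrow> 0" by (rule LIMSEQ_realpow_zero) auto
  thus "(%j. 6 * (M * (1 / 2 :: real) ^ j)) \<longlonglongrightarrow> 0" by (auto intro!: tendsto_eq_intros)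
 qed
 have W: "pw (2 ^ j) (x j) \<in> W r0" "pw (2 ^ j) (y j) \<in> W r0" for j
  using pw_compare(2,3)[OF x(1) x(1) x(2) x(2), of j] pw_compare(2,3)[OF y(1) y(1) y(2) y(2), of j]
  by (auto simp: W_def)
 have cl: "closed (W r0)" by (intro compact_imp_closed compact_W) simp
 have l: "l \<in> W r0" "l' \<in> W r0"
  using closed_sequentially[OF cl _ lim(1)] closed_sequentially[OF cl _ lim(2)] W by auto
 have "isCont ch l" "isCont ch l'"
  using cont_ch open_U0 l by (auto simp: W_def continuous_on_eq_continuous_at)
 hence "p \<longlonglongrightarrow> ch l" "q \<longlonglongrightarrow> ch l'"
  unfolding p_def q_def using lim by (auto intro: isCont_tendsto_compose)
 hence "(%j. p j - q j) \<longlonglongrightarrow> ch l - ch l'" by (rule tendsto_diff)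
 hence "ch l - ch l' = 0" using \<open>(%j. p j - q j) \<longlonglongrightarrow> 0\<close> by (rule LIMSEQ_unique)
 thus ?thesis using l by (intro ch_eqD) (auto simp: W_def)
qed

text \<open>Passing from \<open>j\<close> to \<open>j + 1\<close> replaces the base point by the square of a point at half the distance;
 the two differ by \<open>O(4\<^sup>-\<^sup>j)\<close>, which the power \<open>2\<^sup>j\<close> turns into \<open>O(2\<^sup>-\<^sup>j)\<close>.\<close>

lemma approx_convergent:
 assumes t: "norm (t *\<^sub>R v) <= r0 / 4"
 shows "convergent (%j. ch (approx j t))"
proof (rule convergent_geometric_steps)
 fix j
 have t': "norm (t *\<^sub>R v) <= r0" "norm (t *\<^sub>R v) <= r0 / 2" using t r0 by auto
 note s = step_ch[OF t'(1), of j] and s' = step_ch[OF t'(1), of "Suc j"]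
 define x where "x = \<iota> ((t / 2 ^ Suc j) *\<^sub>R v)"
 have x: "x \<in> U0" "ch x = (t / 2 ^ Suc j) *\<^sub>R v" unfolding x_def by (rule s')+
 have nx: "norm (ch x) = norm (t *\<^sub>R v) / 2 ^ Suc j" using s'(3) by (simp add: x_def field_simps)
 also have "\<dots> <= norm (t *\<^sub>R v) / 1" by (rule divide_left_mono) (auto simp del: power_Suc intro: one_le_power)
 finally have "2 * real 2 * norm (ch x) <= r0" using t by simp
 note p = pw_small[OF x(1) this order_refl] pw_quadratic[OF x(1) this order_refl]
 have "2 ^ j * norm (ch (pw 2 x)) <= 2 ^ j * (9 / 8 * 2 * norm (ch x))" using p(1) by (intro mult_left_mono) auto
 also have "\<dots> = 9 / 8 * norm (t *\<^sub>R v)" by (simp add: nx)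
 also have "\<dots> <= r0 / 2" using t r0 by simp
 finally have small: "2 ^ j * norm (ch (pw 2 x)) <= r0 / 2" .
 have "approx (Suc j) t = pw (2 ^ j) (pw 2 x)" unfolding approx_def x_def by (simp add: pw_mult[symmetric] mult.commute)
 hence "norm (ch (approx (Suc j) t) - ch (approx j t)) <= 6 * 2 ^ j * norm (ch (pw 2 x) - (t / 2 ^ j) *\<^sub>R v)"
  unfolding approx_def using pw_compare(1)[OF _ s(1) small, of] p(1) s(2,3) t'(2) by simp
 also have "(t / 2 ^ j) *\<^sub>R v = real 2 *\<^sub>R ch x" by (simp add: x)
 also have "6 * 2 ^ j * norm (ch (pw 2 x) - real 2 *\<^sub>R ch x) <= 6 * 2 ^ j * (C * (real 2)\<^sup>2 * (norm (ch x))\<^sup>2)"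
  by (intro mult_left_mono p) auto
 also have "\<dots> = (6 * C * (norm (t *\<^sub>R v))\<^sup>2) / 2 ^ j"
  unfolding nx by (simp add: power_divide power2_eq_square field_simps)
 finally show "norm (ch (approx (Suc j) t) - ch (approx j t)) <= (6 * C * (norm (t *\<^sub>R v))\<^sup>2) / 2 ^ j" .
qed

definition flow :: "real => 'g" where "flow t = lim (%j. approx j t)"

lemma approx_shift: "approx (j + m) t = pw (2 ^ m) (approx j (t / 2 ^ m))"
 unfolding approx_def by (simp add: pw_mult[symmetric] power_add mult.commute)

lemma scale_small:
 assumes "r > 0"
 obtains m :: nat where "norm ((t / 2 ^ m) *\<^sub>R v) <= r"
proof -
 obtain m :: nat where "norm (t *\<^sub>R v) / r < real m" using reals_Archimedean2 by blast
 also have "real m <= 2 ^ m" by (simp add: of_nat_less_two_power less_imp_le)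
 finally have "norm (t *\<^sub>R v) <= r * 2 ^ m" using assms by (simp add: field_simps)
 hence "norm ((t / 2 ^ m) *\<^sub>R v) <= r" by (simp add: field_simps)
 thus ?thesis by (rule that)
qed

lemma flow_lim: "(%j. approx j t) \<longlonglongrightarrow> flow t"
proof -
 obtain m :: nat where m: "norm ((t / 2 ^ m) *\<^sub>R v) <= r0 / 4" using scale_small[of "r0 / 4" t] r0 by auto
 define s where "s = t / 2 ^ m"
 obtain l where l: "(%j. ch (approx j s)) \<longlonglongrightarrow> l"
  using approx_convergent m unfolding s_def[symmetric] convergent_def by blast
 have r: "approx j s \<in> U0" "norm (ch (approx j s)) <= r0" for j
  using approx_range(1,2)[of s j] m[folded s_def] r0 by linarith+
 have "norm l <= r0" by (rule LIMSEQ_le_const2[OF tendsto_norm[OF l]]) (use r in auto)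
 hence "(%j. \<iota> (ch (approx j s))) \<longlonglongrightarrow> \<iota> l"
  by (intro continuous_on_tendsto_compose[OF cont_iota l]) (use r in auto)
 hence "(%j. approx j s) \<longlonglongrightarrow> \<iota> l" using iota_ch r by simp
 hence "(%j. pw (2 ^ m) (approx j s)) \<longlonglongrightarrow> pw (2 ^ m) (\<iota> l)"
  by (intro continuous_on_tendsto_compose[OF continuous_pw]) auto
 hence "(%j. approx (j + m) t) \<longlonglongrightarrow> pw (2 ^ m) (\<iota> l)" by (simp add: approx_shift s_def)
 hence "(%j. approx j t) \<longlonglongrightarrow> pw (2 ^ m) (\<iota> l)" by (rule LIMSEQ_offset)
 thus ?thesis unfolding flow_def by (metis limI)
qed

lemma flow_pow2: "flow t = pw (2 ^ m) (flow (t / 2 ^ m))"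
proof -
 have "(%j. approx (j + m) t) \<longlonglongrightarrow> flow t" using flow_lim by (rule LIMSEQ_ignore_initial_segment)
 moreover have "(%j. pw (2 ^ m) (approx j (t / 2 ^ m))) \<longlonglongrightarrow> pw (2 ^ m) (flow (t / 2 ^ m))"
  by (intro continuous_on_tendsto_compose[OF continuous_pw flow_lim]) auto
 ultimately show ?thesis unfolding approx_shift by (rule LIMSEQ_unique)
qed

lemma flow_range:
 assumes t: "norm (t *\<^sub>R v) <= r0 / 2"
 shows "flow t \<in> U0" "norm (ch (flow t)) <= r0" "(%j. ch (approx j t)) \<longlonglongrightarrow> ch (flow t)"
proof -
 have "flow t \<in> W r0"
  by (rule closed_sequentially[OF compact_imp_closed[OF compact_W[OF order_refl]] _ flow_lim])
   (use approx_range[OF t] in \<open>simp add: W_def\<close>)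
 thus w: "flow t \<in> U0" "norm (ch (flow t)) <= r0" by (auto simp: W_def)
 hence "isCont ch (flow t)" using cont_ch open_U0 by (simp add: continuous_on_eq_continuous_at)
 thus "(%j. ch (approx j t)) \<longlonglongrightarrow> ch (flow t)" using flow_lim by (rule isCont_tendsto_compose)
qed

lemma flow_quadratic:
 assumes t: "norm (t *\<^sub>R v) <= r0 / 2"
 shows "norm (ch (flow t) - t *\<^sub>R v) <= C * (norm (t *\<^sub>R v))\<^sup>2"
 by (rule LIMSEQ_le_const2[OF tendsto_norm[OF tendsto_diff[OF flow_range(3)[OF t] tendsto_const]]])
  (use approx_range(3)[OF t] in auto)

lemma flow_lipschitz:
 assumes t: "norm (t *\<^sub>R v) <= r0 / 2" and s: "norm (s *\<^sub>R v) <= r0 / 2"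
 shows "norm (ch (flow t) - ch (flow s)) <= 6 * \<bar>t - s\<bar> * norm v"
 by (rule LIMSEQ_le_const2[OF tendsto_norm[OF tendsto_diff[OF flow_range(3)[OF t] flow_range(3)[OF s]]]])
  (use approx_lipschitz[OF t s] in auto)

text \<open>The \<open>k\<close>-th power of a point at distance \<open>t / 2\<^sup>j\<close> differs by \<open>O(4\<^sup>-\<^sup>j)\<close> from the point at distance
 \<open>k * t / 2\<^sup>j\<close>.\<close>

lemma flow_multiple_small:
 assumes kt: "norm ((real k * t) *\<^sub>R v) <= r0 / 4" and k: "k > 0"
 shows "flow (real k * t) = pw k (flow t)"
proof (rule same_limit)
 define x where "x j = \<iota> ((t / 2 ^ j) *\<^sub>R v)" for j
 define y where "y j = \<iota> ((real k * t / 2 ^ j) *\<^sub>R v)" for j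
 have "norm (t *\<^sub>R v) <= norm ((real k * t) *\<^sub>R v)" using k by (auto simp: abs_mult mult_le_cancel_right1 intro!: mult_right_mono)
 hence t: "norm (t *\<^sub>R v) <= r0" "norm ((real k * t) *\<^sub>R v) <= r0" using kt r0 by auto
 note sx = step_ch[OF t(1), folded x_def] and sy = step_ch[OF t(2), folded y_def]
 show "(%j. pw (2 ^ j) (y j)) \<longlonglongrightarrow> flow (real k * t)" using flow_lim[of "real k * t"] by (simp add: approx_def y_def)
 have "(%j. pw k (approx j t)) \<longlonglongrightarrow> pw k (flow t)"
  by (intro continuous_on_tendsto_compose[OF continuous_pw flow_lim]) auto
 thus "(%j. pw (2 ^ j) (pw k (x j))) \<longlonglongrightarrow> pw k (flow t)"
  by (simp add: approx_def x_def pw_mult[symmetric] mult.commute)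
 fix j
 have kx: "real k * (2 ^ j * norm (ch (x j))) = norm ((real k * t) *\<^sub>R v)" unfolding sx(3) by (simp add: abs_mult)
 have "1 * (real k * norm (ch (x j))) <= 2 ^ j * (real k * norm (ch (x j)))" by (intro mult_right_mono) auto
 hence "2 * real k * norm (ch (x j)) <= r0" using kx kt r0 by (simp add: mult_ac)
 note p = pw_small[OF sx(1) this order_refl] pw_quadratic[OF sx(1) this order_refl]
 show "y j \<in> U0" "pw k (x j) \<in> U0" using sy(1) p(1) by auto
 show "2 ^ j * norm (ch (y j)) <= r0 / 2" unfolding sy(3) using kt r0 by simp
 have "2 ^ j * norm (ch (pw k (x j))) <= 2 ^ j * (9 / 8 * real k * norm (ch (x j)))" using p(1) by (intro mult_left_mono) auto
 also have "\<dots> = 9 / 8 * (real k * (2 ^ j * norm (ch (x j))))" by simp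
 also have "\<dots> <= r0 / 2" unfolding kx using kt r0 by linarith
 finally show "2 ^ j * norm (ch (pw k (x j))) <= r0 / 2" .
 have yx: "ch (y j) = real k *\<^sub>R ch (x j)" by (simp add: sx sy)
 have "2 ^ j * norm (ch (y j) - ch (pw k (x j))) <= 2 ^ j * (C * (real k)\<^sup>2 * (norm (ch (x j)))\<^sup>2)"
  unfolding yx by (subst norm_minus_commute) (intro mult_left_mono p, simp)
 also have "\<dots> = C * (real k * (2 ^ j * norm (ch (x j))))\<^sup>2 / 2 ^ j" by (simp add: power_mult_distrib power2_eq_square)
 finally show "2 ^ j * norm (ch (y j) - ch (pw k (x j))) <= C * (norm ((real k * t) *\<^sub>R v))\<^sup>2 / 2 ^ j"
  unfolding kx .
qed

lemma flow_multiple: "flow (real k * t) = pw k (flow t)"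
proof (cases "k = 0")
 case True
 have "approx j 0 = 0" for j
 proof -
  have "pw m (0::'g) = 0" for m by (induction m) auto
  thus ?thesis by (simp add: approx_def iota_0)
 qed
 hence "flow 0 = 0" using flow_lim[of 0] by (simp add: LIMSEQ_const_iff)
 thus ?thesis using True by simp
next
 case False
 obtain m :: nat where m: "norm ((real k * t / 2 ^ m) *\<^sub>R v) <= r0 / 4" using scale_small[of "r0 / 4" "real k * t"] r0 by auto
 have "flow (real k * t) = pw (2 ^ m) (flow (real k * (t / 2 ^ m)))" using flow_pow2[of "real k * t" m] by simp
 also have "flow (real k * (t / 2 ^ m)) = pw k (flow (t / 2 ^ m))" using m False by (intro flow_multiple_small) auto
 also have "pw (2 ^ m) (pw k (flow (t / 2 ^ m))) = pw k (pw (2 ^ m) (flow (t / 2 ^ m)))"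
  by (simp add: pw_mult[symmetric] mult.commute)
 finally show ?thesis by (simp add: flow_pow2[symmetric])
qed

lemma ch_uminus_quadratic:
 assumes a: "a \<in> U0" "norm (ch a) <= r0 / 2"
 shows "norm (ch (- a) + ch a) <= 2 * C * (norm (ch a))\<^sup>2"
proof -
 have a': "norm (ch a) <= r0" using a(2) r0 by simp
 note m = minus_mem[OF a(1) a'] ch_minus[OF a(1) a']
 have m2: "norm (ch (- a)) <= r0" using m(2) a(2) by linarith
 have "norm (ch (a + - a) - ch a - ch (- a)) <= C * norm (ch a) * norm (ch (- a))"
  by (rule beta[OF a(1) m(1) a' m2])
 also have "\<dots> <= C * norm (ch a) * (2 * norm (ch a))" using m(2) C by (intro mult_left_mono) auto
 also have "ch (a + - a) - ch a - ch (- a) = - (ch (- a) + ch a)" by (simp add: ch_0)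
 finally show ?thesis unfolding norm_minus_cancel by (simp add: power2_eq_square mult_ac)
qed

lemma flow_uminus: "flow (- t) = - flow t"
proof -
 have small: "flow (- s) = - flow s" if s: "norm (s *\<^sub>R v) <= r0 / 4" for s
 proof (rule same_limit)
  define x where "x j = \<iota> ((s / 2 ^ j) *\<^sub>R v)" for j
  define y where "y j = \<iota> ((- s / 2 ^ j) *\<^sub>R v)" for j
  have s': "norm (s *\<^sub>R v) <= r0" "norm ((- s) *\<^sub>R v) <= r0" using s r0 by auto
  note sx = step_ch[OF s'(1), folded x_def] and sy = step_ch[OF s'(2), folded y_def]
  show "(%j. pw (2 ^ j) (y j)) \<longlonglongrightarrow> flow (- s)" using flow_lim[of "- s"] by (simp add: approx_def y_def)
  have "(%j. - approx j s) \<longlonglongrightarrow> - flow s" by (intro tendsto_minus flow_lim)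
  thus "(%j. pw (2 ^ j) (- x j)) \<longlonglongrightarrow> - flow s" by (simp add: approx_def x_def pw_uminus)
  fix j
  have nx: "norm (ch (x j)) <= r0 / 4" unfolding sx(2) by (rule div_small[OF s])
  hence nx': "norm (ch (x j)) <= r0" "norm (ch (x j)) <= r0 / 2" using r0 by auto
  show "y j \<in> U0" "- x j \<in> U0" using sy(1) minus_mem[OF sx(1) nx'(1)] by auto
  show "2 ^ j * norm (ch (y j)) <= r0 / 2" unfolding sy(3) using s r0 by simp
  have "2 ^ j * norm (ch (- x j)) <= 2 ^ j * (2 * norm (ch (x j)))"
   using ch_minus[OF sx(1) nx'(1)] by (intro mult_left_mono) auto
  also have "\<dots> = 2 * (2 ^ j * norm (ch (x j)))" by simp
  also have "\<dots> <= r0 / 2" unfolding sx(3) using s by simp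
  finally show "2 ^ j * norm (ch (- x j)) <= r0 / 2" .
  have "ch (y j) - ch (- x j) = - (ch (- x j) + ch (x j))" by (simp add: sx sy)
  hence "2 ^ j * norm (ch (y j) - ch (- x j)) = 2 ^ j * norm (ch (- x j) + ch (x j))" by (simp only: norm_minus_cancel)
  also have "\<dots> <= 2 ^ j * (2 * C * (norm (ch (x j)))\<^sup>2)"
   by (intro mult_left_mono ch_uminus_quadratic sx nx') auto
  also have "\<dots> = 2 * C * (2 ^ j * norm (ch (x j)))\<^sup>2 / 2 ^ j" by (simp add: power_mult_distrib power2_eq_square)
  finally show "2 ^ j * norm (ch (y j) - ch (- x j)) <= 2 * C * (norm (s *\<^sub>R v))\<^sup>2 / 2 ^ j" unfolding sx(3) .
 qed
 obtain m :: nat where m: "norm ((t / 2 ^ m) *\<^sub>R v) <= r0 / 4" using scale_small[of "r0 / 4" t] r0 by auto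
 have "flow (- t) = pw (2 ^ m) (flow (- (t / 2 ^ m)))" using flow_pow2[of "- t" m] by simp
 also have "\<dots> = - pw (2 ^ m) (flow (t / 2 ^ m))" by (simp only: small[OF m] pw_uminus)
 finally show ?thesis by (simp only: flow_pow2[symmetric])
qed

lemma continuous_flow: "continuous_on UNIV flow"
proof (rule continuous_at_imp_continuous_on, rule ballI)
 fix t
 obtain m :: nat where m: "norm ((t / 2 ^ m) *\<^sub>R v) <= r0 / 4" using scale_small[of "r0 / 4" t] r0 by auto
 define s where "s = t / 2 ^ m"
 define S where "S = {s. norm (s *\<^sub>R v) < r0 / 2}"
 have S: "open S" unfolding S_def by (intro open_Collect_less continuous_intros)
 have "continuous_on S (%s. ch (flow s))"
  by (rule lipschitz_on_continuous_on[of "6 * norm v"], rule lipschitz_onI)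
   (use flow_lipschitz in \<open>auto simp: S_def dist_norm less_imp_le mult_ac\<close>)
 hence "continuous_on S (%s. \<iota> (ch (flow s)))"
  by (rule continuous_on_compose2[OF cont_iota]) (use flow_range(2) in \<open>auto simp: S_def less_imp_le\<close>)
 moreover have "\<iota> (ch (flow s)) = flow s" if "s \<in> S" for s
  using flow_range(1)[of s] that by (intro iota_ch) (simp add: S_def)
 ultimately have "continuous_on S flow" by (simp cong: continuous_on_cong)
 moreover have "s \<in> S" using m[folded s_def] r0 unfolding S_def mem_Collect_eq by linarith
 ultimately have "isCont flow s" using S by (simp add: continuous_on_eq_continuous_at)
 hence "isCont flow (t / 2 ^ m)" by (simp only: s_def)
 moreover have "isCont (%t. t / 2 ^ m) t" by (intro continuous_intros) simp
 ultimately have "isCont (%t. flow (t / 2 ^ m)) t" by (rule isCont_o2[rotated])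
 moreover have "isCont (pw (2 ^ m)) (flow (t / 2 ^ m))"
  using continuous_pw[where 'g='g, of "2 ^ m"] by (simp only: continuous_on_eq_continuous_at open_UNIV) blast
 ultimately have "isCont (%t. pw (2 ^ m) (flow (t / 2 ^ m))) t" by (rule isCont_o2)
 moreover have "(%t. pw (2 ^ m) (flow (t / 2 ^ m))) = flow" by (rule ext) (rule flow_pow2[symmetric])
 ultimately show "isCont flow t" by (rule back_subst[of "%h. isCont h t"])
qed

text \<open>For commensurable nonnegative times the identity follows from \<open>flow_multiple\<close>; continuity extends it to
 all nonnegative times and \<open>flow_uminus\<close> to negative ones.\<close>

lemma flow_add: "flow (s + t) = flow s + flow t"
proof -
 have isC: "isCont flow t" for t using continuous_flow by (simp add: continuous_on_eq_continuous_at)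
 have pos: "flow (s + t) = flow s + flow t" if st: "s \<ge> 0" "t \<ge> 0" for s t
 proof -
  define q where "q r m = real (nat \<lfloor>r * real (Suc m)\<rfloor>) * (1 / real (Suc m))" for r m
  have q: "q r \<longlonglongrightarrow> r" if "r \<ge> 0" for r
  proof (rule LIM_zero_cancel, rule Lim_null_comparison)
   show "\<forall>\<^sub>F m in sequentially. norm (q r m - r) <= inverse (real (Suc m))"
   proof (rule always_eventually, rule allI)
    fix m
    have "r * real (Suc m) - 1 <= real_of_int \<lfloor>r * real (Suc m)\<rfloor>" "real_of_int \<lfloor>r * real (Suc m)\<rfloor> <= r * real (Suc m)"
     by linarith+
    moreover have "0 <= \<lfloor>r * real (Suc m)\<rfloor>" using that by simp
    moreover have "q r m - r = (real_of_int \<lfloor>r * real (Suc m)\<rfloor> - r * real (Suc m)) / real (Suc m)"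
     using \<open>0 <= \<lfloor>r * real (Suc m)\<rfloor>\<close> by (simp add: q_def diff_divide_distrib)
    ultimately show "norm (q r m - r) <= inverse (real (Suc m))"
     unfolding inverse_eq_divide by (simp only: real_norm_def abs_divide) (intro frac_le; linarith)
   qed
   show "(%m. inverse (real (Suc m))) \<longlonglongrightarrow> 0" by (rule LIMSEQ_inverse_real_of_nat)
  qed
  have "flow (q s m + q t m) = flow (q s m) + flow (q t m)" for m
  proof -
   have "q s m + q t m = real (nat \<lfloor>s * real (Suc m)\<rfloor> + nat \<lfloor>t * real (Suc m)\<rfloor>) * (1 / real (Suc m))"
    unfolding q_def by (simp add: distrib_right add_divide_distrib)
   thus ?thesis unfolding q_def by (simp only: flow_multiple pw_add)
  qed
  moreover have "(%m. flow (q s m + q t m)) \<longlonglongrightarrow> flow (s + t)"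
   by (intro isCont_tendsto_compose[OF isC] tendsto_add q st)
  moreover have "(%m. flow (q s m) + flow (q t m)) \<longlonglongrightarrow> flow s + flow t"
   by (intro tendsto_add isCont_tendsto_compose[OF isC] q st)
  ultimately show ?thesis using LIMSEQ_unique by simp
 qed
 have rdiff: "flow (s + t) = flow s + flow t" if "s \<ge> 0" "t <= 0" "s + t \<ge> 0" for s t
  using pos[of "s + t" "- t"] that by (simp add: flow_uminus add.assoc del: add_uminus_conv_diff)
 have ldiff: "flow (s + t) = flow s + flow t" if "s <= 0" "t \<ge> 0" "s + t \<ge> 0" for s t
  using pos[of "- s" "s + t"] that by (simp add: flow_uminus add.assoc[symmetric] del: add_uminus_conv_diff)
 have nonneg: "flow (s + t) = flow s + flow t" if "s + t \<ge> 0" for s t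
  using pos[of s t] rdiff[of s t] ldiff[of s t] that by linarith
 show ?thesis
 proof (cases "s + t \<ge> 0")
  case False
  hence "flow (- t + - s) = flow (- t) + flow (- s)" by (intro nonneg) simp
  moreover have "- t + - s = - (s + t)" by simp
  ultimately have "- flow (s + t) = - flow t + - flow s" by (simp only: flow_uminus)
  hence "- flow (s + t) = - (flow s + flow t)" by (simp only: minus_add)
  thus ?thesis by (simp only: neg_equal_iff_equal)
 qed (rule nonneg)
qed

lemma flow_one_parameter_subgroup: "one_parameter_subgroup ch v flow"
 unfolding one_parameter_subgroup_def
proof (intro conjI allI continuous_flow flow_add)
 have f0: "ch (flow 0) = 0" using flow_multiple[of 0 0] by (simp add: ch_0)
 define D where "D = r0 / (2 * (norm v + 1))"
 have v1: "norm v + 1 > 0" by (rule add_nonneg_pos) auto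
 have D: "D > 0" using r0 v1 by (simp add: D_def)
 have "((%t. ch (flow t)) has_derivative (%t. t *\<^sub>R v)) (at 0)"
  unfolding has_derivative_at_alt
 proof (intro conjI allI impI)
  show "bounded_linear (%t. t *\<^sub>R v)" by (rule bounded_linear_scaleR_left)
  fix e :: real assume e: "e > 0"
  define M where "M = C * (norm v)\<^sup>2 + 1"
  have M: "M > 0" using C by (simp add: M_def add_nonneg_pos)
  show "\<exists>d>0. \<forall>y. norm (y - 0) < d --> norm (ch (flow y) - ch (flow 0) - (y - 0) *\<^sub>R v) <= e * norm (y - 0)"
  proof (intro exI[of _ "min D (e / M)"] conjI allI impI)
   fix y :: real assume "norm (y - 0) < min D (e / M)"
   hence y: "\<bar>y\<bar> <= D" "\<bar>y\<bar> <= e / M" by auto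
   have "norm (y *\<^sub>R v) <= D * (norm v + 1)" using y D by (auto intro!: mult_mono)
   also have "\<dots> = r0 / 2" using v1 by (simp add: D_def field_simps)
   finally have "norm (ch (flow y) - y *\<^sub>R v) <= C * (norm (y *\<^sub>R v))\<^sup>2" by (rule flow_quadratic)
   also have "\<dots> = C * (norm v)\<^sup>2 * (\<bar>y\<bar> * \<bar>y\<bar>)" by (simp add: power_mult_distrib power2_eq_square)
   also have "\<dots> <= M * (\<bar>y\<bar> * \<bar>y\<bar>)" by (intro mult_right_mono) (auto simp: M_def)
   also have "\<dots> <= M * (e / M * \<bar>y\<bar>)" using y M by (intro mult_left_mono mult_right_mono) auto
   also have "\<dots> = e * \<bar>y\<bar>" using M by simp
   finally show "norm (ch (flow y) - ch (flow 0) - (y - 0) *\<^sub>R v) <= e * norm (y - 0)" by (simp add: f0)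
  qed (use D e M in auto)
 qed
 thus "((%t. ch (flow t)) has_vector_derivative v) (at 0)" by (simp add: has_vector_derivative_def)
qed

end

end

section \<open>Coordinates of the second kind\<close>

context local_group
begin

lemma lie_exp_flow: "lie_exp ch v = flow v 1"
proof -
 have "(THE \<gamma>. one_parameter_subgroup ch v \<gamma>) = flow v"
 proof (rule the_equality)
  show "one_parameter_subgroup ch v (flow v)" by (rule flow_one_parameter_subgroup)
  show "\<gamma> = flow v" if "one_parameter_subgroup ch v \<gamma>" for \<gamma>
   by (rule one_parameter_unique[OF that flow_one_parameter_subgroup])
 qed
 thus ?thesis by (simp add: lie_exp_def)
qed

lemma flow_scaleR: "flow (t *\<^sub>R v) s = flow v (t * s)"
proof -
 have f: "one_parameter_subgroup ch v (flow v)" by (rule flow_one_parameter_subgroup)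
 have d: "((%s. ch (flow v s)) has_vector_derivative v) (at (t * 0))" using f by (simp add: one_parameter_subgroup_def)
 have "((%s. t * s) has_vector_derivative t) (at 0)" by (auto intro!: derivative_eq_intros)
 from vector_diff_chain_at[OF this d] have "((%s. ch (flow v (t * s))) has_vector_derivative t *\<^sub>R v) (at 0)"
  by (simp add: o_def)
 moreover have "continuous_on UNIV (%s. flow v (t * s))"
  by (rule continuous_on_compose2[OF continuous_flow[of v]]) (auto intro!: continuous_intros)
 ultimately have "one_parameter_subgroup ch (t *\<^sub>R v) (%s. flow v (t * s))"
  by (simp add: one_parameter_subgroup_def distrib_left flow_add)
 from one_parameter_unique[OF flow_one_parameter_subgroup this] show ?thesis by metis
qed

definition e :: "nat => real => 'g" where "e k t = lie_exp ch (t *\<^sub>R X k)"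

lemma e_flow: "e k = flow (X k)"
 by (rule ext) (simp add: e_def lie_exp_flow flow_scaleR)

lemma e_add: "e k (s + t) = e k s + e k t" by (simp add: e_flow flow_add)

lemma e_uminus: "e k (- t) = - e k t" by (simp add: e_flow flow_uminus)

lemma e_0: "e k 0 = 0" using flow_multiple[of "X k" 0 0] by (simp add: e_flow)

lemma continuous_e: "continuous_on UNIV (e k)" by (simp add: e_flow continuous_flow)

lemma flow_strict_derivative:
 assumes \<delta>: "\<delta> > 0"
 obtains r where "r > 0"
  "\<And>t t'. \<bar>t\<bar> <= r ==> \<bar>t'\<bar> <= r ==> flow v t \<in> U0 \<and> norm (ch (flow v t)) <= \<delta> \<and>
   norm (ch (flow v t) - ch (flow v t') - (t - t') *\<^sub>R v) <= \<delta> * \<bar>t - t'\<bar>"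
proof -
 define b where "b = norm v + 1"
 have b: "b > 0" "norm v <= b" by (auto simp: b_def add_nonneg_pos)
 define r where "r = min (min (r0 / (4 * b)) (\<delta> / (2 * b))) (\<delta> / (6 * (C + 1) * b\<^sup>2))"
 have r: "r > 0" using r0 b \<delta> C by (simp add: r_def)
 have rb: "r <= r0 / (4 * b)" "r <= \<delta> / (2 * b)" "r <= \<delta> / (6 * (C + 1) * b\<^sup>2)" by (auto simp: r_def)
 have rb': "4 * (r * b) <= r0" "2 * (r * b) <= \<delta>" "6 * (C + 1) * b\<^sup>2 * r <= \<delta>"
 proof -
  have "r * (6 * (C + 1) * b\<^sup>2) <= \<delta>" using rb(3) b C by (subst (asm) pos_le_divide_eq) auto
  thus "6 * (C + 1) * b\<^sup>2 * r <= \<delta>" by (simp add: mult_ac)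
 qed (use rb b in \<open>simp_all add: field_simps\<close>)
 have tv: "norm (t *\<^sub>R v) <= \<bar>t\<bar> * b" for t using b by (auto intro: mult_left_mono)
 have sm: "flow v t \<in> U0 \<and> norm (ch (flow v t)) <= 2 * (\<bar>t\<bar> * b) \<and> norm (ch (flow v t)) <= r0 \<and>
   norm (ch (flow v t) - t *\<^sub>R v) <= C * (\<bar>t\<bar> * b)\<^sup>2" if t: "\<bar>t\<bar> <= 2 * r" for t
 proof -
  have "\<bar>t\<bar> * b <= 2 * r * b" using t b by (intro mult_right_mono) auto
  hence tb: "\<bar>t\<bar> * b <= r0 / 2" using rb' by simp
  have h: "norm (t *\<^sub>R v) <= r0 / 2" using tv[of t] tb by linarith
  have q: "norm (ch (flow v t) - t *\<^sub>R v) <= C * (norm (t *\<^sub>R v))\<^sup>2" by (rule flow_quadratic[OF h])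
  also have "\<dots> <= C * (\<bar>t\<bar> * b)\<^sup>2" using tv[of t] C by (intro mult_left_mono power_mono) auto
  finally have q': "norm (ch (flow v t) - t *\<^sub>R v) <= C * (\<bar>t\<bar> * b)\<^sup>2" .
  also have "C * (\<bar>t\<bar> * b)\<^sup>2 = (C * (\<bar>t\<bar> * b)) * (\<bar>t\<bar> * b)" by (simp add: power2_eq_square)
  also have "\<dots> <= (1/8) * (\<bar>t\<bar> * b)"
  proof (rule mult_right_mono)
   have "C * (\<bar>t\<bar> * b) <= C * r0" using C tb r0 by (intro mult_left_mono) auto
   thus "C * (\<bar>t\<bar> * b) <= 1/8" using Cr by simp
  qed (use b in simp)
  finally have "norm (ch (flow v t)) <= 2 * (\<bar>t\<bar> * b)"
   using tv[of t] norm_triangle_ineq2[of "ch (flow v t)" "t *\<^sub>R v"] mult_nonneg_nonneg[of "\<bar>t\<bar>" b] b by linarith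
  thus ?thesis using flow_range[OF h] q' by simp
 qed
 show ?thesis
 proof (rule that[OF r])
  fix t t' assume t: "\<bar>t\<bar> <= r" "\<bar>t'\<bar> <= r"
  define s where "s = t - t'"
  have s: "\<bar>s\<bar> <= 2 * r" using t by (simp add: s_def)
  have t2: "\<bar>t\<bar> <= 2 * r" "\<bar>t'\<bar> <= 2 * r" using t r by auto
  note T = sm[OF t2(1)] and T' = sm[OF t2(2)] and S = sm[OF s]
  have fl: "flow v t = flow v s + flow v t'" by (simp add: s_def flow_add[symmetric])
  have tb: "\<bar>t\<bar> * b <= r * b" "\<bar>t'\<bar> * b <= r * b" using t b by (auto intro: mult_right_mono)
  have sb: "0 <= \<bar>s\<bar> * b" using b by simp
  have "norm (ch (flow v s + flow v t') - ch (flow v s) - ch (flow v t'))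
    <= C * norm (ch (flow v s)) * norm (ch (flow v t'))"
   using S T' by (intro beta) auto
  also have "\<dots> <= C * (2 * (\<bar>s\<bar> * b)) * (2 * (r * b))"
  proof (intro mult_mono mult_left_mono mult_nonneg_nonneg)
   show "norm (ch (flow v t')) <= 2 * (r * b)" using T' tb by linarith
  qed (use S C sb b in auto)
  finally have "norm (ch (flow v t) - ch (flow v t') - s *\<^sub>R v)
    <= C * (2 * (\<bar>s\<bar> * b)) * (2 * (r * b)) + C * (\<bar>s\<bar> * b)\<^sup>2"
   using S norm_triangle_ineq[of "ch (flow v s + flow v t') - ch (flow v s) - ch (flow v t')" "ch (flow v s) - s *\<^sub>R v"]
   by (simp add: fl algebra_simps)
  also have "C * (\<bar>s\<bar> * b)\<^sup>2 <= C * ((\<bar>s\<bar> * b) * (2 * r * b))"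
   unfolding power2_eq_square using s b C by (intro mult_left_mono mult_right_mono) auto
  also have "C * (2 * (\<bar>s\<bar> * b)) * (2 * (r * b)) + C * ((\<bar>s\<bar> * b) * (2 * r * b)) = (6 * C * b\<^sup>2 * r) * \<bar>s\<bar>"
   by (simp add: power2_eq_square)
  also have "\<dots> <= (6 * (C + 1) * b\<^sup>2 * r) * \<bar>s\<bar>" using r by (intro mult_right_mono) auto
  also have "\<dots> <= \<delta> * \<bar>s\<bar>" using rb' by (intro mult_right_mono) auto
  finally have "norm (ch (flow v t) - ch (flow v t') - s *\<^sub>R v) <= \<delta> * \<bar>s\<bar>" by simp
  moreover have "norm (ch (flow v t)) <= \<delta>" using T tb rb' by linarith
  ultimately show "flow v t \<in> U0 \<and> norm (ch (flow v t)) <= \<delta> \<and>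
   norm (ch (flow v t) - ch (flow v t') - (t - t') *\<^sub>R v) <= \<delta> * \<bar>t - t'\<bar>"
   using T by (simp add: s_def)
 qed
qed

definition \<Psi> :: "nat list => (nat => real) => 'g" where "\<Psi> l t = (\<Sum>k\<leftarrow>l. e k (t k))"

lemma Psi_Nil: "\<Psi> [] t = 0" and Psi_Cons: "\<Psi> (k # l) t = e k (t k) + \<Psi> l t"
 by (simp_all add: \<Psi>_def)

lemma Psi_append: "\<Psi> (l @ l') t = \<Psi> l t + \<Psi> l' t"
 by (simp add: \<Psi>_def)

lemma Psi_zero: "\<Psi> l (%_. 0) = 0" by (induction l) (simp_all add: Psi_Nil Psi_Cons e_0)

lemma Psi_cong: "(\<And>k. k \<in> set l ==> t k = t' k) ==> \<Psi> l t = \<Psi> l t'"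
 by (induction l) (simp_all add: Psi_Nil Psi_Cons)

lemma Psi_uminus: "- \<Psi> l t = \<Psi> (rev l) (%k. - t k)"
 by (induction l) (simp_all add: Psi_Nil Psi_Cons Psi_append minus_add e_uminus del: add_uminus_conv_diff)

definition XM :: real where "XM = (\<Sum>k<n. norm (X k))"

lemma XM: "k < n ==> norm (X k) <= XM" "0 <= XM"
 unfolding XM_def by (auto intro!: member_le_sum sum_nonneg)

lemma combination_bound:
 "set l \<subseteq> {..<n} ==> norm (\<Sum>k\<leftarrow>l. s k *\<^sub>R X k) <= XM * (\<Sum>k\<leftarrow>l. \<bar>s k\<bar>)"
proof (induction l)
 case (Cons k l)
 have "norm (\<Sum>k\<leftarrow>k # l. s k *\<^sub>R X k) <= norm (s k *\<^sub>R X k) + norm (\<Sum>k\<leftarrow>l. s k *\<^sub>R X k)"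
  using norm_triangle_ineq[of "s k *\<^sub>R X k" "\<Sum>k\<leftarrow>l. s k *\<^sub>R X k"] by (simp del: norm_scaleR)
 also have "\<dots> <= \<bar>s k\<bar> * XM + XM * (\<Sum>k\<leftarrow>l. \<bar>s k\<bar>)"
  using Cons XM(1)[of k] by (intro add_mono) (auto intro: mult_left_mono)
 finally show ?case by (simp add: algebra_simps)
qed simp

lemma list_abs_nonneg: "0 <= (\<Sum>k\<leftarrow>l. \<bar>s k\<bar> :: real)" by (intro sum_list_nonneg) auto

text \<open>The derivative of \<open>\<Psi> l\<close> at \<open>0\<close> is \<open>s \<mapsto> \<Sum>k\<leftarrow>l. s k *\<^sub>R X k\<close>, in the strict sense that
 makes \<open>\<Psi> l\<close> bi-Lipschitz near \<open>0\<close>.\<close>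

lemma Psi_strict_derivative:
 assumes "set l \<subseteq> {..<n}" "\<delta> > 0"
 shows "\<exists>r>0. \<forall>t t'. (\<forall>k\<in>set l. \<bar>t k\<bar> <= r \<and> \<bar>t' k\<bar> <= r) -->
  \<Psi> l t \<in> U0 \<and> norm (ch (\<Psi> l t)) <= \<delta> \<and>
  norm (ch (\<Psi> l t) - ch (\<Psi> l t') - (\<Sum>k\<leftarrow>l. (t k - t' k) *\<^sub>R X k)) <= \<delta> * (\<Sum>k\<leftarrow>l. \<bar>t k - t' k\<bar>)"
 using assms
proof (induction l arbitrary: \<delta>)
 case Nil
 show ?case using Nil zero_U0 by (intro exI[of _ 1]) (simp add: Psi_Nil ch_0)
next
 case (Cons k l)
 have k: "k < n" "set l \<subseteq> {..<n}" using Cons by auto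
 define \<eta> where "\<eta> = min (min r0 (\<delta> / 4)) (min 1 (\<delta> / (2 * (C + 1) * (XM + 1))))"
 have \<eta>: "\<eta> > 0" using r0 Cons C XM by (simp add: \<eta>_def)
 have \<eta>': "\<eta> <= r0" "4 * \<eta> <= \<delta>" "\<eta> <= 1" "2 * (C + 1) * (XM + 1) * \<eta> <= \<delta>"
 proof -
  have "\<eta> <= \<delta> / (2 * (C + 1) * (XM + 1))" by (simp add: \<eta>_def)
  thus "2 * (C + 1) * (XM + 1) * \<eta> <= \<delta>" using C XM by (subst (asm) pos_le_divide_eq) (auto simp: mult_ac)
 qed (auto simp: \<eta>_def)
 obtain r1 where r1: "r1 > 0" "\<And>t t'. \<bar>t\<bar> <= r1 ==> \<bar>t'\<bar> <= r1 ==> flow (X k) t \<in> U0 \<and> norm (ch (flow (X k) t)) <= \<eta> \<and>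
   norm (ch (flow (X k) t) - ch (flow (X k) t') - (t - t') *\<^sub>R X k) <= \<eta> * \<bar>t - t'\<bar>"
  by (rule flow_strict_derivative[OF \<eta>, where v="X k"]) (rule that)
 obtain r2 where r2: "r2 > 0" "\<And>t t'. (\<forall>k\<in>set l. \<bar>t k\<bar> <= r2 \<and> \<bar>t' k\<bar> <= r2) ==>
  \<Psi> l t \<in> U0 \<and> norm (ch (\<Psi> l t)) <= \<eta> \<and>
  norm (ch (\<Psi> l t) - ch (\<Psi> l t') - (\<Sum>k\<leftarrow>l. (t k - t' k) *\<^sub>R X k)) <= \<eta> * (\<Sum>k\<leftarrow>l. \<bar>t k - t' k\<bar>)"
  using Cons.IH[OF k(2) \<eta>] by (elim exE conjE) (rule that, assumption, blast)
 show ?case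
 proof (intro exI[of _ "min r1 r2"] conjI allI impI)
  show "min r1 r2 > 0" using r1 r2 by simp
  fix t t' assume h: "\<forall>k\<in>set (k # l). \<bar>t k\<bar> <= min r1 r2 \<and> \<bar>t' k\<bar> <= min r1 r2"
  define a where "a = e k (t k)" define a' where "a' = e k (t' k)"
  define b where "b = \<Psi> l t" define b' where "b' = \<Psi> l t'"
  define s where "s = t k - t' k"
  define S where "S = (\<Sum>k\<leftarrow>l. \<bar>t k - t' k\<bar>)"
  define D where "D = (\<Sum>k\<leftarrow>l. (t k - t' k) *\<^sub>R X k)"
  have S0: "0 <= S" unfolding S_def by (rule list_abs_nonneg)
  have hk: "\<bar>t k\<bar> <= r1" "\<bar>t' k\<bar> <= r1" using h by auto
  have hl: "\<forall>k\<in>set l. \<bar>t k\<bar> <= r2 \<and> \<bar>t' k\<bar> <= r2" "\<forall>k\<in>set l. \<bar>t' k\<bar> <= r2 \<and> \<bar>t' k\<bar> <= r2" using h by auto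
  note A = r1(2)[OF hk, folded e_flow, folded a_def a'_def s_def]
  note A' = r1(2)[OF hk(2) hk(2), folded e_flow, folded a'_def]
  note B = r2(2)[OF hl(1), folded b_def b'_def S_def D_def]
  note B' = r2(2)[OF hl(2), folded b'_def]
  have DS: "norm D <= XM * S" unfolding D_def S_def by (rule combination_bound[OF k(2)])
  have na: "norm (ch a) <= r0" "norm (ch a') <= r0" "norm (ch b) <= r0" "norm (ch b') <= r0"
   using A A' B B' \<eta>' by auto
  have da: "norm (ch a - ch a') <= (XM + 1) * \<bar>s\<bar>"
  proof -
   have "norm (ch a - ch a') <= \<eta> * \<bar>s\<bar> + norm (s *\<^sub>R X k)"
    using A norm_triangle_ineq2[of "ch a - ch a'" "s *\<^sub>R X k"] by linarith
   also have "\<dots> <= 1 * \<bar>s\<bar> + \<bar>s\<bar> * XM" using \<eta>' XM(1)[OF k(1)] by (intro add_mono mult_right_mono) (auto intro: mult_left_mono)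
   finally show ?thesis by (simp add: algebra_simps)
  qed
  have db: "norm (ch b - ch b') <= (XM + 1) * S"
  proof -
   have "norm (ch b - ch b') <= \<eta> * S + norm D"
    using B norm_triangle_ineq2[of "ch b - ch b'" D] by linarith
   also have "\<dots> <= 1 * S + XM * S" using \<eta>' DS S0 by (intro add_mono mult_right_mono) auto
   finally show ?thesis by (simp add: algebra_simps)
  qed
  have ab: "norm ((ch (a + b) - ch a) - (ch (a' + b) - ch a')) <= C * norm (ch b) * norm (ch a - ch a')"
   using A A' B by (intro beta_left na) auto
  also have "\<dots> <= C * \<eta> * ((XM + 1) * \<bar>s\<bar>)" using B C \<eta> da by (intro mult_mono mult_left_mono) auto
  finally have ab: "norm ((ch (a + b) - ch a) - (ch (a' + b) - ch a')) <= C * \<eta> * ((XM + 1) * \<bar>s\<bar>)" .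
  have "norm ((ch (a' + b) - ch b) - (ch (a' + b') - ch b')) <= C * norm (ch a') * norm (ch b - ch b')"
   using A' B B' by (intro beta_right na) auto
  also have "\<dots> <= C * \<eta> * ((XM + 1) * S)" using A' C \<eta> db by (intro mult_mono mult_left_mono) auto
  finally have a'b: "norm ((ch (a' + b) - ch b) - (ch (a' + b') - ch b')) <= C * \<eta> * ((XM + 1) * S)" .
  have "ch (a + b) - ch (a' + b') - (s *\<^sub>R X k + D)
   = ((ch (a + b) - ch a) - (ch (a' + b) - ch a')) + (((ch (a' + b) - ch b) - (ch (a' + b') - ch b'))
    + ((ch a - ch a' - s *\<^sub>R X k) + (ch b - ch b' - D)))" by (simp add: algebra_simps)
  also have "norm \<dots> <= C * \<eta> * ((XM + 1) * \<bar>s\<bar>) + (C * \<eta> * ((XM + 1) * S) + (\<eta> * \<bar>s\<bar> + \<eta> * S))"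
   using A B by (intro norm_triangle_mono ab a'b) auto
  also have "\<dots> = (C * \<eta> * (XM + 1) + \<eta>) * (\<bar>s\<bar> + S)" by (simp add: algebra_simps)
  also have "\<dots> <= \<delta> * (\<bar>s\<bar> + S)"
  proof (rule mult_right_mono)
   have "C * \<eta> * (XM + 1) <= (C + 1) * \<eta> * (XM + 1)" using \<eta> XM(2) by (intro mult_right_mono) auto
   moreover have "2 * ((C + 1) * \<eta> * (XM + 1)) <= \<delta>" using \<eta>'(4) by (simp only: mult_ac)
   ultimately show "C * \<eta> * (XM + 1) + \<eta> <= \<delta>" using \<eta>'(2) \<eta> by linarith
  qed (use S0 in simp)
  finally show "norm (ch (\<Psi> (k # l) t) - ch (\<Psi> (k # l) t') - (\<Sum>k\<leftarrow>k # l. (t k - t' k) *\<^sub>R X k))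
    <= \<delta> * (\<Sum>k\<leftarrow>k # l. \<bar>t k - t' k\<bar>)"
   by (simp add: Psi_Cons a_def a'_def b_def b'_def s_def S_def D_def)
  show "\<Psi> (k # l) t \<in> U0" using A B na unfolding Psi_Cons a_def[symmetric] b_def[symmetric] by (intro prod_mem) auto
  have "norm (ch (a + b) - ch a - ch b) <= C * norm (ch a) * norm (ch b)" using A B na by (intro beta) auto
  also have "\<dots> <= 1 / 8 * norm (ch b)" using C_small[OF na(1)] by (intro mult_right_mono) auto
  finally have "norm (ch (a + b) - ch a - ch b) <= 1 / 8 * norm (ch b)" .
  hence "norm (ch (a + b)) <= norm (ch a) + 9 / 8 * norm (ch b)"
   using norm_triangle_ineq[of "ch (a + b) - ch a - ch b" "ch a + ch b"] norm_triangle_ineq[of "ch a" "ch b"] by simp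
  also have "\<dots> <= \<delta>" using A B \<eta>' \<eta> by linarith
  finally show "norm (ch (\<Psi> (k # l) t)) <= \<delta>" by (simp add: Psi_Cons a_def b_def)
 qed
qed

text \<open>The Sobolev inequality below expands in the directions of the basis in varying orders.\<close>

definition full :: "nat list => bool" where "full l \<longleftrightarrow> distinct l \<and> set l = {..<n}"

definition box :: "real => (nat => real) set" where "box r = {t. \<forall>k<n. \<bar>t k\<bar> <= r}"

lemma Psi_bilipschitz:
 assumes l: "full l" and "\<delta> > 0"
 obtains r where "r > 0"
  "\<And>t. t \<in> box r ==> \<Psi> l t \<in> U0"
  "\<And>t. t \<in> box r ==> norm (ch (\<Psi> l t)) <= \<delta>"
  "\<And>t t'. t \<in> box r ==> t' \<in> box r ==>
   norm (ch (\<Psi> l t) - ch (\<Psi> l t') - (\<Sum>k<n. (t k - t' k) *\<^sub>R X k)) <= 1 / 2 * norm (\<Sum>k<n. (t k - t' k) *\<^sub>R X k)"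
proof -
 define \<delta>' where "\<delta>' = min \<delta> (coord_const / (2 * (real n + 1)))"
 have \<delta>': "\<delta>' > 0" "\<delta>' <= \<delta>" "\<delta>' <= coord_const / (2 * (real n + 1))" using assms coord_const(1) by (auto simp: \<delta>'_def)
 have sl: "(\<Sum>k\<leftarrow>l. f k) = (\<Sum>k<n. f k)" for f :: "nat => 'b::comm_monoid_add"
  using l by (simp add: full_def sum.distinct_set_conv_list[symmetric])
 have setl: "set l = {..<n}" using l by (simp add: full_def)
 obtain r where r: "r > 0" "\<And>t t'. (\<forall>k<n. \<bar>t k\<bar> <= r \<and> \<bar>t' k\<bar> <= r) ==>
  \<Psi> l t \<in> U0 \<and> norm (ch (\<Psi> l t)) <= \<delta>' \<and>
  norm (ch (\<Psi> l t) - ch (\<Psi> l t') - (\<Sum>k<n. (t k - t' k) *\<^sub>R X k)) <= \<delta>' * (\<Sum>k<n. \<bar>t k - t' k\<bar>)"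
  using Psi_strict_derivative[of l \<delta>', unfolded sl setl Ball_def lessThan_iff, OF subset_refl \<delta>'(1)]
  by (elim exE conjE) (rule that, assumption, blast)
 show ?thesis
 proof (rule that[OF r(1)])
  fix t assume t: "t \<in> box r"
  hence tt: "\<forall>k<n. \<bar>t k\<bar> <= r \<and> \<bar>t k\<bar> <= r" by (simp add: box_def)
  show "\<Psi> l t \<in> U0" "norm (ch (\<Psi> l t)) <= \<delta>" using r(2)[OF tt] \<delta>'(2) by auto
  fix t' assume t': "t' \<in> box r"
  have tt': "\<forall>k<n. \<bar>t k\<bar> <= r \<and> \<bar>t' k\<bar> <= r" using t t' by (simp add: box_def)
  define D where "D = norm (\<Sum>k<n. (t k - t' k) *\<^sub>R X k)"
  have "(\<Sum>k<n. \<bar>t k - t' k\<bar>) <= (\<Sum>k<n. D / coord_const)"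
   by (rule sum_mono) (use coord_const(2)[of _ "%k. t k - t' k"] coord_const(1) in \<open>auto simp: D_def field_simps\<close>)
  also have "\<dots> = real n * (D / coord_const)" by simp
  finally have "\<delta>' * (\<Sum>k<n. \<bar>t k - t' k\<bar>) <= coord_const / (2 * (real n + 1)) * (real n * (D / coord_const))"
   using \<delta>' coord_const(1) by (intro mult_mono) (auto simp: D_def sum_nonneg)
  also have "\<dots> = real n / (real n + 1) * (D / 2)" using coord_const(1) by simp
  also have "\<dots> <= 1 * (D / 2)" by (intro mult_right_mono) (auto simp: D_def)
  finally show "norm (ch (\<Psi> l t) - ch (\<Psi> l t') - (\<Sum>k<n. (t k - t' k) *\<^sub>R X k)) <= 1 / 2 * norm (\<Sum>k<n. (t k - t' k) *\<^sub>R X k)"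
   using r(2)[OF tt'] by (simp add: D_def)
 qed
qed

text \<open>By the strict derivative, \<open>v - ch (\<Psi> l (coordinates of v)) + w\<close> is a contraction in \<open>v\<close>; its fixed point
 solves \<open>ch (\<Psi> l t) = w\<close>.\<close>

lemma Psi_image_neighbourhood:
 assumes l: "full l" and \<rho>: "\<rho> > 0"
 shows "0 \<in> interior (\<Psi> l ` box \<rho>)"
proof -
 obtain r where r: "r > 0" "\<And>t. t \<in> box r ==> \<Psi> l t \<in> U0" "\<And>t. t \<in> box r ==> norm (ch (\<Psi> l t)) <= r0"
  "\<And>t t'. t \<in> box r ==> t' \<in> box r ==>
   norm (ch (\<Psi> l t) - ch (\<Psi> l t') - (\<Sum>k<n. (t k - t' k) *\<^sub>R X k)) <= 1 / 2 * norm (\<Sum>k<n. (t k - t' k) *\<^sub>R X k)"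
  by (rule Psi_bilipschitz[OF l r0]) (rule that)
 define R where "R = min r \<rho>"
 define s where "s = R * coord_const"
 have s: "s > 0" using r(1) \<rho> coord_const by (simp add: s_def R_def)
 define F where "F v = ch (\<Psi> l (%k. co k v))" for v
 have bx: "(%k. co k v) \<in> box R" if "v \<in> cball 0 s" for v
  unfolding box_def using that coord_const(1) by (auto intro!: order_trans[OF co_bound] simp: s_def field_simps)
 hence bxr: "(%k. co k v) \<in> box r" if "v \<in> cball 0 s" for v
  using bx[OF that] by (auto simp: box_def R_def)
 have F: "norm (F v - F v' - (v - v')) <= 1 / 2 * norm (v - v')" if v: "v \<in> cball 0 s" "v' \<in> cball 0 s" for v v'
 proof -
  have eq: "(\<Sum>k<n. (co k v - co k v') *\<^sub>R X k) = v - v'" by (simp add: scaleR_diff_left sum_subtractf co_sum)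
  show ?thesis using r(4)[OF bxr[OF v(1)] bxr[OF v(2)]] unfolding eq F_def .
 qed
 have co0: "co k 0 = 0" if "k < n" for k using co_bound[OF that, of 0] by simp
 have "\<Psi> l (%k. co k 0) = \<Psi> l (%_. 0)" using l by (intro Psi_cong co0) (simp add: full_def)
 hence F0: "F 0 = 0" by (simp add: F_def Psi_zero ch_0)
 have "W (s / 2) \<subseteq> \<Psi> l ` box \<rho>"
 proof
  fix g assume g: "g \<in> W (s / 2)"
  define w where "w = ch g"
  have w: "norm w <= s / 2" using g by (simp add: W_def w_def)
  have "\<exists>!v\<in>cball (0::'e) s. v - F v + w = v"
  proof (rule Banach_fix[where c="1/2"])
   show "complete (cball (0::'e) s)" by (simp add: complete_eq_closed)
   show "cball (0::'e) s \<noteq> {}" using s by simp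
   show "(%v. v - F v + w) ` cball 0 s \<subseteq> cball 0 s"
   proof (rule image_subsetI)
    fix v :: 'e assume v: "v \<in> cball 0 s"
    have "norm (F v - F 0 - (v - 0)) <= 1 / 2 * norm (v - 0)" using v s by (intro F) auto
    hence "norm (v - F v) <= 1 / 2 * norm v" by (simp add: F0 norm_minus_commute)
    also have "\<dots> <= s / 2" using v by simp
    finally show "v - F v + w \<in> cball 0 s" using w norm_triangle_ineq[of "v - F v" w] by simp
   qed
   show "dist (v - F v + w) (v' - F v' + w) <= 1 / 2 * dist v v'" if "v \<in> cball 0 s" "v' \<in> cball 0 s" for v v' :: 'e
   proof -
    have "dist (v - F v + w) (v' - F v' + w) = norm (F v - F v' - (v - v'))"
     unfolding dist_norm by (subst norm_minus_commute) (simp add: algebra_simps)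
    thus ?thesis using F[OF that] by (simp add: dist_norm)
   qed
  qed auto
  then obtain v where v: "v \<in> cball 0 s" "v - F v + w = v" by blast
  have b: "(%k. co k v) \<in> box r" "(%k. co k v) \<in> box \<rho>" using bx[OF v(1)] by (auto simp: box_def R_def)
  have "ch (\<Psi> l (%k. co k v)) = ch g" using v(2) by (simp add: F_def w_def)
  hence "\<Psi> l (%k. co k v) = g" using r(2)[OF b(1)] g by (intro ch_eqD) (auto simp: W_def)
  thus "g \<in> \<Psi> l ` box \<rho>" using b(2) by blast
 qed
 thus ?thesis using W_neighbourhood[of "s / 2"] s interior_mono by (metis half_gt_zero subsetD)
qed

lemma continuous_Psi: "continuous_on UNIV (\<Psi> l)"
proof (induction l)
 case (Cons k l)
 have "continuous_on UNIV (%t::nat => real. e k (t k))"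
  by (rule continuous_on_compose2[OF continuous_e[of k] continuous_on_product_coordinates]) auto
 thus ?case unfolding Psi_Cons using Cons by (intro continuous_on_add) auto
qed (simp add: Psi_Nil)

lemma Psi_image_compact:
 assumes l: "full l"
 shows "compact (\<Psi> l ` box \<rho>)"
proof -
 define Q where "Q = (\<Pi>\<^sub>E k\<in>(UNIV::nat set). {-\<rho>..\<rho>})"
 have "compactin (product_topology (%_. euclidean) UNIV) Q"
  unfolding Q_def compactin_PiE by auto
 hence Q: "compact Q" unfolding euclidean_product_topology by simp
 have "\<Psi> l ` box \<rho> = \<Psi> l ` Q" if "\<rho> \<ge> 0"
 proof (intro equalityI image_subsetI)
  fix t assume t: "t \<in> box \<rho>"
  have "\<Psi> l t = \<Psi> l (%k. if k < n then t k else 0)" using l by (intro Psi_cong) (simp add: full_def)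
  moreover have "(%k. if k < n then t k else 0) \<in> Q"
   using t that by (auto simp: Q_def box_def abs_le_iff PiE_def minus_le_iff)
  ultimately show "\<Psi> l t \<in> \<Psi> l ` Q" by simp
 next
  fix t assume "t \<in> Q"
  hence "t \<in> box \<rho>" unfolding Q_def box_def by (auto simp: PiE_def Pi_def abs_le_iff minus_le_iff)
  thus "\<Psi> l t \<in> \<Psi> l ` box \<rho>" by simp
 qed
 moreover have "compact (\<Psi> l ` Q)" by (rule compact_continuous_image[OF continuous_on_subset[OF continuous_Psi] Q]) simp
 moreover have "compact (\<Psi> l ` box \<rho>)" if "\<rho> < 0"
 proof (cases "n = 0")
  case True
  hence "l = []" using l unfolding full_def by simp
  hence "\<Psi> l t = 0" for t by (simp add: Psi_Nil)
  hence "\<Psi> l ` box \<rho> \<subseteq> {0}" by auto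
  thus ?thesis by (meson finite.emptyI finite.insertI finite_imp_compact finite_subset)
 next
  case False
  have "box \<rho> = {}"
  proof (rule ccontr)
   assume "box \<rho> \<noteq> {}"
   then obtain t where "t \<in> box \<rho>" by blast
   hence "\<bar>t 0\<bar> <= \<rho>" using False by (simp add: box_def)
   thus False using that by simp
  qed
  thus ?thesis by simp
 qed
 ultimately show ?thesis by (metis not_le)
qed

lemma U_eps_eq: "U_eps ch X \<epsilon> = \<Psi> [0..<n] ` box \<epsilon>"
 unfolding U_eps_def n_def[symmetric] \<Psi>_def e_def box_def by (auto simp: abs_le_iff minus_le_iff)

lemma full_upt: "full [0..<n]" by (auto simp: full_def)

end

section \<open>Averages over boxes are dominated by the Haar measure\<close>

locale lie_haar = local_group X n U0 ch r0 C + left_haar_measure \<mu>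
 for X :: "nat => 'e::banach" and n :: nat
  and U0 :: "'g::{topological_group_add, t2_space, second_countable_topology} set"
  and ch :: "'g => 'e" and r0 C :: real and \<mu> :: "'g measure"
begin

sublocale haar_group \<mu>
proof
 show "\<exists>K::'g set. compact K \<and> 0 \<in> interior K" using compact_W W_neighbourhood r0 by blast
qed

text \<open>Lebesgue measure on an interval, kept as a measure on the whole line.\<close>

definition \<nu> :: "real => real measure" where "\<nu> r = density lborel (indicator {-r..r})"

lemma sets_nu [simp, measurable_cong]: "sets (\<nu> r) = sets borel"
 and space_nu [simp]: "space (\<nu> r) = UNIV"
 by (simp_all add: \<nu>_def)

lemma emeasure_nu: "S \<in> sets borel ==> emeasure (\<nu> r) S = emeasure lborel (S \<inter> {-r..r})"
 by (subst Int_commute) (simp add: \<nu>_def emeasure_density indicator_inter_arith[symmetric])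

lemma nu_le: "S \<in> sets borel ==> emeasure (\<nu> r) S <= emeasure lborel S"
 by (simp add: emeasure_nu emeasure_mono)

lemma finite_nu: "finite_measure (\<nu> r)"
 by (rule finite_measureI) (cases "r \<ge> 0"; simp add: emeasure_nu)

lemma sigma_finite_nu: "sigma_finite_measure (\<nu> r)"
proof -
 interpret finite_measure "\<nu> r" by (rule finite_nu)
 show ?thesis by (rule sigma_finite_measure_axioms)
qed

sublocale nu: product_sigma_finite "%_::nat. \<nu> r" for r
 by (rule product_sigma_finite.intro) (rule sigma_finite_nu)

abbreviation P :: "real => nat set => (nat => real) measure" where "P r J \<equiv> PiM J (%_. \<nu> r)"

lemma measurable_e [measurable]: "e k \<in> borel_measurable borel"
 by (rule borel_measurable_continuous_onI[OF continuous_e])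

lemma measurable_Psi: "set l \<subseteq> J ==> \<Psi> l \<in> borel_measurable (P r J)"
proof (induction l)
 case (Cons k l)
 have [measurable]: "k \<in> J" "\<Psi> l \<in> borel_measurable (P r J)" using Cons by auto
 have "(%t. e k (t k) + \<Psi> l t) \<in> borel_measurable (P r J)" by measurable
 thus ?case by (simp add: Psi_Cons[abs_def])
qed (simp add: Psi_Nil[abs_def])

lemma AE_box: "AE t in P r {..<n}. t \<in> box r"
proof -
 have "AE t in P r {..<n}. \<forall>k\<in>{..<n}. \<bar>t k\<bar> <= r"
 proof (rule AE_finite_allI)
  fix k assume k: "k \<in> {..<n}"
  define A where "A j = (if j = k then - {-r..r} else (UNIV::real set))" for j
  have "emeasure (P r {..<n}) (Pi\<^sub>E {..<n} A) = (\<Prod>j<n. emeasure (\<nu> r) (A j))"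
   by (rule nu.emeasure_PiM) (auto simp: A_def)
  also have "\<dots> = 0" using k by (intro prod_zero) (auto simp: A_def emeasure_nu intro!: bexI[of _ k])
  finally have 0: "emeasure (P r {..<n}) (Pi\<^sub>E {..<n} A) = 0" .
  show "AE t in P r {..<n}. \<bar>t k\<bar> <= r"
  proof (rule AE_I)
   show "{t \<in> space (P r {..<n}). \<not> \<bar>t k\<bar> <= r} \<subseteq> Pi\<^sub>E {..<n} A"
    by (auto simp: space_PiM A_def PiE_iff abs_le_iff minus_le_iff extensional_def)
   show "Pi\<^sub>E {..<n} A \<in> sets (P r {..<n})" by (intro sets_PiM_I_finite) (auto simp: A_def)
  qed (rule 0)
 qed simp
 thus ?thesis by (simp add: box_def Ball_def)
qed

lemma ch_quotient:
 assumes p: "p \<in> U0" "norm (ch p) <= r0 / 2" and q: "q \<in> U0" "norm (ch q) <= r0 / 2"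
 shows "- p + q \<in> U0" "norm (ch (- p + q)) <= 2 * norm (ch q - ch p)"
proof -
 have pq: "norm (ch p) <= r0" "norm (ch q) <= r0" using p q r0 by auto
 note m = minus_mem[OF p(1) pq(1)] ch_minus[OF p(1) pq(1)]
 have mp: "norm (ch (- p)) <= r0" using m(2) p(2) by linarith
 show "- p + q \<in> U0" by (rule prod_mem[OF m(1) q(1) mp pq(2)])
 have "norm ((ch (- p + q) - ch q) - (ch (- p + p) - ch p)) <= C * norm (ch (- p)) * norm (ch q - ch p)"
  by (rule beta_right[OF m(1) q(1) p(1) mp pq(2,1)])
 also have "\<dots> <= 1 / 8 * norm (ch q - ch p)" using C_small[OF mp] by (intro mult_right_mono) auto
 also have "(ch (- p + q) - ch q) - (ch (- p + p) - ch p) = ch (- p + q) - (ch q - ch p)" by (simp add: ch_0)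
 finally have "norm (ch (- p + q) - (ch q - ch p)) <= 1 / 8 * norm (ch q - ch p)" .
 thus "norm (ch (- p + q)) <= 2 * norm (ch q - ch p)"
  using norm_triangle_ineq2[of "ch (- p + q)" "ch q - ch p"] norm_ge_zero[of "ch q - ch p"] by linarith
qed

lemma ch_right_translate:
 assumes "a \<in> U0" "a' \<in> U0" "b \<in> U0" "norm (ch a) <= r0" "norm (ch a') <= r0" "norm (ch b) <= r0"
 shows "norm (ch (a + b) - ch (a' + b)) <= 2 * norm (ch a - ch a')"
proof -
 have "norm ((ch (a + b) - ch a) - (ch (a' + b) - ch a')) <= C * norm (ch b) * norm (ch a - ch a')"
  by (rule beta_left[OF assms])
 also have "\<dots> <= 1 / 8 * norm (ch a - ch a')" using C_small[OF assms(6)] by (intro mult_right_mono) auto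
 finally have h: "norm ((ch (a + b) - ch a) - (ch (a' + b) - ch a')) <= 1 / 8 * norm (ch a - ch a')" .
 have "ch (a + b) - ch (a' + b) = ((ch (a + b) - ch a) - (ch (a' + b) - ch a')) + (ch a - ch a')" by simp
 hence "norm (ch (a + b) - ch (a' + b)) <= 1 / 8 * norm (ch a - ch a') + norm (ch a - ch a')"
  using norm_triangle_mono[OF h order_refl] by metis
 thus ?thesis using norm_ge_zero[of "ch a - ch a'"] by linarith
qed

lemma sets_W: "r <= r0 ==> W r \<in> sets borel"
 using compact_W compact_imp_closed borel_closed by blast

lemma W_nonempty_pos: "r > 0 ==> r <= r0 ==> 0 < emeasure \<mu> (W r) \<and> emeasure \<mu> (W r) < \<infinity>"
proof
 assume r: "r > 0" "r <= r0"
 have "0 < emeasure \<mu> (interior (W r))" using W_neighbourhood[OF r(1)] by (intro emeasure_open_pos) auto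
 also have "\<dots> <= emeasure \<mu> (W r)" using sets_W[OF r(2)] by (intro emeasure_mono interior_subset) auto
 finally show "0 < emeasure \<mu> (W r)" .
 show "emeasure \<mu> (W r) < \<infinity>" by (rule finite_on_compact[OF compact_W[OF r(2)]])
qed

text \<open>Along a sequence of small neighbourhoods \<open>W\<close> of the identity, both the set of parameters \<open>t\<close>
 with \<open>\<Psi> l t\<close> in a right translate of \<open>W\<close> and \<open>W\<close> itself have measure comparable with the \<open>n\<close>-th
 power of the size: the former because \<open>\<Psi> l\<close> does not contract distances, the latter because
 finitely many left translates of \<open>W\<close>, one for every point of a grid, cover the image of a box.\<close>

lemma small_neighbourhood_measures:
 assumes l: "full l"
 obtains R Cd :: real and w :: "nat => real" where "R > 0" "Cd \<ge> 0" "w \<longlonglongrightarrow> 0"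
  "\<And>i. w i > 0" "\<And>i. w i <= r0 / 4"
  "\<And>t. t \<in> box R ==> \<Psi> l t \<in> U0" "\<And>t. t \<in> box R ==> norm (ch (\<Psi> l t)) <= r0 / 4"
  "\<And>r y i. 0 < r ==> r <= R ==>
   emeasure (P r {..<n}) {t \<in> space (P r {..<n}). \<Psi> l t + y \<in> W (w i)} <= ennreal Cd * emeasure \<mu> (W (w i))"
proof -
 have r4: "r0 / 4 > 0" using r0 by simp
 obtain R where R: "R > 0" "\<And>t. t \<in> box R ==> \<Psi> l t \<in> U0" "\<And>t. t \<in> box R ==> norm (ch (\<Psi> l t)) <= r0 / 4"
  "\<And>t t'. t \<in> box R ==> t' \<in> box R ==>
   norm (ch (\<Psi> l t) - ch (\<Psi> l t') - (\<Sum>k<n. (t k - t' k) *\<^sub>R X k)) <= 1 / 2 * norm (\<Sum>k<n. (t k - t' k) *\<^sub>R X k)"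
  by (rule Psi_bilipschitz[OF l r4]) (rule that)
 define L where "L = 2 * ((XM + 1) * (real n + 1))"
 have L: "L > 0" using XM(2) unfolding L_def by (intro mult_pos_pos) auto
 have lower: "coord_const * \<bar>t k - t' k\<bar> <= 2 * norm (ch (\<Psi> l t) - ch (\<Psi> l t'))"
  if "t \<in> box R" "t' \<in> box R" "k < n" for t t' k
 proof -
  define D where "D = (\<Sum>k<n. (t k - t' k) *\<^sub>R X k)"
  have "coord_const * \<bar>t k - t' k\<bar> <= norm D" using coord_const(2)[OF that(3), of "%k. t k - t' k"] by (simp add: D_def)
  also have "norm D <= 2 * norm (ch (\<Psi> l t) - ch (\<Psi> l t'))"
   using R(4)[OF that(1,2)] norm_triangle_ineq2[of D "ch (\<Psi> l t) - ch (\<Psi> l t')"] unfolding D_def[symmetric]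
   by (simp only: norm_minus_commute[of D])
  finally show ?thesis .
 qed
 have upper: "norm (ch (\<Psi> l t) - ch (\<Psi> l t')) <= L * d"
  if "t \<in> box R" "t' \<in> box R" "\<And>k. k < n ==> \<bar>t k - t' k\<bar> <= d" "d \<ge> 0" for t t' d
 proof -
  define D where "D = (\<Sum>k<n. (t k - t' k) *\<^sub>R X k)"
  have "norm D <= (\<Sum>k<n. d * XM)" unfolding D_def
  proof (rule sum_norm_le)
   fix k assume "k \<in> {..<n}"
   thus "norm ((t k - t' k) *\<^sub>R X k) <= d * XM" using that(3)[of k] that(4) XM(1)[of k] by (auto intro!: mult_mono)
  qed
  also have "\<dots> = real n * (d * XM)" by simp
  also have "\<dots> <= (real n + 1) * (d * (XM + 1))" using that(4) XM(2) by (intro mult_mono) auto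
  finally have "2 * norm D <= L * d" by (simp add: L_def mult_ac)
  moreover have "norm (ch (\<Psi> l t) - ch (\<Psi> l t')) <= 2 * norm D"
   using R(4)[OF that(1,2)] norm_triangle_ineq2[of "ch (\<Psi> l t) - ch (\<Psi> l t')" D] norm_ge_zero[of D] unfolding D_def[symmetric]
   by linarith
  ultimately show ?thesis by linarith
 qed
 obtain N0 :: nat where N0: "16 * L * R / r0 < real N0" using reals_Archimedean2 by blast
 define N where "N i = Suc (N0 + i)" for i
 \<comment> \<open>The mesh of the grid is \<open>2 * R / N i\<close>, and \<open>\<Psi> l\<close> together with the quotient of two points expands
  distances by at most \<open>2 * L\<close>.\<close>
 define w where "w i = 4 * L * R / real (N i)" for i
 have Npos: "real (N i) > 0" for i by (simp add: N_def)
 have w: "w i > 0" "w i <= r0 / 4" for i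
 proof -
  show "w i > 0" using L R(1) Npos by (simp add: w_def)
  have "16 * L * R <= r0 * real N0" using N0 r0 by (simp add: field_simps)
  also have "\<dots> <= r0 * real (N i)" using r0 by (intro mult_left_mono) (auto simp: N_def)
  finally show "w i <= r0 / 4" using Npos[of i] by (simp add: w_def field_simps)
 qed
 have "w \<longlonglongrightarrow> 0"
 proof -
  have "(%i. 4 * L * R * inverse (real (Suc (i + N0)))) \<longlonglongrightarrow> 4 * L * R * 0"
   by (intro tendsto_mult tendsto_const LIMSEQ_ignore_initial_segment[OF LIMSEQ_inverse_real_of_nat])
  thus ?thesis by (simp add: w_def[abs_def] N_def divide_inverse add.commute)
 qed
 define K where "K = \<Psi> l ` box R"
 have Kc: "compact K" unfolding K_def by (rule Psi_image_compact[OF l])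
 have K0: "0 \<in> interior K" unfolding K_def by (rule Psi_image_neighbourhood[OF l R(1)])
 have "0 < emeasure \<mu> (interior K)" using K0 by (intro emeasure_open_pos) auto
 also have "\<dots> <= emeasure \<mu> K" using Kc by (intro emeasure_mono interior_subset) (auto intro: borel_closed compact_imp_closed)
 finally have Kpos: "0 < emeasure \<mu> K" .
 define m where "m = enn2real (emeasure \<mu> K)"
 have m: "m > 0" "emeasure \<mu> K = ennreal m"
  using Kpos finite_on_compact[OF Kc] by (auto simp: m_def enn2real_positive_iff)
 have wr0: "w i <= r0" for i using w(2)[of i] r0 by simp
 have grid: "ennreal m <= of_nat (N i ^ n) * emeasure \<mu> (W (w i))" for i
 proof -
  define d where "d = 2 * R / real (N i)"
  have d: "d > 0" using R Npos by (simp add: d_def)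
  define G where "G = (\<Pi>\<^sub>E k\<in>{..<n}. {..<N i})"
  define pt where "pt g k = - R + d * real (g k)" for g :: "nat => nat" and k :: nat
  have "finite G" unfolding G_def by (intro finite_PiE) auto
  have cG: "card G = N i ^ n" unfolding G_def by (subst card_PiE) auto
  have ptbox: "pt g \<in> box R" if "g \<in> G" for g
   unfolding box_def
  proof (rule CollectI, intro allI impI)
   fix k assume "k < n"
   hence "real (g k) <= real (N i)" using that by (auto simp: G_def PiE_iff less_imp_le)
   hence "d * real (g k) <= d * real (N i)" using d by (intro mult_left_mono) auto
   moreover have "d * real (N i) = 2 * R" using Npos[of i] by (simp add: d_def)
   moreover have "0 <= d * real (g k)" using d by simp
   ultimately show "\<bar>pt g k\<bar> <= R" unfolding pt_def by linarith
  qed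
  have cover: "K \<subseteq> (\<Union>g\<in>G. (%x. \<Psi> l (pt g) + x) ` W (w i))"
  proof
   fix x assume "x \<in> K"
   then obtain t where t: "t \<in> box R" "x = \<Psi> l t" by (auto simp: K_def)
   define g where "g = (\<lambda>k\<in>{..<n}. min (N i - 1) (nat \<lfloor>(t k + R) / d\<rfloor>))"
   have g: "g \<in> G" using Npos by (auto simp: g_def G_def N_def)
   have close: "\<bar>t k - pt g k\<bar> <= d" if k: "k < n" for k
   proof -
    have tk: "- R <= t k" "t k <= R" using t(1) k by (auto simp: box_def abs_le_iff minus_le_iff)
    define z where "z = (t k + R) / d"
    have z0: "0 <= z" using tk d by (simp add: z_def)
    have "z <= 2 * R / d" unfolding z_def using tk d by (intro divide_right_mono) auto
    also have "\<dots> = real (N i)" using R(1) Npos[of i] by (simp add: d_def)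
    finally have zN: "z <= real (N i)" .
    have fl: "real (nat \<lfloor>z\<rfloor>) <= z" "z < real (nat \<lfloor>z\<rfloor>) + 1" using z0 by linarith+
    have N1: "real (N i - 1) = real (N i) - 1" by (simp add: N_def)
    have gk: "g k = min (N i - 1) (nat \<lfloor>z\<rfloor>)" using k by (simp add: g_def z_def)
    have "\<bar>z - real (g k)\<bar> <= 1"
    proof (cases "N i - 1 <= nat \<lfloor>z\<rfloor>")
     case True
     hence "real (N i - 1) <= real (nat \<lfloor>z\<rfloor>)" by (simp only: of_nat_le_iff)
     moreover have "g k = N i - 1" using True gk by simp
     ultimately show ?thesis using fl zN N1 by linarith
    next
     case False
     hence "g k = nat \<lfloor>z\<rfloor>" using gk by simp
     thus ?thesis using fl by linarith
    qed
    hence "d * \<bar>z - real (g k)\<bar> <= d * 1" using d by (intro mult_left_mono) auto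
    moreover have "d * z = t k + R" using d by (simp add: z_def)
    hence "t k - pt g k = d * (z - real (g k))" by (simp add: pt_def algebra_simps)
    ultimately show ?thesis using d by (simp add: abs_mult)
   qed
   have close': "norm (ch (\<Psi> l t) - ch (\<Psi> l (pt g))) <= L * d"
    by (rule upper[OF t(1) ptbox[OF g] close]) (use d in auto)
   have "norm (ch (\<Psi> l t)) <= r0 / 2" "norm (ch (\<Psi> l (pt g))) <= r0 / 2"
    using R(3)[OF t(1)] R(3)[OF ptbox[OF g]] r0 by linarith+
   note kq = ch_quotient[OF R(2)[OF ptbox[OF g]] this(2) R(2)[OF t(1)] this(1)]
   have "2 * (L * d) = w i" by (simp add: w_def d_def)
   hence "- \<Psi> l (pt g) + \<Psi> l t \<in> W (w i)" using kq close' by (intro W_I) linarith+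
   moreover have "x = \<Psi> l (pt g) + (- \<Psi> l (pt g) + \<Psi> l t)" by (simp add: t(2) add.assoc[symmetric])
   ultimately show "x \<in> (\<Union>g\<in>G. (%x. \<Psi> l (pt g) + x) ` W (w i))" using g by blast
  qed
  have Wb: "(%x. a + x) ` W (w i) \<in> sets \<mu>" for a
   using compact_translate[OF compact_W[OF wr0]] by (auto intro: borel_closed compact_imp_closed)
  have "emeasure \<mu> K <= emeasure \<mu> (\<Union>g\<in>G. (%x. \<Psi> l (pt g) + x) ` W (w i))"
   using Wb \<open>finite G\<close> by (intro emeasure_mono cover sets.finite_UN) auto
  also have "\<dots> <= (\<Sum>g\<in>G. emeasure \<mu> ((%x. \<Psi> l (pt g) + x) ` W (w i)))"
   using Wb \<open>finite G\<close> by (intro emeasure_subadditive_finite) auto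
  also have "\<dots> = of_nat (N i ^ n) * emeasure \<mu> (W (w i))"
   using left_invariant[OF sets_W[OF wr0]] by (simp add: cG)
  finally show ?thesis by (simp add: m(2))
 qed
 define K0 where "K0 = 64 * L * R / coord_const"
 have K0: "K0 > 0" using L R(1) coord_const(1) by (simp add: K0_def)
 have small: "emeasure (P r {..<n}) {t \<in> space (P r {..<n}). \<Psi> l t + y \<in> W (w i)} <= ennreal ((K0 / real (N i)) ^ n)"
  if r: "0 < r" "r <= R" for r y i
 proof -
  define T where "T = {t \<in> space (P r {..<n}). \<Psi> l t + y \<in> W (w i)}"
  have rb: "t \<in> box R" if "t \<in> box r" for t using that r by (force simp: box_def)
  have meas: "emeasure (P r {..<n}) T <= emeasure (P r {..<n}) S" if "T \<inter> box r \<subseteq> S" "S \<in> sets (P r {..<n})" for S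
   using that AE_box[of r] by (intro emeasure_mono_AE) (auto elim!: eventually_mono)
  show ?thesis unfolding T_def[symmetric]
  proof (cases "T \<inter> box r = {}")
   case True
   thus "emeasure (P r {..<n}) T <= ennreal ((K0 / real (N i)) ^ n)" using meas[of "{}"] by simp
  next
   case False
   then obtain t0 where t0: "t0 \<in> T" "t0 \<in> box r" by blast
   define q where "q = 8 * w i / coord_const"
   have q: "q \<ge> 0" using w(1)[of i] coord_const(1) by (simp add: q_def)
   define S where "S = Pi\<^sub>E {..<n} (%k. {t0 k - q..t0 k + q})"
   have "T \<inter> box r \<subseteq> S"
   proof
    fix t assume t: "t \<in> T \<inter> box r"
    define a where "a = \<Psi> l t + y" define a0 where "a0 = \<Psi> l t0 + y"
    have a: "a \<in> U0" "norm (ch a) <= w i" "a0 \<in> U0" "norm (ch a0) <= w i"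
     using t t0 by (auto simp: T_def W_def a_def a0_def)
    hence ar: "norm (ch a) <= r0" "norm (ch a0) <= r0" "norm (ch a0) <= r0 / 2" using w(2)[of i] r0 by linarith+
    define b where "b = - a0 + \<Psi> l t0"
    have p0: "\<Psi> l t0 \<in> U0" "norm (ch (\<Psi> l t0)) <= r0 / 4" using R(2,3)[OF rb[OF t0(2)]] by auto
    have "norm (ch (\<Psi> l t0)) <= r0 / 2" using p0(2) r0 by linarith
    note bq = ch_quotient[OF a(3) ar(3) p0(1) this, folded b_def]
    have "norm (ch (\<Psi> l t0) - ch a0) <= r0 / 4 + r0 / 4"
     using p0(2) a(4) w(2)[of i] norm_triangle_ineq4[of "ch (\<Psi> l t0)" "ch a0"] by linarith
    hence b: "norm (ch b) <= r0" using bq(2) by linarith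
    have by': "b = - y" by (simp add: b_def a0_def minus_add add.assoc del: add_uminus_conv_diff)
    have "\<Psi> l t = a + b" "\<Psi> l t0 = a0 + b" by (simp_all add: by' a_def a0_def add.assoc)
    hence "norm (ch (\<Psi> l t) - ch (\<Psi> l t0)) <= 2 * norm (ch a - ch a0)"
     using ch_right_translate[OF a(1,3) bq(1) ar(1,2) b] by simp
    also have "\<dots> <= 4 * w i" using norm_triangle_ineq4[of "ch a" "ch a0"] a by linarith
    finally have k4: "norm (ch (\<Psi> l t) - ch (\<Psi> l t0)) <= 4 * w i" .
    have "\<bar>t k - t0 k\<bar> <= q" if "k < n" for k
    proof -
     have "coord_const * \<bar>t k - t0 k\<bar> <= 8 * w i" using lower[OF rb rb that, of t t0] t t0 k4 by auto
     thus ?thesis using coord_const(1) by (simp add: q_def field_simps)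
    qed
    hence "t k \<in> {t0 k - q..t0 k + q}" if "k < n" for k using that by (fastforce simp: abs_le_iff)
    thus "t \<in> S" using t by (auto simp: S_def T_def space_PiM PiE_iff)
   qed
   hence "emeasure (P r {..<n}) T <= emeasure (P r {..<n}) S" by (rule meas) (auto simp: S_def intro!: sets_PiM_I_finite)
   also have "\<dots> = (\<Prod>k<n. emeasure (\<nu> r) {t0 k - q..t0 k + q})" unfolding S_def by (rule nu.emeasure_PiM) auto
   also have "\<dots> <= (\<Prod>k<n. emeasure lborel {t0 k - q..t0 k + q})" by (intro prod_mono_ennreal nu_le) simp
   also have "\<dots> = ennreal ((2 * q) ^ n)" using q by (simp add: ennreal_power)
   also have "2 * q = K0 / real (N i)" by (simp add: q_def K0_def w_def mult_ac)
   finally show "emeasure (P r {..<n}) T <= ennreal ((K0 / real (N i)) ^ n)" .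
  qed
 qed
 show ?thesis
 proof (rule that[of R "K0 ^ n / m" w])
  fix r y i assume r: "(0::real) < r" "r <= R"
  define M where "M = enn2real (emeasure \<mu> (W (w i)))"
  have Wf: "emeasure \<mu> (W (w i)) = ennreal M"
   using W_nonempty_pos[OF w(1) wr0, of i] by (simp add: M_def)
  have "ennreal m <= ennreal (real (N i) ^ n * M)"
   using grid[of i] unfolding Wf by (simp add: ennreal_mult M_def ennreal_of_nat_eq_real_of_nat ennreal_power[symmetric])
  hence mM: "m <= real (N i) ^ n * M" by (subst (asm) ennreal_le_iff) (auto simp: M_def)
  have "(K0 / real (N i)) ^ n = K0 ^ n / m * (m / real (N i) ^ n)" using m(1) by (simp add: power_divide)
  also have "\<dots> <= K0 ^ n / m * M" using m(1) mM K0 Npos[of i] by (intro mult_left_mono) (auto simp: field_simps)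
  finally have "ennreal ((K0 / real (N i)) ^ n) <= ennreal (K0 ^ n / m * M)" by (rule ennreal_leI)
  also have "\<dots> = ennreal (K0 ^ n / m) * emeasure \<mu> (W (w i))"
   unfolding Wf using K0 m(1) by (intro ennreal_mult) (auto simp: M_def)
  finally show "emeasure (P r {..<n}) {t \<in> space (P r {..<n}). \<Psi> l t + y \<in> W (w i)} <= ennreal (K0 ^ n / m) * emeasure \<mu> (W (w i))"
   using small[OF r, of y i] by (rule order_trans[rotated])
 qed (use R \<open>w \<longlonglongrightarrow> 0\<close> w K0 m in auto)
qed

end

context lie_haar
begin

text \<open>Averaging the indicator of an open set over right translates by a shrinking neighbourhood \<open>W\<close> recovers it
 in the limit, and Fubini's theorem turns this average into the measure of parameters with \<open>\<Psi> l t\<close> in a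
 right translate of \<open>W\<close>, divided by the measure of \<open>W\<close>. Fatou's lemma gives the bound for open sets,
 regularity for Borel sets.\<close>

lemma law_dominated:
 assumes l: "full l"
 obtains R Cd :: real where "R > 0" "Cd \<ge> 0"
  "\<And>r E. 0 < r ==> r <= R ==> E \<in> sets borel ==>
   emeasure (distr (P r {..<n}) borel (%t. - \<Psi> l t)) E <= ennreal Cd * emeasure \<mu> E"
proof -
 obtain R Cd :: real and w :: "nat => real" where R: "R > 0" and Cd: "Cd \<ge> 0" and w0: "w \<longlonglongrightarrow> 0"
  and w: "\<And>i. w i > 0" "\<And>i. w i <= r0 / 4"
  and RU: "\<And>t. t \<in> box R ==> \<Psi> l t \<in> U0" and Rk: "\<And>t. t \<in> box R ==> norm (ch (\<Psi> l t)) <= r0 / 4"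
  and bound: "\<And>r y i. 0 < r ==> r <= R ==>
   emeasure (P r {..<n}) {t \<in> space (P r {..<n}). \<Psi> l t + y \<in> W (w i)} <= ennreal Cd * emeasure \<mu> (W (w i))"
  by (rule small_neighbourhood_measures[OF l]) (rule that)
 have wr0: "w i <= r0" for i using w(2)[of i] r0 by simp
 have main: "emeasure (distr (P r {..<n}) borel (%t. - \<Psi> l t)) E <= ennreal Cd * emeasure \<mu> E"
  if r: "0 < r" "r <= R" and E: "E \<in> sets borel" for r E
 proof -
  define Pr where "Pr = P r {..<n}"
  define F where "F t = - \<Psi> l t" for t
  define Q where "Q = distr Pr borel F"
  have mP [measurable]: "\<Psi> l \<in> borel_measurable Pr"
   unfolding Pr_def by (rule measurable_Psi) (use l in \<open>simp add: full_def\<close>)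
  have mF [measurable]: "F \<in> borel_measurable Pr" unfolding F_def by measurable
  interpret Pr: sigma_finite_measure Pr unfolding Pr_def by (rule nu.sigma_finite) simp
  interpret PM: pair_sigma_finite Pr \<mu> ..
  have "emeasure Pr (space Pr) = (\<Prod>k<n. emeasure (\<nu> r) UNIV)"
   unfolding Pr_def space_PiM space_nu by (rule nu.emeasure_PiM) auto
  also have "\<dots> = ennreal (2 * r) ^ n" using r(1) by (simp add: emeasure_nu)
  finally have "finite_measure Pr" using r(1) by (intro finite_measureI) (simp add: ennreal_power)
  then interpret Pf: finite_measure Pr .
  have finQ: "finite_measure Q" unfolding Q_def by (rule Pf.finite_measure_distr[OF mF])
  have rb: "t \<in> box R" if "t \<in> box r" for t using that r by (force simp: box_def)
  have emQ: "emeasure Q S = emeasure Pr {t \<in> space Pr. F t \<in> S}" if "S \<in> sets borel" for S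
   unfolding Q_def using that by (subst emeasure_distr[OF mF]) (auto intro!: arg_cong[where f="emeasure Pr"])
  have openQ: "emeasure Q S <= ennreal Cd * emeasure \<mu> S" if S: "open S" for S
  proof -
   have [measurable]: "S \<in> sets borel" using S by simp
   have [measurable]: "W (w i) \<in> sets borel" for i by (rule sets_W[OF wr0])
   define g where "g i t = (\<integral>\<^sup>+y. indicator S y * indicator (W (w i)) (\<Psi> l t + y) \<partial>\<mu>) / emeasure \<mu> (W (w i))" for i t
   have mg: "g i \<in> borel_measurable Pr" for i unfolding g_def by measurable
   have Wi: "emeasure \<mu> (W (w i)) \<noteq> 0" "emeasure \<mu> (W (w i)) < top" for i
    using W_nonempty_pos[OF w(1) wr0, of i] by auto
   have fatou: "indicator {t. F t \<in> S} t <= liminf (%i. g i t)" for t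
   proof (cases "F t \<in> S")
    case True
    have "open ((%x. F t + x) -` S)" by (intro open_vimage S continuous_intros)
    moreover have "0 \<in> (%x. F t + x) -` S" using True by simp
    ultimately obtain r' where r': "r' > 0" "r' <= r0" "W r' \<subseteq> (%x. F t + x) -` S"
     by (rule W_basis) (rule that)
    have "1 <= liminf (%i. g i t)"
    proof (rule Liminf_bounded)
     have "\<forall>\<^sub>F i in sequentially. w i < r'" by (rule order_tendstoD(2)[OF w0 r'(1)])
     thus "\<forall>\<^sub>F i in sequentially. 1 <= g i t"
     proof eventually_elim
      case (elim i)
      have "(\<integral>\<^sup>+y. indicator S y * indicator (W (w i)) (\<Psi> l t + y) \<partial>\<mu>)
        = (\<integral>\<^sup>+x. indicator S (F t + x) * indicator (W (w i)) (\<Psi> l t + (F t + x)) \<partial>\<mu>)"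
       by (rule nn_integral_translate[symmetric]) measurable
      also have "\<dots> = (\<integral>\<^sup>+x. indicator (W (w i)) x \<partial>\<mu>)"
      proof (rule nn_integral_cong)
       fix x
       have "\<Psi> l t + (F t + x) = x" by (simp add: F_def add.assoc[symmetric])
       moreover have "F t + x \<in> S" if "x \<in> W (w i)"
        using that elim r'(3) by (auto simp: W_def)
       ultimately show "indicator S (F t + x) * indicator (W (w i)) (\<Psi> l t + (F t + x)) = (indicator (W (w i)) x :: ennreal)"
        by (auto simp: indicator_def)
      qed
      also have "\<dots> = emeasure \<mu> (W (w i))" by simp
      finally show ?case using Wi by (simp add: g_def)
     qed
    qed
    thus ?thesis by (simp add: True)
   qed simp
   have gint: "(\<integral>\<^sup>+t. g i t \<partial>Pr) <= ennreal Cd * emeasure \<mu> S" for i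
   proof -
    have "(\<integral>\<^sup>+t. g i t \<partial>Pr) = (\<integral>\<^sup>+t. (\<integral>\<^sup>+y. indicator S y * indicator (W (w i)) (\<Psi> l t + y) \<partial>\<mu>) \<partial>Pr) / emeasure \<mu> (W (w i))"
     unfolding g_def by (rule nn_integral_divide) measurable
    also have "(\<integral>\<^sup>+t. (\<integral>\<^sup>+y. indicator S y * indicator (W (w i)) (\<Psi> l t + y) \<partial>\<mu>) \<partial>Pr)
      = (\<integral>\<^sup>+y. (\<integral>\<^sup>+t. indicator S y * indicator (W (w i)) (\<Psi> l t + y) \<partial>Pr) \<partial>\<mu>)"
     by (rule PM.Fubini'[symmetric]) measurable
    also have "\<dots> = (\<integral>\<^sup>+y. indicator S y * emeasure Pr {t \<in> space Pr. \<Psi> l t + y \<in> W (w i)} \<partial>\<mu>)"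
    proof (rule nn_integral_cong)
     fix y
     have "(\<integral>\<^sup>+t. indicator S y * indicator (W (w i)) (\<Psi> l t + y) \<partial>Pr)
       = indicator S y * (\<integral>\<^sup>+t. indicator (W (w i)) (\<Psi> l t + y) \<partial>Pr)" by (rule nn_integral_cmult) measurable
     also have "(\<integral>\<^sup>+t. indicator (W (w i)) (\<Psi> l t + y) \<partial>Pr)
       = (\<integral>\<^sup>+t. indicator {t \<in> space Pr. \<Psi> l t + y \<in> W (w i)} t \<partial>Pr)"
      by (rule nn_integral_cong) (auto simp: indicator_def)
     also have "\<dots> = emeasure Pr {t \<in> space Pr. \<Psi> l t + y \<in> W (w i)}" by (rule nn_integral_indicator) measurable
     finally show "(\<integral>\<^sup>+t. indicator S y * indicator (W (w i)) (\<Psi> l t + y) \<partial>Pr)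
       = indicator S y * emeasure Pr {t \<in> space Pr. \<Psi> l t + y \<in> W (w i)}" .
    qed
    also have "\<dots> <= (\<integral>\<^sup>+y. (ennreal Cd * emeasure \<mu> (W (w i))) * indicator S y \<partial>\<mu>)"
    proof (rule nn_integral_mono)
     fix y
     show "indicator S y * emeasure Pr {t \<in> space Pr. \<Psi> l t + y \<in> W (w i)} <= (ennreal Cd * emeasure \<mu> (W (w i))) * indicator S y"
      using bound[OF r, of y i] unfolding Pr_def by (auto simp: indicator_def)
    qed
    also have "\<dots> = (ennreal Cd * emeasure \<mu> S) * emeasure \<mu> (W (w i))" by (subst nn_integral_cmult_indicator) (simp_all add: mult_ac)
    finally show ?thesis using Wi[of i] by (auto simp: ennreal_mult_divide_eq divide_right_mono_ennreal dest!: divide_right_mono_ennreal[where c="emeasure \<mu> (W (w i))"])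
   qed
   have "emeasure Q S = (\<integral>\<^sup>+t. indicator {t \<in> space Pr. F t \<in> S} t \<partial>Pr)" by (simp add: emQ)
   also have "\<dots> <= (\<integral>\<^sup>+t. liminf (%i. g i t) \<partial>Pr)"
    by (rule nn_integral_mono) (use fatou in \<open>auto simp: indicator_def\<close>)
   also have "\<dots> <= liminf (%i. \<integral>\<^sup>+t. g i t \<partial>Pr)" by (rule nn_integral_liminf[OF mg])
   also have "\<dots> <= ennreal Cd * emeasure \<mu> S" by (rule Liminf_le) (simp_all add: gint)
   finally show ?thesis .
  qed
  define V where "V = U0 \<inter> ch -` ball 0 r0"
  have V: "open V" unfolding V_def by (intro continuous_open_preimage cont_ch open_U0 open_ball)
  define K where "K = W r0"
  have K: "compact K" unfolding K_def by (rule compact_W) simp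
  have VK: "V \<subseteq> K" by (auto simp: V_def K_def W_def)
  have FV: "F t \<in> V" if "t \<in> box r" for t
  proof -
   have t: "\<Psi> l t \<in> U0" "norm (ch (\<Psi> l t)) <= r0 / 4" using RU Rk rb[OF that] by auto
   hence "norm (ch (\<Psi> l t)) <= r0" using r0 by simp
   note m = minus_mem[OF t(1) this] ch_minus[OF t(1) this]
   show ?thesis using m t(2) r0 by (simp add: V_def F_def)
  qed
  have EV: "E \<inter> V \<in> sets borel" using E V by auto
  have QE: "emeasure Q E = emeasure Q (E \<inter> V)"
   unfolding emQ[OF E] emQ[OF EV]
  proof (rule emeasure_eq_AE)
   show "AE t in Pr. (t \<in> {t \<in> space Pr. F t \<in> E}) = (t \<in> {t \<in> space Pr. F t \<in> E \<inter> V})"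
    using AE_box[of r] unfolding Pr_def[symmetric] by eventually_elim (use FV in auto)
   show "{t \<in> space Pr. F t \<in> E} \<in> sets Pr" "{t \<in> space Pr. F t \<in> E \<inter> V} \<in> sets Pr"
    using E EV by measurable
  qed
  have "emeasure Q E <= ennreal Cd * emeasure \<mu> E"
  proof (rule ennreal_le_epsilon)
   fix e :: real assume e: "0 < e"
   define e' where "e' = e / (Cd + 1)"
   have e': "e' > 0" using e Cd by (simp add: e'_def)
   obtain H S where HS: "closed H" "open S" "H \<subseteq> E \<inter> V" "E \<inter> V \<subseteq> S" "measure (cut K) (S - H) < e'"
    by (rule finite_measure_regular[OF finite_cut[OF K] sets_cut[OF K] EV e']) (rule that)
   interpret cK: finite_measure "cut K" by (rule finite_cut[OF K])
   have SV: "open (S \<inter> V)" using HS V by auto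
   have bS: "S \<inter> V \<in> sets borel" "S - H \<in> sets borel" using SV HS by auto
   have "emeasure Q E <= emeasure Q (S \<inter> V)" unfolding QE using HS(4) bS by (intro emeasure_mono) (auto simp: Q_def)
   also have "\<dots> <= ennreal Cd * emeasure \<mu> (S \<inter> V)" by (rule openQ[OF SV])
   also have "emeasure \<mu> (S \<inter> V) = emeasure (cut K) (S \<inter> V)"
    using VK by (intro measure_cut_Int[symmetric] K bS) auto
   also have "\<dots> <= emeasure (cut K) ((E \<inter> V) \<union> (S - H))"
    using HS(3) EV bS by (intro emeasure_mono) (auto simp: sets_cut[OF K])
   also have "\<dots> <= emeasure (cut K) (E \<inter> V) + emeasure (cut K) (S - H)"
    using EV bS by (intro emeasure_subadditive) (simp_all add: sets_cut[OF K])
   also have "emeasure (cut K) (E \<inter> V) <= emeasure \<mu> E"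
    unfolding emeasure_cut[OF K EV] using E by (intro emeasure_mono) auto
   also have "emeasure (cut K) (S - H) <= ennreal e'"
    using HS(5) by (simp add: cK.emeasure_eq_measure ennreal_leI)
   finally have "emeasure Q E <= ennreal Cd * (emeasure \<mu> E + ennreal e')" by (simp add: mult_left_mono add_mono)
   also have "\<dots> = ennreal Cd * emeasure \<mu> E + ennreal (Cd * e')" using Cd e' by (simp add: distrib_left ennreal_mult)
   also have "Cd * e' <= e" using Cd e by (simp add: e'_def field_simps)
   hence "ennreal Cd * emeasure \<mu> E + ennreal (Cd * e') <= ennreal Cd * emeasure \<mu> E + ennreal e"
    by (intro add_left_mono ennreal_leI)
   finally show "emeasure Q E <= ennreal Cd * emeasure \<mu> E + ennreal e" .
  qed
  thus ?thesis unfolding Q_def Pr_def F_def .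
 qed
 show ?thesis by (rule that[OF R Cd main])
qed

definition Av :: "real => nat => ('g => ennreal) => 'g => ennreal" where
 "Av r k f z = (\<integral>\<^sup>+s. f (e k s + z) \<partial>\<nu> r)"

lemma Av_measurable [measurable]:
 assumes [measurable]: "f \<in> borel_measurable borel"
 shows "Av r k f \<in> borel_measurable borel"
proof -
 interpret sigma_finite_measure "\<nu> r" by (rule sigma_finite_nu)
 show ?thesis unfolding Av_def by measurable
qed

lemma Av_mono: "(\<And>z. f z <= g z) ==> Av r k f z <= Av r k g z"
 unfolding Av_def by (intro nn_integral_mono) auto

text \<open>The average of \<open>f (\<dots> + e k2 s2 + e k1 s1 + z)\<close> over \<open>\<bar>si\<bar> \<le> r\<close>, without normalization: later entries of
 the list act further to the left, as in \<open>L_multi\<close>.\<close>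

primrec It :: "real => nat list => ('g => ennreal) => 'g => ennreal" where
 "It r [] f = f"
| "It r (k # l) f = Av r k (It r l f)"

lemma It_measurable [measurable]: "f \<in> borel_measurable borel ==> It r l f \<in> borel_measurable borel"
 by (induction l) simp_all

lemma It_mono: "(\<And>z. f z <= g z) ==> It r l f z <= It r l g z"
 by (induction l arbitrary: z) (auto intro: Av_mono)

lemma It_append: "It r (l @ l') f = It r l (It r l' f)"
 by (induction l) simp_all

lemma It_eq:
 assumes "distinct l" and [measurable]: "f \<in> borel_measurable borel"
 shows "It r l f z = (\<integral>\<^sup>+t. f (\<Psi> (rev l) t + z) \<partial>P r (set l))"
 using assms(1)
proof (induction l arbitrary: z)
 case Nil
 show ?case by (simp add: PiM_empty nn_integral_count_space_finite Psi_Nil)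
next
 case (Cons k l)
 have [measurable]: "\<Psi> (rev l @ [k]) \<in> borel_measurable (P r (insert k (set l)))" by (rule measurable_Psi) auto
 have k: "k \<notin> set l" using Cons by simp
 have "(\<integral>\<^sup>+t. f (\<Psi> (rev l @ [k]) t + z) \<partial>P r (insert k (set l)))
   = (\<integral>\<^sup>+s. (\<integral>\<^sup>+t. f (\<Psi> (rev l @ [k]) (t(k := s)) + z) \<partial>P r (set l)) \<partial>\<nu> r)"
  by (rule nu.product_nn_integral_insert_rev) (use k in auto)
 also have "\<dots> = (\<integral>\<^sup>+s. It r l f (e k s + z) \<partial>\<nu> r)"
 proof (rule nn_integral_cong)
  fix s
  have "\<Psi> (rev l @ [k]) (t(k := s)) + z = \<Psi> (rev l) t + (e k s + z)" for t
  proof -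
   have "\<Psi> (rev l) (t(k := s)) = \<Psi> (rev l) t" using k by (intro Psi_cong) auto
   thus ?thesis by (simp add: Psi_append Psi_Cons Psi_Nil add.assoc)
  qed
  thus "(\<integral>\<^sup>+t. f (\<Psi> (rev l @ [k]) (t(k := s)) + z) \<partial>P r (set l)) = It r l f (e k s + z)"
   using Cons by simp
 qed
 finally show ?case by (simp add: Av_def)
qed

text \<open>The inverse of the product of the factors is again a product of the same kind in the opposite order,
 so its distribution is dominated by the Haar measure.\<close>

lemma It_dominated:
 assumes l: "full l"
 obtains R Cd :: real where "R > 0" "Cd \<ge> 0"
  "\<And>r V f z. 0 < r ==> r <= R ==> V \<in> sets borel ==> \<Psi> l ` box r \<subseteq> V ==>
   f \<in> borel_measurable borel ==> It r l f z <= ennreal Cd * star (indicator V) f z"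
proof -
 have lr: "full (rev l)" using l by (simp add: full_def)
 obtain R Cd :: real where R: "R > 0" "Cd \<ge> 0"
  "\<And>r E. 0 < r ==> r <= R ==> E \<in> sets borel ==>
   emeasure (distr (P r {..<n}) borel (%t. - \<Psi> (rev l) t)) E <= ennreal Cd * emeasure \<mu> E"
  by (rule law_dominated[OF lr]) (rule that)
 show ?thesis
 proof (rule that[OF R(1,2)])
  fix r V z and f :: "'g => ennreal" assume r: "0 < r" "r <= R" and [measurable]: "V \<in> sets borel"
   and V: "\<Psi> l ` box r \<subseteq> V" and [measurable]: "f \<in> borel_measurable borel"
  define Pr where "Pr = P r {..<n}"
  define F where "F t = - \<Psi> (rev l) t" for t
  have [measurable]: "\<Psi> (rev l) \<in> borel_measurable Pr"
   unfolding Pr_def by (rule measurable_Psi) (use l in \<open>simp add: full_def\<close>)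
  have [measurable]: "F \<in> borel_measurable Pr" unfolding F_def by measurable
  have FV: "F t \<in> V" if "t \<in> box r" for t
  proof -
   have "F t = \<Psi> l (%k. - t k)" by (simp add: F_def Psi_uminus)
   moreover have "(%k. - t k) \<in> box r" using that by (simp add: box_def)
   ultimately show ?thesis using V by auto
  qed
  have le: "distr Pr borel F <= scale_measure (ennreal Cd) \<mu>"
   using R(3)[OF r] by (subst le_measure) (auto simp: Pr_def F_def[abs_def])
  have "It r l f z = (\<integral>\<^sup>+t. f (\<Psi> (rev l) t + z) \<partial>Pr)"
   using l by (simp add: It_eq full_def Pr_def)
  also have "\<dots> <= (\<integral>\<^sup>+t. indicator V (F t) * f (- F t + z) \<partial>Pr)"
  proof (rule nn_integral_mono_AE)
   show "AE t in Pr. f (\<Psi> (rev l) t + z) <= indicator V (F t) * f (- F t + z)"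
    using AE_box[of r] unfolding Pr_def[symmetric]
   proof eventually_elim
    case (elim t)
    thus ?case using FV[OF elim] by (simp add: F_def)
   qed
  qed
  also have "\<dots> = (\<integral>\<^sup>+x. indicator V x * f (- x + z) \<partial>distr Pr borel F)"
   by (rule nn_integral_distr[symmetric]) measurable
  also have "\<dots> <= (\<integral>\<^sup>+x. indicator V x * f (- x + z) \<partial>scale_measure (ennreal Cd) \<mu>)"
   by (rule nn_integral_mono_measure[OF _ le]) simp
  also have "\<dots> = ennreal Cd * star (indicator V) f z"
   unfolding star_def by (rule nn_integral_scale_measure) measurable
  finally show "It r l f z <= ennreal Cd * star (indicator V) f z" .
 qed
qed

lemma It_dominated_uniform:
 obtains R Cd :: real where "R > 0" "Cd \<ge> 0"
  "\<And>l r V f z. full l ==> 0 < r ==> r <= R ==> V \<in> sets borel ==> \<Psi> l ` box r \<subseteq> V ==>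
   f \<in> borel_measurable borel ==> It r l f z <= ennreal Cd * star (indicator V) f z"
proof -
 define good where "good l R Cd \<longleftrightarrow> (\<forall>r V f z. 0 < r --> r <= R --> V \<in> sets borel --> \<Psi> l ` box r \<subseteq> V -->
   f \<in> borel_measurable borel --> It r l f z <= ennreal Cd * star (indicator V) f z)" for l R Cd
 have "\<exists>R>0. \<exists>Cd\<ge>0. \<forall>l\<in>L. good l R Cd" if "finite L" "L \<subseteq> {l. full l}" for L
  using that
 proof (induction L rule: finite_induct)
  case empty
  thus ?case by (intro exI[of _ 1] conjI exI[of _ 0]) auto
 next
  case (insert l L)
  then obtain R Cd where 1: "R > 0" "Cd \<ge> 0" "\<forall>l\<in>L. good l R Cd" by auto
  have "full l" using insert.prems by simp
  obtain R' Cd' :: real where h: "R' > 0" "Cd' \<ge> 0"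
    "\<And>r V f z. 0 < r ==> r <= R' ==> V \<in> sets borel ==> \<Psi> l ` box r \<subseteq> V ==>
     f \<in> borel_measurable borel ==> It r l f z <= ennreal Cd' * star (indicator V) f z"
   by (rule It_dominated[OF \<open>full l\<close>]) (rule that)
  have "good l R' Cd'" unfolding good_def by (intro allI impI) (rule h(3); simp)
  note 2 = h(1,2) this
  have mono: "good l (min R R') (max Cd Cd')" if "good l a b" "min R R' <= a" "b <= max Cd Cd'" for l a b
   unfolding good_def
  proof (intro allI impI)
   fix r V z and f :: "'g => ennreal"
   assume h: "0 < r" "r <= min R R'" "V \<in> sets borel" "\<Psi> l ` box r \<subseteq> V" "f \<in> borel_measurable borel"
   have "It r l f z <= ennreal b * star (indicator V) f z" using that h unfolding good_def by auto
   also have "\<dots> <= ennreal (max Cd Cd') * star (indicator V) f z" by (intro mult_right_mono ennreal_leI that) simp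
   finally show "It r l f z <= ennreal (max Cd Cd') * star (indicator V) f z" .
  qed
  have all: "\<forall>l'\<in>insert l L. good l' (min R R') (max Cd Cd')"
   using mono[of l R' Cd'] mono[of _ R Cd] 1 2 by auto
  have pos: "min R R' > 0" "max Cd Cd' \<ge> 0" using 1 2 by auto
  show ?case
   by (rule exI[of _ "min R R'"], rule conjI, rule pos, rule exI[of _ "max Cd Cd'"], rule conjI, rule pos, rule all)
 qed
 moreover have "finite {l. full l}"
 proof (rule finite_subset)
  show "{l. full l} \<subseteq> {l. set l \<subseteq> {..<n} \<and> length l <= n}"
   using distinct_card by (fastforce simp: full_def)
 qed (rule finite_lists_length_le, simp)
 ultimately obtain R Cd where "R > 0" "Cd \<ge> 0" "\<forall>l\<in>{l. full l}. good l R Cd" by blast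
 thus ?thesis by (intro that[of R Cd]) (auto simp: good_def)
qed

end

section \<open>A Sobolev inequality along one-parameter subgroups\<close>

text \<open>If the derivative is not integrable, the right-hand side is infinite.\<close>

lemma derivative_integral_bound:
 fixes F G :: "real => complex"
 assumes d: "\<And>s. (F has_vector_derivative G s) (at s)" and G [measurable]: "G \<in> borel_measurable borel" and ab: "a <= b"
 shows "ennreal (cmod (F b - F a)) <= (\<integral>\<^sup>+s. ennreal (cmod (G s)) * indicator {a..b} s \<partial>lborel)"
proof (cases "(\<integral>\<^sup>+s. ennreal (cmod (G s)) * indicator {a..b} s \<partial>lborel) = \<infinity>")
 case False
 define H where "H s = indicat_real {a..b} s *\<^sub>R G s" for s
 have nH: "ennreal (cmod (H s)) = ennreal (cmod (G s)) * indicator {a..b} s" for s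
  by (auto simp: H_def indicator_def)
 have int: "integrable lborel H"
 proof (rule integrableI_bounded)
  show "H \<in> borel_measurable lborel" unfolding H_def by measurable
  show "(\<integral>\<^sup>+s. ennreal (cmod (H s)) \<partial>lborel) < \<infinity>" unfolding nH using False by (simp add: less_top)
 qed
 have si: "set_integrable lborel {a..b} G" using int by (simp add: set_integrable_def H_def[abs_def])
 have "(G has_integral (F b - F a)) {a..b}"
  by (rule fundamental_theorem_of_calculus[OF ab]) (rule has_vector_derivative_at_within[OF d])
 hence "F b - F a = integral {a..b} G" by (simp add: integral_unique)
 also have "\<dots> = integral\<^sup>L lborel H"
  using set_borel_integral_eq_integral(2)[OF si] by (simp add: set_lebesgue_integral_def H_def[abs_def])
 finally have "ennreal (cmod (F b - F a)) <= (\<integral>\<^sup>+s. ennreal (cmod (H s)) \<partial>lborel)"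
  using integral_norm_bound_ennreal[OF int] by simp
 thus ?thesis by (simp add: nH)
qed simp

lemma L_multi_append: "L_multi c X (\<alpha> @ \<beta>) f = L_multi c X \<beta> (L_multi c X \<alpha> f)"
 by (induction \<alpha> arbitrary: f) auto

lemma L_multi_exists_append:
 "L_multi_exists c X (\<alpha> @ \<beta>) f \<longleftrightarrow> L_multi_exists c X \<alpha> f \<and> L_multi_exists c X \<beta> (L_multi c X \<alpha> f)"
 by (induction \<alpha> arbitrary: f) auto

context lie_haar
begin

abbreviation differentiable_along :: "nat => ('g => complex) => bool" where
 "differentiable_along k f \<equiv> \<forall>x. \<exists>l. (L_quotient ch (X k) f x \<longlongrightarrow> l) (at 0)"

abbreviation Ld :: "nat => ('g => complex) => 'g => complex" where
 "Ld k f \<equiv> L_op ch (X k) f"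

lemma Ld_limit: "differentiable_along k f ==> (L_quotient ch (X k) f x \<longlongrightarrow> Ld k f x) (at 0)"
 unfolding L_op_def using tendsto_Lim by (metis at_neq_bot)

lemma Ld_path_derivative:
 assumes d: "differentiable_along k f"
 shows "((%s. f (e k s + p)) has_vector_derivative Ld k f (e k s + p)) (at s)"
proof -
 define l where "l = Ld k f (e k s + p)"
 have "((%h. norm (L_quotient ch (X k) f (e k s + p) h - l)) \<longlongrightarrow> 0) (at 0)"
  using Ld_limit[OF d, of "e k s + p"] unfolding l_def by (intro tendsto_norm_zero LIM_zero)
 hence "((%h. norm (f (e k (s + h) + p) - f (e k s + p) - h *\<^sub>R l) / norm h) \<longlongrightarrow> 0) (at 0)"
 proof (rule Lim_transform_eventually)
  have "norm (L_quotient ch (X k) f (e k s + p) h - l) = norm (f (e k (s + h) + p) - f (e k s + p) - h *\<^sub>R l) / norm h"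
   if "h \<noteq> 0" for h
  proof -
   have "e k (s + h) + p = e k h + (e k s + p)" by (subst add.commute) (simp add: e_add add.assoc)
   hence "L_quotient ch (X k) f (e k s + p) h - l = (f (e k (s + h) + p) - f (e k s + p) - h *\<^sub>R l) / of_real h"
    using that by (simp add: L_quotient_def e_def[symmetric] scaleR_conv_of_real diff_divide_distrib)
   thus ?thesis by (simp add: norm_divide)
  qed
  thus "\<forall>\<^sub>F h in at 0. norm (L_quotient ch (X k) f (e k s + p) h - l)
    = norm (f (e k (s + h) + p) - f (e k s + p) - h *\<^sub>R l) / norm h"
   by (auto simp: eventually_at_filter)
 qed
 thus ?thesis unfolding has_vector_derivative_def has_derivative_at l_def[symmetric]
  by (auto intro: bounded_linear_scaleR_left)
qed

lemma Ld_measurable: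
 assumes [measurable]: "f \<in> borel_measurable borel" and d: "differentiable_along k f"
 shows "Ld k f \<in> borel_measurable borel"
proof (rule borel_measurable_LIMSEQ_metric)
 fix i
 show "(%x. L_quotient ch (X k) f x (inverse (real (Suc i)))) \<in> borel_measurable borel"
  unfolding L_quotient_def e_def[symmetric] by measurable
next
 fix x
 have "filterlim (%i. inverse (real (Suc i))) (at 0) sequentially"
  using LIMSEQ_inverse_real_of_nat by (intro filterlim_atI) auto
 from filterlim_compose[OF Ld_limit[OF d, of x] this]
 show "(%i. L_quotient ch (X k) f x (inverse (real (Suc i)))) \<longlonglongrightarrow> Ld k f x" .
qed

lemma L_multi_measurable:
 "f \<in> borel_measurable borel ==> L_multi_exists ch X \<alpha> f ==> L_multi ch X \<alpha> f \<in> borel_measurable borel"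
 by (induction \<alpha> arbitrary: f) (auto intro: Ld_measurable)

lemma nn_integral_nu:
 "g \<in> borel_measurable borel ==> (\<integral>\<^sup>+s. g s \<partial>\<nu> r) = (\<integral>\<^sup>+s. g s * indicator {-r..r} s \<partial>lborel)"
 unfolding \<nu>_def by (subst nn_integral_density) (auto simp: mult.commute)

lemma Av_measurable_path: "f \<in> borel_measurable borel ==> (%s. f (e k s + p)) \<in> borel_measurable borel"
 by (rule measurable_compose[of "%s. e k s + p"]) measurable

lemma Av_radius_mono:
 assumes "f \<in> borel_measurable borel" "r <= r'" shows "Av r k f z <= Av r' k f z"
proof -
 have m: "(%s. f (e k s + z)) \<in> borel_measurable borel" using assms(1) by measurable
 show ?thesis unfolding Av_def nn_integral_nu[OF m]
  using assms(2) by (intro nn_integral_mono mult_left_mono) (auto simp: indicator_def)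
qed

lemma Av_add:
 "f \<in> borel_measurable borel ==> g \<in> borel_measurable borel ==> Av r k (%z. f z + g z) p = Av r k f p + Av r k g p"
 unfolding Av_def by (intro nn_integral_add) (auto simp: measurable_cong_sets[OF sets_nu refl] Av_measurable_path)

lemma Av_cmult: "f \<in> borel_measurable borel ==> Av r k (%z. c * f z) p = c * Av r k f p"
 unfolding Av_def by (intro nn_integral_cmult) (auto simp: measurable_cong_sets[OF sets_nu refl] Av_measurable_path)

lemma It_cmult: "f \<in> borel_measurable borel ==> It r l (%z. c * f z) p = c * It r l f p"
proof (induction l arbitrary: p)
 case (Cons k l)
 have "It r (k # l) (%z. c * f z) p = Av r k (%z. c * It r l f z) p" using Cons by (simp add: Av_def)
 also have "\<dots> = c * It r (k # l) f p" using Cons by (simp add: Av_cmult)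
 finally show ?case .
qed simp

lemma increment_bound:
 assumes [measurable]: "f \<in> borel_measurable borel" and d: "differentiable_along k f" and t: "\<bar>t\<bar> <= r"
 shows "ennreal (cmod (f (e k t + p) - f p)) <= Av r k (mag (Ld k f)) p"
proof -
 have [measurable]: "Ld k f \<in> borel_measurable borel" by (rule Ld_measurable) fact+
 define F where "F s = f (e k s + p)" for s
 define G where "G s = Ld k f (e k s + p)" for s
 have FG: "(F has_vector_derivative G s) (at s)" for s unfolding F_def G_def by (rule Ld_path_derivative[OF d])
 have mG [measurable]: "G \<in> borel_measurable borel" unfolding G_def by measurable
 have "ennreal (cmod (F t - F 0)) <= (\<integral>\<^sup>+s. ennreal (cmod (G s)) * indicator {min 0 t..max 0 t} s \<partial>lborel)"
  using derivative_integral_bound[OF FG mG, of 0 t] derivative_integral_bound[OF FG mG, of t 0]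
  by (cases "t \<ge> 0") (auto simp: norm_minus_commute max_def min_def)
 also have "\<dots> <= (\<integral>\<^sup>+s. ennreal (cmod (G s)) * indicator {-r..r} s \<partial>lborel)"
  using t by (intro nn_integral_mono mult_left_mono) (auto simp: indicator_def abs_le_iff)
 also have "\<dots> = Av r k (mag (Ld k f)) p" by (simp add: Av_def nn_integral_nu G_def)
 finally show ?thesis by (simp add: F_def e_0)
qed

text \<open>The value at \<open>p\<close> differs from the value at any point of the path through \<open>p\<close> by at most the integral of the
 derivative; average over the path.\<close>

lemma sobolev_step:
 assumes [measurable]: "f \<in> borel_measurable borel" and d: "differentiable_along k f" and r: "r > 0"
 shows "mag f p <= ennreal (1 / (2 * r)) * Av r k (mag f) p + Av r k (mag (Ld k f)) p"
proof -
 define J where "J = Av r k (mag (Ld k f)) p"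
 have tot: "emeasure (\<nu> r) UNIV = ennreal (2 * r)" using r by (simp add: emeasure_nu)
 have m: "(%s. mag f (e k s + p)) \<in> borel_measurable (\<nu> r)" by measurable
 have "mag f p * ennreal (2 * r) = (\<integral>\<^sup>+s. mag f p \<partial>\<nu> r)" by (simp add: tot)
 also have "\<dots> <= (\<integral>\<^sup>+s. mag f (e k s + p) + J \<partial>\<nu> r)"
 proof (rule nn_integral_mono_AE)
  have "AE s in \<nu> r. \<bar>s\<bar> <= r" unfolding \<nu>_def by (subst AE_density) (auto simp: indicator_def abs_le_iff)
  thus "AE s in \<nu> r. mag f p <= mag f (e k s + p) + J"
  proof eventually_elim
   case (elim s)
   have "cmod (f p) <= cmod (f (e k s + p)) + cmod (f (e k s + p) - f p)"
    by (metis norm_minus_commute norm_triangle_sub)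
   hence "mag f p <= mag f (e k s + p) + ennreal (cmod (f (e k s + p) - f p))"
    by (simp add: ennreal_plus[symmetric] ennreal_leI del: ennreal_plus)
   also have "\<dots> <= mag f (e k s + p) + J"
    unfolding J_def by (intro add_left_mono increment_bound[OF _ d elim]) fact
   finally show ?case .
  qed
 qed
 also have "\<dots> = Av r k (mag f) p + J * ennreal (2 * r)"
  using m by (subst nn_integral_add) (auto simp: Av_def tot)
 finally have "ennreal (1 / (2 * r)) * (mag f p * ennreal (2 * r)) <= ennreal (1 / (2 * r)) * (Av r k (mag f) p + J * ennreal (2 * r))"
  by (rule mult_left_mono) simp
 moreover have "ennreal (1 / (2 * r)) * ennreal (2 * r) = 1" using r by (simp add: ennreal_mult[symmetric])
 hence "ennreal (1 / (2 * r)) * (a * ennreal (2 * r)) = a" for a by (metis mult.commute mult.left_commute mult_1_right)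
 ultimately show ?thesis by (simp add: distrib_left J_def)
qed

text \<open>Iterating the one-dimensional inequality over a list of directions produces the mixed
 derivative in all of them with coefficient one; only the lower derivatives are multiplied by a
 constant that grows when the radius shrinks.\<close>

lemma sobolev_list:
 assumes "r > 0"
 shows "\<exists>D\<ge>0. \<forall>f H. f \<in> borel_measurable borel --> H \<in> borel_measurable borel -->
  (\<forall>\<beta>. set \<beta> \<subseteq> set ks --> length \<beta> <= length ks --> L_multi_exists ch X \<beta> f) -->
  (\<forall>\<beta> z. set \<beta> \<subseteq> set ks --> length \<beta> < length ks --> mag (L_multi ch X \<beta> f) z <= H z) -->
  (\<forall>p. mag f p <= It r ks (mag (L_multi ch X ks f)) p + ennreal D * It r ks H p)"
proof (induction ks)
 case Nil
 show ?case by (intro exI[of _ 0]) auto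
next
 case (Cons k ks)
 obtain D where D: "D \<ge> 0" and IH: "\<And>f H p. f \<in> borel_measurable borel ==> H \<in> borel_measurable borel ==>
  (\<forall>\<beta>. set \<beta> \<subseteq> set ks --> length \<beta> <= length ks --> L_multi_exists ch X \<beta> f) ==>
  (\<forall>\<beta> z. set \<beta> \<subseteq> set ks --> length \<beta> < length ks --> mag (L_multi ch X \<beta> f) z <= H z) ==>
  mag f p <= It r ks (mag (L_multi ch X ks f)) p + ennreal D * It r ks H p"
  using Cons.IH by (elim exE conjE) (rule that, assumption, blast)
 define c where "c = 1 / (2 * r)"
 have c: "c \<ge> 0" using assms by (simp add: c_def)
 show ?case
 proof (intro exI[of _ "c * (1 + D) + D"] conjI allI impI)
  show "0 <= c * (1 + D) + D" using c D by simp
  fix f p and H :: "'g => ennreal"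
  assume f [measurable]: "f \<in> borel_measurable borel" and H [measurable]: "H \<in> borel_measurable borel"
   and ex: "\<forall>\<beta>. set \<beta> \<subseteq> set (k # ks) --> length \<beta> <= length (k # ks) --> L_multi_exists ch X \<beta> f"
   and le: "\<forall>\<beta> z. set \<beta> \<subseteq> set (k # ks) --> length \<beta> < length (k # ks) --> mag (L_multi ch X \<beta> f) z <= H z"
  have exk: "L_multi_exists ch X \<beta> (Ld k f)" "differentiable_along k f"
   if "set \<beta> \<subseteq> set (k # ks)" "length \<beta> <= length ks" for \<beta>
   using ex[rule_format, of "k # \<beta>"] that by auto
  have d: "differentiable_along k f" by (rule exk(2)[of "[]"]) auto
  have lek: "mag (L_multi ch X \<beta> (Ld k f)) z <= H z"
   if "set \<beta> \<subseteq> set (k # ks)" "length \<beta> < length ks" for \<beta> z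
   using le[rule_format, of "k # \<beta>" z] that by auto
  have [measurable]: "Ld k f \<in> borel_measurable borel" by (rule Ld_measurable[OF f d])
  have [measurable]: "L_multi ch X ks (Ld k f) \<in> borel_measurable borel"
   by (rule L_multi_measurable) (auto intro: exk(1))
  have 1: "mag f z <= ennreal (1 + D) * It r ks H z" for z
  proof -
   have "mag f z <= It r ks (mag (L_multi ch X ks f)) z + ennreal D * It r ks H z"
    using ex le by (intro IH f H) auto
   also have "It r ks (mag (L_multi ch X ks f)) z <= It r ks H z"
    using le by (intro It_mono) auto
   also have "It r ks H z + ennreal D * It r ks H z = ennreal (1 + D) * It r ks H z"
    using D by (simp add: distrib_right)
   finally show ?thesis by (simp add: add_right_mono)
  qed
  have 2: "mag (Ld k f) z <= It r ks (mag (L_multi ch X ks (Ld k f))) z + ennreal D * It r ks H z" for z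
   using exk(1) lek by (intro IH) auto
  have "mag f p <= ennreal c * Av r k (mag f) p + Av r k (mag (Ld k f)) p"
   unfolding c_def by (rule sobolev_step[OF f d assms])
  also have "Av r k (mag f) p <= Av r k (%z. ennreal (1 + D) * It r ks H z) p" by (rule Av_mono[OF 1])
  also have "\<dots> = ennreal (1 + D) * It r (k # ks) H p" by (simp add: Av_cmult)
  also have "Av r k (mag (Ld k f)) p <= Av r k (%z. It r ks (mag (L_multi ch X ks (Ld k f))) z + ennreal D * It r ks H z) p"
   by (rule Av_mono[OF 2])
  also have "\<dots> = It r (k # ks) (mag (L_multi ch X (k # ks) f)) p + ennreal D * It r (k # ks) H p"
   by (simp add: Av_add Av_cmult)
  finally have "mag f p <= ennreal c * (ennreal (1 + D) * It r (k # ks) H p)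
    + (It r (k # ks) (mag (L_multi ch X (k # ks) f)) p + ennreal D * It r (k # ks) H p)"
   by (simp add: add_mono mult_left_mono)
  also have "\<dots> = It r (k # ks) (mag (L_multi ch X (k # ks) f)) p + ennreal (c * (1 + D) + D) * It r (k # ks) H p"
   using c D by (simp add: ennreal_plus ennreal_mult distrib_right mult.assoc add_ac del: It.simps)
  finally show "mag f p <= It r (k # ks) (mag (L_multi ch X (k # ks) f)) p + ennreal (c * (1 + D) + D) * It r (k # ks) H p" .
 qed
qed

lemma small_boxes:
 assumes Y: "open Y" "0 \<in> Y"
 obtains r where "r > 0" "\<And>l. set l \<subseteq> {..<n} ==> length l <= n ==> \<Psi> l ` box r \<subseteq> Y"
proof -
 obtain s where s: "s > 0" "s <= r0" "W s \<subseteq> Y" by (rule W_basis[OF Y]) (rule that)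
 have family: "\<exists>r>0. \<forall>l\<in>\<Lambda>. \<Psi> l ` box r \<subseteq> Y" if "finite \<Lambda>" "\<forall>l\<in>\<Lambda>. set l \<subseteq> {..<n}" for \<Lambda>
  using that
 proof (induction \<Lambda> rule: finite_induct)
  case empty
  thus ?case by (intro exI[of _ 1]) auto
 next
  case (insert l \<Lambda>)
  then obtain r where r: "r > 0" "\<forall>l\<in>\<Lambda>. \<Psi> l ` box r \<subseteq> Y" by auto
  have l: "set l \<subseteq> {..<n}" using insert.prems by simp
  obtain r' where r': "r' > 0" "\<forall>t t'. (\<forall>k\<in>set l. \<bar>t k\<bar> <= r' \<and> \<bar>t' k\<bar> <= r') -->
   \<Psi> l t \<in> U0 \<and> norm (ch (\<Psi> l t)) <= s \<and>
   norm (ch (\<Psi> l t) - ch (\<Psi> l t') - (\<Sum>k\<leftarrow>l. (t k - t' k) *\<^sub>R X k)) <= s * (\<Sum>k\<leftarrow>l. \<bar>t k - t' k\<bar>)"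
   using Psi_strict_derivative[OF l s(1)] by (elim exE conjE) (rule that)
  have "\<Psi> l t \<in> Y" if "t \<in> box r'" for t
  proof -
   have "\<forall>k\<in>set l. \<bar>t k\<bar> <= r' \<and> \<bar>t k\<bar> <= r'" using that l by (auto simp: box_def)
   with r'(2) have "\<Psi> l t \<in> U0 \<and> norm (ch (\<Psi> l t)) <= s" by blast
   thus ?thesis using s(3) W_I by blast
  qed
  hence "\<Psi> l ` box r' \<subseteq> Y" by (rule image_subsetI)
  hence "\<forall>l'\<in>insert l \<Lambda>. \<Psi> l' ` box r \<subseteq> Y \<or> \<Psi> l' ` box r' \<subseteq> Y" using r(2) by simp
  moreover have "\<Psi> l' ` box (min r r') \<subseteq> \<Psi> l' ` box r" "\<Psi> l' ` box (min r r') \<subseteq> \<Psi> l' ` box r'" for l'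
   by (intro image_mono; force simp: box_def)+
  ultimately have "\<forall>l'\<in>insert l \<Lambda>. \<Psi> l' ` box (min r r') \<subseteq> Y" by (meson order_trans)
  moreover have "min r r' > 0" using r(1) r'(1) by simp
  ultimately show ?case by (intro exI[of _ "min r r'"] conjI)
 qed
 have "finite {l. set l \<subseteq> {..<n} \<and> length l <= n}" by (rule finite_lists_length_le) simp
 hence "\<exists>r>0. \<forall>l\<in>{l. set l \<subseteq> {..<n} \<and> length l <= n}. \<Psi> l ` box r \<subseteq> Y" by (rule family) simp
 then obtain r where r: "r > 0" "\<forall>l\<in>{l. set l \<subseteq> {..<n} \<and> length l <= n}. \<Psi> l ` box r \<subseteq> Y"
  by (elim exE conjE) (rule that)
 show ?thesis
 proof (rule that[OF r(1)])
  fix l assume "set l \<subseteq> {..<n}" "length l <= n"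
  thus "\<Psi> l ` box r \<subseteq> Y" by (intro bspec[OF r(2)]) simp
 qed
qed

lemma star_shift:
 assumes [measurable]: "V \<in> sets borel" "h \<in> borel_measurable borel" and V': "\<And>x. x \<in> V ==> - a + x \<in> V'"
 shows "star (indicator V) h (a + z) <= star (indicator V') h z"
proof -
 have "star (indicator V) h (a + z) = (\<integral>\<^sup>+x. indicator V (a + x) * h (- (a + x) + (a + z)) \<partial>\<mu>)"
  unfolding star_def by (rule nn_integral_translate[symmetric]) measurable
 also have "\<dots> <= star (indicator V') h z"
  unfolding star_def
 proof (rule nn_integral_mono)
  fix x
  have "- (a + x) + (a + z) = - x + z" by (simp add: minus_add add.assoc del: add_uminus_conv_diff)
  moreover have "x \<in> V'" if "a + x \<in> V" using V'[OF that] by (simp add: add.assoc[symmetric])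
  ultimately show "indicator V (a + x) * h (- (a + x) + (a + z)) <= indicator V' x * h (- x + z)"
   by (auto simp: indicator_def)
 qed
 finally show ?thesis .
qed

definition h :: "('g => complex) => 'g => ennreal" where
 "h f z = (\<Sum>\<alpha>\<in>{\<alpha>. set \<alpha> \<subseteq> {..<n} \<and> length \<alpha> <= n}. mag (L_multi ch X \<alpha> f) z)"

lemma finite_multi_indices: "finite {\<alpha>. set \<alpha> \<subseteq> {..<n} \<and> length \<alpha> <= n}"
 by (rule finite_lists_length_le) simp

lemma h_ge: "set \<alpha> \<subseteq> {..<n} ==> length \<alpha> <= n ==> mag (L_multi ch X \<alpha> f) z <= h f z"
 unfolding h_def by (intro member_le_sum finite_multi_indices) auto

lemma h_measurable:
 assumes "f \<in> borel_measurable borel"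
  "\<And>\<alpha>. set \<alpha> \<subseteq> {..<n} ==> length \<alpha> <= n ==> L_multi_exists ch X \<alpha> f"
 shows "h f \<in> borel_measurable borel"
proof -
 have [measurable]: "L_multi ch X \<alpha> f \<in> borel_measurable borel" if "\<alpha> \<in> {\<alpha>. set \<alpha> \<subseteq> {..<n} \<and> length \<alpha> <= n}" for \<alpha>
  using that by (intro L_multi_measurable assms) auto
 show ?thesis unfolding h_def[abs_def] by (intro borel_measurable_sum) measurable
qed

text \<open>The mixed derivative in all directions, averaged over a box, is controlled by the Haar
 measure with a constant that does not depend on the box. All other terms carry a constant that does,
 but one more integration in the direction \<open>j\<close>, over an interval of length \<open>2 * \<epsilon>\<close>, makes them as
 small as desired.\<close>

lemma oscillation_bound:
 assumes f [measurable]: "f \<in> borel_measurable borel"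
  and ex: "\<And>\<alpha>. set \<alpha> \<subseteq> {..<n} ==> length \<alpha> <= n ==> L_multi_exists ch X \<alpha> f"
 obtains C1 :: real where "C1 \<ge> 0"
  "\<And>V. open V ==> 0 \<in> V ==> \<exists>\<epsilon>>0. \<forall>u\<in>U_eps ch X \<epsilon>. \<forall>z.
   ennreal (cmod (f (u + z) - f z)) <= ennreal C1 * star (indicator V) (h f) z"
proof -
 have hm [measurable]: "h f \<in> borel_measurable borel" by (rule h_measurable[OF f ex])
 obtain R Cd :: real where R: "R > 0" and Cd: "Cd \<ge> 0" and dom:
  "\<And>l r V g z. full l ==> 0 < r ==> r <= R ==> V \<in> sets borel ==> \<Psi> l ` box r \<subseteq> V ==>
   g \<in> borel_measurable borel ==> It r l g z <= ennreal Cd * star (indicator V) g z"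
  by (rule It_dominated_uniform) (rule that)
 show ?thesis
 proof (rule that[of "real n * (2 * Cd)"])
  show "0 <= real n * (2 * Cd)" using Cd by simp
  fix V :: "'g set" assume V: "open V" "0 \<in> V"
  \<comment> \<open>\<open>V\<close> contains the products of three factors from \<open>Y\<close>: a point of the box, a point \<open>e j s\<close>, and the
   factors of \<open>u\<close> that precede in the telescoping sum.\<close>
  obtain Y1 :: "'g set" where Y1: "open Y1" "0 \<in> Y1" "\<And>x y. x \<in> Y1 ==> y \<in> Y1 ==> x + y \<in> V" "Y1 \<subseteq> V" "\<And>x. x \<in> Y1 ==> - x \<in> Y1"
   using symmetric_half_neighbourhood[OF V] by metis
  obtain Y :: "'g set" where Y: "open Y" "0 \<in> Y" "\<And>x y. x \<in> Y ==> y \<in> Y ==> x + y \<in> Y1" "Y \<subseteq> Y1" "\<And>x. x \<in> Y ==> - x \<in> Y"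
   using symmetric_half_neighbourhood[OF Y1(1,2)] by metis
  have [measurable]: "Y \<in> sets borel" "Y1 \<in> sets borel" "V \<in> sets borel" using Y Y1 V by auto
  obtain r1 where r1: "r1 > 0" "\<And>l. set l \<subseteq> {..<n} ==> length l <= n ==> \<Psi> l ` box r1 \<subseteq> Y"
   by (rule small_boxes[OF Y(1,2)]) (rule that)
  define r where "r = min r1 R"
  have r: "r > 0" "r <= R" using r1 R by (auto simp: r_def)
  have boxY: "\<Psi> l t \<in> Y" if "set l \<subseteq> {..<n}" "length l <= n" "t \<in> box r" for l t
  proof -
   have "t \<in> box r1" using that(3) by (auto simp: box_def r_def)
   thus ?thesis using r1(2)[OF that(1,2)] by blast
  qed
  have fullY: "\<Psi> l ` box r \<subseteq> Y" if "full l" for l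
   using that boxY[of l] distinct_card[of l] by (auto simp: full_def)
  define ks where "ks j = filter (%k. k \<noteq> j) [0..<n]" for j
  have fullks: "full (j # ks j)" "full (ks j @ [j])" if "j < n" for j
   using that by (auto simp: full_def ks_def)
  have lks: "Suc (length (ks j)) = n" if "j < n" for j
   using distinct_card[of "j # ks j"] fullks(1)[OF that] unfolding full_def by (metis card_lessThan length_Cons)
  have "\<exists>D\<ge>0. \<forall>j<n. \<forall>p. mag (Ld j f) p <= It r (ks j) (h f) p + ennreal D * It r (ks j @ [j]) (h f) p"
  proof -
   define c where "c = 1 / (2 * r)"
   have c: "c \<ge> 0" using r by (simp add: c_def)
   have "\<exists>D\<ge>0. \<forall>p. mag (Ld j f) p <= It r (ks j) (h f) p + ennreal D * It r (ks j @ [j]) (h f) p" if j: "j < n" for j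
   proof -
    \<comment> \<open>A majorant of the lower derivatives that contains one more average in the direction \<open>j\<close>.\<close>
    define H where "H z = ennreal (c + 1) * Av r j (h f) z" for z
    have [measurable]: "H \<in> borel_measurable borel" unfolding H_def by measurable
    have sks: "set (ks j) \<subseteq> {..<n}" by (auto simp: ks_def)
    have exj: "L_multi_exists ch X (j # \<beta>) f" if "set \<beta> \<subseteq> set (ks j)" "length \<beta> <= length (ks j)" for \<beta>
     using that sks j lks[OF j] by (intro ex) auto
    have "L_multi_exists ch X [j] f" using j by (intro ex) auto
    hence dj: "differentiable_along j f" by simp
    have mj: "Ld j f \<in> borel_measurable borel" by (rule Ld_measurable[OF f dj])
    obtain D where D: "D \<ge> 0" and sob: "\<And>g H p. g \<in> borel_measurable borel ==> H \<in> borel_measurable borel ==>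
     (\<forall>\<beta>. set \<beta> \<subseteq> set (ks j) --> length \<beta> <= length (ks j) --> L_multi_exists ch X \<beta> g) ==>
     (\<forall>\<beta> z. set \<beta> \<subseteq> set (ks j) --> length \<beta> < length (ks j) --> mag (L_multi ch X \<beta> g) z <= H z) ==>
     mag g p <= It r (ks j) (mag (L_multi ch X (ks j) g)) p + ennreal D * It r (ks j) H p"
     using sobolev_list[OF r(1), of "ks j"] by (elim exE conjE) (rule that, assumption, blast)
    have lower: "mag (L_multi ch X \<beta> (Ld j f)) z <= H z"
     if b: "set \<beta> \<subseteq> set (ks j)" "length \<beta> < length (ks j)" for \<beta> z
    proof -
     have ba: "set (j # \<beta>) \<subseteq> {..<n}" "length (j # \<beta>) <= n" "set ((j # \<beta>) @ [j]) \<subseteq> {..<n}" "length ((j # \<beta>) @ [j]) <= n"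
      using b sks j lks[OF j] by auto
     define g where "g = L_multi ch X (j # \<beta>) f"
     have exb: "L_multi_exists ch X ((j # \<beta>) @ [j]) f" by (rule ex[OF ba(3,4)])
     have dg: "differentiable_along j g" using exb unfolding L_multi_exists_append g_def by simp
     have mg: "g \<in> borel_measurable borel" unfolding g_def by (rule L_multi_measurable[OF f ex[OF ba(1,2)]])
     have Lg: "Ld j g = L_multi ch X ((j # \<beta>) @ [j]) f" by (simp add: L_multi_append g_def)
     have "mag g z <= ennreal c * Av r j (mag g) z + Av r j (mag (Ld j g)) z"
      unfolding c_def by (rule sobolev_step[OF mg dg r(1)])
     also have "\<dots> <= ennreal c * Av r j (h f) z + Av r j (h f) z"
      unfolding Lg using h_ge[OF ba(1,2)] h_ge[OF ba(3,4)]
      by (intro add_mono mult_left_mono Av_mono) (auto simp: g_def)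
     also have "\<dots> = H z" using c by (simp add: H_def distrib_right)
     finally show ?thesis by (simp add: g_def)
    qed
    have "mag (Ld j f) p <= It r (ks j) (h f) p + ennreal (D * (c + 1)) * It r (ks j @ [j]) (h f) p" for p
    proof -
     have "mag (Ld j f) p <= It r (ks j) (mag (L_multi ch X (ks j) (Ld j f))) p + ennreal D * It r (ks j) H p"
      using exj lower by (intro sob mj) auto
     also have "It r (ks j) (mag (L_multi ch X (ks j) (Ld j f))) p <= It r (ks j) (h f) p"
      using h_ge[of "j # ks j" f] fullks(1)[OF j] lks[OF j] by (intro It_mono) (auto simp: full_def)
     also have "It r (ks j) H p = ennreal (c + 1) * It r (ks j @ [j]) (h f) p"
      unfolding H_def[abs_def] by (simp add: It_cmult It_append)
     finally show ?thesis using D c by (simp add: ennreal_mult mult.assoc add_right_mono)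
    qed
    thus ?thesis using D c by (intro exI[of _ "D * (c + 1)"]) auto
   qed
   then obtain D where D: "\<And>j. j < n ==> D j \<ge> 0" "\<And>j p. j < n ==>
     mag (Ld j f) p <= It r (ks j) (h f) p + ennreal (D j) * It r (ks j @ [j]) (h f) p" by metis
   show ?thesis
   proof (intro exI[of _ "\<Sum>j<n. D j"] conjI allI impI)
    show "0 <= (\<Sum>j<n. D j)" using D(1) by (intro sum_nonneg) auto
    fix j p assume j: "j < n"
    have "D j <= (\<Sum>j<n. D j)" using D(1) j by (intro member_le_sum) auto
    hence "ennreal (D j) * It r (ks j @ [j]) (h f) p <= ennreal (\<Sum>j<n. D j) * It r (ks j @ [j]) (h f) p"
     by (intro mult_right_mono ennreal_leI) auto
    thus "mag (Ld j f) p <= It r (ks j) (h f) p + ennreal (\<Sum>j<n. D j) * It r (ks j @ [j]) (h f) p"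
     using D(2)[OF j, of p] by (meson add_left_mono order_trans)
   qed
  qed
  then obtain D where D: "D \<ge> 0" "\<And>j p. j < n ==> mag (Ld j f) p <= It r (ks j) (h f) p + ennreal D * It r (ks j @ [j]) (h f) p"
   by blast
  \<comment> \<open>\<open>D\<close> depends on \<open>r\<close> and hence on \<open>V\<close>; the factor \<open>2 * \<epsilon>\<close> makes up for it.\<close>
  define \<epsilon> where "\<epsilon> = min r (1 / (2 * (D + 1)))"
  have \<epsilon>: "\<epsilon> > 0" "\<epsilon> <= r" "2 * \<epsilon> * D <= 1"
  proof -
   have "\<epsilon> * (2 * (D + 1)) <= 1 / (2 * (D + 1)) * (2 * (D + 1))" using D by (intro mult_right_mono) (auto simp: \<epsilon>_def)
   hence "\<epsilon> * (2 * (D + 1)) <= 1" using D by simp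
   moreover have "\<epsilon> > 0" using r D by (simp add: \<epsilon>_def)
   ultimately show "2 * \<epsilon> * D <= 1" by (simp add: algebra_simps)
  qed (use r D in \<open>auto simp: \<epsilon>_def\<close>)
  have step: "ennreal (cmod (f (e j t + w) - f w)) <= ennreal (2 * Cd) * star (indicator Y1) (h f) w"
   if j: "j < n" and t: "\<bar>t\<bar> <= \<epsilon>" for j t w
  proof -
   have "L_multi_exists ch X [j] f" using j by (intro ex) auto
   hence dj: "differentiable_along j f" by simp
   have "ennreal (cmod (f (e j t + w) - f w)) <= Av \<epsilon> j (mag (Ld j f)) w" by (rule increment_bound[OF f dj t])
   also have "\<dots> <= Av \<epsilon> j (%p. It r (ks j) (h f) p + ennreal D * It r (ks j @ [j]) (h f) p) w"
    by (rule Av_mono) (rule D(2)[OF j])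
   also have "\<dots> = Av \<epsilon> j (It r (ks j) (h f)) w + ennreal D * Av \<epsilon> j (It r (ks j @ [j]) (h f)) w"
    by (simp add: Av_add Av_cmult)
   also have "\<dots> <= ennreal Cd * star (indicator Y1) (h f) w + ennreal D * (ennreal (2 * \<epsilon>) * (ennreal Cd * star (indicator Y1) (h f) w))"
   proof (intro add_mono mult_left_mono)
    have "Av \<epsilon> j (It r (ks j) (h f)) w <= Av r j (It r (ks j) (h f)) w" by (intro Av_radius_mono \<epsilon>) measurable
    also have "\<dots> = It r (j # ks j) (h f) w" by simp
    also have "\<dots> <= ennreal Cd * star (indicator Y1) (h f) w"
     using fullY[OF fullks(1)[OF j]] Y(4) by (intro dom[OF fullks(1)[OF j] r]) auto
    finally show "Av \<epsilon> j (It r (ks j) (h f)) w <= ennreal Cd * star (indicator Y1) (h f) w" .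
    have ae: "AE s in \<nu> \<epsilon>. \<bar>s\<bar> <= \<epsilon>" unfolding \<nu>_def by (subst AE_density) (auto simp: indicator_def abs_le_iff)
    have "Av \<epsilon> j (It r (ks j @ [j]) (h f)) w <= (\<integral>\<^sup>+s. ennreal Cd * star (indicator Y1) (h f) w \<partial>\<nu> \<epsilon>)"
     unfolding Av_def
    proof (rule nn_integral_mono_AE)
     show "AE s in \<nu> \<epsilon>. It r (ks j @ [j]) (h f) (e j s + w) <= ennreal Cd * star (indicator Y1) (h f) w"
      using ae
     proof eventually_elim
      case (elim s)
      have "\<Psi> [j] (%_. s) \<in> Y" using j elim \<epsilon>(2) by (intro boxY) (auto simp: box_def)
      hence "e j s \<in> Y" by (simp add: Psi_Cons Psi_Nil)
      hence sh: "- e j s + x \<in> Y1" if "x \<in> Y" for x using Y(3)[OF Y(5) that] by blast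
      have "It r (ks j @ [j]) (h f) (e j s + w) <= ennreal Cd * star (indicator Y) (h f) (e j s + w)"
       by (rule dom[OF fullks(2)[OF j] r _ fullY[OF fullks(2)[OF j]]]) measurable
      also have "\<dots> <= ennreal Cd * star (indicator Y1) (h f) w"
       by (intro mult_left_mono star_shift sh) auto
      finally show ?case .
     qed
    qed
    also have "\<dots> = ennreal (2 * \<epsilon>) * (ennreal Cd * star (indicator Y1) (h f) w)"
     using \<epsilon>(1) by (simp add: emeasure_nu mult_ac)
    finally show "Av \<epsilon> j (It r (ks j @ [j]) (h f)) w <= ennreal (2 * \<epsilon>) * (ennreal Cd * star (indicator Y1) (h f) w)" .
   qed auto
   also have "ennreal D * (ennreal (2 * \<epsilon>) * (ennreal Cd * star (indicator Y1) (h f) w))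
     = ennreal (2 * \<epsilon> * D) * (ennreal Cd * star (indicator Y1) (h f) w)"
    using D \<epsilon> by (simp add: ennreal_mult mult_ac)
   also have "\<dots> <= 1 * (ennreal Cd * star (indicator Y1) (h f) w)"
    using \<epsilon>(3) by (intro mult_right_mono) (auto simp: ennreal_le_1)
   also have "ennreal Cd * star (indicator Y1) (h f) w + 1 * (ennreal Cd * star (indicator Y1) (h f) w)
     = ennreal (2 * Cd) * star (indicator Y1) (h f) w"
   proof -
    have "ennreal (2 * Cd) = ennreal Cd + ennreal Cd"
     unfolding mult_2 using Cd by (intro ennreal_plus)
    thus ?thesis by (simp only: mult_1_left distrib_right)
   qed
   finally show ?thesis by (simp add: add_left_mono)
  qed
  have tele: "ennreal (cmod (f (\<Psi> l t + z) - f z)) <= ennreal (real (length l) * (2 * Cd)) * star (indicator V) (h f) z"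
   if "set l \<subseteq> {..<n}" "length l <= n" "t \<in> box \<epsilon>" for l t z
   using that(1,2)
  proof (induction l)
   case Nil
   show ?case by (simp add: Psi_Nil)
  next
   case (Cons k l)
   define w where "w = \<Psi> l t + z"
   have k: "k < n" "\<bar>t k\<bar> <= \<epsilon>" using Cons that(3) by (auto simp: box_def)
   have tr: "t \<in> box r" using that(3) \<epsilon>(2) by (force simp: box_def)
   have lY: "\<Psi> l t \<in> Y" using Cons by (intro boxY tr) auto
   have "- \<Psi> l t \<in> Y1" using Y(5)[OF lY] Y(4) by blast
   hence sh: "- \<Psi> l t + x \<in> V" if "x \<in> Y1" for x using Y1(3) that by blast
   have "cmod (f (\<Psi> (k # l) t + z) - f z) <= cmod (f (e k (t k) + w) - f w) + cmod (f w - f z)"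
    using norm_triangle_ineq[of "f (e k (t k) + w) - f w" "f w - f z"] by (simp add: Psi_Cons w_def add.assoc)
   hence "ennreal (cmod (f (\<Psi> (k # l) t + z) - f z)) <= ennreal (cmod (f (e k (t k) + w) - f w)) + ennreal (cmod (f w - f z))"
    by (simp add: ennreal_plus[symmetric] ennreal_leI del: ennreal_plus)
   also have "\<dots> <= ennreal (2 * Cd) * star (indicator V) (h f) z + ennreal (real (length l) * (2 * Cd)) * star (indicator V) (h f) z"
   proof (rule add_mono)
    have "ennreal (cmod (f (e k (t k) + w) - f w)) <= ennreal (2 * Cd) * star (indicator Y1) (h f) w" by (rule step[OF k])
    also have "\<dots> <= ennreal (2 * Cd) * star (indicator V) (h f) z"
     unfolding w_def by (intro mult_left_mono star_shift sh) auto
    finally show "ennreal (cmod (f (e k (t k) + w) - f w)) <= ennreal (2 * Cd) * star (indicator V) (h f) z" .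
    show "ennreal (cmod (f w - f z)) <= ennreal (real (length l) * (2 * Cd)) * star (indicator V) (h f) z"
     unfolding w_def using Cons.prems by (intro Cons.IH) auto
   qed
   also have "\<dots> = ennreal (real (length (k # l)) * (2 * Cd)) * star (indicator V) (h f) z"
    using Cd by (simp add: distrib_right[symmetric] ennreal_plus[symmetric] algebra_simps del: ennreal_plus)
   finally show ?case .
  qed
  show "\<exists>\<epsilon>>0. \<forall>u\<in>U_eps ch X \<epsilon>. \<forall>z. ennreal (cmod (f (u + z) - f z)) <= ennreal (real n * (2 * Cd)) * star (indicator V) (h f) z"
  proof (intro exI[of _ \<epsilon>] conjI ballI allI \<epsilon>(1))
   fix u z assume "u \<in> U_eps ch X \<epsilon>"
   then obtain t where "t \<in> box \<epsilon>" "u = \<Psi> [0..<n] t" unfolding U_eps_eq by auto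
   thus "ennreal (cmod (f (u + z) - f z)) <= ennreal (real n * (2 * Cd)) * star (indicator V) (h f) z"
    using tele[of "[0..<n]" t z] by (auto simp: atLeast0LessThan)
  qed
 qed
qed

end

section \<open>Neighbourhoods that are fine enough for sampling\<close>

locale lie_reproducing = lie_haar X n U0 ch r0 C \<mu> + reproducing_space \<mu> B N \<phi>
 for X :: "nat => 'e::banach" and n :: nat
  and U0 :: "'g::{topological_group_add, t2_space, second_countable_topology} set"
  and ch :: "'g => 'e" and r0 C :: real and \<mu> :: "'g measure"
  and B :: "('g => complex) set" and N :: "('g => complex) => real" and \<phi> :: "'g => complex" +
 assumes derivatives_exist: "\<And>\<alpha>. set \<alpha> \<subseteq> {..<n} ==> length \<alpha> <= n ==> L_multi_exists ch X \<alpha> \<phi>"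
  and derivatives_bounded: "\<And>\<alpha>. set \<alpha> \<subseteq> {..<n} ==> length \<alpha> <= n ==>
   kernel_bounded (%z. ennreal (cmod (L_multi ch X \<alpha> \<phi> z)))"
begin

lemma kernel_h: "kernel_bounded (h \<phi>)"
 unfolding h_def[abs_def] by (intro kernel_bounded_sum finite_multi_indices derivatives_bounded) auto

text \<open>The one-parameter subgroup with velocity \<open>X 0\<close> is not constant because \<open>X 0\<close> is not zero. Such a path,
 leaving a neighbourhood of the identity, is what the gain from averaging needs.\<close>

lemma nontrivial_path:
 assumes "n > 0"
 obtains \<gamma> :: "real => 'g" where "continuous_on {0..1} \<gamma>" "\<gamma> 0 = 0" "\<gamma> 1 \<noteq> 0"
proof -
 have "\<exists>t. e 0 t \<noteq> 0"
 proof (rule ccontr)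
  assume "\<not> ?thesis"
  hence "flow (X 0) t = 0" for t by (simp add: e_flow)
  hence z: "ch (flow (X 0) t) = 0" for t by (simp add: ch_0)
  have "((%t. ch (flow (X 0) t)) has_vector_derivative X 0) (at 0)"
   using flow_one_parameter_subgroup[of "X 0"] by (simp add: one_parameter_subgroup_def)
  hence "((%t::real. 0::'e) has_vector_derivative X 0) (at 0)" by (simp only: z)
  hence "X 0 = 0" by (rule vector_derivative_unique_at) (rule has_vector_derivative_const)
  hence "0 \<in> X ` {..<n}" using assms by (metis image_eqI lessThan_iff)
  hence "dependent (X ` {..<n})" by (rule dependent_zero)
  moreover have "independent (X ` {..<n})" using basis by (simp add: is_basis_def n_def)
  ultimately show False by (rule notE[rotated])
 qed
 then obtain t where t: "e 0 t \<noteq> 0" by blast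
 show ?thesis
 proof (rule that[of "%s. e 0 (s * t)"])
  show "continuous_on {0..1} (%s. e 0 (s * t))"
   by (rule continuous_on_compose2[OF continuous_e[of 0]]) (auto intro!: continuous_intros)
 qed (use t e_0 in auto)
qed

text \<open>In dimension zero \<open>U_eps\<close> is trivial and the oscillation vanishes. Otherwise the constants are chosen in
 the order \<open>V\<close>, the norm of \<open>Q * Q\<close> with \<open>Q = 1\<^sub>V * h\<close>, the exponent \<open>m\<close>, the neighbourhood \<open>Z\<close> with the gain
 \<open>2\<^sup>m\<close>, and finally \<open>\<epsilon>\<close>; this works because \<open>C1\<close> does not depend on \<open>Z\<close>.\<close>

lemma fine_neighbourhood:
 obtains \<epsilon> :: real and K where "\<epsilon> > 0" "kernel_bounded K"
  "\<And>u z. u \<in> U_eps ch X \<epsilon> ==> ennreal (cmod (\<phi> (u + z) - \<phi> z)) <= K z"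
  "\<And>F c. F \<in> borel_measurable borel ==> dominated F c ==>
   dominated (star (star F K) K) (c / (2 * solid_const))"
proof (cases "n = 0")
 case True
 show ?thesis
 proof (rule that[of 1 "%z. 0"])
  show "kernel_bounded (%z. 0)" by (rule kernel_bounded_zero)
  fix u z assume "u \<in> U_eps ch X 1"
  hence "u = 0" unfolding U_eps_eq using True by (auto simp: Psi_Nil)
  thus "ennreal (cmod (\<phi> (u + z) - \<phi> z)) <= 0" by simp
 next
  fix F :: "'g => ennreal" and c assume "dominated F c"
  hence "0 <= c / (2 * solid_const)" using dominated_nonneg solid_const(1) by simp
  moreover have "star (star F (%z. 0)) (%z. 0) = (%z. ennreal 0 * F z)" by (simp add: star_def[abs_def])
  ultimately show "dominated (star (star F (%z. 0)) (%z. 0)) (c / (2 * solid_const))"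
   using dominated_cmult[OF \<open>dominated F c\<close> order_refl] by (auto intro: dominated_mono)
 qed simp
next
 case False
 note hm [measurable] = kernel_h[THEN kernel_bounded_measurable]
 obtain \<gamma> :: "real => 'g" where \<gamma>: "continuous_on {0..1} \<gamma>" "\<gamma> 0 = 0" "\<gamma> 1 \<noteq> 0"
  using nontrivial_path False by blast
 have "open (- {\<gamma> 1})" "0 \<in> - {\<gamma> 1}" using \<gamma>(3) by auto
 then obtain V :: "'g set" where V: "open V" "0 \<in> V" "compact (closure V)" "closure V \<subseteq> - {\<gamma> 1}"
  using open_compact_neighbourhood by metis
 have \<gamma>V: "\<gamma> 1 \<notin> V" using V(4) closure_subset[of V] by auto
 have [measurable]: "V \<in> sets borel" using V(1) by auto
 define Q where "Q = star (indicator V) (h \<phi>)"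
 have "kernel_bounded (indicator V)"
  by (rule kernel_bounded_mono[OF kernel_indicator[OF V(3)]])
   (use closure_subset[of V] in \<open>auto simp: indicator_def\<close>)
 hence kQ: "kernel_bounded Q" unfolding Q_def by (rule kernel_bounded_star) (rule kernel_h)
 note [measurable] = kQ[THEN kernel_bounded_measurable]
 obtain CQ where CQ: "CQ \<ge> 0" "\<And>F c. F \<in> borel_measurable borel ==> dominated F c ==> dominated (star F (star Q Q)) (CQ * c)"
  using kernel_bounded_star[OF kQ kQ] by (rule kernel_boundedE) blast
 have phi [measurable]: "\<phi> \<in> borel_measurable borel" by (rule phi_measurable)
 obtain C1 :: real where C1: "C1 \<ge> 0" and osc: "\<And>V. open V ==> 0 \<in> V ==> \<exists>\<epsilon>>0. \<forall>u\<in>U_eps ch X \<epsilon>. \<forall>z.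
   ennreal (cmod (\<phi> (u + z) - \<phi> z)) <= ennreal C1 * star (indicator V) (h \<phi>) z"
  by (rule oscillation_bound[OF phi derivatives_exist]) (assumption, assumption, rule that)
 define M where "M = C1\<^sup>2 * CQ * (2 * solid_const)"
 obtain m where m: "M <= 2 ^ m" using real_arch_pow[of 2 M] by (auto intro: less_imp_le)
 obtain Z :: "'g set" where Z: "open Z" "0 \<in> Z" "Z \<subseteq> V" and gain: "\<And>k y. k \<in> borel_measurable borel ==>
   2 ^ m * star (star (indicator Z) k) (indicator Z) y <= star (star (indicator V) k) (indicator V) y"
  by (rule two_sided_gain[OF V(1,2) \<gamma>(1,2) \<gamma>V]) (rule that)
 have [measurable]: "Z \<in> sets borel" using Z(1) by auto
 obtain \<epsilon> where \<epsilon>: "\<epsilon> > 0" "\<forall>u\<in>U_eps ch X \<epsilon>. \<forall>z. ennreal (cmod (\<phi> (u + z) - \<phi> z)) <= ennreal C1 * star (indicator Z) (h \<phi>) z"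
  using osc[OF Z(1,2)] by (elim exE conjE) (rule that)
 define L where "L = star (indicator Z) (h \<phi>)"
 define K where "K z = ennreal C1 * L z" for z
 have Lm [measurable]: "L \<in> borel_measurable borel" unfolding L_def by measurable
 have Km [measurable]: "K \<in> borel_measurable borel" unfolding K_def by measurable
 have "L z <= Q z" for z unfolding L_def Q_def
  by (rule star_mono) (use Z(3) in \<open>auto simp: indicator_def\<close>)
 hence "kernel_bounded L" by (intro kernel_bounded_mono[OF kQ Lm])
 hence kK: "kernel_bounded K" unfolding K_def by (rule kernel_bounded_cmult[OF _ C1])
 have sq: "star L L = star (star (star (indicator Z) (h \<phi>)) (indicator Z)) (h \<phi>)"
  "star Q Q = star (star (star (indicator V) (h \<phi>)) (indicator V)) (h \<phi>)"
  unfolding L_def Q_def by (simp_all add: star_assoc)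
 have LQ: "ennreal (2 ^ m) * star L L z <= star Q Q z" for z
 proof -
  have "ennreal (2 ^ m) * star L L z
    = star (%x. ennreal (2 ^ m) * star (star (indicator Z) (h \<phi>)) (indicator Z) x) (h \<phi>) z"
   unfolding sq by (rule star_cmult_left[symmetric]) measurable
  also have "\<dots> <= star Q Q z"
   unfolding sq using gain[OF hm] by (intro star_mono) (simp_all add: ennreal_power[symmetric])
  finally show ?thesis .
 qed
 define \<theta> where "\<theta> = C1\<^sup>2 / 2 ^ m"
 have \<theta>: "\<theta> \<ge> 0" by (simp add: \<theta>_def)
 have KK: "star K K z <= ennreal \<theta> * star Q Q z" for z
 proof -
  have "star K K z = ennreal C1 * (ennreal C1 * star L L z)"
   unfolding K_def[abs_def] by (subst star_cmult_left) (simp_all add: star_cmult_right)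
  also have "\<dots> = ennreal \<theta> * (ennreal (2 ^ m) * star L L z)"
   using C1 by (simp add: \<theta>_def mult.assoc[symmetric] ennreal_mult[symmetric] power2_eq_square)
  also have "\<dots> <= ennreal \<theta> * star Q Q z" by (intro mult_left_mono LQ) simp
  finally show ?thesis .
 qed
 show ?thesis
 proof (rule that[OF \<epsilon>(1) kK])
  show "ennreal (cmod (\<phi> (u + z) - \<phi> z)) <= K z" if "u \<in> U_eps ch X \<epsilon>" for u z
   using \<epsilon>(2) that by (simp add: K_def L_def)
  fix F :: "'g => ennreal" and c assume F [measurable]: "F \<in> borel_measurable borel" and d: "dominated F c"
  have c: "c \<ge> 0" by (rule dominated_nonneg[OF d])
  have "star (star F K) K y <= ennreal \<theta> * star F (star Q Q) y" for y
  proof -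
   have "star (star F K) K y = star F (star K K) y" by (simp add: star_assoc)
   also have "\<dots> <= star F (%z. ennreal \<theta> * star Q Q z) y" by (intro star_mono KK) simp
   also have "\<dots> = ennreal \<theta> * star F (star Q Q) y" by (rule star_cmult_right) measurable
   finally show ?thesis .
  qed
  moreover have "\<theta> * (CQ * c) <= c / (2 * solid_const)"
  proof -
   have "\<theta> * (CQ * c) = (M / 2 ^ m) * (c / (2 * solid_const))"
    using solid_const(1) by (simp add: \<theta>_def M_def)
   also have "\<dots> <= 1 * (c / (2 * solid_const))"
    using m c solid_const(1) by (intro mult_right_mono) auto
   finally show ?thesis by simp
  qed
  ultimately show "dominated (star (star F K) K) (c / (2 * solid_const))"
   by (intro dominated_mono[OF dominated_cmult[OF CQ(2)[OF F d] \<theta>]]) auto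
 qed
qed

end

section \<open>The sampling theorem\<close>

text \<open>Translating the chart in the model space changes none of the objects of the statement.\<close>

lemma one_parameter_subgroup_shift:
 "one_parameter_subgroup (%g. c g - a) v \<gamma> \<longleftrightarrow> one_parameter_subgroup c v \<gamma>"
proof -
 have "((%t. c (\<gamma> t)) has_vector_derivative v) (at 0)" if "((%t. c (\<gamma> t) - a) has_vector_derivative v) (at 0)"
  using has_vector_derivative_add[OF that has_vector_derivative_const[of a]] by simp
 moreover have "((%t. c (\<gamma> t) - a) has_vector_derivative v) (at 0)" if "((%t. c (\<gamma> t)) has_vector_derivative v) (at 0)"
  using has_vector_derivative_diff[OF that has_vector_derivative_const[of a]] by simp
 ultimately show ?thesis unfolding one_parameter_subgroup_def by blast
qed

lemma lie_exp_shift: "lie_exp (%g. c g - a) = lie_exp c"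
 by (rule ext) (simp add: lie_exp_def one_parameter_subgroup_shift)

lemma L_op_shift: "L_quotient (%g. c g - a) = L_quotient c" "L_op (%g. c g - a) = L_op c"
proof -
 show q: "L_quotient (%g. c g - a) = L_quotient c" by (intro ext) (simp add: L_quotient_def lie_exp_shift)
 show "L_op (%g. c g - a) = L_op c" by (intro ext) (simp add: L_op_def q)
qed

lemma L_multi_shift: "L_multi (%g. c g - a) X \<alpha> f = L_multi c X \<alpha> f"
 "L_multi_exists (%g. c g - a) X \<alpha> f \<longleftrightarrow> L_multi_exists c X \<alpha> f"
 by (induction \<alpha> arbitrary: f) (simp_all add: L_op_shift)

lemma U_eps_shift: "U_eps (%g. c g - a) X = U_eps c X"
 by (intro ext) (simp add: U_eps_def lie_exp_shift)

theorem theorem3p12: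
  fixes A :: "('g::{topological_group_add, t2_space, second_countable_topology}, 'e::banach) chart set"
    and U0 :: "'g set" and c :: "'g \<Rightarrow> 'e" and X :: "nat \<Rightarrow> 'e"
    and \<mu> :: "'g measure"
    and B :: "('g \<Rightarrow> complex) set" and N :: "('g \<Rightarrow> complex) \<Rightarrow> real"
    and \<phi> :: "'g \<Rightarrow> complex"
  assumes "lie_group A"
    and "(U0, c) \<in> A" and "0 \<in> U0"
    and "is_basis X"
    and "left_haar_measure \<mu>"
    and "solid_function_space \<mu> B N"
    and "reproducing \<mu> B N \<phi>"
    and "\<And>\<alpha>. set \<alpha> \<subseteq> {..<dim (UNIV :: 'e set)} \<Longrightarrow> length \<alpha> \<le> dim (UNIV :: 'e set) \<Longrightarrow>
      L_multi_exists c X \<alpha> \<phi> \<and>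
      (\<forall>f\<in>B. conv_exists \<mu> (absf f) (absf (L_multi c X \<alpha> \<phi>))) \<and>
      continuous_self_map B N (\<lambda>f. conv \<mu> (absf f) (absf (L_multi c X \<alpha> \<phi>)))"
  shows "\<exists>\<epsilon>>0. \<exists>(I :: nat set) (x :: nat \<Rightarrow> 'g).
    relatively_separated (U_eps c X \<epsilon>) I x \<and>
    (\<forall>\<psi>. BUPU (U_eps c X \<epsilon>) I \<psi> \<longrightarrow>
      (\<forall>i\<in>I. supp (\<psi> i) \<subseteq> (\<lambda>u. x i + u) ` U_eps c X \<epsilon>) \<longrightarrow>
      (\<forall>f\<in>B_phi \<mu> B \<phi>. \<forall>i\<in>I. integrable \<mu> (\<lambda>y. f y * of_real (\<psi> i y))) \<and>
      (\<forall>f\<in>B_phi \<mu> B \<phi>. \<forall>y. (\<lambda>i. psi_coeff \<mu> \<psi> i f * ltrans (x i) \<phi> y) summable_on I) \<and>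
      invertible_on (B_phi \<mu> B \<phi>) N (T2 \<mu> \<phi> I x \<psi>) \<and>
      (C_c_dense B N \<longrightarrow>
        (\<forall>f\<in>B_phi \<mu> B \<phi>.
          ((\<lambda>F. N (\<lambda>y. T2 \<mu> \<phi> I x \<psi> f y - (\<Sum>i\<in>F. psi_coeff \<mu> \<psi> i f * ltrans (x i) \<phi> y)))
            \<longlongrightarrow> 0) (finite_subsets_at_top I))) \<and>
      atomic_decomposition (B_phi \<mu> B \<phi>) N
        (B_sharp B (U_eps c X \<epsilon>) I x) (norm_sharp N (U_eps c X \<epsilon>) I x) I
        (\<lambda>i f. psi_coeff \<mu> \<psi> i (inv_into (B_phi \<mu> B \<phi>) (T2 \<mu> \<phi> I x \<psi>) f))
        (\<lambda>i. ltrans (x i) \<phi>))"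
proof -
 define ch where "ch g = c g - c 0" for g
 define n where "n = dim (UNIV :: 'e set)"
 interpret coordinates: basis_coordinates X n by (rule basis_coordinates.intro) (fact, rule n_def)
 have ch_eq: "(%g. c g - c 0) = ch" by (rule ext) (simp add: ch_def)
 obtain r C where "local_group X n U0 (%g. c g - c 0) r C"
  by (rule coordinates.local_group_exists[OF assms(1-3)]) (rule that)
 hence lg: "local_group X n U0 ch r C" by (simp only: ch_eq)
 interpret lie_haar X n U0 ch r C \<mu> by (rule lie_haar.intro[OF lg assms(5)])
 interpret haar_space \<mu> B N by (rule haar_space.intro[OF haar_group_axioms assms(6)])
 have shift: "L_multi c X \<alpha> \<phi> = L_multi ch X \<alpha> \<phi>" "L_multi_exists c X \<alpha> \<phi> = L_multi_exists ch X \<alpha> \<phi>"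
  "U_eps c X = U_eps ch X" for \<alpha>
  by (simp_all add: ch_def[abs_def] L_multi_shift U_eps_shift)
 note derivatives = assms(8)[unfolded shift n_def[symmetric]]
 have ex: "L_multi_exists ch X \<alpha> \<phi>" if "set \<alpha> \<subseteq> {..<n}" "length \<alpha> <= n" for \<alpha>
  using derivatives[OF that] by blast
 have phi: "\<phi> \<in> borel_measurable borel" using assms(7) B_measurable by (simp add: reproducing_def)
 have bounded: "kernel_bounded (%z. ennreal (cmod (L_multi ch X \<alpha> \<phi> z)))"
  if "set \<alpha> \<subseteq> {..<n}" "length \<alpha> <= n" for \<alpha>
  using derivatives[OF that] by (intro kernel_bounded_of_continuous L_multi_measurable phi) auto
 interpret lie_reproducing X n U0 ch r C \<mu> B N \<phi>
 proof unfold_locales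
  show "reproducing \<mu> B N \<phi>" by fact
  show "conv_exists \<mu> (absf f) (absf \<phi>)" if "f \<in> B" for f using derivatives[of "[]"] that by simp
  show "kernel_bounded (%x. ennreal (cmod (\<phi> x)))" using bounded[of "[]"] by simp
 qed (use ex bounded in auto)
 obtain \<epsilon> K where \<epsilon>: "\<epsilon> > 0" and K: "kernel_bounded K"
  "\<And>u z. u \<in> U_eps ch X \<epsilon> ==> ennreal (cmod (\<phi> (u + z) - \<phi> z)) <= K z"
  "\<And>F c. F \<in> borel_measurable borel ==> dominated F c ==> dominated (star (star F K) K) (c / (2 * solid_const))"
  by (rule fine_neighbourhood) (rule that)
 define U where "U = U_eps ch X \<epsilon>"
 have U: "compact U" "0 \<in> interior U"
  unfolding U_def U_eps_eq by (rule Psi_image_compact[OF full_upt], rule Psi_image_neighbourhood[OF full_upt \<epsilon>])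
 obtain I :: "nat set" and x where sep: "relatively_separated U I x" by (rule relatively_separated_exists[OF U])
 show ?thesis unfolding shift
 proof (rule exI[of _ \<epsilon>], rule conjI[OF \<epsilon>], rule exI[of _ I], rule exI[of _ x], fold U_def, rule conjI[OF sep], intro allI impI)
  fix \<psi> assume bupu: "BUPU U I \<psi>" and supp: "\<forall>i\<in>I. supp (\<psi> i) \<subseteq> (%u. x i + u) ` U"
  interpret sampling \<mu> B N \<phi> U K I x \<psi>
   by unfold_locales (use U sep K bupu supp in \<open>auto simp: BUPU_def U_def[symmetric]\<close>)
  show "(\<forall>f\<in>B_phi \<mu> B \<phi>. \<forall>i\<in>I. integrable \<mu> (%y. f y * of_real (\<psi> i y))) \<and>
   (\<forall>f\<in>B_phi \<mu> B \<phi>. \<forall>y. (%i. psi_coeff \<mu> \<psi> i f * ltrans (x i) \<phi> y) summable_on I) \<and>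
   invertible_on (B_phi \<mu> B \<phi>) N (T2 \<mu> \<phi> I x \<psi>) \<and>
   (C_c_dense B N -->
    (\<forall>f\<in>B_phi \<mu> B \<phi>.
     ((%F. N (%y. T2 \<mu> \<phi> I x \<psi> f y - (\<Sum>i\<in>F. psi_coeff \<mu> \<psi> i f * ltrans (x i) \<phi> y)))
      \<longlongrightarrow> 0) (finite_subsets_at_top I))) \<and>
   atomic_decomposition (B_phi \<mu> B \<phi>) N (B_sharp B U I x) (norm_sharp N U I x) I
    (%i f. psi_coeff \<mu> \<psi> i (inv_into (B_phi \<mu> B \<phi>) (T2 \<mu> \<phi> I x \<psi>) f)) (%i. ltrans (x i) \<phi>)"
   using psi_integrable atoms_summable T_invertible(1) norm_convergence decomposition E_mem by blast
 qed
qed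

end
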